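(* Let $k$ be an algebraically closed field of characteristic zero. Let $U$ be a Hopf algebra over $k$ which satisfies the following: 1. There exist integers $1\le\nu<N$, $N\nmid\nu^2$, such that as an algebra $U$ is generated by a grouplike element $a$ of order $N$ and by the space $P_{a^\nu,1}(U)$, which has dimension $3$. 2. For any positive integer $i\not\equiv\nu \pmod N$, $P_{a^i,1}(U)=\mathrm{sp}_k\{a^i-1\}$. 3. $U$ is minimal quasitriangular. Then there exists a primitive $N$th root of unity $\omega\in k$ such that $U\cong U_{(N,\nu,\omega)}$ as Hopf algebras.
   Context: For grouplike elements $g,h$ of a Hopf algebra $H$, $P_{g,h}(H)=\{z\in H\mid\Delta(z)=z\otimes g+h\otimes z\}$. Definition of $U_{(N,\nu,\omega)}$: let $1\le\nu<N$ be integers with $N\nmid\nu^2$, $\omega\in k$ a primitive $N$th root of unity, $q=\omega^\nu$, $r=|q^\nu|=|\omega^{\nu^2}|$ the multiplicative order. $U_{(N,\nu,\omega)}$ is the Hopf algebra generated as an algebra by $a,x,y$ with relations $a^N=1$, $x^r=0$, $y^r=0$, $xa=qax$, $ya=q^{-1}ay$, $yx-q^{-\nu}xy=a^{2\nu}-1$, with $\Delta(a)=a\otimes a$, $\Delta(x)=x\otimes a^\nu+1\otimes x$, $\Delta(y)=y\otimes a^\nu+1\otimes y$, $\varepsilon(a)=1$, $\varepsilon(x)=\varepsilon(y)=0$, antipode $s(a)=a^{-1}$, $s(x)=-q^{-\nu}a^{-\nu}x$, $s(y)=-q^\nu a^{-\nu}y$. A pair $(H,R)$, $R=\sum R^{(1)}\otimes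 R^{(2)}\in H\otimes H$, is a quasitriangular Hopf algebra if (with $r=R$ a second copy) $\sum\Delta(R^{(1)})\otimes R^{(2)}=\sum R^{(1)}\otimes r^{(1)}\otimes R^{(2)}r^{(2)}$; $\sum\varepsilon(R^{(1)})R^{(2)}=1$; $\sum R^{(1)}\otimes\Delta^{cop}(R^{(2)})=\sum R^{(1)}r^{(1)}\otimes R^{(2)}\otimes r^{(2)}$; $\sum R^{(1)}\varepsilon(R^{(2)})=1$; and $\Delta^{cop}(h)R=R\Delta(h)$ for all $h\in H$. Writing $R=\sum R^{(1)}\otimes R^{(2)}$ in the shortest possible way, let $l(R)=\mathrm{sp}_k\{R^{(1)}\}$, $r(R)=\mathrm{sp}_k\{R^{(2)}\}$ (these are finite-dimensional Hopf subalgebras of $H$), and let $H_R$ be the Hopf subalgebra generated by $l(R)$ and $r(R)$. $(H,R)$ is minimal quasitriangular if $H=H_R$; $H$ is minimal quasitriangular if $(H,R)$ is for some $R$. *)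

theory Defs
  imports
    "HOL-Algebra.QuotRing"
    "HOL-Algebra.Subrings"
    "HOL-Algebra.Multiplicative_Group"
    "HOL-Library.Poly_Mapping"
    "HOL-Number_Theory.Cong"
    "Jordan_Normal_Form.VS_Connect"
begin

hide_const (open) Multiset.mult Polynomial.smult

text \<open>
  The ground field is a type \<open>'k\<close> of class \<^class>\<open>field\<close>, entering the record-based notions of
  HOL-Algebra as \<^term>\<open>class_ring\<close>. Algebras need not be commutative, so the locale
  \<open>algebra\<close> of HOL-Algebra (which assumes a commutative ring) is not applicable.
\<close>

section \<open>Algebras\<close>

definition k_algebra :: "('k::field, 'a, 'm) module_scheme \<Rightarrow> bool" where
  "k_algebra A \<longleftrightarrow> vectorspace class_ring A \<and> ring A \<and>
     (\<forall>c. \<forall>x\<in>carrier A. \<forall>y\<in>carrier A.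
        c \<odot>\<^bsub>A\<^esub> (x \<otimes>\<^bsub>A\<^esub> y) = (c \<odot>\<^bsub>A\<^esub> x) \<otimes>\<^bsub>A\<^esub> y \<and>
        c \<odot>\<^bsub>A\<^esub> (x \<otimes>\<^bsub>A\<^esub> y) = x \<otimes>\<^bsub>A\<^esub> (c \<odot>\<^bsub>A\<^esub> y))"

definition base_algebra :: "('k::field, 'k) module" where
  "base_algebra = \<lparr>carrier = UNIV, mult = (*), one = 1, ring.zero = 0, add = (+), smult = (*)\<rparr>"

definition alg_hom ::
  "('k::field, 'a, 'm) module_scheme \<Rightarrow> ('k, 'b, 'n) module_scheme \<Rightarrow> ('a \<Rightarrow> 'b) set" where
  "alg_hom A B = Ring.ring_hom A B \<inter> module_hom class_ring A B"

abbreviation lin_span :: "('k::field, 'a, 'm) module_scheme \<Rightarrow> 'a set \<Rightarrow> 'a set" where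
  "lin_span V S \<equiv> LinearCombinations.module.span class_ring V S"

definition subalgebra_of :: "'a set \<Rightarrow> ('k::field, 'a, 'm) module_scheme \<Rightarrow> bool" where
  "subalgebra_of B A \<longleftrightarrow> subring B A \<and> subspace class_ring B A"

definition generated_subalgebra :: "('k::field, 'a, 'm) module_scheme \<Rightarrow> 'a set \<Rightarrow> 'a set" where
  "generated_subalgebra A S = \<Inter>{B. subalgebra_of B A \<and> S \<subseteq> B}"

text \<open>Elements are the finitely supported functions from the monoid to the field.\<close>

definition monoid_algebra :: "('m, 'z) monoid_scheme \<Rightarrow> ('k::field, 'm \<Rightarrow>\<^sub>0 'k) module" where
  "monoid_algebra M =
     \<lparr>carrier = {f. Poly_Mapping.keys f \<subseteq> carrier M},
      mult = (\<lambda>f g. \<Sum>p\<in>Poly_Mapping.keys f. \<Sum>q\<in>Poly_Mapping.keys g.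
                Poly_Mapping.single (p \<otimes>\<^bsub>M\<^esub> q) (Poly_Mapping.lookup f p * Poly_Mapping.lookup g q)),
      one = Poly_Mapping.single \<one>\<^bsub>M\<^esub> 1,
      ring.zero = 0,
      add = (+),
      smult = (\<lambda>c. Poly_Mapping.map ((*) c))\<rparr>"

definition lin_ext :: "('k::field, 'a, 'm) module_scheme \<Rightarrow> ('p \<Rightarrow> 'a) \<Rightarrow> ('p \<Rightarrow>\<^sub>0 'k) \<Rightarrow> 'a" where
  "lin_ext Z b f = (\<Oplus>\<^bsub>Z\<^esub>p\<in>Poly_Mapping.keys f. Poly_Mapping.lookup f p \<odot>\<^bsub>Z\<^esub> b p)"

definition quotient_algebra ::
  "('k::field, 'a, 'm) module_scheme \<Rightarrow> 'a set \<Rightarrow> ('k, 'a set) module" where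
  "quotient_algebra A I =
     \<lparr>carrier = carrier (A Quot I), mult = mult (A Quot I), one = one (A Quot I),
      ring.zero = \<zero>\<^bsub>A Quot I\<^esub>, add = add (A Quot I),
      smult = (\<lambda>c C. \<Union>x\<in>C. I +>\<^bsub>A\<^esub> (c \<odot>\<^bsub>A\<^esub> x))\<rparr>"

section \<open>Tensor products\<close>

text \<open>
  \<open>A \<otimes> B\<close> is the vector space with basis \<open>A \<times> B\<close> modulo the bilinearity relations. Taking that
  vector space to be the monoid algebra of the multiplicative monoid of \<open>A \<times> B\<close>, whose product is
  \<open>(v, w)(v', w') = (vv', ww')\<close>, the relations span an ideal and the quotient carries the usual
  algebra structure of \<open>A \<otimes> B\<close>.
\<close>

definition tensor_relations ::
  "('k::field, 'a, 'm) module_scheme \<Rightarrow> ('k, 'b, 'n) module_scheme \<Rightarrow> ('a \<times> 'b \<Rightarrow>\<^sub>0 'k) set" where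
  "tensor_relations A B = lin_span (monoid_algebra (A \<times>\<times> B))
     ({Poly_Mapping.single (v \<oplus>\<^bsub>A\<^esub> v', w) 1 - Poly_Mapping.single (v, w) 1
         - Poly_Mapping.single (v', w) 1
         | v v' w. v \<in> carrier A \<and> v' \<in> carrier A \<and> w \<in> carrier B} \<union>
      {Poly_Mapping.single (v, w \<oplus>\<^bsub>B\<^esub> w') 1 - Poly_Mapping.single (v, w) 1
         - Poly_Mapping.single (v, w') 1
         | v w w'. v \<in> carrier A \<and> w \<in> carrier B \<and> w' \<in> carrier B} \<union>
      {Poly_Mapping.single (c \<odot>\<^bsub>A\<^esub> v, w) 1 - Poly_Mapping.single (v, w) c
         | c v w. v \<in> carrier A \<and> w \<in> carrier B} \<union>
      {Poly_Mapping.single (v, c \<odot>\<^bsub>B\<^esub> w) 1 - Poly_Mapping.single (v, w) c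
         | c v w. v \<in> carrier A \<and> w \<in> carrier B})"

definition tensor ::
  "('k::field, 'a, 'm) module_scheme \<Rightarrow> ('k, 'b, 'n) module_scheme \<Rightarrow>
     ('k, ('a \<times> 'b \<Rightarrow>\<^sub>0 'k) set) module" where
  "tensor A B = quotient_algebra (monoid_algebra (A \<times>\<times> B)) (tensor_relations A B)"

definition tens ::
  "('k::field, 'a, 'm) module_scheme \<Rightarrow> ('k, 'b, 'n) module_scheme \<Rightarrow>
     'a \<Rightarrow> 'b \<Rightarrow> ('a \<times> 'b \<Rightarrow>\<^sub>0 'k) set" where
  "tens A B v w = tensor_relations A B +>\<^bsub>monoid_algebra (A \<times>\<times> B)\<^esub> Poly_Mapping.single (v, w) 1"

text \<open>
  For \<open>b\<close> bilinear on \<open>A \<times> B\<close> with values in \<open>Z\<close>, \<open>tensor_lift Z b\<close> is the induced linear map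
  \<open>A \<otimes> B \<rightarrow> Z\<close>; bilinearity makes it independent of the chosen representative. It plays the
  role of Sweedler notation: \<open>tensor_lift Z b t\<close> is \<open>\<Sum> b t\<^sub>(\<^sub>1\<^sub>) t\<^sub>(\<^sub>2\<^sub>)\<close>.
\<close>

definition tensor_lift ::
  "('k::field, 'c, 'm) module_scheme \<Rightarrow> ('a \<Rightarrow> 'b \<Rightarrow> 'c) \<Rightarrow> ('a \<times> 'b \<Rightarrow>\<^sub>0 'k) set \<Rightarrow> 'c" where
  "tensor_lift Z b t = lin_ext Z (\<lambda>(v, w). b v w) (SOME f. f \<in> t)"

text \<open>\<open>tensor_map A' B' f g\<close> is \<open>f \<otimes> g\<close>, where \<open>A'\<close> and \<open>B'\<close> are the codomains of \<open>f\<close> and \<open>g\<close>.\<close>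

definition tensor_map ::
  "('k::field, 'c, 'm) module_scheme \<Rightarrow> ('k, 'd, 'n) module_scheme \<Rightarrow> ('a \<Rightarrow> 'c) \<Rightarrow> ('b \<Rightarrow> 'd) \<Rightarrow>
     ('a \<times> 'b \<Rightarrow>\<^sub>0 'k) set \<Rightarrow> ('c \<times> 'd \<Rightarrow>\<^sub>0 'k) set" where
  "tensor_map A' B' f g = tensor_lift (tensor A' B') (\<lambda>v w. tens A' B' (f v) (g w))"

text \<open>The canonical map \<open>(A \<otimes> B) \<otimes> C \<rightarrow> A \<otimes> (B \<otimes> C)\<close>.\<close>

definition tensor_assoc ::
  "('k::field, 'a, 'm) module_scheme \<Rightarrow> ('k, 'b, 'n) module_scheme \<Rightarrow> ('k, 'c, 'l) module_scheme \<Rightarrow>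
     (('a \<times> 'b \<Rightarrow>\<^sub>0 'k) set \<times> 'c \<Rightarrow>\<^sub>0 'k) set \<Rightarrow> ('a \<times> ('b \<times> 'c \<Rightarrow>\<^sub>0 'k) set \<Rightarrow>\<^sub>0 'k) set" where
  "tensor_assoc A B C =
     tensor_lift (tensor A (tensor B C)) (\<lambda>t w.
       tensor_lift (tensor A (tensor B C)) (\<lambda>u v. tens A (tensor B C) u (tens B C v w)) t)"

section \<open>Hopf algebras\<close>

record (overloaded) ('k::field, 'a) hopf = "('k, 'a) module" +
  comult :: "'a \<Rightarrow> ('a \<times> 'a \<Rightarrow>\<^sub>0 'k) set"
  counit :: "'a \<Rightarrow> 'k"
  antipode :: "'a \<Rightarrow> 'a"

definition hopf_algebra :: "('k::field, 'a) hopf \<Rightarrow> bool" where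
  "hopf_algebra H \<longleftrightarrow>
     k_algebra H \<and>
     comult H \<in> alg_hom H (tensor H H) \<and>
     counit H \<in> alg_hom H base_algebra \<and>
     antipode H \<in> module_hom class_ring H H \<and>
     (\<forall>h\<in>carrier H.
        tensor_assoc H H H (tensor_map (tensor H H) H (comult H) id (comult H h))
          = tensor_map H (tensor H H) id (comult H) (comult H h) \<and>
        tensor_lift H (\<lambda>u v. counit H u \<odot>\<^bsub>H\<^esub> v) (comult H h) = h \<and>
        tensor_lift H (\<lambda>u v. counit H v \<odot>\<^bsub>H\<^esub> u) (comult H h) = h \<and>
        tensor_lift H (\<lambda>u v. antipode H u \<otimes>\<^bsub>H\<^esub> v) (comult H h) = counit H h \<odot>\<^bsub>H\<^esub> \<one>\<^bsub>H\<^esub> \<and>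
        tensor_lift H (\<lambda>u v. u \<otimes>\<^bsub>H\<^esub> antipode H v) (comult H h) = counit H h \<odot>\<^bsub>H\<^esub> \<one>\<^bsub>H\<^esub>)"

definition hopf_iso :: "('k::field, 'a) hopf \<Rightarrow> ('k, 'b) hopf \<Rightarrow> ('a \<Rightarrow> 'b) set" where
  "hopf_iso A B = {f \<in> alg_hom A B. bij_betw f (carrier A) (carrier B) \<and>
     (\<forall>h\<in>carrier A.
        comult B (f h) = tensor_map B B f f (comult A h) \<and>
        counit B (f h) = counit A h \<and>
        antipode B (f h) = f (antipode A h))}"

definition hopf_isomorphic :: "('k::field, 'a) hopf \<Rightarrow> ('k, 'b) hopf \<Rightarrow> bool" where
  "hopf_isomorphic A B \<longleftrightarrow> hopf_iso A B \<noteq> {}"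

definition grouplikes :: "('k::field, 'a) hopf \<Rightarrow> 'a set" where
  "grouplikes H = {g \<in> carrier H. comult H g = tens H H g g \<and> counit H g = 1}"

text \<open>\<open>skew_primitives H g h\<close> is \<open>P\<^sub>g\<^sub>,\<^sub>h(H)\<close>.\<close>

definition skew_primitives :: "('k::field, 'a) hopf \<Rightarrow> 'a \<Rightarrow> 'a \<Rightarrow> 'a set" where
  "skew_primitives H g h =
     {z \<in> carrier H. comult H z = tens H H z g \<oplus>\<^bsub>tensor H H\<^esub> tens H H h z}"

definition hopf_subalgebra :: "'a set \<Rightarrow> ('k::field, 'a) hopf \<Rightarrow> bool" where
  "hopf_subalgebra B H \<longleftrightarrow> subalgebra_of B H \<and>
     comult H ` B \<subseteq> lin_span (tensor H H) {tens H H u v | u v. u \<in> B \<and> v \<in> B} \<and>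
     antipode H ` B \<subseteq> B"

section \<open>Minimal quasitriangular Hopf algebras\<close>

definition cocomult :: "('k::field, 'a) hopf \<Rightarrow> 'a \<Rightarrow> ('a \<times> 'a \<Rightarrow>\<^sub>0 'k) set" where
  "cocomult H h = tensor_lift (tensor H H) (\<lambda>u v. tens H H v u) (comult H h)"

definition quasitriangular :: "('k::field, 'a) hopf \<Rightarrow> ('a \<times> 'a \<Rightarrow>\<^sub>0 'k) set \<Rightarrow> bool" where
  "quasitriangular H R \<longleftrightarrow>
     (let T = tensor H H; TH = tensor T H; HT = tensor H T in
       R \<in> carrier T \<and>
       tensor_map T H (comult H) id R
         = tensor_lift TH (\<lambda>R1 R2. tensor_lift TH (\<lambda>r1 r2.
             tens T H (tens H H R1 r1) (R2 \<otimes>\<^bsub>H\<^esub> r2)) R) R \<and>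
       tensor_lift H (\<lambda>R1 R2. counit H R1 \<odot>\<^bsub>H\<^esub> R2) R = \<one>\<^bsub>H\<^esub> \<and>
       tensor_map H T id (cocomult H) R
         = tensor_lift HT (\<lambda>R1 R2. tensor_lift HT (\<lambda>r1 r2.
             tens H T (R1 \<otimes>\<^bsub>H\<^esub> r1) (tens H H R2 r2)) R) R \<and>
       tensor_lift H (\<lambda>R1 R2. counit H R2 \<odot>\<^bsub>H\<^esub> R1) R = \<one>\<^bsub>H\<^esub> \<and>
       (\<forall>h\<in>carrier H. cocomult H h \<otimes>\<^bsub>T\<^esub> R = R \<otimes>\<^bsub>T\<^esub> comult H h))"

definition tensor_expressions ::
  "('k::field, 'a) hopf \<Rightarrow> ('a \<times> 'a \<Rightarrow>\<^sub>0 'k) set \<Rightarrow> ('a \<times> 'a) list set" where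
  "tensor_expressions H t = {ps. set ps \<subseteq> carrier H \<times> carrier H \<and>
     t = (\<Oplus>\<^bsub>tensor H H\<^esub>i\<in>{..<length ps}. tens H H (fst (ps ! i)) (snd (ps ! i)))}"

definition shortest_expression ::
  "('k::field, 'a) hopf \<Rightarrow> ('a \<times> 'a \<Rightarrow>\<^sub>0 'k) set \<Rightarrow> ('a \<times> 'a) list" where
  "shortest_expression H t = (ARG_MIN length ps. ps \<in> tensor_expressions H t)"

text \<open>
  \<open>l(R)\<close> and \<open>r(R)\<close>; the spans do not depend on which shortest expression is chosen.
\<close>

definition left_leg :: "('k::field, 'a) hopf \<Rightarrow> ('a \<times> 'a \<Rightarrow>\<^sub>0 'k) set \<Rightarrow> 'a set" where
  "left_leg H R = lin_span H (fst ` set (shortest_expression H R))"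

definition right_leg :: "('k::field, 'a) hopf \<Rightarrow> ('a \<times> 'a \<Rightarrow>\<^sub>0 'k) set \<Rightarrow> 'a set" where
  "right_leg H R = lin_span H (snd ` set (shortest_expression H R))"

definition minimal_part :: "('k::field, 'a) hopf \<Rightarrow> ('a \<times> 'a \<Rightarrow>\<^sub>0 'k) set \<Rightarrow> 'a set" where
  "minimal_part H R = \<Inter>{B. hopf_subalgebra B H \<and> left_leg H R \<subseteq> B \<and> right_leg H R \<subseteq> B}"

definition minimal_quasitriangular :: "('k::field, 'a) hopf \<Rightarrow> bool" where
  "minimal_quasitriangular H \<longleftrightarrow> (\<exists>R. quasitriangular H R \<and> minimal_part H R = carrier H)"

section \<open>The Hopf algebras \<open>U\<^sub>(\<^sub>N\<^sub>,\<^sub>\<nu>\<^sub>,\<^sub>\<omega>\<^sub>)\<close>\<close>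

definition mult_order :: "'k::field \<Rightarrow> nat" where
  "mult_order z = group.ord (units_of class_ring) z"

definition primitive_root_of_unity :: "nat \<Rightarrow> 'k::field \<Rightarrow> bool" where
  "primitive_root_of_unity N w \<longleftrightarrow> 0 < N \<and> w ^ N = 1 \<and> (\<forall>m. 0 < m \<and> m < N \<longrightarrow> w ^ m \<noteq> 1)"

datatype U_gen = Gen_a | Gen_x | Gen_y

definition free_algebra :: "('k::field, U_gen list \<Rightarrow>\<^sub>0 'k) module" where
  "free_algebra = monoid_algebra \<lparr>carrier = UNIV, mult = (@), one = []\<rparr>"

definition word_prod :: "('a, 'z) monoid_scheme \<Rightarrow> (U_gen \<Rightarrow> 'a) \<Rightarrow> U_gen list \<Rightarrow> 'a" where
  "word_prod M g w = foldr (\<lambda>s z. g s \<otimes>\<^bsub>M\<^esub> z) w \<one>\<^bsub>M\<^esub>"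

definition U_relations :: "nat \<Rightarrow> nat \<Rightarrow> 'k::field \<Rightarrow> (U_gen list \<Rightarrow>\<^sub>0 'k) set" where
  "U_relations N \<nu> \<omega> =
     (let F = free_algebra;
          a = Poly_Mapping.single [Gen_a] 1;
          x = Poly_Mapping.single [Gen_x] 1;
          y = Poly_Mapping.single [Gen_y] 1;
          q = \<omega> ^ \<nu>;
          r = mult_order (q ^ \<nu>)
      in {a [^]\<^bsub>F\<^esub> N \<ominus>\<^bsub>F\<^esub> \<one>\<^bsub>F\<^esub>,
          x [^]\<^bsub>F\<^esub> r,
          y [^]\<^bsub>F\<^esub> r,
          (x \<otimes>\<^bsub>F\<^esub> a) \<ominus>\<^bsub>F\<^esub> (q \<odot>\<^bsub>F\<^esub> (a \<otimes>\<^bsub>F\<^esub> x)),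
          (y \<otimes>\<^bsub>F\<^esub> a) \<ominus>\<^bsub>F\<^esub> (inverse q \<odot>\<^bsub>F\<^esub> (a \<otimes>\<^bsub>F\<^esub> y)),
          ((y \<otimes>\<^bsub>F\<^esub> x) \<ominus>\<^bsub>F\<^esub> (inverse (q ^ \<nu>) \<odot>\<^bsub>F\<^esub> (x \<otimes>\<^bsub>F\<^esub> y)))
            \<ominus>\<^bsub>F\<^esub> (a [^]\<^bsub>F\<^esub> (2 * \<nu>) \<ominus>\<^bsub>F\<^esub> \<one>\<^bsub>F\<^esub>)})"

definition U_ideal :: "nat \<Rightarrow> nat \<Rightarrow> 'k::field \<Rightarrow> (U_gen list \<Rightarrow>\<^sub>0 'k) set" where
  "U_ideal N \<nu> \<omega> = Idl\<^bsub>free_algebra\<^esub> (U_relations N \<nu> \<omega>)"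

definition U_algebra :: "nat \<Rightarrow> nat \<Rightarrow> 'k::field \<Rightarrow> ('k, (U_gen list \<Rightarrow>\<^sub>0 'k) set) module" where
  "U_algebra N \<nu> \<omega> = quotient_algebra free_algebra (U_ideal N \<nu> \<omega>)"

definition U_class :: "nat \<Rightarrow> nat \<Rightarrow> 'k::field \<Rightarrow> U_gen \<Rightarrow> (U_gen list \<Rightarrow>\<^sub>0 'k) set" where
  "U_class N \<nu> \<omega> s = U_ideal N \<nu> \<omega> +>\<^bsub>free_algebra\<^esub> Poly_Mapping.single [s] 1"

definition U_comult_gen ::
  "nat \<Rightarrow> nat \<Rightarrow> 'k::field \<Rightarrow> U_gen \<Rightarrow>
     ((U_gen list \<Rightarrow>\<^sub>0 'k) set \<times> (U_gen list \<Rightarrow>\<^sub>0 'k) set \<Rightarrow>\<^sub>0 'k) set" where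
  "U_comult_gen N \<nu> \<omega> s =
     (let Q = U_algebra N \<nu> \<omega>; a = U_class N \<nu> \<omega> Gen_a; z = U_class N \<nu> \<omega> s in
       if s = Gen_a then tens Q Q a a
       else tens Q Q z (a [^]\<^bsub>Q\<^esub> \<nu>) \<oplus>\<^bsub>tensor Q Q\<^esub> tens Q Q \<one>\<^bsub>Q\<^esub> z)"

fun U_counit_gen :: "U_gen \<Rightarrow> 'k::field" where
  "U_counit_gen Gen_a = 1"
| "U_counit_gen Gen_x = 0"
| "U_counit_gen Gen_y = 0"

fun U_antipode_gen :: "nat \<Rightarrow> nat \<Rightarrow> 'k::field \<Rightarrow> U_gen \<Rightarrow> (U_gen list \<Rightarrow>\<^sub>0 'k) set" where
  "U_antipode_gen N \<nu> \<omega> Gen_a = inv\<^bsub>U_algebra N \<nu> \<omega>\<^esub> (U_class N \<nu> \<omega> Gen_a)"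
| "U_antipode_gen N \<nu> \<omega> Gen_x =
     (let Q = U_algebra N \<nu> \<omega>; q = \<omega> ^ \<nu> in
       (- inverse (q ^ \<nu>)) \<odot>\<^bsub>Q\<^esub>
         ((inv\<^bsub>Q\<^esub> (U_class N \<nu> \<omega> Gen_a)) [^]\<^bsub>Q\<^esub> \<nu> \<otimes>\<^bsub>Q\<^esub> U_class N \<nu> \<omega> Gen_x))"
| "U_antipode_gen N \<nu> \<omega> Gen_y =
     (let Q = U_algebra N \<nu> \<omega>; q = \<omega> ^ \<nu> in
       (- (q ^ \<nu>)) \<odot>\<^bsub>Q\<^esub>
         ((inv\<^bsub>Q\<^esub> (U_class N \<nu> \<omega> Gen_a)) [^]\<^bsub>Q\<^esub> \<nu> \<otimes>\<^bsub>Q\<^esub> U_class N \<nu> \<omega> Gen_y))"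

text \<open>
  The structure maps are the multiplicative (for the antipode: anti-multiplicative, whence the
  reversed words) extensions of their values on generators; they respect the relations, so the
  choice of a representative of the coset \<open>C\<close> does not matter.
\<close>

definition U_hopf :: "nat \<Rightarrow> nat \<Rightarrow> 'k::field \<Rightarrow> ('k, (U_gen list \<Rightarrow>\<^sub>0 'k) set) hopf" where
  "U_hopf N \<nu> \<omega> =
     (let Q = U_algebra N \<nu> \<omega>; T = tensor Q Q in
       \<lparr>carrier = carrier Q, mult = mult Q, one = one Q, ring.zero = \<zero>\<^bsub>Q\<^esub>, add = add Q,
        smult = smult Q,
        comult = (\<lambda>C. lin_ext T (word_prod T (U_comult_gen N \<nu> \<omega>)) (SOME f. f \<in> C)),
        counit = (\<lambda>C. lin_ext base_algebra (word_prod base_algebra U_counit_gen) (SOME f. f \<in> C)),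
        antipode = (\<lambda>C. lin_ext Q (\<lambda>w. word_prod Q (U_antipode_gen N \<nu> \<omega>) (rev w))
                      (SOME f. f \<in> C))\<rparr>)"

end

theory Submission
  imports Defs
begin

text \<open>
  Idea of the proof. Minimality writes the Hopf algebra as the product of the two subalgebras
  \<open>{(id \<otimes> p) R}\<close> and \<open>{(p \<otimes> id) R}\<close>, which \<open>R\<close> pairs with each other. The element
  \<open>a\<close> acts by conjugation on the three-dimensional space of skew primitives; an eigenvector lying in
  one of the subalgebras pairs nontrivially with one lying in the other, so there are eigenvectors \<open>x\<close>
  and \<open>y\<close> with inverse eigenvalues \<open>\<alpha>\<close> and \<open>\<alpha>\<^sup>-\<^sup>1\<close>, and the commutation rule of \<open>R\<close> with \<open>\<Delta> x\<close>
  gives \<open>y x - \<alpha>\<^sup>-\<^sup>\<nu> x y = a\<^sup>2\<^sup>\<nu> - 1\<close> after rescaling. Triviality of the remaining skew primitives forces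
  \<open>x\<^sup>r\<close> and \<open>y\<^sup>r\<close> to be multiples of \<open>a\<^sup>r\<^sup>\<nu> - 1\<close>, which vanish because \<open>\<alpha>\<close> and \<open>a\<^sup>\<nu>\<close>
  have the same order. Comultiplication shows that the monomials
  \<open>a\<^sup>i x\<^sup>j y\<^sup>k\<close> are independent, so the presentation is complete, and \<open>\<alpha> = \<omega>\<^sup>\<nu>\<close> for some primitive
  \<open>\<omega>\<close> because both sides have the same order.

  The Hopf algebra is a record over a carrier; the computations take place in its image under a faithful
  representation by linear operators, whose type is a ring.
\<close>

section \<open>Sweedler calculus with lists\<close>

text \<open>A list of pairs stands for a tensor, and two lists are compared only by evaluating them
  on products of linear functionals; no quotient construction enters the algebra itself. The
  delicate point is the choice of x and y. Write g for \<open>a ^ \<nu>\<close>. The eigenvectors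
  found in the two legs of R may be proportional modulo g - 1, so a partner y with (\<alpha>
  \<beta>)^\<nu> = 1 has to be found among the remaining eigenvectors, by slicing a q-commutator;
  and if x pairs only with x and y only with y, both eigenvalues are -1 and y is replaced by x + y.
  The condition \<alpha>^\<nu> \<noteq> 1, which gives r > 1, comes from the finite dimension of the
  left leg together with characteristic zero. That \<alpha> and g have the same order is
  nondegeneracy of the pairing in one direction and minimality in the other: if g^m = 1 but
  \<alpha>^m \<noteq> 1, the powers of a in the two legs together with x and y could not generate a.
  The monomial basis serves twice, to find generators of the legs before the eigenvalues are matched
  and to show that the presentation is faithful.\<close>

definition sw :: "('b \<times> 'd) list \<Rightarrow> ('b \<Rightarrow> 'd \<Rightarrow> 'c::comm_monoid_add) \<Rightarrow> 'c" where
  "sw xs b = (\<Sum>(u, v)\<leftarrow>xs. b u v)"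

abbreviation prd :: "('b \<Rightarrow> 'k::times) \<Rightarrow> ('d \<Rightarrow> 'k) \<Rightarrow> 'b \<Rightarrow> 'd \<Rightarrow> 'k" where
  "prd p q \<equiv> \<lambda>u v. p u * q v"

lemma sw_Nil [simp]: "sw [] b = 0"
  and sw_Cons [simp]: "sw ((u, v) # xs) b = b u v + sw xs b"
  and sw_append: "sw (xs @ ys) b = sw xs b + sw ys b"
  by (simp_all add: sw_def)

lemma sw_map: "sw (map (\<lambda>(u, v). (F u, G v)) xs) b = sw xs (\<lambda>u v. b (F u) (G v))"
  by (induction xs) auto

lemma sw_add: "sw xs (\<lambda>u v. b u v + d u v) = sw xs b + sw xs d"
  by (induction xs) (auto simp: ac_simps)

lemma sw_cong: "(\<And>u v. (u, v) \<in> set xs \<Longrightarrow> b u v = d u v) \<Longrightarrow> sw xs b = sw xs d"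
  by (induction xs) auto

lemma sw_hom:
  assumes "F 0 = 0" "\<And>x y. F (x + y) = F x + F y"
  shows "F (sw xs b) = sw xs (\<lambda>u v. F (b u v))"
  by (induction xs) (auto simp: assms)

lemma sw_zero [simp]: "sw xs (\<lambda>u v. 0) = 0"
  by (induction xs) auto

lemma sw_swap: "sw xs (\<lambda>u v. sw ys (\<lambda>u' v'. b u v u' v')) = sw ys (\<lambda>u' v'. sw xs (\<lambda>u v. b u v u' v'))"
  by (induction xs) (auto simp: sw_add)

lemma sw_distrib_left: "(c::'c::semiring_0) * sw xs b = sw xs (\<lambda>u v. c * b u v)"
  and sw_distrib_right: "sw xs b * (c::'c::semiring_0) = sw xs (\<lambda>u v. b u v * c)"
  by (induction xs) (auto simp: algebra_simps)

lemma sw_in: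
  assumes "0 \<in> W" "\<And>x y. x \<in> W \<Longrightarrow> y \<in> W \<Longrightarrow> x + y \<in> W" "\<And>u v. (u, v) \<in> set xs \<Longrightarrow> b u v \<in> W"
  shows "sw xs b \<in> W"
  using assms(3) by (induction xs) (auto intro!: assms(1,2))

section \<open>Linear functionals as coordinates\<close>

locale vspace = vector_space scale
  for scale :: "'k::field \<Rightarrow> 'b::ab_group_add \<Rightarrow> 'b" (infixr \<open>*s\<close> 75)
begin

definition lf :: "('b \<Rightarrow> 'k) \<Rightarrow> bool" where
  "lf p \<longleftrightarrow> (\<forall>x y. p (x + y) = p x + p y) \<and> (\<forall>c x. p (c *s x) = c * p x)"

lemma lf_add: "lf p \<Longrightarrow> p (x + y) = p x + p y"
  and lf_scale: "lf p \<Longrightarrow> p (c *s x) = c * p x"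
  by (auto simp: lf_def)

lemma lf_zero: "lf p \<Longrightarrow> p 0 = 0"
  using lf_scale[of p 0 0] by simp

lemma lf_neg: "lf p \<Longrightarrow> p (- x) = - p x"
  using lf_add[of p x "- x"] by (simp add: lf_zero eq_neg_iff_add_eq_0 add.commute)

lemma lf_diff: "lf p \<Longrightarrow> p (x - y) = p x - p y"
  using lf_add[of p x "- y"] by (simp add: lf_neg)

lemma lf_sum: "lf p \<Longrightarrow> p (sum F A) = (\<Sum>i\<in>A. p (F i))"
  by (induction A rule: infinite_finite_induct) (auto simp: lf_zero lf_add)

lemma lf_sw: "lf p \<Longrightarrow> p (sw xs b) = sw xs (\<lambda>u v. p (b u v))"
  by (rule sw_hom) (auto simp: lf_zero lf_add)

lemmas lf_simps = lf_add lf_scale lf_zero lf_neg lf_diff lf_sum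

lemma lf_cmult [simp]: "lf p \<Longrightarrow> lf (\<lambda>u. k * p u)"
  and lf_plus [simp]: "lf p \<Longrightarrow> lf q \<Longrightarrow> lf (\<lambda>u. p u + q u)"
  and lf_minus [simp]: "lf p \<Longrightarrow> lf q \<Longrightarrow> lf (\<lambda>u. p u - q u)"
  and lf_const_zero [simp]: "lf (\<lambda>u. 0)"
  by (auto simp: lf_def algebra_simps)

lemma lf_sums [simp]: "(\<And>i. i \<in> A \<Longrightarrow> lf (p i)) \<Longrightarrow> lf (\<lambda>u. \<Sum>i\<in>A. p i u)"
  by (induction A rule: infinite_finite_induct) auto

lemma lf_extend:
  assumes "independent B"
  obtains p where "lf p" "\<And>x. x \<in> B \<Longrightarrow> p x = f x"
proof -
  interpret vector_space_pair scale "(*) :: 'k \<Rightarrow> 'k \<Rightarrow> 'k"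
    by unfold_locales (auto simp: algebra_simps)
  obtain p where p: "Vector_Spaces.linear scale (*) p" "\<forall>x\<in>B. p x = f x"
    using linear_independent_extend[OF assms] by blast
  interpret Vector_Spaces.linear scale "(*) :: 'k \<Rightarrow> 'k \<Rightarrow> 'k" p by fact
  show ?thesis using that[of p] p(2) by (auto simp: lf_def add scale)
qed

text \<open>A basis of \<open>W\<close> remains independent after adding \<open>v\<close>, so values
  on it can be prescribed freely. Every non-membership in a subspace is thereby witnessed by a
  functional.\<close>

lemma lf_separate:
  assumes "subspace W" "v \<notin> W"
  obtains p where "lf p" "\<And>w. w \<in> W \<Longrightarrow> p w = 0" "p v = 1"
proof -
  obtain B where B: "B \<subseteq> W" "independent B" "W \<subseteq> span B"
    using maximal_independent_subset by blast
  then have sB: "span B = W" using span_minimal[OF B(1) assms(1)] by auto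
  then have "independent (insert v B)"
    using B assms(2) by (simp add: independent_insert)
  then obtain p where p: "lf p" "\<And>x. x \<in> insert v B \<Longrightarrow> p x = (if x = v then 1 else 0)"
    by (rule lf_extend[where f = "\<lambda>x. if x = v then 1 else 0"]) blast
  have "subspace {x. p x = 0}"
    using p(1) by (auto simp: subspace_def lf_simps)
  moreover have "B \<subseteq> {x. p x = 0}" using p(2) B(1) assms(2) by auto
  ultimately have "W \<subseteq> {x. p x = 0}" using span_minimal sB by metis
  then show ?thesis using that[of p] p by auto
qed

lemma lf_eqI:
  assumes "\<And>p. lf p \<Longrightarrow> p x = p y"
  shows "x = y"
proof (rule ccontr)
  assume "x \<noteq> y"
  then have "x - y \<notin> {0}" by simp
  then obtain p where "lf p" "p (x - y) = 1"
    using lf_separate[of "{0}" "x - y"] by (auto simp: subspace_0)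
  then show False using assms[of p] by (simp add: lf_diff)
qed

end

locale kalg = vspace scale
  for scale :: "'k::field \<Rightarrow> 'b::ring_1 \<Rightarrow> 'b" (infixr \<open>*s\<close> 75) +
  assumes scale_mult_left: "(c *s x) * y = c *s (x * y)"
    and scale_mult_right: "x * (c *s y) = c *s (x * y)"
begin

lemmas smult_simps = scale_mult_left scale_mult_right

lemma lf_mult_left [simp]: "lf p \<Longrightarrow> lf (\<lambda>u. p (c * u))"
  and lf_mult_right [simp]: "lf p \<Longrightarrow> lf (\<lambda>u. p (u * c))"
  by (auto simp: lf_def algebra_simps scale_mult_left scale_mult_right)

lemma subspace_mult_left: "subspace W \<Longrightarrow> subspace {u. c * u \<in> W}"
  and subspace_mult_right: "subspace W \<Longrightarrow> subspace {u. u * c \<in> W}"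
  by (auto simp: subspace_def algebra_simps scale_mult_right scale_mult_left)

lemma subspace_neg_iff: "subspace W \<Longrightarrow> c \<noteq> 0 \<Longrightarrow> c *s x \<in> W \<longleftrightarrow> x \<in> W"
  using subspace_scale[of W x c] subspace_scale[of W "c *s x" "inverse c"] by auto

lemma span_mult_left:
  assumes "\<And>e. e \<in> E \<Longrightarrow> s * e \<in> span F" "u \<in> span E"
  shows "s * u \<in> span F"
proof -
  have "span E \<subseteq> {u. s * u \<in> span F}"
    by (rule span_minimal) (auto intro: subspace_mult_left assms)
  then show ?thesis using assms by auto
qed

end

text \<open>The list \<open>dl h\<close> represents the coproduct of h but is not canonical, so
  every axiom about it is an equation between its values on multilinear expressions in functionals.
  Linearity of \<open>dl\<close>, \<open>eps\<close> and \<open>S\<close> is demanded on the whole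
  type, not only on \<open>C\<close>, so that composites such as \<open>cv p q\<close> below are
  again functionals in the sense of \<open>lf\<close>.\<close>

locale hopf_data = kalg scale
  for scale :: "'k::field \<Rightarrow> 'b::ring_1 \<Rightarrow> 'b" (infixr \<open>*s\<close> 75) +
  fixes C :: "'b set" and dl :: "'b \<Rightarrow> ('b \<times> 'b) list" and eps :: "'b \<Rightarrow> 'k" and S :: "'b \<Rightarrow> 'b"
  assumes C_sub: "subspace C" and one_C: "1 \<in> C" and mult_C: "x \<in> C \<Longrightarrow> y \<in> C \<Longrightarrow> x * y \<in> C"
    and dl_in: "set (dl h) \<subseteq> C \<times> C"
    and dl_add: "lf p \<Longrightarrow> lf q \<Longrightarrow> sw (dl (x + y)) (prd p q) =
      sw (dl x) (prd p q) + sw (dl y) (prd p q)"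
    and dl_scale: "lf p \<Longrightarrow> lf q \<Longrightarrow> sw (dl (c *s x)) (prd p q) =
      c * sw (dl x) (prd p q)"
    and dl_mult: "h \<in> C \<Longrightarrow> h' \<in> C \<Longrightarrow> lf p \<Longrightarrow> lf q \<Longrightarrow> sw (dl (h * h')) (prd p q) =
      sw (dl h) (\<lambda>u v. sw (dl h') (\<lambda>u' v'. p (u * u') * q (v * v')))"
    and dl_one: "lf p \<Longrightarrow> lf q \<Longrightarrow> sw (dl 1) (prd p q) = p 1 * q 1"
    and dl_coassoc: "h \<in> C \<Longrightarrow> (\<And>x y. lf (\<lambda>u. t u x y)) \<Longrightarrow> (\<And>x y. lf (\<lambda>u. t x u y)) \<Longrightarrow>
      (\<And>x y. lf (\<lambda>u. t x y u)) \<Longrightarrow>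
      sw (dl h) (\<lambda>u v. sw (dl u) (\<lambda>u1 u2. t u1 u2 v)) = sw (dl h) (\<lambda>u v. sw (dl v) (\<lambda>v1 v2. t u v1 v2))"
    and eps_lf: "lf eps" and eps_mult: "x \<in> C \<Longrightarrow> y \<in> C \<Longrightarrow> eps (x * y) = eps x * eps y"
    and eps_one: "eps 1 = 1"
    and counit_left: "h \<in> C \<Longrightarrow> sw (dl h) (\<lambda>u v. eps u *s v) = h"
    and counit_right: "h \<in> C \<Longrightarrow> sw (dl h) (\<lambda>u v. eps v *s u) = h"
    and S_add: "S (x + y) = S x + S y" and S_scale: "S (c *s x) = c *s S x" and S_in: "S x \<in> C"
    and antipode_left: "h \<in> C \<Longrightarrow> sw (dl h) (\<lambda>u v. S u * v) = eps h *s 1"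
    and antipode_right: "h \<in> C \<Longrightarrow> sw (dl h) (\<lambda>u v. u * S v) = eps h *s 1"
begin

text \<open>\<open>Lc p h\<close> and \<open>Rc q h\<close> are the slices (p \<otimes> id) and (id
  \<otimes> q) of the coproduct of h, and \<open>cv\<close> is the product of the dual algebra. A
  slice is an element again, so statements about coproducts become statements without
  tensors.\<close>

definition Lc where "Lc p h = sw (dl h) (\<lambda>u v. p u *s v)"
definition Rc where "Rc q h = sw (dl h) (\<lambda>u v. q v *s u)"
definition cv where "cv p q h = sw (dl h) (prd p q)"

lemmas C_add = subspace_add[OF C_sub] and C_diff = subspace_diff[OF C_sub]
  and C_scale = subspace_scale[OF C_sub] and C_neg = subspace_neg[OF C_sub] and C_zero = subspace_0[OF C_sub]

lemmas C_intros = one_C mult_C C_add C_diff C_scale C_neg C_zero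

lemma C_power: "x \<in> C \<Longrightarrow> x ^ n \<in> C"
  by (induction n) (auto intro: C_intros)

lemma lf_cv [simp]: "lf p \<Longrightarrow> lf q \<Longrightarrow> lf (cv p q)"
  by (simp add: cv_def lf_def[of "cv p q"] dl_add dl_scale)

lemma Lc_pair: "lf q \<Longrightarrow> q (Lc p h) = cv p q h"
  by (simp add: Lc_def cv_def lf_sw lf_scale)

lemma Rc_pair: "lf p \<Longrightarrow> p (Rc q h) = cv p q h"
  by (simp add: Rc_def cv_def lf_sw lf_scale mult.commute)

lemma Lc_add: "lf p \<Longrightarrow> Lc p (x + y) = Lc p x + Lc p y"
  and Lc_scale: "lf p \<Longrightarrow> Lc p (c *s x) = c *s Lc p x"
  by (rule lf_eqI, simp add: Lc_pair lf_add lf_scale[of "cv _ _"] lf_scale)+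

lemma Rc_add: "lf p \<Longrightarrow> Rc p (x + y) = Rc p x + Rc p y"
  and Rc_scale: "lf p \<Longrightarrow> Rc p (c *s x) = c *s Rc p x"
  by (rule lf_eqI, simp add: Rc_pair lf_add lf_scale[of "cv _ _"] lf_scale)+

lemma Lc_zero: "lf p \<Longrightarrow> Lc p 0 = 0" and Rc_zero: "lf p \<Longrightarrow> Rc p 0 = 0"
  using Lc_scale[of p 0 0] Rc_scale[of p 0 0] by auto

lemma Lc_diff: "lf p \<Longrightarrow> Lc p (x - y) = Lc p x - Lc p y"
  by (rule lf_eqI) (simp add: Lc_pair lf_diff)

lemma Lc_sum: "lf p \<Longrightarrow> Lc p (sum F A) = (\<Sum>i\<in>A. Lc p (F i))"
  by (induction A rule: infinite_finite_induct) (auto simp: Lc_zero Lc_add)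

lemma Rc_sum: "lf p \<Longrightarrow> Rc p (sum F A) = (\<Sum>i\<in>A. Rc p (F i))"
  by (induction A rule: infinite_finite_induct) (auto simp: Rc_zero Rc_add)

lemma Lc_cmult_fun: "Lc (\<lambda>u. c * p u) h = c *s Lc p h"
  and Lc_add_fun: "Lc (\<lambda>u. p u + q u) h = Lc p h + Lc q h"
  by (rule lf_eqI, simp add: Lc_pair cv_def lf_simps sw_distrib_left sw_add algebra_simps)+

lemma Rc_sum_fun: "Rc (\<lambda>u. \<Sum>i\<in>A. F i u) h = (\<Sum>i\<in>A. Rc (F i) h)"
  and Lc_sum_fun: "Lc (\<lambda>u. \<Sum>i\<in>A. F i u) h = (\<Sum>i\<in>A. Lc (F i) h)"
proof -
  have "Rc (\<lambda>u. 0) h = 0" "Lc (\<lambda>u. 0) h = 0" by (simp_all add: Rc_def Lc_def)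
  moreover have "Rc (\<lambda>u. p u + q u) h = Rc p h + Rc q h" "Lc (\<lambda>u. p u + q u) h = Lc p h + Lc q h" for p q
    by (simp_all add: Rc_def Lc_def sw_add scale_left_distrib)
  ultimately show "Rc (\<lambda>u. \<Sum>i\<in>A. F i u) h = (\<Sum>i\<in>A. Rc (F i) h)" "Lc (\<lambda>u. \<Sum>i\<in>A. F i u) h = (\<Sum>i\<in>A. Lc (F i) h)"
    by (induction A rule: infinite_finite_induct) auto
qed

lemma Lc_in: "Lc p h \<in> C" and Rc_in: "Rc p h \<in> C"
  unfolding Lc_def Rc_def using dl_in[of h] by (auto intro!: sw_in C_intros)

lemma cv_assoc:
  assumes "h \<in> C" "lf p" "lf q" "lf s"
  shows "cv (cv p q) s h = cv p (cv q s) h"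
proof -
  have "lf (\<lambda>u. p u * (c * d))" "lf (\<lambda>u. c * (q u * d))" "lf (\<lambda>u. c * (d * s u))" for c d
    using assms by (auto simp: lf_def algebra_simps)
  then show ?thesis
    unfolding cv_def using dl_coassoc[of h "\<lambda>u v w. p u * (q v * s w)"] assms(1)
    by (simp add: sw_distrib_left sw_distrib_right mult.assoc)
qed

lemma Lc_Lc: "h \<in> C \<Longrightarrow> lf p \<Longrightarrow> lf s \<Longrightarrow> Lc s (Lc p h) = Lc (cv p s) h"
  by (rule lf_eqI) (simp add: Lc_pair cv_assoc)

lemma Rc_Rc: "h \<in> C \<Longrightarrow> lf p \<Longrightarrow> lf s \<Longrightarrow> Rc s (Rc p h) = Rc (cv s p) h"
  by (rule lf_eqI) (simp add: Rc_pair cv_assoc)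

lemma Lc_Rc: "h \<in> C \<Longrightarrow> lf p \<Longrightarrow> lf q \<Longrightarrow> Lc p (Rc q h) = Rc q (Lc p h)"
proof (rule lf_eqI)
  fix t assume "h \<in> C" "lf p" "lf q" "lf t"
  then show "t (Lc p (Rc q h)) = t (Rc q (Lc p h))"
    using Lc_pair[of "cv t q" p h] Rc_pair[of "cv p t" q h] Lc_pair[of t p "Rc q h"] Rc_pair[of t q "Lc p h"]
    by (simp add: cv_assoc)
qed

lemma Lc_eps: "h \<in> C \<Longrightarrow> Lc eps h = h" and Rc_eps: "h \<in> C \<Longrightarrow> Rc eps h = h"
  by (simp_all add: Lc_def Rc_def counit_left counit_right)

text \<open>Grouplikes and skew primitives in sliced form: the coproduct is h \<otimes> h,
  respectively z \<otimes> h + 1 \<otimes> z, after applying a functional to the left factor. Zero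
  satisfies \<open>gl\<close>, so nonvanishing is asked for separately where it matters.\<close>

definition gl where "gl h \<longleftrightarrow> h \<in> C \<and> (\<forall>p. lf p \<longrightarrow> Lc p h = p h *s h)"
definition sp where "sp h z \<longleftrightarrow> z \<in> C \<and> (\<forall>p. lf p \<longrightarrow> Lc p z = p z *s h + p 1 *s z)"

lemma glI: "h \<in> C \<Longrightarrow> (\<And>p. lf p \<Longrightarrow> Lc p h = p h *s h) \<Longrightarrow> gl h"
  and gl_C: "gl h \<Longrightarrow> h \<in> C" and gl_Lc: "gl h \<Longrightarrow> lf p \<Longrightarrow> Lc p h = p h *s h"
  by (auto simp: gl_def)

lemma spI: "z \<in> C \<Longrightarrow> (\<And>p. lf p \<Longrightarrow> Lc p z = p z *s h + p 1 *s z) \<Longrightarrow> sp h z"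
  and sp_C: "sp h z \<Longrightarrow> z \<in> C" and sp_Lc: "sp h z \<Longrightarrow> lf p \<Longrightarrow> Lc p z = p z *s h + p 1 *s z"
  by (auto simp: sp_def)

lemma gl_cv: "gl h \<Longrightarrow> lf p \<Longrightarrow> lf q \<Longrightarrow> cv p q h = p h * q h"
  using Lc_pair[of q p h] by (simp add: gl_Lc lf_simps)

lemma sp_cv: "sp h z \<Longrightarrow> lf p \<Longrightarrow> lf q \<Longrightarrow> cv p q z = p z * q h + p 1 * q z"
  using Lc_pair[of q p z] by (simp add: sp_Lc lf_simps)

lemma gl_Rc: "gl h \<Longrightarrow> lf q \<Longrightarrow> Rc q h = q h *s h"
  by (rule lf_eqI) (simp add: Rc_pair gl_cv lf_simps)

lemma sp_Rc: "sp h z \<Longrightarrow> lf q \<Longrightarrow> Rc q z = q h *s z + q z *s 1"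
  by (rule lf_eqI) (simp add: Rc_pair sp_cv lf_simps)

lemma cv_mult: "h \<in> C \<Longrightarrow> u \<in> C \<Longrightarrow> lf p \<Longrightarrow> lf q \<Longrightarrow>
    cv p q (h * u) = sw (dl u) (\<lambda>u' v'. cv (\<lambda>c. p (c * u')) (\<lambda>c. q (c * v')) h)"
  unfolding cv_def by (subst dl_mult) (auto simp: sw_swap[of "dl h"])

lemma cv_gl_mult: "gl h \<Longrightarrow> u \<in> C \<Longrightarrow> lf p \<Longrightarrow> lf q \<Longrightarrow>
    cv p q (h * u) = cv (\<lambda>c. p (h * c)) (\<lambda>c. q (h * c)) u"
  by (subst cv_mult) (simp_all add: gl_C gl_cv, simp add: cv_def)

lemma cv_sp_mult: "sp h z \<Longrightarrow> u \<in> C \<Longrightarrow> lf p \<Longrightarrow> lf q \<Longrightarrow>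
    cv p q (z * u) = cv (\<lambda>c. p (z * c)) (\<lambda>c. q (h * c)) u + cv p (\<lambda>c. q (z * c)) u"
  by (subst cv_mult) (simp_all add: sp_C sp_cv sw_add, simp add: cv_def)

lemma Lc_gl_mult: "gl h \<Longrightarrow> u \<in> C \<Longrightarrow> lf p \<Longrightarrow> Lc p (h * u) = h * Lc (\<lambda>c. p (h * c)) u"
  by (rule lf_eqI) (simp add: Lc_pair cv_gl_mult Lc_pair[of "\<lambda>c. _ (h * c)", symmetric])

lemma Lc_sp_mult: "sp h z \<Longrightarrow> u \<in> C \<Longrightarrow> lf p \<Longrightarrow>
    Lc p (z * u) = h * Lc (\<lambda>c. p (z * c)) u + z * Lc p u"
  by (rule lf_eqI)
    (simp add: Lc_pair cv_sp_mult lf_add Lc_pair[of "\<lambda>c. _ (_ * c)", symmetric])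

lemma Rc_sp_mult: "sp h z \<Longrightarrow> u \<in> C \<Longrightarrow> lf p \<Longrightarrow>
    Rc p (z * u) = z * Rc (\<lambda>c. p (h * c)) u + Rc (\<lambda>c. p (z * c)) u"
  by (rule lf_eqI)
    (simp add: Rc_pair cv_sp_mult lf_add Rc_pair[of "\<lambda>c. _ (_ * c)", symmetric])

lemma gl_one: "gl 1"
  by (rule glI[OF one_C], rule lf_eqI) (simp add: Lc_pair cv_def dl_one lf_simps)

lemma gl_mult: "gl h \<Longrightarrow> gl h' \<Longrightarrow> gl (h * h')"
  by (rule glI) (auto simp: gl_C mult_C Lc_gl_mult gl_Lc smult_simps)

lemma gl_power: "gl h \<Longrightarrow> gl (h ^ n)"
  by (induction n) (auto simp: gl_one gl_mult)

lemma gl_eps: assumes "gl h" "h \<noteq> 0" shows "eps h = 1"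
proof -
  have "eps h *s h = 1 *s h" using Lc_eps[OF gl_C[OF assms(1)]] gl_Lc[OF assms(1) eps_lf] by simp
  then show ?thesis using assms(2) by (metis scale_cancel_right)
qed

lemma sp_eps: assumes "sp h z" "h \<noteq> 0" shows "eps z = 0"
  using Lc_eps[OF sp_C[OF assms(1)]] sp_Lc[OF assms(1) eps_lf] assms(2) by (simp add: eps_one)

lemma sp_add: "sp h z \<Longrightarrow> sp h z' \<Longrightarrow> sp h (z + z')"
  and sp_scale: "sp h z \<Longrightarrow> sp h (c *s z)"
  by (auto simp: sp_def lf_simps Lc_add Lc_scale C_intros algebra_simps)

lemma sp_zero: "sp h 0"
  by (auto simp: sp_def lf_simps Lc_zero C_intros)

lemma subspace_sp: "subspace {z. sp h z}"
  by (auto simp: subspace_def sp_add sp_scale sp_zero)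

lemma sp_gl: "gl h \<Longrightarrow> sp h (h - 1)"
  by (auto simp: sp_def C_intros gl_C Lc_diff gl_Lc gl_one lf_simps algebra_simps)

end

context hopf_data begin

text \<open>Slicing a relation h = sum c_k k by the functional dual to one k with c_k \<noteq> 0
  leaves c_k h on one side and c_k k on the other, which forces h = k.\<close>

lemma independent_gl:
  assumes "finite G" "\<And>h. h \<in> G \<Longrightarrow> gl h" "0 \<notin> G"
  shows "independent G"
  using assms
proof (induction G rule: finite_induct)
  case (insert h G)
  then have ind: "independent G" by auto
  have "h \<notin> span G"
  proof
    assume "h \<in> span G"
    then obtain c where c: "h = (\<Sum>k\<in>G. c k *s k)"
      using span_finite[OF insert.hyps(1)] by auto
    have "\<exists>k\<in>G. c k \<noteq> 0"
    proof (rule ccontr)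
      assume "\<not> ?thesis"
      then have "h = 0" unfolding c by (intro sum.neutral) auto
      then show False using insert.prems(2) by simp
    qed
    then obtain k where k: "k \<in> G" "c k \<noteq> 0" by auto
    obtain p where p: "lf p" "\<And>x. x \<in> G \<Longrightarrow> p x = (if x = k then 1 else 0)"
      using lf_extend[OF ind, of "\<lambda>x. if x = k then 1 else 0"] by metis
    have ph: "p h = c k"
      using k insert.hyps(1) p by (simp add: c lf_simps sum.delta' if_distrib[of "(*) _"] cong: if_cong)
    have "p h *s h = Lc p h" using insert.prems p by (simp add: gl_Lc)
    also have "\<dots> = (\<Sum>k'\<in>G. c k' *s (p k' *s k'))"
      unfolding c using p insert.prems by (simp add: Lc_sum Lc_scale gl_Lc)
    also have "\<dots> = (\<Sum>k'\<in>G. if k' = k then c k *s k else 0)"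
      by (rule sum.cong) (auto simp: p)
    also have "\<dots> = c k *s k" using k insert.hyps(1) by simp
    finally have "h = k" using ph k(2) by simp
    then show False using k insert.hyps by simp
  qed
  then show ?case using ind by (simp add: independent_insert)
qed (simp add: independent_empty)

text \<open>Sub-bialgebras: the subcoalgebra condition, that coproducts of elements of X lie in X
  \<otimes> X, is encoded as stability under all left and right slices.\<close>

definition subbi :: "'b set \<Rightarrow> bool" where
  "subbi X \<longleftrightarrow> subspace X \<and> X \<subseteq> C \<and> 1 \<in> X \<and> (\<forall>x\<in>X. \<forall>y\<in>X. x * y \<in> X) \<and>
     (\<forall>p. lf p \<longrightarrow> (\<forall>x\<in>X. Lc p x \<in> X \<and> Rc p x \<in> X))"

lemma subbi_subspace: "subbi X \<Longrightarrow> subspace X"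
  and subbi_C: "subbi X \<Longrightarrow> x \<in> X \<Longrightarrow> x \<in> C"
  and subbi_one: "subbi X \<Longrightarrow> 1 \<in> X"
  and subbi_mult: "subbi X \<Longrightarrow> x \<in> X \<Longrightarrow> y \<in> X \<Longrightarrow> x * y \<in> X"
  and subbi_Lc: "subbi X \<Longrightarrow> lf p \<Longrightarrow> x \<in> X \<Longrightarrow> Lc p x \<in> X"
  and subbi_Rc: "subbi X \<Longrightarrow> lf p \<Longrightarrow> x \<in> X \<Longrightarrow> Rc p x \<in> X"
  by (auto simp: subbi_def)

lemma subbi_add: "subbi X \<Longrightarrow> x \<in> X \<Longrightarrow> y \<in> X \<Longrightarrow> x + y \<in> X"
  and subbi_diff: "subbi X \<Longrightarrow> x \<in> X \<Longrightarrow> y \<in> X \<Longrightarrow> x - y \<in> X"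
  and subbi_scale: "subbi X \<Longrightarrow> x \<in> X \<Longrightarrow> c *s x \<in> X"
  and subbi_scale_iff: "subbi X \<Longrightarrow> c \<noteq> 0 \<Longrightarrow> c *s x \<in> X \<longleftrightarrow> x \<in> X"
  by (auto simp: subbi_subspace subspace_add subspace_diff subspace_scale subspace_neg_iff)

lemma subbi_power: "subbi X \<Longrightarrow> x \<in> X \<Longrightarrow> x ^ n \<in> X"
  by (induction n) (auto intro: subbi_one subbi_mult)

end

section \<open>The filtration by skew primitives and sub-bialgebras\<close>

locale hopf_gen = hopf_data scale C dl eps S
  for scale :: "'k::{alg_closed_field, field_char_0} \<Rightarrow> 'b::ring_1 \<Rightarrow> 'b" (infixr \<open>*s\<close> 75)
    and C dl eps S +
  fixes a :: 'b and N \<nu> :: nat and g :: 'b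
  defines "g \<equiv> a ^ \<nu>"
  assumes a_gl: "gl a" and a_order: "a ^ N = 1" "\<And>m. 0 < m \<Longrightarrow> m < N \<Longrightarrow> a ^ m \<noteq> 1"
    and nu: "1 \<le> \<nu>" "\<nu> < N" "\<not> N dvd \<nu>\<^sup>2"
    and gen: "subspace D \<Longrightarrow> 1 \<in> D \<Longrightarrow> (\<And>x y. x \<in> D \<Longrightarrow> y \<in> D \<Longrightarrow> x * y \<in> D) \<Longrightarrow>
      a \<in> D \<Longrightarrow> (\<And>z. sp g z \<Longrightarrow> z \<in> D) \<Longrightarrow> C \<subseteq> D"
    and P_dim: "\<exists>B. finite B \<and> card B = 3 \<and> independent B \<and> span B = {z. sp g z}"
    and sp_trivial: "0 < i \<Longrightarrow> \<not> [i = \<nu>] (mod N) \<Longrightarrow> sp (a ^ i) z \<Longrightarrow> z \<in> span {a ^ i - 1}"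
begin

lemma N_pos: "0 < N" using nu by simp

lemma a_pow_mod: "a ^ (i mod N) = a ^ i"
proof -
  have "a ^ i = a ^ (N * (i div N) + i mod N)" by simp
  also have "\<dots> = a ^ (i mod N)" by (simp only: power_add power_mult a_order power_one mult_1_left)
  finally show ?thesis by simp
qed

lemma a_pow_cong: "[i = j] (mod N) \<Longrightarrow> a ^ i = a ^ j"
  by (metis a_pow_mod cong_def)

lemma a_pow_eq_one_iff: "a ^ i = 1 \<longleftrightarrow> N dvd i"
proof
  assume "a ^ i = 1"
  then have "a ^ (i mod N) = 1" by (simp add: a_pow_mod)
  then show "N dvd i" using a_order(2)[of "i mod N"] N_pos by (auto simp: dvd_eq_mod_eq_0)
next
  assume "N dvd i"
  then show "a ^ i = 1" using a_pow_mod[of i] by simp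
qed

lemma a_inv: "a ^ (N - i mod N) * a ^ i = 1" "a ^ i * a ^ (N - i mod N) = 1"
proof -
  have "N - i mod N + i mod N = N" using N_pos by (simp add: less_imp_le)
  then have "a ^ (N - i mod N) * a ^ (i mod N) = 1" "a ^ (i mod N) * a ^ (N - i mod N) = 1"
    by (metis power_add a_order(1), metis power_add a_order(1) add.commute)
  then show "a ^ (N - i mod N) * a ^ i = 1" "a ^ i * a ^ (N - i mod N) = 1"
    by (simp_all add: a_pow_mod)
qed

lemma a_pow_cancel: "a ^ i * x = a ^ i * y \<longleftrightarrow> x = y"
  by (metis a_inv(1) mult.assoc mult_1_left)

lemma a_pow_eq_iff: "a ^ i = a ^ j \<longleftrightarrow> [i = j] (mod N)"
proof
  assume *: "a ^ i = a ^ j"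
  show "[i = j] (mod N)"
  proof (cases "i \<le> j")
    case True
    then have "a ^ i * 1 = a ^ i * a ^ (j - i)"
      using * by (metis le_add_diff_inverse mult.right_neutral power_add)
    then have "a ^ (j - i) = 1" using a_pow_cancel[of i 1] by simp
    then show ?thesis using True a_pow_eq_one_iff by (metis cong_altdef_nat cong_sym)
  next
    case False
    then have "a ^ j * 1 = a ^ j * a ^ (i - j)"
      using * by (metis le_add_diff_inverse mult.right_neutral nat_le_linear power_add)
    then have "a ^ (i - j) = 1" using a_pow_cancel[of j 1] by simp
    then show ?thesis using False a_pow_eq_one_iff by (metis cong_altdef_nat nat_le_linear)
  qed
qed (rule a_pow_cong)

lemma a_pow_nz: "a ^ i \<noteq> 0"
  using a_inv(1)[of i] by auto

lemma a_pow_gl: "gl (a ^ i)" by (simp add: gl_power a_gl)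

lemma a_pow_C: "a ^ i \<in> C" by (simp add: gl_C a_pow_gl)

lemma g_gl: "gl g" and g_C: "g \<in> C" and g_nz: "g \<noteq> 0"
  by (simp_all add: g_def a_pow_gl a_pow_C a_pow_nz)

lemma g_ne_one: "g \<noteq> 1"
  using a_order(2) nu by (auto simp: g_def)

lemma eps_a: "eps (a ^ i) = 1" using gl_eps a_pow_gl a_pow_nz by simp

lemma g_power: "g ^ n = a ^ (\<nu> * n)" by (simp add: g_def power_mult)

lemma a_commute_g: "a ^ i * g = g * a ^ i"
  by (simp add: g_def add.commute flip: power_add)

text \<open>The group algebra of the cyclic group generated by \<open>a\<close>; it plays the part
  of the coradical.\<close>

definition K0 where "K0 = span (range (\<lambda>i. a ^ i))"

lemma range_a: "range (\<lambda>i. a ^ i) = (\<lambda>i. a ^ i) ` {..<N}"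
  using N_pos by (auto simp: image_iff intro!: bexI[of _ "_ mod N"] simp: a_pow_mod)

lemma K0_sub: "subspace K0" by (simp add: K0_def)

lemma a_pow_K0: "a ^ i \<in> K0" by (auto simp: K0_def intro: span_base)

lemma one_K0: "1 \<in> K0" using a_pow_K0[of 0] by simp

lemma g_K0: "g \<in> K0" by (simp add: g_def a_pow_K0)

lemma K0_C: "K0 \<subseteq> C"
  unfolding K0_def by (rule span_minimal) (auto simp: a_pow_C C_sub)

lemma K0_repr:
  assumes "u \<in> K0" obtains c where "u = (\<Sum>i<N. c i *s a ^ i)"
proof -
  have inj: "inj_on (\<lambda>i. a ^ i) {..<N}"
    by (auto simp: inj_on_def a_pow_eq_iff cong_def)
  from assms obtain c where "u = (\<Sum>k\<in>(\<lambda>i. a ^ i) ` {..<N}. c k *s k)"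
    unfolding K0_def range_a by (auto simp: span_finite)
  then have "u = (\<Sum>i<N. c (a ^ i) *s a ^ i)" by (simp add: sum.reindex[OF inj])
  then show ?thesis by (rule that)
qed

lemma vanish_K0: "lf p \<Longrightarrow> (\<And>i. p (a ^ i) = 0) \<Longrightarrow> u \<in> K0 \<Longrightarrow> p u = 0"
  using span_minimal[of "range (\<lambda>i. a ^ i)" "{u. p u = 0}"]
  by (auto simp: K0_def subspace_def lf_simps)

lemma K0_Lc: "u \<in> K0 \<Longrightarrow> lf p \<Longrightarrow> Lc p u \<in> K0" and K0_Rc: "u \<in> K0 \<Longrightarrow> lf p \<Longrightarrow> Rc p u \<in> K0"
  by (erule K0_repr, simp add: Lc_sum Lc_scale gl_Lc a_pow_gl Rc_sum Rc_scale gl_Rc,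
      intro subspace_sum[OF K0_sub] subspace_scale[OF K0_sub] a_pow_K0)+

lemma K0_mult: "u \<in> K0 \<Longrightarrow> a ^ i * u \<in> K0"
  unfolding K0_def
  by (rule span_mult_left[where E = "range (\<lambda>i. a ^ i)"]) (auto intro!: span_base simp flip: power_add)

lemma K0_mult_iff: "a ^ i * u \<in> K0 \<longleftrightarrow> u \<in> K0"
  by (metis K0_mult a_inv(1) mult.assoc mult_1_left)

lemma K0_ext:
  assumes "u \<in> K0" "\<And>i. F (a ^ i) = G (a ^ i)"
    and "\<And>x y. F (x + y) = F x + F y" "\<And>c x. F (c *s x) = c *s F x"
    and "\<And>x y. G (x + y) = G x + G y" "\<And>c x. G (c *s x) = c *s G x"
  shows "F u = G u"
proof -
  have "subspace {u. F u = G u}"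
    using assms(4)[of 0 0] assms(6)[of 0 0] by (auto simp: subspace_def assms)
  then have "K0 \<subseteq> {u. F u = G u}"
    unfolding K0_def by (rule span_minimal[rotated]) (use assms(2) in auto)
  then show ?thesis using assms(1) by blast
qed

lemma K0_comm: assumes "u \<in> K0" "v \<in> K0" shows "u * v = v * u"
proof -
  have *: "x * a ^ j = a ^ j * x" if "x \<in> K0" for x j
    using that
    by (rule K0_ext[where F = "\<lambda>x. x * a ^ j" and G = "\<lambda>x. a ^ j * x"])
      (simp_all add: smult_simps distrib_left distrib_right add.commute flip: power_add)
  show ?thesis
    by (rule K0_ext[OF assms(1), where F = "\<lambda>x. x * v" and G = "\<lambda>x. v * x"])
      (simp_all add: smult_simps distrib_left distrib_right *[OF assms(2)])
qed

text \<open>A linear extension of the coordinate function of \<open>a ^ i\<close> on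
  \<open>K0\<close>. Its values off \<open>K0\<close> are arbitrary, and every argument below works
  for any such choice.\<close>

definition dual :: "nat \<Rightarrow> 'b \<Rightarrow> 'k" where
  "dual i = (SOME p. lf p \<and> (\<forall>j. p (a ^ j) = (if [j = i] (mod N) then 1 else 0)))"

lemma dual: "lf (dual i)" "dual i (a ^ j) = (if [j = i] (mod N) then 1 else 0)"
proof -
  have "independent ((\<lambda>i. a ^ i) ` {..<N})"
    by (rule independent_gl) (auto simp: a_pow_gl a_pow_nz)
  then obtain p where p: "lf p" "\<And>x. x \<in> (\<lambda>i. a ^ i) ` {..<N} \<Longrightarrow> p x = (if x = a ^ i then 1 else 0)"
    using lf_extend[of _ "\<lambda>x. if x = a ^ i then 1 else 0"] by metis
  have "p (a ^ j) = (if [j = i] (mod N) then 1 else 0)" for j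
    using p(2)[of "a ^ j"] range_a by (metis a_pow_eq_iff rangeI)
  with p(1) have "\<exists>p. lf p \<and> (\<forall>j. p (a ^ j) = (if [j = i] (mod N) then 1 else 0))" by blast
  from someI_ex[OF this, folded dual_def]
  show "lf (dual i)" "dual i (a ^ j) = (if [j = i] (mod N) then 1 else 0)" by auto
qed

lemma dual_sum:
  assumes "u \<in> K0" shows "(\<Sum>i<N. dual i u) = eps u"
proof -
  define p where "p u = (\<Sum>i<N. dual i u) - eps u" for u
  have lfp: "lf p" unfolding p_def[abs_def] by (intro lf_minus lf_sums dual(1) eps_lf)
  have "(\<Sum>i<N. dual i (a ^ j)) = 1" for j
  proof -
    have "(\<Sum>i<N. dual i (a ^ j)) = (\<Sum>i<N. if i = j mod N then 1 else 0)"
      by (rule sum.cong) (auto simp: dual cong_def)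
    also have "\<dots> = 1" using N_pos by simp
    finally show ?thesis .
  qed
  then have "p (a ^ j) = 0" for j by (simp add: p_def eps_a)
  from vanish_K0[OF lfp this assms] show ?thesis by (simp add: p_def)
qed

lemma dual_cases: "a ^ k = a ^ i \<or> dual i (a ^ k) = 0"
  using a_pow_cong[of k i] by (simp add: dual)

lemma K0_dual_Lc: "u \<in> K0 \<Longrightarrow> Lc (dual i) u = dual i u *s a ^ i"
  by (erule K0_ext[where F = "Lc (dual i)" and G = "\<lambda>u. dual i u *s a ^ i"])
    (simp_all add: Lc_add Lc_scale lf_add lf_scale gl_Lc a_pow_gl dual(1) dual_cases scale_left_distrib)

lemma K0_dual_Rc: "u \<in> K0 \<Longrightarrow> Rc (dual i) u = dual i u *s a ^ i"
  by (erule K0_ext[where F = "Rc (dual i)" and G = "\<lambda>u. dual i u *s a ^ i"])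
    (simp_all add: Rc_add Rc_scale lf_add lf_scale gl_Rc a_pow_gl dual(1) dual_cases scale_left_distrib)

text \<open>Conjugation fixes both 1 and g, since \<open>a\<close> commutes with g, so it preserves
  the shape z \<otimes> g + 1 \<otimes> z of the coproduct.\<close>

lemma sp_conj: assumes "sp g z" shows "sp g (a ^ i * z * a ^ (N - i mod N))"
proof (rule spI)
  let ?b = "a ^ (N - i mod N)"
  show "a ^ i * z * ?b \<in> C" by (intro mult_C a_pow_C sp_C[OF assms])
  fix p assume p: "lf p"
  have "Lc p (a ^ i * (z * ?b)) = a ^ i * Lc (\<lambda>c. p (a ^ i * c)) (z * ?b)"
    using p by (intro Lc_gl_mult a_pow_gl mult_C a_pow_C sp_C[OF assms])
  also have "Lc (\<lambda>c. p (a ^ i * c)) (z * ?b) = p (a ^ i * (z * ?b)) *s (g * ?b) + p (a ^ i * ?b) *s (z * ?b)"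
    using gl_Lc[OF a_pow_gl lf_mult_left[OF lf_mult_left[OF p, of "a ^ i"], of z]] p
    by (subst Lc_sp_mult[OF assms]) (simp_all add: a_pow_C gl_Lc a_pow_gl smult_simps)
  also have "a ^ i * \<dots> = p (a ^ i * (z * ?b)) *s (a ^ i * (g * ?b)) + p 1 *s (a ^ i * (z * ?b))"
    by (simp add: distrib_left smult_simps a_inv)
  also have "a ^ i * (g * ?b) = g"
    using a_commute_g by (metis a_inv(2) mult.assoc mult.right_neutral)
  finally show "Lc p (a ^ i * z * ?b) = p (a ^ i * z * ?b) *s g + p 1 *s (a ^ i * z * ?b)"
    by (simp add: mult.assoc)
qed

text \<open>The degree counts the skew-primitive factors standing to the left of \<open>K0\<close>.
  Powers of \<open>a\<close> can be moved through such factors by \<open>sp_conj\<close>, so each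
  stage is stable under left multiplication by them.\<close>

primrec fil :: "nat \<Rightarrow> 'b set" where
  "fil 0 = K0"
| "fil (Suc n) = span (fil n \<union> {z * u | z u. sp g z \<and> u \<in> fil n})"

lemma fil_subspace: "subspace (fil n)"
  by (cases n) (auto simp: K0_sub)

lemma fil_Suc: "fil n \<subseteq> fil (Suc n)" and fil_sp: "sp g z \<Longrightarrow> u \<in> fil n \<Longrightarrow> z * u \<in> fil (Suc n)"
  by (auto intro!: span_base)

lemma fil_mono: "m \<le> n \<Longrightarrow> fil m \<subseteq> fil n"
  by (rule lift_Suc_mono_le[of fil]) (use fil_Suc in blast)+

lemma fil_Suc_induct [consumes 1, case_names subspace low mult]:
  assumes "u \<in> fil (Suc n)" "subspace {u. Q u}" "\<And>u. u \<in> fil n \<Longrightarrow> Q u"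
    "\<And>z u. sp g z \<Longrightarrow> u \<in> fil n \<Longrightarrow> Q (z * u)"
  shows "Q u"
  using assms(1) span_minimal[of "fil n \<union> {z * u | z u. sp g z \<and> u \<in> fil n}" "{u. Q u}"] assms(2-) by auto

lemma fil_C: "fil n \<subseteq> C"
proof (induction n)
  case (Suc n)
  show ?case
  proof
    fix u assume "u \<in> fil (Suc n)"
    then show "u \<in> C"
      by (induction rule: fil_Suc_induct) (use Suc in \<open>auto simp: C_sub intro: C_intros sp_C\<close>)
  qed
qed (simp add: K0_C)

lemma fil_a: "u \<in> fil n \<Longrightarrow> a ^ i * u \<in> fil n"
proof (induction n arbitrary: u)
  case (Suc n)
  from Suc.prems show ?case
  proof (induction rule: fil_Suc_induct)
    case subspace show ?case by (intro subspace_mult_left fil_subspace)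
  next
    case (low u) then show ?case using Suc.IH fil_Suc by blast
  next
    case (mult z u)
    have "(a ^ i * z * a ^ (N - i mod N)) * (a ^ i * u) \<in> fil (Suc n)"
      using mult Suc.IH by (intro fil_sp sp_conj)
    moreover have "(a ^ i * z * a ^ (N - i mod N)) * (a ^ i * u) = a ^ i * (z * u)"
      by (metis a_inv(1) mult.assoc mult.left_neutral)
    ultimately show ?case by simp
  qed
qed (simp add: K0_mult)

lemma subspace_op:
  assumes "\<And>x y. F (x + y) = F x + F y" "\<And>c x. F (c *s x) = c *s F x" "subspace W"
  shows "subspace {u. F u \<in> W}"
proof (rule subspaceI)
  have "F 0 = 0" using assms(2)[of 0 0] by simp
  then show "0 \<in> {u. F u \<in> W}" by (simp add: subspace_0[OF assms(3)])
qed (simp_all add: assms(1,2) subspace_add[OF assms(3)] subspace_scale[OF assms(3)])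

lemma subspace_Lc: "lf p \<Longrightarrow> subspace W \<Longrightarrow> subspace {u. Lc p u \<in> W}"
  and subspace_Rc: "lf p \<Longrightarrow> subspace W \<Longrightarrow> subspace {u. Rc p u \<in> W}"
  by (rule subspace_op, simp_all only: Lc_add Lc_scale Rc_add Rc_scale)+

lemma fil_Lc_Rc: "u \<in> fil n \<Longrightarrow> lf p \<Longrightarrow> Lc p u \<in> fil n \<and> Rc p u \<in> fil n"
proof (induction n arbitrary: u p)
  case (Suc n)
  from Suc.prems(1) show ?case
  proof (induction rule: fil_Suc_induct)
    case subspace
    show ?case using subspace_inter[OF subspace_Lc subspace_Rc] Suc.prems(2) fil_subspace
      by (auto simp: Collect_conj_eq)
  next
    case (low u) then show ?case using Suc.IH[OF low Suc.prems(2)] fil_Suc by blast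
  next
    case (mult z u)
    then have uC: "u \<in> C" using fil_C by blast
    have IH: "Lc q u \<in> fil n" "Rc q u \<in> fil n" if "lf q" for q using Suc.IH[OF mult(2) that] by auto
    have 1: "g * Lc (\<lambda>c. p (z * c)) u \<in> fil (Suc n)" "z * Lc p u \<in> fil (Suc n)"
      "z * Rc (\<lambda>c. p (g * c)) u \<in> fil (Suc n)" "Rc (\<lambda>c. p (z * c)) u \<in> fil (Suc n)"
      unfolding g_def
      using subsetD[OF fil_Suc[of n] fil_a[OF IH(1)[OF lf_mult_left[OF Suc.prems(2), of z]], of \<nu>]]
        fil_sp[OF mult(1) IH(1)[OF Suc.prems(2)]]
        fil_sp[OF mult(1) IH(2)[OF lf_mult_left[OF Suc.prems(2), of g]]]
        subsetD[OF fil_Suc[of n] IH(2)[OF lf_mult_left[OF Suc.prems(2), of z]]]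
      by (simp_all only: g_def)
    then show ?case
      using Lc_sp_mult[OF mult(1) uC Suc.prems(2)] Rc_sp_mult[OF mult(1) uC Suc.prems(2)]
        subspace_add[OF fil_subspace] by metis
  qed
qed (simp add: K0_Lc K0_Rc)

text \<open>A functional that kills the powers of \<open>a\<close> has to consume at least one
  skew-primitive factor, so slicing with it lowers the degree; the \<open>case\<close> expression
  supplies {0} as the stage below degree 0. This is what makes \<open>K0\<close> behave like the
  coradical.\<close>

lemma fil_lower: "u \<in> fil n \<Longrightarrow> lf p \<Longrightarrow> (\<And>i. p (a ^ i) = 0) \<Longrightarrow>
    Lc p u \<in> (case n of 0 \<Rightarrow> {0} | Suc m \<Rightarrow> fil m) \<and> Rc p u \<in> (case n of 0 \<Rightarrow> {0} | Suc m \<Rightarrow> fil m)"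
proof (induction n arbitrary: u p)
  case 0
  then show ?case
    by (auto elim!: K0_repr simp: Lc_sum Lc_scale Rc_sum Rc_scale gl_Lc gl_Rc a_pow_gl)
next
  case (Suc n)
  have "Lc p u \<in> fil n \<and> Rc p u \<in> fil n"
    using Suc.prems(1)
  proof (induction rule: fil_Suc_induct)
    case subspace
    show ?case using subspace_inter[OF subspace_Lc subspace_Rc] Suc.prems(2) fil_subspace
      by (auto simp: Collect_conj_eq)
  next
    case (low u) then show ?case using fil_Lc_Rc Suc.prems(2) by blast
  next
    case (mult z u)
    then have uC: "u \<in> C" using fil_C by blast
    \<comment> \<open>Multiplication by g permutes the powers of \<open>a\<close>, so the shifted
      functional vanishes on them as well and falls under the induction hypothesis.\<close>
    have p': "lf (\<lambda>c. p (g * c))" "p (g * a ^ i) = 0" for i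
      using Suc.prems by (auto simp: g_def simp flip: power_add)
    have IH: "Lc p u \<in> (case n of 0 \<Rightarrow> {0} | Suc m \<Rightarrow> fil m)"
      "Rc (\<lambda>c. p (g * c)) u \<in> (case n of 0 \<Rightarrow> {0} | Suc m \<Rightarrow> fil m)"
      using Suc.IH[OF mult(2) Suc.prems(2,3)] Suc.IH[OF mult(2) p'] by auto
    have low: "z * v \<in> fil n" if "v \<in> (case n of 0 \<Rightarrow> {0} | Suc m \<Rightarrow> fil m)" for v
      using that mult(1) fil_sp subspace_0[OF K0_sub] by (cases n) auto
    have "Lc (\<lambda>c. p (z * c)) u \<in> fil n" "Rc (\<lambda>c. p (z * c)) u \<in> fil n"
      using fil_Lc_Rc[OF mult(2)] Suc.prems(2) by auto
    then show ?case
      using Lc_sp_mult[OF mult(1) uC Suc.prems(2)] Rc_sp_mult[OF mult(1) uC Suc.prems(2)]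
        subspace_add[OF fil_subspace] low[OF IH(1)] low[OF IH(2)] fil_a[of _ n \<nu>, folded g_def] by metis
  qed
  then show ?case by simp
qed

text \<open>The union of the stages is closed under products, by induction on the degree of the left
  factor with the right factor arbitrary; it contains the generators, so it is everything.\<close>

lemma fil_exhaust: "u \<in> C \<Longrightarrow> \<exists>n. u \<in> fil n"
proof -
  let ?D = "\<Union>n. fil n"
  have "subspace ?D"
    unfolding subspace_def
  proof (intro conjI ballI allI)
    show "0 \<in> ?D" using subspace_0[OF fil_subspace] by blast
    show "c *s x \<in> ?D" if "x \<in> ?D" for c x using that subspace_scale[OF fil_subspace] by blast
    fix x y assume "x \<in> ?D" "y \<in> ?D"
    then obtain m n where "x \<in> fil m" "y \<in> fil n" by auto
    then have "x \<in> fil (max m n)" "y \<in> fil (max m n)"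
      using fil_mono[of m "max m n"] fil_mono[of n "max m n"] by auto
    then show "x + y \<in> ?D" using subspace_add[OF fil_subspace] by blast
  qed
  moreover have "1 \<in> ?D" using one_K0 fil.simps(1) by blast
  moreover have "x * y \<in> ?D" if "x \<in> ?D" "y \<in> ?D" for x y
  proof -
    have "\<forall>y\<in>?D. x * y \<in> ?D" if "x \<in> fil n" for n x
      using that
    proof (induction n arbitrary: x)
      case 0
      then obtain c where x: "x = (\<Sum>i<N. c i *s a ^ i)" using K0_repr by (metis fil.simps(1))
      show ?case
      proof
        fix y assume "y \<in> ?D"
        then have "a ^ i * y \<in> ?D" for i using fil_a by blast
        then show "x * y \<in> ?D"
          unfolding x sum_distrib_right scale_mult_left
          by (intro subspace_sum[OF \<open>subspace ?D\<close>] subspace_scale[OF \<open>subspace ?D\<close>])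
      qed
    next
      case (Suc n)
      from Suc.prems show ?case
      proof (induction rule: fil_Suc_induct)
        case subspace
        show ?case
          using subspace_mult_right[OF \<open>subspace ?D\<close>] subspace_Inter[of "(\<lambda>y. {x. x * y \<in> ?D}) ` ?D"]
          by (simp add: Inter_eq)
      next
        case (low u) then show ?case using Suc.IH by blast
      next
        case (mult z u)
        show ?case
        proof
          fix y assume "y \<in> ?D"
          then have "u * y \<in> ?D" using Suc.IH mult(2) by blast
          then obtain m where "u * y \<in> fil m" by auto
          then have "z * (u * y) \<in> fil (Suc m)" using fil_sp mult(1) by blast
          then show "z * u * y \<in> ?D" by (metis UN_I UNIV_I mult.assoc)
        qed
      qed
    qed
    then show ?thesis using that by blast
  qed
  moreover have "a \<in> ?D" using a_pow_K0[of 1] fil.simps(1) by (metis UN_I UNIV_I power_one_right)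
  moreover have "z \<in> ?D" if "sp g z" for z
    using fil_sp[OF that, of 1 0] one_K0 by (metis UN_I UNIV_I fil.simps(1) mult.right_neutral)
  ultimately have "C \<subseteq> ?D" by (rule gen)
  then show "u \<in> C \<Longrightarrow> \<exists>n. u \<in> fil n" by blast
qed

text \<open>An element of X outside \<open>K0\<close> of least degree has its slices inside
  \<open>K0\<close> whenever the functional vanishes on \<open>K0\<close>. Cutting it by coordinate
  functionals on both sides isolates a component v with coproduct v \<otimes> a^j + a^i \<otimes> v
  up to a term in \<open>K0\<close> \<otimes> \<open>K0\<close>, and a correction makes this exact.
  Dividing by a^i gives a skew primitive for a power of \<open>a\<close>, and triviality of the
  other skew primitives identifies that power as g.\<close>

lemma Taft_Wilson:
  assumes X: "subbi X" and ne: "\<not> X \<subseteq> K0"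
  shows "g \<in> X" "\<exists>z\<in>X. sp g z \<and> z \<notin> K0"
proof -
  have "\<exists>n. \<not> X \<inter> fil n \<subseteq> K0" using ne fil_exhaust subbi_C[OF X] by blast
  then obtain n where n: "\<not> X \<inter> fil n \<subseteq> K0" "\<And>m. m < n \<Longrightarrow> X \<inter> fil m \<subseteq> K0"
    using exists_least_iff[of "\<lambda>n. \<not> X \<inter> fil n \<subseteq> K0"] by blast
  then obtain u where u: "u \<in> X" "u \<in> fil n" "u \<notin> K0" by blast
  have uC: "u \<in> C" using u X subbi_C by blast
  have uK: "Lc p u \<in> K0" "Rc p u \<in> K0" if "lf p" "\<And>i. p (a ^ i) = 0" for p
    using fil_lower[OF u(2) that] n(2) subbi_Lc[OF X that(1) u(1)] subbi_Rc[OF X that(1) u(1)]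
    by (auto split: nat.splits simp: subspace_0[OF K0_sub])
  \<comment> \<open>On \<open>K0\<close> the functional E agrees with the counit, so slices of u by
    eps - E lie in \<open>K0\<close>; the double slice of u by E therefore differs from u only by an
    element of \<open>K0\<close>.\<close>
  define E where "E x = (\<Sum>i<N. dual i x)" for x
  have lfE: "lf E" unfolding E_def[abs_def] by (intro lf_sums dual(1))
  have E0: "lf (\<lambda>x. eps x - E x)" "eps (a ^ i) - E (a ^ i) = 0" for i
    using dual_sum[OF a_pow_K0, of i] by (intro lf_minus eps_lf lfE, simp add: E_def)
  have diffL: "x - Lc E x = Lc (\<lambda>x. eps x - E x) x" and diffR: "x - Rc E x = Rc (\<lambda>x. eps x - E x) x"
    if "x \<in> C" for x
    using Lc_add_fun[of "\<lambda>x. eps x - E x" E x] Lc_eps[OF that] that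
      Rc_sum_fun[of "\<lambda>b. if b then E else (\<lambda>x. eps x - E x)" UNIV x] Rc_eps[OF that]
    by (auto simp: UNIV_bool algebra_simps)
  have "Lc E (Rc E u) \<notin> K0"
  proof
    assume *: "Lc E (Rc E u) \<in> K0"
    have 1: "u - Rc E u \<in> K0" using diffR[OF uC] uK[OF E0] by simp
    have "Rc E u - Lc E (Rc E u) = Lc (\<lambda>x. eps x - E x) (Rc E u)" using diffL[OF Rc_in] .
    also have "\<dots> = Lc (\<lambda>x. eps x - E x) u - Lc (\<lambda>x. eps x - E x) (u - Rc E u)"
      using Lc_diff[OF E0(1)] by simp
    also have "\<dots> \<in> K0" using uK[OF E0] K0_Lc[OF 1 E0(1)] subspace_diff[OF K0_sub] by blast
    finally have "u \<in> K0" using 1 * subspace_add[OF K0_sub, of "u - Rc E u" "Rc E u - Lc E (Rc E u)"]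
        subspace_add[OF K0_sub, of "u - Lc E (Rc E u)" "Lc E (Rc E u)"] by simp
    then show False using u by simp
  qed
  moreover have "Lc E (Rc E u) = (\<Sum>i<N. \<Sum>j<N. Lc (dual i) (Rc (dual j) u))"
    unfolding E_def[abs_def] Rc_sum_fun Lc_sum_fun Lc_sum[OF dual(1)] ..
  ultimately have "\<not> (\<forall>i j. Lc (dual i) (Rc (dual j) u) \<in> K0)"
    by (metis (no_types, lifting) subspace_sum[OF K0_sub])
  then obtain i j where ij: "Lc (dual i) (Rc (dual j) u) \<notin> K0" by blast
  define v where "v = Lc (dual i) (Rc (dual j) u)"
  have vX: "v \<in> X" unfolding v_def using u X dual subbi_Lc subbi_Rc by blast
  have vC: "v \<in> C" unfolding v_def by (rule Lc_in)
  \<comment> \<open>Slicing by p pushes u into \<open>K0\<close>, where a coordinate functional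
    extracts a multiple of a single power of \<open>a\<close>; this is why all these slices of v are
    multiples of a^i or a^j.\<close>
  have Rv: "Rc p v = p v *s a ^ i" and Lv: "Lc p v = p v *s a ^ j" if p: "lf p" "\<And>i. p (a ^ i) = 0" for p
  proof -
    have q: "lf (cv p (dual j))" "cv p (dual j) (a ^ m) = 0" "lf (cv (dual i) p)" "cv (dual i) p (a ^ m) = 0" for m
      using p dual by (auto simp: gl_cv a_pow_gl)
    have pv: "p v = cv (cv (dual i) p) (dual j) u"
      unfolding v_def Lc_pair[OF p(1)] using Rc_pair[OF q(3)] by simp
    have "Rc p v = Lc (dual i) (Rc p (Rc (dual j) u))"
      unfolding v_def using Lc_Rc[OF Rc_in dual(1) p(1)] by simp
    also have "\<dots> = Lc (dual i) (Rc (cv p (dual j)) u)"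
      using Rc_Rc[OF uC dual(1) p(1)] by simp
    also have "\<dots> = dual i (Rc (cv p (dual j)) u) *s a ^ i"
      using uK(2)[OF q(1,2)] by (rule K0_dual_Lc)
    also have "dual i (Rc (cv p (dual j)) u) = p v"
      unfolding pv Rc_pair[OF dual(1)] using cv_assoc[OF uC dual(1) p(1) dual(1)] by simp
    finally show "Rc p v = p v *s a ^ i" .
    have "Lc p v = Rc (dual j) (Lc (cv (dual i) p) u)"
      unfolding v_def Lc_Lc[OF Rc_in dual(1) p(1)] Lc_Rc[OF uC q(3) dual(1)] ..
    also have "\<dots> = dual j (Lc (cv (dual i) p) u) *s a ^ j"
      using uK(1)[OF q(3,4)] by (rule K0_dual_Rc)
    also have "dual j (Lc (cv (dual i) p) u) = p v"
      unfolding pv Lc_pair[OF dual(1)] ..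
    finally show "Lc p v = p v *s a ^ j" .
  qed
  obtain f where f: "lf f" "\<And>w. w \<in> K0 \<Longrightarrow> f w = 0" "f v = 1"
    by (rule lf_separate[OF K0_sub ij[folded v_def]]) blast
  have f0: "f (a ^ m) = 0" for m by (rule f(2)[OF a_pow_K0])
  have aX: "a ^ i \<in> X" "a ^ j \<in> X"
    using subbi_Rc[OF X f(1) vX] subbi_Lc[OF X f(1) vX] by (simp_all add: Rv[OF f(1) f0] Lv[OF f(1) f0] f(3))
  \<comment> \<open>The term in \<open>K0\<close> \<otimes> \<open>K0\<close> is removed by passing
    from v to its slice w and subtracting a multiple of a^j; the result has coproduct exactly z
    \<otimes> a^j + a^i \<otimes> z.\<close>
  define w where "w = Lc (dual i) v"
  define z where "z = w - dual i v *s a ^ j"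
  have wC: "w \<in> C" unfolding w_def by (rule Lc_in)
  have zX: "z \<in> X" unfolding z_def w_def
    by (rule subbi_diff[OF X subbi_Lc[OF X dual(1) vX] subbi_scale[OF X aX(2)]])
  have "f z = 1"
  proof -
    have "f w = dual i (Rc f v)" unfolding w_def Lc_pair[OF f(1)] Rc_pair[OF dual(1)] ..
    also have "\<dots> = 1" unfolding Rv[OF f(1) f0] lf_scale[OF dual(1)] dual(2) f(3) by simp
    finally show ?thesis unfolding z_def lf_diff[OF f(1)] lf_scale[OF f(1)] f0 by simp
  qed
  then have zK: "z \<notin> K0" using f(2)[of z] by (intro notI) simp
  have Lz: "Lc q z = q z *s a ^ j + q (a ^ i) *s z" if q: "lf q" for q
  proof -
    let ?\<phi> = "\<lambda>x. cv (dual i) q x - q (a ^ i) * dual i x"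
    have \<phi>: "lf ?\<phi>" by (rule lf_minus[OF lf_cv[OF dual(1) q] lf_cmult[OF dual(1)]])
    have \<phi>0: "?\<phi> (a ^ m) = 0" for m
      unfolding gl_cv[OF a_pow_gl dual(1) q] dual(2) using a_pow_cong[of m i] by auto
    have "Lc q w = Lc (cv (dual i) q) v" unfolding w_def Lc_Lc[OF vC dual(1) q] ..
    also have "\<dots> = Lc (\<lambda>x. ?\<phi> x + q (a ^ i) * dual i x) v" by (simp only: diff_add_cancel)
    also have "\<dots> = Lc ?\<phi> v + q (a ^ i) *s w"
      unfolding w_def Lc_add_fun Lc_cmult_fun ..
    also have "Lc ?\<phi> v = ?\<phi> v *s a ^ j" using Lv[OF \<phi> \<phi>0] .
    also have "cv (dual i) q v = q w" unfolding w_def Lc_pair[OF q] ..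
    finally have "Lc q w = (q w - q (a ^ i) * dual i v) *s a ^ j + q (a ^ i) *s w" .
    then show ?thesis
      unfolding z_def Lc_diff[OF q] Lc_scale[OF q] gl_Lc[OF a_pow_gl q] lf_diff[OF q] lf_scale[OF q]
      by (simp add: algebra_simps)
  qed
  \<comment> \<open>Adding N - i mod N instead of subtracting i keeps the exponent a positive
    natural number, as \<open>sp_trivial\<close> demands.\<close>
  define e where "e = N - i mod N + j"
  define z' where "z' = a ^ (N - i mod N) * z"
  have zC: "z \<in> C" using zX X subbi_C by blast
  have sp: "sp (a ^ e) z'"
  proof (rule spI)
    show "z' \<in> C" unfolding z'_def by (intro C_intros a_pow_C zC)
    fix p assume p: "lf p"
    have "Lc p z' = a ^ (N - i mod N) * (p z' *s a ^ j + p 1 *s z)"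
      unfolding z'_def using p by (simp add: Lc_gl_mult a_pow_gl zC Lz a_inv)
    then show "Lc p z' = p z' *s a ^ e + p 1 *s z'"
      by (simp add: z'_def e_def distrib_left smult_simps power_add)
  qed
  have z'K: "z' \<notin> K0" using zK by (simp add: z'_def K0_mult_iff)
  have "a ^ e - 1 \<in> K0" by (intro subspace_diff K0_sub a_pow_K0 one_K0)
  then have "span {a ^ e - 1} \<subseteq> K0" by (intro span_minimal K0_sub) auto
  moreover have "0 < e" using mod_less_divisor[OF N_pos, of i] unfolding e_def by linarith
  ultimately have "[e = \<nu>] (mod N)" using sp_trivial[of e z'] sp z'K by blast
  then have ag: "a ^ e = g" by (simp add: g_def a_pow_cong)
  have "a ^ (N - i mod N) = (a ^ i) ^ (N - 1)"
  proof -
    have "a ^ i * (a ^ i) ^ (N - 1) = (a ^ N) ^ i"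
      using N_pos by (metis Suc_pred' mult.commute power_Suc power_mult)
    then have "a ^ i * (a ^ i) ^ (N - 1) = a ^ i * a ^ (N - i mod N)" by (simp add: a_order a_inv)
    then show ?thesis by (simp add: a_pow_cancel)
  qed
  then have inv: "a ^ (N - i mod N) \<in> X" using subbi_power[OF X aX(1)] by simp
  have "z' \<in> X" unfolding z'_def using X inv zX by (rule subbi_mult)
  then show "\<exists>z\<in>X. sp g z \<and> z \<notin> K0" using sp ag z'K by auto
  have "a ^ e \<in> X" unfolding e_def power_add using X inv aX(2) by (rule subbi_mult)
  then show "g \<in> X" using ag by simp
qed

end

section \<open>Bilinear extension, the antipode and generated subalgebras\<close>

context hopf_data begin

text \<open>Products of functionals determine a tensor. A basis of the span of all left entries
  expresses any bilinear form through the slices of the list by the dual functionals, and these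
  slices agree by hypothesis.\<close>

lemma sw_bilinear_eq:
  fixes t :: "'b \<Rightarrow> 'b \<Rightarrow> 'k"
  assumes eq: "\<And>p q. lf p \<Longrightarrow> lf q \<Longrightarrow> sw xs (prd p q) = sw ys (prd p q)"
    and t: "\<And>x. lf (\<lambda>u. t u x)" "\<And>x. lf (t x)"
  shows "sw xs t = sw ys t"
proof -
  let ?F = "fst ` set xs \<union> fst ` set ys"
  obtain B where B: "B \<subseteq> ?F" "independent B" "?F \<subseteq> span B"
    using maximal_independent_subset[of ?F] by blast
  have fin: "finite B" using B(1) finite_subset by blast
  define d where "d e = (SOME p. lf p \<and> (\<forall>x\<in>B. p x = (if x = e then 1 else 0)))" for e
  have d: "lf (d e)" "x \<in> B \<Longrightarrow> d e x = (if x = e then 1 else 0)" for e x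
  proof -
    have "\<exists>p. lf p \<and> (\<forall>x\<in>B. p x = (if x = e then 1 else 0))"
      using lf_extend[OF B(2), of "\<lambda>x. if x = e then 1 else 0"] by metis
    from someI_ex[OF this, folded d_def]
    show "lf (d e)" "x \<in> B \<Longrightarrow> d e x = (if x = e then 1 else 0)" by auto
  qed
  have expand: "t u v = (\<Sum>e\<in>B. t e (d e u *s v))" if "u \<in> ?F" for u v
  proof -
    have "u \<in> span B" using that B(3) by blast
    then obtain c where c: "u = (\<Sum>e\<in>B. c e *s e)" using span_finite[OF fin] by auto
    have "d e u = c e" if "e \<in> B" for e
    proof -
      have "d e u = (\<Sum>x\<in>B. c x * d e x)" unfolding c by (simp add: lf_sum[OF d(1)] lf_scale[OF d(1)])
      also have "\<dots> = (\<Sum>x\<in>B. if x = e then c e else 0)" by (rule sum.cong) (auto simp: d(2))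
      also have "\<dots> = c e" using that fin by simp
      finally show ?thesis .
    qed
    then have "(\<Sum>e\<in>B. t e (d e u *s v)) = (\<Sum>e\<in>B. c e * t e v)"
      by (intro sum.cong) (simp_all add: lf_scale[OF t(2)])
    also have "\<dots> = t u v" unfolding c by (simp add: lf_sum[OF t(1)] lf_scale[OF t(1)])
    finally show ?thesis by simp
  qed
  have sum_sw: "sw zs (\<lambda>u v. \<Sum>e\<in>B. f e u v) = (\<Sum>e\<in>B. sw zs (f e))" for zs and f :: "'b \<Rightarrow> 'b \<Rightarrow> 'b \<Rightarrow> 'k"
    by (induction zs) (auto simp: sum.distrib)
  have main: "sw zs t = (\<Sum>e\<in>B. t e (sw zs (\<lambda>u v. d e u *s v)))" if "fst ` set zs \<subseteq> ?F" for zs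
  proof -
    have "sw zs t = sw zs (\<lambda>u v. \<Sum>e\<in>B. t e (d e u *s v))"
      by (rule sw_cong, rule expand) (use that in force)
    then show ?thesis by (simp add: sum_sw lf_sw[OF t(2)])
  qed
  have "sw xs (\<lambda>u v. d e u *s v) = sw ys (\<lambda>u v. d e u *s v)" for e
  proof (rule lf_eqI)
    fix q assume q: "lf q"
    show "q (sw xs (\<lambda>u v. d e u *s v)) = q (sw ys (\<lambda>u v. d e u *s v))"
      using eq[OF d(1) q] by (simp add: lf_sw[OF q] lf_scale[OF q])
  qed
  then show ?thesis by (simp add: main)
qed

definition lin :: "('b \<Rightarrow> 'b) \<Rightarrow> bool" where
  "lin F \<longleftrightarrow> (\<forall>x y. F (x + y) = F x + F y) \<and> (\<forall>c x. F (c *s x) = c *s F x)"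

lemma lin_lf: "lin F \<Longrightarrow> lf p \<Longrightarrow> lf (\<lambda>u. p (F u))"
  by (simp add: lin_def lf_def)

lemma sw_bilinear_eq':
  fixes t :: "'b \<Rightarrow> 'b \<Rightarrow> 'b"
  assumes eq: "\<And>p q. lf p \<Longrightarrow> lf q \<Longrightarrow> sw xs (prd p q) = sw ys (prd p q)"
    and t: "\<And>x. lin (\<lambda>u. t u x)" "\<And>x. lin (t x)"
  shows "sw xs t = sw ys t"
proof (rule lf_eqI)
  fix p assume p: "lf p"
  show "p (sw xs t) = p (sw ys t)"
    unfolding lf_sw[OF p] by (rule sw_bilinear_eq[OF eq lin_lf[OF t(1) p] lin_lf[OF t(2) p]])
qed

lemma linI: "(\<And>x y. F (x + y) = F x + F y) \<Longrightarrow> (\<And>c x. F (c *s x) = c *s F x) \<Longrightarrow> lin F"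
  and lin_add: "lin F \<Longrightarrow> F (x + y) = F x + F y" and lin_scale: "lin F \<Longrightarrow> F (c *s x) = c *s F x"
  by (auto simp: lin_def)

lemma lin_mult_left: "lin F \<Longrightarrow> lin (\<lambda>u. c * F u)"
  by (rule linI) (simp_all only: lin_add lin_scale distrib_left scale_mult_right)

lemma lin_mult_right: "lin F \<Longrightarrow> lin (\<lambda>u. F u * c)"
  by (rule linI) (simp_all only: lin_add lin_scale distrib_right scale_mult_left)

lemma lin_comp: "lin F \<Longrightarrow> lin G \<Longrightarrow> lin (\<lambda>u. F (G u))"
  by (rule linI) (simp_all only: lin_add lin_scale)

lemma lin_S: "lin S" and lin_id: "lin (\<lambda>u. u)"
  by (auto intro: linI simp: S_add S_scale)

text \<open>The antipode inverts the identity under convolution, so convolving F with the identity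
  and then with \<open>S\<close> gives F back. Consequently linear maps that agree after convolution
  with the identity are equal, which is how values of \<open>S\<close> are identified.\<close>

lemma conv_cancel:
  assumes F: "lin F" and u: "u \<in> C"
  shows "F u = sw (dl u) (\<lambda>u v. sw (dl u) (\<lambda>u1 u2. F u1 * u2) * S v)"
proof -
  have "F u = F (sw (dl u) (\<lambda>u v. eps v *s u))" using counit_right[OF u] by simp
  also have "\<dots> = sw (dl u) (\<lambda>u v. F u * (eps v *s 1))"
    using F by (subst sw_hom[of F]) (simp_all add: lin_add lin_scale scale_mult_right lin_scale[of F 0 0, simplified])
  also have "\<dots> = sw (dl u) (\<lambda>u v. F u * sw (dl v) (\<lambda>v1 v2. v1 * S v2))"
    using dl_in[of u] by (intro sw_cong) (auto simp: antipode_right)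
  also have "\<dots> = sw (dl u) (\<lambda>u v. sw (dl u) (\<lambda>u1 u2. F u1 * u2) * S v)"
  proof (rule lf_eqI)
    fix p assume p: "lf p"
    let ?t = "\<lambda>x y z. p (F x * (y * S z))"
    have "lf (\<lambda>u. ?t u x y)" "lf (\<lambda>u. ?t x u y)" "lf (\<lambda>u. ?t x y u)" for x y
      by (intro lin_lf[OF _ p] lin_mult_left lin_mult_right F lin_S lin_id)+
    from dl_coassoc[OF u this]
    have eq: "sw (dl u) (\<lambda>u v. sw (dl u) (\<lambda>u1 u2. ?t u1 u2 v)) = sw (dl u) (\<lambda>u v. sw (dl v) (\<lambda>v1 v2. ?t u v1 v2))" .
    have "c * sw xs b = sw xs (\<lambda>u v. c * b u v)" "sw xs b * c = sw xs (\<lambda>u v. b u v * c)"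
      for xs :: "('b \<times> 'b) list" and b :: "'b \<Rightarrow> 'b \<Rightarrow> 'b" and c
      by (rule sw_distrib_left, rule sw_distrib_right)
    then show "p (sw (dl u) (\<lambda>u v. F u * sw (dl v) (\<lambda>v1 v2. v1 * S v2))) =
        p (sw (dl u) (\<lambda>u v. sw (dl u) (\<lambda>u1 u2. F u1 * u2) * S v))"
      using eq by (simp add: lf_sw[OF p] mult.assoc)
  qed
  finally show ?thesis .
qed

lemma conv_eq:
  assumes "lin F" "lin G" "u \<in> C"
    and "\<And>u. u \<in> C \<Longrightarrow> sw (dl u) (\<lambda>x y. F x * y) = sw (dl u) (\<lambda>x y. G x * y)"
  shows "F u = G u"
proof -
  have "sw (dl u) (\<lambda>u v. sw (dl u) (\<lambda>u1 u2. F u1 * u2) * S v) =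
    sw (dl u) (\<lambda>u v. sw (dl u) (\<lambda>u1 u2. G u1 * u2) * S v)"
    using dl_in[of u] assms(4) by (intro sw_cong) auto
  then show ?thesis using conv_cancel assms by simp
qed

text \<open>The map u |-> S (h u) h and \<open>S\<close> itself both give the counit when convolved
  with the identity. Anti-multiplicativity is proved only for a left factor that is grouplike or
  skew primitive, the two kinds of generators.\<close>

lemma S_gl_mult:
  assumes h: "gl h" "h * h' = 1" and u: "u \<in> C"
  shows "S (h * u) = S u * h'"
proof -
  have "h \<noteq> 0" using h(2) by auto
  then have eps_h: "eps h = 1" using gl_eps h by blast
  have "S (h * u) * h = S u"
  proof (rule conv_eq[where F = "\<lambda>u. S (h * u) * h" and G = S])
    show "lin (\<lambda>u. S (h * u) * h)" by (intro lin_mult_right lin_comp[OF lin_S] lin_mult_left lin_id)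
    fix u assume u: "u \<in> C"
    have "sw (dl u) (\<lambda>x y. S (h * x) * h * y) = sw (map (\<lambda>(x, y). (h * x, h * y)) (dl u)) (\<lambda>x y. S x * y)"
      by (simp add: sw_map mult.assoc)
    also have "\<dots> = sw (dl (h * u)) (\<lambda>x y. S x * y)"
    proof (rule sw_bilinear_eq')
      fix p q assume "lf p" "lf q"
      then show "sw (map (\<lambda>(x, y). (h * x, h * y)) (dl u)) (prd p q) = sw (dl (h * u)) (prd p q)"
        using cv_gl_mult[OF h(1) u, of p q] by (simp add: sw_map cv_def)
    qed (intro lin_mult_right lin_mult_left lin_S lin_id)+
    also have "\<dots> = sw (dl u) (\<lambda>x y. S x * y)"
      using h u by (simp add: antipode_left gl_C mult_C eps_mult eps_h)
    finally show "sw (dl u) (\<lambda>x y. S (h * x) * h * y) = sw (dl u) (\<lambda>x y. S x * y)" .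
  qed (use u lin_S in auto)
  then show ?thesis by (metis h(2) mult.assoc mult.right_neutral)
qed

lemma S_one: "S 1 = 1"
  using antipode_left[OF one_C]
    sw_bilinear_eq'[of "dl 1" "[(1, 1)]" "\<lambda>x y. S x * y"]
  by (simp add: dl_one lin_mult_left lin_mult_right lin_S lin_id eps_one)

text \<open>Since the counit of z vanishes, the two summands of the coproduct of z u contribute
  opposite convolutions; cancelling the identity gives S (z u) h = - S u z.\<close>

lemma S_sp_mult:
  assumes z: "sp h z" and h: "gl h" "h * h' = 1" and u: "u \<in> C"
  shows "S (z * u) = - (S u * z * h')"
proof -
  have "h \<noteq> 0" using h(2) by auto
  then have eps_z: "eps z = 0" using sp_eps z by blast
  have "S (z * u) * h = - (S u * z)"
  proof (rule conv_eq[where F = "\<lambda>u. S (z * u) * h" and G = "\<lambda>u. - (S u * z)"])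
    show "lin (\<lambda>u. S (z * u) * h)" by (intro lin_mult_right lin_comp[OF lin_S] lin_mult_left lin_id)
    show "lin (\<lambda>u. - (S u * z))" using lin_mult_right[OF lin_S, of z] by (simp add: lin_def)
    fix u assume u: "u \<in> C"
    have "sw (dl u) (\<lambda>x y. S (z * x) * h * y) + sw (dl u) (\<lambda>x y. S x * z * y) =
       sw (map (\<lambda>(x, y). (z * x, h * y)) (dl u) @ map (\<lambda>(x, y). (x, z * y)) (dl u)) (\<lambda>x y. S x * y)"
      by (simp add: sw_map[of "\<lambda>x. x"] sw_map sw_append mult.assoc)
    also have "\<dots> = sw (dl (z * u)) (\<lambda>x y. S x * y)"
    proof (rule sw_bilinear_eq')
      fix p q assume "lf p" "lf q"
      then show "sw (map (\<lambda>(x, y). (z * x, h * y)) (dl u) @ map (\<lambda>(x, y). (x, z * y)) (dl u)) (prd p q) =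
          sw (dl (z * u)) (prd p q)"
        using cv_sp_mult[OF z u, of p q] by (simp add: sw_map[of "\<lambda>x. x"] sw_map cv_def sw_append)
    qed (intro lin_mult_right lin_mult_left lin_S lin_id)+
    also have "\<dots> = 0"
      using z u by (simp add: antipode_left sp_C mult_C eps_mult eps_z)
    finally have "sw (dl u) (\<lambda>x y. S (z * x) * h * y) = - sw (dl u) (\<lambda>x y. S x * z * y)"
      by (simp add: eq_neg_iff_add_eq_0)
    also have "\<dots> = sw (dl u) (\<lambda>x y. - (S x * z) * y)"
      by (subst sw_hom[of uminus], simp, simp, rule sw_cong) simp
    finally show "sw (dl u) (\<lambda>x y. S (z * x) * h * y) = sw (dl u) (\<lambda>x y. - (S x * z) * y)" .
  qed (use u in auto)
  then have "S (z * u) * h * h' = - (S u * z) * h'" by simp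
  then show ?thesis by (simp add: mult.assoc h(2))
qed

text \<open>The generated subalgebra, built by multiplying one generator at a time from the left, so
  that induction over it is induction over words.\<close>

inductive_set gn for Gs :: "'b set" where
  gn_one: "1 \<in> gn Gs"
| gn_gen: "s \<in> Gs \<Longrightarrow> u \<in> gn Gs \<Longrightarrow> s * u \<in> gn Gs"
| gn_add: "u \<in> gn Gs \<Longrightarrow> v \<in> gn Gs \<Longrightarrow> u + v \<in> gn Gs"
| gn_scale: "u \<in> gn Gs \<Longrightarrow> c *s u \<in> gn Gs"

lemma gn_zero: "0 \<in> gn Gs"
  using gn_scale[OF gn_one, of 0 Gs] by simp

lemma gn_subspace: "subspace (gn Gs)"
  by (rule subspaceI) (auto intro: gn.intros gn_zero)

lemma gn_mult: "u \<in> gn Gs \<Longrightarrow> v \<in> gn Gs \<Longrightarrow> u * v \<in> gn Gs"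
  by (induction u rule: gn.induct) (auto simp: mult.assoc distrib_right smult_simps intro: gn.intros)

lemma gn_base: "s \<in> Gs \<Longrightarrow> s \<in> gn Gs"
  using gn_gen[OF _ gn_one, of s Gs] by simp

lemma gn_power: "u \<in> gn Gs \<Longrightarrow> u ^ n \<in> gn Gs"
  by (induction n) (auto intro: gn_one gn_mult)

lemma gn_C: "Gs \<subseteq> C \<Longrightarrow> gn Gs \<subseteq> C"
proof
  fix u assume "Gs \<subseteq> C" "u \<in> gn Gs"
  from this(2,1) show "u \<in> C" by (induction rule: gn.induct) (auto intro: C_intros)
qed

lemma gn_subset:
  assumes "subspace W" "1 \<in> W" "\<And>s u. s \<in> Gs \<Longrightarrow> u \<in> W \<Longrightarrow> s * u \<in> W"
  shows "gn Gs \<subseteq> W"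
proof
  fix u assume "u \<in> gn Gs"
  then show "u \<in> W"
    by (induction rule: gn.induct) (use assms subspace_add subspace_scale in auto)
qed

text \<open>The coproduct of a generator involves only that generator, 1 and h, so coproducts of
  words stay inside. The witness is an explicit list because minimality asks for one with entries in
  the subalgebra.\<close>

lemma gn_coproduct:
  assumes Gs: "Gs \<subseteq> C" and s: "\<And>s. s \<in> Gs \<Longrightarrow> gl s \<or> sp h s" and h: "h \<in> gn Gs" and u: "u \<in> gn Gs"
  shows "\<exists>xs. set xs \<subseteq> gn Gs \<times> gn Gs \<and> (\<forall>p q. lf p \<longrightarrow> lf q \<longrightarrow> cv p q u = sw xs (prd p q))"
  using u
proof (induction u rule: gn.induct)
  case gn_one
  show ?case by (rule exI[of _ "[(1, 1)]"]) (auto simp: gn.gn_one cv_def dl_one)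
next
  case (gn_gen s u)
  then obtain xs where xs: "set xs \<subseteq> gn Gs \<times> gn Gs" "\<And>p q. lf p \<Longrightarrow> lf q \<Longrightarrow> cv p q u = sw xs (prd p q)"
    by blast
  have uC: "u \<in> C" using gn_C[OF Gs] gn_gen by blast
  have sG: "s \<in> gn Gs" using gn_gen gn_base by blast
  consider "gl s" | "sp h s" using s gn_gen by blast
  then show ?case
  proof cases
    case 1
    show ?thesis
      using xs 1 uC sG
      by (intro exI[of _ "map (\<lambda>(u, v). (s * u, s * v)) xs"]) (auto simp: cv_gl_mult sw_map intro: gn_mult)
  next
    case 2
    show ?thesis
      using xs 2 uC sG h
      by (intro exI[of _ "map (\<lambda>(u, v). (s * u, h * v)) xs @ map (\<lambda>(u, v). (u, s * v)) xs"])
        (auto simp: cv_sp_mult sw_map sw_map[of "\<lambda>x. x"] sw_append intro: gn_mult)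
  qed
next
  case (gn_add u v)
  then obtain xs ys where "set xs \<subseteq> gn Gs \<times> gn Gs" "\<And>p q. lf p \<Longrightarrow> lf q \<Longrightarrow> cv p q u = sw xs (prd p q)"
    "set ys \<subseteq> gn Gs \<times> gn Gs" "\<And>p q. lf p \<Longrightarrow> lf q \<Longrightarrow> cv p q v = sw ys (prd p q)"
    by blast
  then show ?case by (intro exI[of _ "xs @ ys"]) (auto simp: lf_add[OF lf_cv] sw_append)
next
  case (gn_scale u c)
  then obtain xs where "set xs \<subseteq> gn Gs \<times> gn Gs" "\<And>p q. lf p \<Longrightarrow> lf q \<Longrightarrow> cv p q u = sw xs (prd p q)"
    by blast
  then show ?case
    by (intro exI[of _ "map (\<lambda>(u, v). (c *s u, v)) xs"])
      (auto simp: lf_scale[OF lf_cv] lf_scale sw_map[of _ "\<lambda>x. x"] sw_distrib_left mult.assoc intro: gn.gn_scale)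
qed

lemma gn_antipode:
  assumes Gs: "Gs \<subseteq> C" and s: "\<And>s. s \<in> Gs \<Longrightarrow> (gl s \<and> (\<exists>s'\<in>gn Gs. s * s' = 1)) \<or> sp h s"
    and h: "gl h" "h * h' = 1" "h' \<in> gn Gs" and u: "u \<in> gn Gs"
  shows "S u \<in> gn Gs"
  using u
proof (induction u rule: gn.induct)
  case gn_one
  show ?case by (simp add: S_one gn.gn_one)
next
  case (gn_gen s u)
  have uC: "u \<in> C" using gn_C[OF Gs] gn_gen by blast
  have sG: "s \<in> gn Gs" using gn_gen gn_base by blast
  from s[OF gn_gen(1)] show ?case
  proof
    assume "gl s \<and> (\<exists>s'\<in>gn Gs. s * s' = 1)"
    then obtain s' where s': "gl s" "s' \<in> gn Gs" "s * s' = 1" by blast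
    then show ?case using S_gl_mult[OF s'(1,3) uC] gn_gen gn_mult by simp
  next
    assume sp: "sp h s"
    show ?case
      unfolding S_sp_mult[OF sp h(1,2) uC]
      by (intro subspace_neg[OF gn_subspace] gn_mult gn_gen sG h)
  qed
qed (auto simp: S_add S_scale intro: gn.intros)

end

section \<open>Primitive roots of unity in the ground field\<close>

lemma nontrivial_root_of_unity:
  assumes "prime p"
  obtains z :: "'k::{alg_closed_field, field_char_0}" where "\<And>i. z ^ i = 1 \<longleftrightarrow> p dvd i"
proof -
  have p: "1 < p" using assms prime_gt_1_nat by blast
  \<comment> \<open>A root of 1 + t + ... + t^(p-1); it is not 1, since there the value is p, which
    is nonzero in characteristic zero.\<close>
  obtain z :: 'k where z: "(\<Sum>k\<le>p - 1. 1 * z ^ k) = 0"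
    using alg_closed[of "p - 1" "\<lambda>_. 1"] p by auto
  then have sum0: "(\<Sum>k<p. z ^ k) = 0"
    using p by (simp add: lessThan_Suc_atMost[symmetric])
  have zp: "z ^ p = 1"
    using power_diff_1_eq[of z p] sum0 by simp
  have z1: "z \<noteq> 1" using sum0 p by auto
  have "z ^ i = 1 \<longleftrightarrow> p dvd i" for i
  proof
    assume zi: "z ^ i = 1"
    show "p dvd i"
    proof (rule ccontr)
      assume "\<not> p dvd i"
      then have "coprime i p" using assms by (metis coprime_commute prime_imp_coprime)
      then obtain u where u: "[i * u = 1] (mod p)" using cong_solve_coprime_nat by auto
      have "z ^ (i * u) = z ^ ((i * u) mod p)"
        by (metis mod_div_mult_eq mult.commute mult_1_right power_add power_mult power_one zp)
      also have "(i * u) mod p = 1" using u p by (simp add: cong_def)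
      finally show False using zi z1 by (simp add: power_mult)
    qed
  qed (auto simp: power_mult zp)
  then show ?thesis by (rule that)
qed

text \<open>Induction on N = p M with p prime. If p divides M, a p-th root of a primitive M-th root
  has order N; otherwise M and p are coprime and the product of roots of orders M and p
  works.\<close>

lemma primitive_root_exists:
  assumes "0 < N"
  shows "\<exists>w::'k::{alg_closed_field, field_char_0}. \<forall>i. w ^ i = 1 \<longleftrightarrow> N dvd i"
  using assms
proof (induction N rule: less_induct)
  case (less N)
  show ?case
  proof (cases "N = 1")
    case True
    then show ?thesis by (intro exI[of _ 1]) simp
  next
    case False
    then obtain p M where p: "prime p" "N = p * M"
      using prime_factor_nat by (metis dvdE)
    then have M: "0 < M" "M < N" using less.prems prime_gt_1_nat[of p] by auto
    obtain w :: 'k where w: "\<And>i. w ^ i = 1 \<longleftrightarrow> M dvd i" using less.IH[OF M(2,1)] by blast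
    show ?thesis
    proof (cases "p dvd M")
      case True
      obtain y where y: "y ^ p = w" using nth_root_exists[of p w] p prime_gt_0_nat by auto
      have "y ^ i = 1 \<longleftrightarrow> N dvd i" for i
      proof
        assume yi: "y ^ i = 1"
        have "w ^ i = (y ^ i) ^ p" by (metis y power_mult mult.commute)
        then have "M dvd i" using yi w by simp
        then obtain j where j: "i = p * j" using True by (meson dvd_trans dvdE)
        have "w ^ j = 1" using yi unfolding j power_mult y .
        then show "N dvd i" using w p j by simp
      next
        assume "N dvd i"
        then obtain j where "i = p * (M * j)" using p(2) by (metis dvdE mult.assoc)
        then show "y ^ i = 1" using w[of "M * j"] by (simp add: power_mult y)
      qed
      then show ?thesis by blast
    next
      case False
      then have cop: "coprime M p" using p(1) by (metis coprime_commute prime_imp_coprime)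
      obtain z :: 'k where z: "\<And>i. z ^ i = 1 \<longleftrightarrow> p dvd i" using nontrivial_root_of_unity[OF p(1)] by blast
      have "(w * z) ^ i = 1 \<longleftrightarrow> N dvd i" for i
      proof
        assume wz: "(w * z) ^ i = 1"
        have "w ^ (i * p) * z ^ (i * p) = ((w * z) ^ i) ^ p"
          by (simp add: power_mult power_mult_distrib)
        then have "w ^ (i * p) = 1" using wz z[of "i * p"] by simp
        then have "M dvd i" using w cop by (metis coprime_dvd_mult_left_iff)
        then have "w ^ i = 1" using w by blast
        then have "z ^ i = 1" using wz by (simp add: power_mult_distrib)
        then have "p dvd i" using z by simp
        then show "N dvd i" using \<open>M dvd i\<close> cop p by (simp add: divides_mult mult.commute)
      next
        assume "N dvd i"
        then have "M dvd i" "p dvd i" using p by (auto intro: dvd_mult_left dvd_mult_right)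
        then have "w ^ i = 1" "z ^ i = 1" using w z by blast+
        then show "(w * z) ^ i = 1" by (simp add: power_mult_distrib)
      qed
      then show ?thesis by blast
    qed
  qed
qed

section \<open>Eigenvectors of conjugation by a\<close>

context hopf_gen begin

definition eig :: "'k \<Rightarrow> 'b \<Rightarrow> bool" where "eig c z \<longleftrightarrow> z * a = c *s (a * z)"

lemma eig_pow: assumes "eig c z" shows "z * a ^ k = c ^ k *s (a ^ k * z)"
proof (induction k)
  case (Suc k)
  have "z * a ^ Suc k = (z * a ^ k) * a" by (simp add: power_Suc2 mult.assoc del: power_Suc)
  also have "\<dots> = c ^ k *s (a ^ k * (z * a))" by (simp add: Suc smult_simps mult.assoc)
  also have "\<dots> = c ^ Suc k *s (a ^ Suc k * z)"
    using assms by (simp add: eig_def smult_simps mult.assoc power_Suc2 del: power_Suc)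
  finally show ?case .
qed simp

lemma eig_g: "eig c z \<Longrightarrow> z * g = c ^ \<nu> *s (g * z)"
  by (simp add: g_def eig_pow)

lemma eig_order: assumes "eig c z" "z \<noteq> 0" shows "c ^ N = 1"
proof -
  have "c ^ N *s z = 1 *s z" using eig_pow[OF assms(1), of N] by (simp add: a_order)
  then show ?thesis using assms(2) by (metis scale_cancel_right)
qed

lemma eig_scale: "eig c z \<Longrightarrow> eig c (d *s z)" and eig_add: "eig c z \<Longrightarrow> eig c z' \<Longrightarrow> eig c (z + z')"
  by (simp_all add: eig_def smult_simps distrib_left distrib_right scale_right_distrib mult.commute)

text \<open>Averaging the conjugates of z against the characters of the cyclic group of order N
  projects z onto eigenvectors. The projections sum to N z, and N is invertible in characteristic
  zero.\<close>

lemma eigenvectors_span: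
  assumes W: "subspace W" and ev: "\<And>c x. sp g x \<Longrightarrow> eig c x \<Longrightarrow> x \<in> W" and z: "sp g z"
  shows "z \<in> W"
proof -
  obtain w :: 'k where w: "\<And>i. w ^ i = 1 \<longleftrightarrow> N dvd i" using primitive_root_exists[OF N_pos] by blast
  define T where "T m = a ^ m * z * a ^ (N - m)" for m
  define E where "E j = (\<Sum>m<N. (w ^ j) ^ m *s T m)" for j
  have spE: "sp g (E j)" for j
  proof -
    have "sp g (T m)" if "m < N" for m using sp_conj[OF z, of m] that by (simp add: T_def)
    then have "E j \<in> {z. sp g z}" unfolding E_def
      by (intro subspace_sum[OF subspace_sp] subspace_scale[OF subspace_sp]) simp
    then show ?thesis by simp
  qed
  have "eig (w ^ j) (E j)" for j
  proof -
    let ?c = "w ^ j"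
    obtain M where M: "N = Suc M" using N_pos gr0_implies_Suc by blast
    have cN: "?c ^ N = 1" by (simp add: w flip: power_mult)
    have step: "T (Suc m) * a = a * T m" if "m < N" for m
    proof -
      have "a ^ (N - m) = a ^ (N - Suc m) * a" using that by (metis Suc_diff_Suc power_Suc2)
      then show ?thesis by (simp add: T_def mult.assoc)
    qed
    have T0: "T 0 * a = a * T M"
    proof -
      have "a * T M = (a * a ^ M) * z * a" by (simp add: T_def M mult.assoc)
      moreover have "a * a ^ M = 1" by (metis M a_order(1) power_Suc)
      ultimately show ?thesis by (simp add: T_def a_order)
    qed
    have "E j * a = (\<Sum>m<Suc M. ?c ^ m *s (T m * a))" by (simp only: E_def sum_distrib_right scale_mult_left M)
    also have "\<dots> = T 0 * a + (\<Sum>m<M. ?c ^ Suc m *s (T (Suc m) * a))"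
      by (subst sum.lessThan_Suc_shift) simp
    also have "\<dots> = ?c ^ N *s (a * T M) + (\<Sum>m<M. ?c ^ Suc m *s (a * T m))"
      unfolding cN T0 using step by (simp add: M)
    also have "\<dots> = (\<Sum>m<Suc M. ?c ^ Suc m *s (a * T m))" unfolding sum.lessThan_Suc M by (rule add.commute)
    also have "\<dots> = ?c *s (a * E j)"
      unfolding E_def sum_distrib_left scale_mult_right scale_sum_right M scale_scale power_Suc ..
    finally show ?thesis unfolding eig_def .
  qed
  then have "E j \<in> W" for j using ev spE by blast
  then have inW: "(\<Sum>j<N. E j) \<in> W" by (intro subspace_sum[OF W])
  have "(\<Sum>j<N. E j) = (\<Sum>m<N. (\<Sum>j<N. (w ^ m) ^ j) *s T m)"
  proof -
    have "(w ^ j) ^ m = (w ^ m) ^ j" for j m by (metis mult.commute power_mult)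
    then have "(\<Sum>j<N. E j) = (\<Sum>j<N. \<Sum>m<N. (w ^ m) ^ j *s T m)"
      unfolding E_def by (intro sum.cong refl) metis
    also have "\<dots> = (\<Sum>m<N. \<Sum>j<N. (w ^ m) ^ j *s T m)" by (rule sum.swap)
    finally show ?thesis unfolding scale_sum_left .
  qed
  also have "\<dots> = (\<Sum>m<N. if m = 0 then of_nat N *s z else 0)"
  proof (rule sum.cong)
    fix m assume m: "m \<in> {..<N}"
    show "(\<Sum>j<N. (w ^ m) ^ j) *s T m = (if m = 0 then of_nat N *s z else 0)"
    proof (cases "m = 0")
      case True then show ?thesis by (simp add: T_def a_order)
    next
      case False
      have ne: "w ^ m \<noteq> 1" using w[of m] m False by (auto dest: dvd_imp_le)
      have "(w ^ m) ^ N = 1" by (simp add: w flip: power_mult)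
      then have "(w ^ m - 1) * (\<Sum>j<N. (w ^ m) ^ j) = 0" using power_diff_1_eq[of "w ^ m" N] by simp
      then show ?thesis using ne False by simp
    qed
  qed simp
  also have "\<dots> = of_nat N *s z" using N_pos by simp
  finally have "of_nat N *s z \<in> W" using inW by simp
  then show ?thesis using subspace_neg_iff[OF W, of "of_nat N" z] N_pos by simp
qed

lemma K0_sp: assumes "z \<in> K0" "sp g z" shows "\<exists>c. z = c *s (g - 1)"
proof -
  have "dual 0 z *s 1 = dual 0 z *s g + dual 0 1 *s z"
    using K0_dual_Lc[OF assms(1), of 0] sp_Lc[OF assms(2) dual(1)] by simp
  moreover have "dual 0 1 = 1" using dual(2)[of 0 0] by simp
  ultimately have "z = (- dual 0 z) *s (g - 1)" by (simp add: algebra_simps)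
  then show ?thesis by blast
qed

lemma g_diff_K0: "g - 1 \<in> K0"
  by (intro subspace_diff K0_sub g_K0 one_K0)

text \<open>x and y complete g - 1 to an eigenbasis of the skew primitives for g. Independence is
  asked for modulo \<open>K0\<close>, which by \<open>K0_sp\<close> meets this space only in
  multiples of g - 1.\<close>

definition P_basis :: "'b \<Rightarrow> 'b \<Rightarrow> 'k \<Rightarrow> 'k \<Rightarrow> bool" where
  "P_basis x y \<alpha> \<beta> \<longleftrightarrow> sp g x \<and> sp g y \<and> eig \<alpha> x \<and> eig \<beta> y \<and>
     (\<forall>c d. c *s x + d *s y \<in> K0 \<longrightarrow> c = 0 \<and> d = 0) \<and>
     (\<forall>z. sp g z \<longrightarrow> (\<exists>b c d. z = b *s (g - 1) + c *s x + d *s y))"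

lemma P_basisD:
  assumes "P_basis x y \<alpha> \<beta>"
  shows "sp g x" "sp g y" "eig \<alpha> x" "eig \<beta> y"
    and "c *s x + d *s y \<in> K0 \<Longrightarrow> c = 0 \<and> d = 0"
    and "sp g z \<Longrightarrow> \<exists>b c d. z = b *s (g - 1) + c *s x + d *s y"
    and "x \<notin> K0" "y \<notin> K0"
proof -
  note P = assms[unfolded P_basis_def]
  show "sp g x" "sp g y" "eig \<alpha> x" "eig \<beta> y" using P by (simp_all only:)
  have lin: "c = 0 \<and> d = 0" if "c *s x + d *s y \<in> K0" for c d
    using P that by (elim conjE) simp
  then show "c *s x + d *s y \<in> K0 \<Longrightarrow> c = 0 \<and> d = 0" .
  show "sp g z \<Longrightarrow> \<exists>b c d. z = b *s (g - 1) + c *s x + d *s y"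
    using P by (elim conjE) simp
  show "x \<notin> K0" "y \<notin> K0" using lin[of 1 0] lin[of 0 1] by auto
qed

text \<open>The vectors y, x, g - 1 are independent in a space of dimension three, so they span it;
  a fourth independent vector would exceed the dimension bound.\<close>

lemma P_basisI:
  assumes x: "sp g x" "eig \<alpha> x" "x \<notin> K0" and y: "sp g y" "eig \<beta> y" and nxy: "\<And>c. y - c *s x \<notin> K0"
  shows "P_basis x y \<alpha> \<beta>"
proof -
  have lin: "c = 0 \<and> d = 0" if "c *s x + d *s y \<in> K0" for c d
  proof -
    have "d = 0"
    proof (rule ccontr)
      assume d: "d \<noteq> 0"
      have "inverse d *s (c *s x + d *s y) \<in> K0" using that by (rule subspace_scale[OF K0_sub])
      then have "y - (- inverse d * c) *s x \<in> K0" using d by (simp add: algebra_simps)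
      then show False using nxy by blast
    qed
    moreover have "c = 0"
      using that x(3) subspace_neg_iff[OF K0_sub, of c x] \<open>d = 0\<close> by auto
    ultimately show ?thesis by simp
  qed
  obtain B where B: "finite B" "card B = 3" "independent B" "span B = {z. sp g z}" using P_dim by blast
  have xs: "x \<notin> span {g - 1}"
    using x(3) span_minimal[of "{g - 1}" K0] g_diff_K0 K0_sub by auto
  have ys: "y \<notin> span {x, g - 1}"
  proof
    assume "y \<in> span {x, g - 1}"
    then obtain c where "y - c *s x \<in> span {g - 1}" by (auto simp: span_breakdown_eq)
    then show False using nxy span_minimal[of "{g - 1}" K0] g_diff_K0 K0_sub by auto
  qed
  have ind: "independent {y, x, g - 1}"
    using xs ys g_ne_one by (simp add: independent_insert independent_empty span_base dependent_single)
  have card: "card {y, x, g - 1} = 3"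
    using xs ys by (auto simp: card_insert_if span_base)
  have gen: "\<exists>b c d. z = b *s (g - 1) + c *s x + d *s y" if z: "sp g z" for z
  proof -
    have "z \<in> span {y, x, g - 1}"
    proof (rule ccontr)
      assume nz: "z \<notin> span {y, x, g - 1}"
      then have "independent (insert z {y, x, g - 1})" "z \<notin> {y, x, g - 1}"
        using ind by (simp_all only: independent_insert) (auto simp: span_base)
      moreover have "insert z {y, x, g - 1} \<subseteq> span B" using x y z B(4) sp_gl[OF g_gl] by auto
      ultimately have "card (insert z {y, x, g - 1}) \<le> 3"
        using independent_span_bound[OF B(1)] B(2) by metis
      moreover have "card (insert z {y, x, g - 1}) = 4"
      proof -
        have "card (insert z {y, x, g - 1}) = Suc (card {y, x, g - 1})"
          using \<open>z \<notin> {y, x, g - 1}\<close> by (intro card_insert_disjoint) auto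
        then show ?thesis using card by simp
      qed
      ultimately show False by simp
    qed
    then obtain d c b where "z - d *s y - c *s x - b *s (g - 1) = 0"
      by (auto simp: span_breakdown_eq)
    then have "z = b *s (g - 1) + c *s x + d *s y" by (simp add: algebra_simps)
    then show ?thesis by blast
  qed
  show ?thesis unfolding P_basis_def using x y lin gen by blast
qed

lemma exists_eig_outside:
  assumes "card F < 3" "finite F"
  obtains c x where "sp g x" "eig c x" "x \<notin> span F"
proof -
  obtain B where B: "finite B" "card B = 3" "independent B" "span B = {z. sp g z}" using P_dim by blast
  have "\<not> B \<subseteq> span F"
    using independent_span_bound[OF assms(2) B(3)] assms(1) B(2) by auto
  then obtain z where z: "z \<in> B" "z \<notin> span F" by blast
  then have "sp g z" using B(4) span_base by blast
  then show ?thesis using eigenvectors_span[of "span F" z] z(2) that by auto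
qed

lemma sp_diff: "sp h z \<Longrightarrow> sp h z' \<Longrightarrow> sp h (z - z')"
  using subspace_diff[OF subspace_sp[of h]] by simp

lemma sp_notin_K0: "sp g x \<Longrightarrow> x \<notin> span {g - 1} \<Longrightarrow> x \<notin> K0"
  using K0_sp by (metis span_base insertI1 span_scale)

lemma P_basis_exists: "\<exists>x y \<alpha> \<beta>. P_basis x y \<alpha> \<beta>"
proof -
  obtain \<alpha> x where x: "sp g x" "eig \<alpha> x" "x \<notin> span {g - 1}"
    by (rule exists_eig_outside[of "{g - 1}"]) (simp, simp, blast)
  obtain \<beta> y where y: "sp g y" "eig \<beta> y" "y \<notin> span {x, g - 1}"
    by (rule exists_eig_outside[of "{x, g - 1}"]) (simp add: card_insert_if, simp, blast)
  have "y - c *s x \<notin> K0" for c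
  proof
    assume *: "y - c *s x \<in> K0"
    have "sp g (y - c *s x)" using x y by (intro sp_diff sp_scale)
    with * obtain b where "y - c *s x = b *s (g - 1)" using K0_sp by blast
    then show False using y(3) by (auto simp: span_breakdown_eq intro: span_scale span_base)
  qed
  then show ?thesis using P_basisI[OF x(1,2) sp_notin_K0[OF x(1,3)] y(1,2)] by blast
qed

text \<open>Modulo g - 1 the given element is u = c x + d y. If both coefficients are nonzero and
  the eigenvalues differ, u minus \<beta> times its conjugate has no y-component, so stability of X
  under conjugation extracts x. In the other cases u is already an eigenvector.\<close>

lemma eigenvector_exists:
  assumes X: "subbi X" and conj: "\<And>u. u \<in> X \<Longrightarrow> a * u * a ^ (N - 1) \<in> X"
    and g: "g \<in> X" and z: "z \<in> X" "sp g z" "z \<notin> K0"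
  obtains c x where "x \<in> X" "sp g x" "eig c x" "x \<notin> K0"
proof -
  obtain x y \<alpha> \<beta> where P: "P_basis x y \<alpha> \<beta>" using P_basis_exists by blast
  note xy = P_basisD(1-4)[OF P] and xyK = P_basisD(7,8)[OF P] and lin = P_basisD(5)[OF P]
  obtain b c d where zb: "z = b *s (g - 1) + c *s x + d *s y"
    using P_basisD(6)[OF P z(2)] by blast
  define b' where "b' = a ^ (N - 1)"
  define u where "u = c *s x + d *s y"
  have uX: "u \<in> X"
  proof -
    have "u = z - b *s (g - 1)" by (simp add: u_def zb)
    then show ?thesis
      using subbi_diff[OF X z(1) subbi_scale[OF X subbi_diff[OF X g subbi_one[OF X]], of b]] by simp
  qed
  have "N = Suc (N - 1)" using N_pos by simp
  then have ab: "a * b' = 1" unfolding b'_def using a_order(1) by (metis power_Suc)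
  have cj: "\<gamma> *s (a * v * b') = v" if "eig \<gamma> v" for \<gamma> v
  proof -
    have "\<gamma> *s (a * v * b') = v * a * b'" using that by (simp add: eig_def smult_simps)
    then show ?thesis by (simp add: mult.assoc ab)
  qed
  define u' where "u' = a * u * b'"
  have u'X: "u' \<in> X" unfolding u'_def b'_def using uX by (rule conj)
  show ?thesis
  proof (cases "c = 0 \<or> d = 0")
    case True
    have "u \<notin> K0"
      using z(3) subspace_add[OF K0_sub subspace_scale[OF K0_sub g_diff_K0], of u b]
      unfolding zb u_def by (auto simp: add.assoc)
    then show ?thesis
    proof (cases "c = 0")
      case True
      then show ?thesis using that[of u \<beta>] uX \<open>u \<notin> K0\<close> xy by (simp add: u_def sp_scale eig_scale)
    next
      case False
      then have "d = 0" using \<open>c = 0 \<or> d = 0\<close> by simp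
      then show ?thesis using that[of u \<alpha>] uX \<open>u \<notin> K0\<close> xy by (simp add: u_def sp_scale eig_scale)
    qed
  next
    case False
    show ?thesis
    proof (cases "\<alpha> = \<beta>")
      case True
      have "u \<notin> K0" using lin False unfolding u_def by blast
      moreover have "eig \<alpha> u" "sp g u" using xy True by (auto simp: u_def eig_add eig_scale sp_add sp_scale)
      ultimately show ?thesis using that uX by blast
    next
      case ne: False
      have "\<beta> *s u' = (c * \<beta>) *s (a * x * b') + d *s (\<beta> *s (a * y * b'))"
        by (simp add: u'_def u_def distrib_left distrib_right smult_simps scale_right_distrib mult.commute)
      then have 1: "\<beta> *s u' = (c * \<beta>) *s (a * x * b') + d *s y" using cj[OF xy(4)] by simp
      have "\<alpha> *s (u - \<beta> *s u') = (c * \<alpha>) *s x - (c * \<beta>) *s (\<alpha> *s (a * x * b'))"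
        unfolding 1 by (simp add: u_def scale_right_diff_distrib scale_right_distrib mult.commute mult.left_commute)
      also have "\<dots> = (c * (\<alpha> - \<beta>)) *s x"
        by (simp add: cj[OF xy(3)] scale_left_diff_distrib right_diff_distrib)
      finally have "(c * (\<alpha> - \<beta>)) *s x \<in> X"
        using subbi_scale[OF X subbi_diff[OF X uX subbi_scale[OF X u'X, of \<beta>]], of \<alpha>] by simp
      then have "x \<in> X" using X False ne subbi_scale_iff[OF X, of "c * (\<alpha> - \<beta>)" x] by simp
      then show ?thesis using that xy xyK by blast
    qed
  qed
qed

end

section \<open>Quasitriangular structures\<close>

text \<open>The axioms of R read through functionals. Minimality becomes a closure principle: a Hopf
  subalgebra containing all one-sided slices of R is everything. Shortest expressions are thereby
  avoided until the transfer.\<close>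

locale hopf_qt = hopf_gen scale C dl eps S a N \<nu> g
  for scale :: "'k::{alg_closed_field, field_char_0} \<Rightarrow> 'b::ring_1 \<Rightarrow> 'b" (infixr \<open>*s\<close> 75)
    and C dl eps S a N \<nu> g +
  fixes R :: "('b \<times> 'b) list"
  assumes R_in: "set R \<subseteq> C \<times> C"
    and R_comult_left: "lf p \<Longrightarrow> lf q \<Longrightarrow> lf t \<Longrightarrow> sw R (\<lambda>r s. cv p q r * t s) =
      sw R (\<lambda>r s. sw R (\<lambda>r' s'. p r * q r' * t (s * s')))"
    and R_comult_right: "lf p \<Longrightarrow> lf q \<Longrightarrow> lf t \<Longrightarrow> sw R (\<lambda>r s. p r * cv t q s) =
      sw R (\<lambda>r s. sw R (\<lambda>r' s'. p (r * r') * (q s * t s')))"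
    and R_eps_left: "sw R (\<lambda>r s. eps r *s s) = 1" and R_eps_right: "sw R (\<lambda>r s. eps s *s r) = 1"
    and R_comm: "h \<in> C \<Longrightarrow> lf p \<Longrightarrow> lf q \<Longrightarrow> sw R (\<lambda>r s. cv (\<lambda>u. q (u * s)) (\<lambda>v. p (v * r)) h) =
      sw R (\<lambda>r s. cv (\<lambda>u. p (r * u)) (\<lambda>v. q (s * v)) h)"
    and minimal: "subspace D \<Longrightarrow> 1 \<in> D \<Longrightarrow> (\<And>x y. x \<in> D \<Longrightarrow> y \<in> D \<Longrightarrow> x * y \<in> D) \<Longrightarrow> D \<subseteq> C \<Longrightarrow>
      (\<And>u. u \<in> D \<Longrightarrow> \<exists>xs. set xs \<subseteq> D \<times> D \<and> (\<forall>p q. lf p \<longrightarrow> lf q \<longrightarrow> cv p q u = sw xs (prd p q))) \<Longrightarrow>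
      (\<And>u. u \<in> D \<Longrightarrow> S u \<in> D) \<Longrightarrow> (\<And>p. lf p \<Longrightarrow> sw R (\<lambda>r s. p s *s r) \<in> D) \<Longrightarrow>
      (\<And>p. lf p \<Longrightarrow> sw R (\<lambda>r s. p r *s s) \<in> D) \<Longrightarrow> C \<subseteq> D"
begin

text \<open>The maps p |-> (p \<otimes> id) R and p |-> (id \<otimes> p) R on the dual space; their
  images \<open>BB\<close> and \<open>AA\<close> below are the right leg r(R) and the left leg
  l(R).\<close>

definition fR :: "('b \<Rightarrow> 'k) \<Rightarrow> 'b" where "fR p = sw R (\<lambda>r s. p r *s s)"
definition fL :: "('b \<Rightarrow> 'k) \<Rightarrow> 'b" where "fL p = sw R (\<lambda>r s. p s *s r)"

lemma lf_fR: "lf t \<Longrightarrow> t (fR p) = sw R (\<lambda>r s. p r * t s)"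
  and lf_fL: "lf t \<Longrightarrow> t (fL p) = sw R (\<lambda>r s. p s * t r)"
  by (simp_all add: fR_def fL_def lf_sw lf_scale)

text \<open>Both sides are (p \<otimes> t) R. A functional t with \<open>fL t\<close> = v therefore
  represents v as a functional on \<open>BB\<close>; this is the pairing of the two legs, and it is
  nondegenerate by construction.\<close>

lemma pair: "lf t \<Longrightarrow> lf p \<Longrightarrow> t (fR p) = p (fL t)"
  by (simp add: lf_fR lf_fL mult.commute)

lemma fR_C: "fR p \<in> C" and fL_C: "fL p \<in> C"
  unfolding fR_def fL_def using R_in by (auto intro!: sw_in C_intros)

lemma fR_eps: "fR eps = 1" and fL_eps: "fL eps = 1"
  by (simp_all add: fR_def fL_def R_eps_left R_eps_right)

lemma fR_mult: assumes "lf p" "lf q" shows "fR p * fR q = fR (cv p q)"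
proof (rule lf_eqI)
  fix t assume t: "lf t"
  have "t (fR p * fR q) = sw R (\<lambda>r s. p r * t (s * fR q))"
    using lf_fR[OF lf_mult_right[OF t, of "fR q"], of p] by simp
  also have "\<dots> = sw R (\<lambda>r s. sw R (\<lambda>r' s'. p r * q r' * t (s * s')))"
    by (rule sw_cong) (simp add: lf_fR[OF lf_mult_left[OF t]] sw_distrib_left mult.assoc)
  also have "\<dots> = t (fR (cv p q))" by (simp add: R_comult_left assms t lf_fR)
  finally show "t (fR p * fR q) = t (fR (cv p q))" .
qed

lemma fL_mult: assumes "lf p" "lf q" shows "fL p * fL q = fL (cv q p)"
proof (rule lf_eqI)
  fix t assume t: "lf t"
  have "t (fL p * fL q) = sw R (\<lambda>r s. p s * t (r * fL q))"
    using lf_fL[OF lf_mult_right[OF t, of "fL q"], of p] by simp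
  also have "\<dots> = sw R (\<lambda>r s. sw R (\<lambda>r' s'. t (r * r') * (p s * q s')))"
    by (rule sw_cong) (simp add: lf_fL[OF lf_mult_left[OF t]] sw_distrib_left mult.assoc mult.commute mult.left_commute)
  also have "\<dots> = t (fL (cv q p))" by (simp flip: R_comult_right add: assms t lf_fL mult.commute)
  finally show "t (fL p * fL q) = t (fL (cv q p))" .
qed

text \<open>The coproduct of one leg is dual to the multiplication of the other. Together with the
  companion for \<open>fL\<close> this makes both legs stable under slices, hence
  sub-bialgebras.\<close>

lemma Lc_fR: assumes "lf p" "lf t" shows "Lc t (fR p) = fR (\<lambda>u. p (u * fL t))"
  and Rc_fR: "Rc t (fR p) = fR (\<lambda>u. p (fL t * u))"
proof -
  show "Lc t (fR p) = fR (\<lambda>u. p (u * fL t))"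
  proof (rule lf_eqI)
    fix q assume q: "lf q"
    have "q (Lc t (fR p)) = sw R (\<lambda>r s. p r * cv t q s)"
      using assms q by (simp add: Lc_pair lf_fR)
    also have "\<dots> = sw R (\<lambda>r s. sw R (\<lambda>r' s'. p (r * r') * (q s * t s')))"
      by (rule R_comult_right[OF assms(1) q assms(2)])
    also have "\<dots> = sw R (\<lambda>r s. p (r * fL t) * q s)"
      by (rule sw_cong)
        (simp add: lf_fL[OF lf_mult_left[OF assms(1)]] sw_distrib_left sw_distrib_right mult.assoc mult.commute mult.left_commute)
    also have "\<dots> = q (fR (\<lambda>u. p (u * fL t)))" by (simp add: lf_fR q)
    finally show "q (Lc t (fR p)) = q (fR (\<lambda>u. p (u * fL t)))" .
  qed
  show "Rc t (fR p) = fR (\<lambda>u. p (fL t * u))"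
  proof (rule lf_eqI)
    fix q assume q: "lf q"
    have "q (Rc t (fR p)) = sw R (\<lambda>r s. p r * cv q t s)"
      using assms q by (simp add: Rc_pair lf_fR)
    also have "\<dots> = sw R (\<lambda>r s. sw R (\<lambda>r' s'. p (r * r') * (t s * q s')))"
      by (rule R_comult_right[OF assms(1) assms(2) q])
    also have "\<dots> = sw R (\<lambda>r' s'. sw R (\<lambda>r s. p (r * r') * (t s * q s')))"
      by (rule sw_swap)
    also have "\<dots> = sw R (\<lambda>r s. p (fL t * r) * q s)"
      by (rule sw_cong)
        (simp add: lf_fL[OF lf_mult_right[OF assms(1)]] sw_distrib_left sw_distrib_right mult.assoc mult.commute mult.left_commute)
    also have "\<dots> = q (fR (\<lambda>u. p (fL t * u)))" by (simp add: lf_fR q)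
    finally show "q (Rc t (fR p)) = q (fR (\<lambda>u. p (fL t * u)))" .
  qed
qed

lemma Lc_fL: assumes "lf p" "lf t" shows "Lc t (fL p) = fL (\<lambda>u. p (fR t * u))"
  and Rc_fL: "Rc t (fL p) = fL (\<lambda>u. p (u * fR t))"
proof -
  show "Lc t (fL p) = fL (\<lambda>u. p (fR t * u))"
  proof (rule lf_eqI)
    fix q assume q: "lf q"
    have "q (Lc t (fL p)) = sw R (\<lambda>r s. cv t q r * p s)"
      using assms q by (simp add: Lc_pair lf_fL mult.commute)
    also have "\<dots> = sw R (\<lambda>r s. sw R (\<lambda>r' s'. t r * q r' * p (s * s')))"
      by (rule R_comult_left[OF assms(2) q assms(1)])
    also have "\<dots> = sw R (\<lambda>r' s'. sw R (\<lambda>r s. t r * q r' * p (s * s')))"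
      by (rule sw_swap)
    also have "\<dots> = sw R (\<lambda>r s. p (fR t * s) * q r)"
      by (rule sw_cong)
        (simp add: lf_fR[OF lf_mult_right[OF assms(1)]] sw_distrib_left sw_distrib_right mult.assoc mult.commute mult.left_commute)
    also have "\<dots> = q (fL (\<lambda>u. p (fR t * u)))" by (simp add: lf_fL q)
    finally show "q (Lc t (fL p)) = q (fL (\<lambda>u. p (fR t * u)))" .
  qed
  show "Rc t (fL p) = fL (\<lambda>u. p (u * fR t))"
  proof (rule lf_eqI)
    fix q assume q: "lf q"
    have "q (Rc t (fL p)) = sw R (\<lambda>r s. cv q t r * p s)"
      using assms q by (simp add: Rc_pair lf_fL mult.commute)
    also have "\<dots> = sw R (\<lambda>r s. sw R (\<lambda>r' s'. q r * t r' * p (s * s')))"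
      by (rule R_comult_left[OF q assms(2) assms(1)])
    also have "\<dots> = sw R (\<lambda>r s. p (s * fR t) * q r)"
      by (rule sw_cong)
        (simp add: lf_fR[OF lf_mult_left[OF assms(1)]] sw_distrib_left sw_distrib_right mult.assoc mult.commute mult.left_commute)
    also have "\<dots> = q (fL (\<lambda>u. p (u * fR t)))" by (simp add: lf_fL q)
    finally show "q (Rc t (fL p)) = q (fL (\<lambda>u. p (u * fR t)))" .
  qed
qed

definition AA where "AA = fL ` {p. lf p}"
definition BB where "BB = fR ` {p. lf p}"

lemma fL_add: "fL (\<lambda>u. p u + q u) = fL p + fL q" and fL_scale: "fL (\<lambda>u. c * p u) = c *s fL p"
  and fR_add: "fR (\<lambda>u. p u + q u) = fR p + fR q" and fR_scale: "fR (\<lambda>u. c * p u) = c *s fR p"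
  by (rule lf_eqI, simp add: lf_add lf_scale lf_fL lf_fR sw_add[symmetric] sw_distrib_left algebra_simps)+

lemma subbi_AA: "subbi AA"
  unfolding subbi_def
proof (intro conjI allI impI ballI)
  show "subspace AA"
  proof (rule subspaceI)
    show "0 \<in> AA" using fL_scale[of 0 eps] lf_const_zero by (auto simp: AA_def image_iff intro!: exI[of _ "\<lambda>_. 0"])
    show "x + y \<in> AA" if "x \<in> AA" "y \<in> AA" for x y
      using that lf_plus by (auto simp: AA_def fL_add[symmetric])
    show "c *s x \<in> AA" if "x \<in> AA" for c x
      using that lf_cmult by (auto simp: AA_def fL_scale[symmetric])
  qed
  show "AA \<subseteq> C" by (auto simp: AA_def fL_C)
  show "1 \<in> AA" using fL_eps eps_lf by (auto simp: AA_def image_iff intro!: exI[of _ eps])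
  show "x * y \<in> AA" if "x \<in> AA" "y \<in> AA" for x y
    using that by (auto simp: AA_def fL_mult)
  fix p x assume "lf p" "x \<in> AA"
  then show "Lc p x \<in> AA" "Rc p x \<in> AA"
    by (auto simp: AA_def Lc_fL Rc_fL)
qed

lemma subbi_BB: "subbi BB"
  unfolding subbi_def
proof (intro conjI allI impI ballI)
  show "subspace BB"
  proof (rule subspaceI)
    show "0 \<in> BB" using fR_scale[of 0 eps] lf_const_zero by (auto simp: BB_def image_iff intro!: exI[of _ "\<lambda>_. 0"])
    show "x + y \<in> BB" if "x \<in> BB" "y \<in> BB" for x y
      using that lf_plus by (auto simp: BB_def fR_add[symmetric])
    show "c *s x \<in> BB" if "x \<in> BB" for c x
      using that lf_cmult by (auto simp: BB_def fR_scale[symmetric])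
  qed
  show "BB \<subseteq> C" by (auto simp: BB_def fR_C)
  show "1 \<in> BB" using fR_eps eps_lf by (auto simp: BB_def image_iff intro!: exI[of _ eps])
  show "x * y \<in> BB" if "x \<in> BB" "y \<in> BB" for x y
    using that by (auto simp: BB_def fR_mult)
  fix p x assume "lf p" "x \<in> BB"
  then show "Lc p x \<in> BB" "Rc p x \<in> BB"
    by (auto simp: BB_def Lc_fR Rc_fR)
qed

lemma AA_E: assumes "u \<in> AA" obtains t where "lf t" "fL t = u" using assms by (auto simp: AA_def)
lemma BB_E: assumes "u \<in> BB" obtains t where "lf t" "fR t = u" using assms by (auto simp: BB_def)

lemma comm_gl: assumes "gl h" "lf p" shows "h * fR (\<lambda>u. p (h * u)) = fR (\<lambda>u. p (u * h)) * h"
proof (rule lf_eqI)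
  fix q assume q: "lf q"
  have "q (h * fR (\<lambda>u. p (h * u))) = sw R (\<lambda>r s. cv (\<lambda>u. q (u * s)) (\<lambda>v. p (v * r)) h)"
    using assms q by (simp add: gl_cv lf_fR[OF lf_mult_left[OF q]] mult.commute)
  also have "\<dots> = sw R (\<lambda>r s. cv (\<lambda>u. p (r * u)) (\<lambda>v. q (s * v)) h)"
    using assms q by (intro R_comm) (auto simp: gl_C)
  also have "\<dots> = q (fR (\<lambda>u. p (u * h)) * h)"
    using assms q by (simp add: gl_cv lf_fR[OF lf_mult_right[OF q]])
  finally show "q (h * fR (\<lambda>u. p (h * u))) = q (fR (\<lambda>u. p (u * h)) * h)" .
qed

lemma comm_sp: assumes "sp h z" "lf p"
  shows "z * fR (\<lambda>u. p (h * u)) + fR (\<lambda>u. p (z * u)) = fR (\<lambda>u. p (u * z)) * h + fR p * z"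
proof (rule lf_eqI)
  fix q assume q: "lf q"
  have "q (z * fR (\<lambda>u. p (h * u)) + fR (\<lambda>u. p (z * u))) = sw R (\<lambda>r s. cv (\<lambda>u. q (u * s)) (\<lambda>v. p (v * r)) z)"
    using assms q by (simp add: sp_cv lf_add lf_fR[OF lf_mult_left[OF q]] lf_fR sw_add[symmetric] mult.commute)
  also have "\<dots> = sw R (\<lambda>r s. cv (\<lambda>u. p (r * u)) (\<lambda>v. q (s * v)) z)"
    using assms q by (intro R_comm) (auto simp: sp_C)
  also have "\<dots> = q (fR (\<lambda>u. p (u * z)) * h + fR p * z)"
    using assms q by (simp add: sp_cv lf_add lf_fR[OF lf_mult_right[OF q]] sw_add[symmetric])
  finally show "q (z * fR (\<lambda>u. p (h * u)) + fR (\<lambda>u. p (z * u))) = q (fR (\<lambda>u. p (u * z)) * h + fR p * z)" .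
qed

text \<open>Cross relations of Drinfeld double type: the commutation of R with a coproduct,
  rewritten through slices of b, becomes an equation in the algebra itself in which
  \<open>th\<close> acts on b only through its pairing. \<open>double_sp\<close> is the
  skew-primitive version.\<close>

lemma double_gl:
  assumes "gl (fL th)" "lf th" "b \<in> BB"
  shows "fL th * Rc th b = Lc th b * fL th"
  using assms(3) comm_gl[OF assms(1)] by (auto simp: BB_def Rc_fR Lc_fR assms)

lemma double_sp:
  assumes "sp (fL th) (fL tz)" "lf th" "lf tz" "b \<in> BB"
  shows "fL tz * Rc th b + Rc tz b = Lc tz b * fL th + b * fL tz"
  using assms(4) comm_sp[OF assms(1)] by (auto simp: BB_def Rc_fR Lc_fR assms)

lemma one_pair: "lf t \<Longrightarrow> t 1 = eps (fL t)"
  using pair[of t eps] by (simp add: fR_eps eps_lf)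

definition ai where "ai = a ^ (N - 1)"

lemma ai: "a * ai = 1" "ai * a = 1"
proof -
  have "N = Suc (N - 1)" using N_pos by simp
  then show "a * ai = 1" "ai * a = 1" unfolding ai_def
    using a_order(1) by (metis power_Suc, metis power_Suc2)
qed

lemma ai_cancel: "a * (ai * x) = x" "ai * (a * x) = x"
  by (simp_all add: ai flip: mult.assoc)

text \<open>Because R commutes with a \<otimes> a, the conjugate of u is represented by the
  functional of u twisted by the inverse conjugation.\<close>

lemma AA_conj: assumes "u \<in> AA" shows "a * u * ai \<in> AA"
proof -
  obtain t where t: "lf t" "fL t = u" using AA_E assms by blast
  define t' where "t' = (\<lambda>u. t (ai * u * a))"
  have t': "lf t'" unfolding t'_def using lf_mult_left[OF lf_mult_right[OF t(1), of a], of "ai"] by simp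
  have "fL t' = a * u * ai"
  proof (rule lf_eqI)
    fix p assume p: "lf p"
    define p' where "p' = (\<lambda>u. p (u * ai))"
    have p': "lf p'" unfolding p'_def using p by (rule lf_mult_right)
    from comm_gl[OF a_gl p']
    have "a * fR (\<lambda>u. p (a * u * ai)) = fR p * a"
      by (simp add: p'_def mult.assoc ai ai_cancel)
    then have 1: "ai * (fR p * a) = fR (\<lambda>u. p (a * u * ai))"
      using ai_cancel(2) by metis
    have q: "lf (\<lambda>u. p (a * u * ai))"
      using lf_mult_left[OF p', of a] by (simp add: p'_def)
    have "p (fL t') = t (ai * (fR p * a))"
      using pair[OF t' p] by (simp add: t'_def mult.assoc)
    also have "\<dots> = p (a * u * ai)" unfolding 1 using pair[OF t(1) q] t(2) by simp
    finally show "p (fL t') = p (a * u * ai)" .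
  qed
  moreover have "fL t' \<in> AA" using t' by (auto simp: AA_def)
  ultimately show ?thesis by simp
qed

lemma BB_conj: assumes "u \<in> BB" shows "a * u * ai \<in> BB"
proof -
  obtain t where t: "lf t" "fR t = u" using BB_E assms by blast
  define t' where "t' = (\<lambda>u. t (ai * u))"
  have t': "lf t'" unfolding t'_def using t(1) by (rule lf_mult_left)
  from comm_gl[OF a_gl t'] have "a * u = fR (\<lambda>u. t (ai * (u * a))) * a"
    by (simp add: t'_def mult.assoc ai_cancel t(2))
  then have "a * u * ai = fR (\<lambda>u. t (ai * (u * a)))"
    by (simp add: mult.assoc ai ai_cancel)
  moreover have "lf (\<lambda>u. t (ai * (u * a)))"
    using lf_mult_right[OF t', of a] by (simp add: t'_def)
  ultimately show ?thesis unfolding BB_def by blast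
qed

lemma minimal_gn:
  assumes "Gs \<subseteq> C" "\<And>s. s \<in> Gs \<Longrightarrow> (gl s \<and> (\<exists>s'\<in>gn Gs. s * s' = 1)) \<or> sp g s"
    and "g \<in> gn Gs" "AA \<subseteq> gn Gs" "BB \<subseteq> gn Gs"
  shows "C \<subseteq> gn Gs"
proof (rule minimal)
  have ginv: "g * g ^ (N - 1) = 1"
    using N_pos by (metis Suc_pred' a_order(1) g_def mult.commute power_Suc power_mult power_one)
  show "S u \<in> gn Gs" if "u \<in> gn Gs" for u
    using gn_antipode[OF assms(1,2) g_gl ginv gn_power[OF assms(3)] that] by blast
  show "\<exists>xs. set xs \<subseteq> gn Gs \<times> gn Gs \<and> (\<forall>p q. lf p \<longrightarrow> lf q \<longrightarrow> cv p q u = sw xs (prd p q))"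
    if "u \<in> gn Gs" for u
    using assms(2) by (intro gn_coproduct[OF assms(1) _ assms(3) that]) blast
qed (use assms in \<open>auto simp: gn_subspace gn_one gn_mult gn_C AA_def BB_def simp flip: fL_def fR_def\<close>)

text \<open>Otherwise X contains a skew primitive z outside \<open>K0\<close>. For a functional that
  kills \<open>K0\<close> and is 1 on z, its left and right slices are g and 1, which
  differ.\<close>

lemma cocommutative_K0:
  assumes X: "subbi X" and coc: "\<And>u t. u \<in> X \<Longrightarrow> lf t \<Longrightarrow> Lc t u = Rc t u"
  shows "X \<subseteq> K0"
proof (rule ccontr)
  assume "\<not> X \<subseteq> K0"
  from Taft_Wilson(2)[OF X this] obtain z where z: "z \<in> X" "sp g z" "z \<notin> K0" by blast
  obtain t where t: "lf t" "\<And>w. w \<in> K0 \<Longrightarrow> t w = 0" "t z = 1"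
    using lf_separate[OF K0_sub z(3)] by blast
  have "t z *s g + t 1 *s z = t g *s z + t z *s 1"
    using coc[OF z(1) t(1)] sp_Lc[OF z(2) t(1)] sp_Rc[OF z(2) t(1)] by simp
  then have "g = 1" using t(2)[OF one_K0] t(2)[OF g_K0] t(3) by simp
  then show False using g_ne_one by simp
qed

lemma fL_cong: "lf p \<Longrightarrow> lf q \<Longrightarrow> (\<And>b. b \<in> BB \<Longrightarrow> p b = q b) \<Longrightarrow> fL p = fL q"
  by (rule lf_eqI) (auto simp: BB_def simp flip: pair)

lemma fR_cong: "lf p \<Longrightarrow> lf q \<Longrightarrow> (\<And>b. b \<in> AA \<Longrightarrow> p b = q b) \<Longrightarrow> fR p = fR q"
  by (rule lf_eqI) (auto simp: AA_def pair)

text \<open>A left leg inside \<open>K0\<close> is commutative, and by duality the right leg is then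
  cocommutative.\<close>

lemma BB_K0: assumes "AA \<subseteq> K0" shows "BB \<subseteq> K0"
proof (rule cocommutative_K0[OF subbi_BB])
  fix u t assume "u \<in> BB" and t: "lf t"
  then obtain p where p: "lf p" "fR p = u" using BB_E by blast
  have tA: "fL t \<in> AA" using t by (auto simp: AA_def)
  have "fR (\<lambda>u. p (u * fL t)) = fR (\<lambda>u. p (fL t * u))"
  proof (rule fR_cong[OF lf_mult_right[OF p(1)] lf_mult_left[OF p(1)]])
    fix b assume "b \<in> AA"
    then have "b \<in> K0" "fL t \<in> K0" using assms tA by blast+
    then show "p (b * fL t) = p (fL t * b)" using K0_comm by metis
  qed
  then show "Lc t u = Rc t u" using Lc_fR[OF p(1) t] Rc_fR[OF p(1) t] p(2) by simp
qed

lemma AA_K0: assumes "BB \<subseteq> K0" shows "AA \<subseteq> K0"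
proof (rule cocommutative_K0[OF subbi_AA])
  fix u t assume "u \<in> AA" and t: "lf t"
  then obtain p where p: "lf p" "fL p = u" using AA_E by blast
  have tB: "fR t \<in> BB" using t by (auto simp: BB_def)
  have "fL (\<lambda>u. p (u * fR t)) = fL (\<lambda>u. p (fR t * u))"
  proof (rule fL_cong[OF lf_mult_right[OF p(1)] lf_mult_left[OF p(1)]])
    fix b assume "b \<in> BB"
    then have "b \<in> K0" "fR t \<in> K0" using assms tB by blast+
    then show "p (b * fR t) = p (fR t * b)" using K0_comm by metis
  qed
  then show "Lc t u = Rc t u" using Lc_fL[OF p(1) t] Rc_fL[OF p(1) t] p(2) by simp
qed

lemma gn_a: "K0 \<subseteq> gn {a}" "gn {a} \<subseteq> K0"
proof -
  have "a ^ i \<in> gn {a}" for i by (rule gn_power, rule gn_base) simp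
  then show "K0 \<subseteq> gn {a}" unfolding K0_def by (intro span_minimal gn_subspace) auto
  show "gn {a} \<subseteq> K0" using K0_mult[of _ 1] by (intro gn_subset K0_sub one_K0) auto
qed

text \<open>One leg inside \<open>K0\<close> drags the other along by duality, and then minimality
  would generate everything from \<open>a\<close>, leaving no room for the skew primitive x.\<close>

lemma not_K0: "\<not> AA \<subseteq> K0" "\<not> BB \<subseteq> K0"
proof -
  have "\<not> (AA \<subseteq> K0 \<and> BB \<subseteq> K0)"
  proof
    assume *: "AA \<subseteq> K0 \<and> BB \<subseteq> K0"
    have "a * a ^ (N - 1) = 1" using N_pos a_order(1) by (metis Suc_pred' power_Suc)
    moreover have "a ^ (N - 1) \<in> gn {a}" by (rule gn_power, rule gn_base) simp
    ultimately have "C \<subseteq> gn {a}"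
      using * gn_a(1) g_K0 a_gl gl_C[OF a_gl] by (intro minimal_gn) auto
    then have "C \<subseteq> K0" using gn_a(2) by blast
    moreover obtain x y \<alpha> \<beta> where "P_basis x y \<alpha> \<beta>" using P_basis_exists by blast
    ultimately show False using P_basisD(1,7) sp_C by blast
  qed
  then show "\<not> AA \<subseteq> K0" "\<not> BB \<subseteq> K0" using BB_K0 AA_K0 by blast+
qed

lemma g_AA: "g \<in> AA" and g_BB: "g \<in> BB"
  using Taft_Wilson(1) subbi_AA subbi_BB not_K0 by blast+

lemma eig_AA: obtains c x where "x \<in> AA" "sp g x" "eig c x" "x \<notin> K0"
  using Taft_Wilson(2)[OF subbi_AA not_K0(1)] eigenvector_exists[OF subbi_AA AA_conj[unfolded ai_def] g_AA] by blast

lemma eig_BB: obtains c x where "x \<in> BB" "sp g x" "eig c x" "x \<notin> K0"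
  using Taft_Wilson(2)[OF subbi_BB not_K0(2)] eigenvector_exists[OF subbi_BB BB_conj[unfolded ai_def] g_BB] by blast

lemma g_mult_diff: "c *s (a ^ k * g - a ^ k) \<in> K0"
  using a_pow_K0 K0_mult[OF g_K0] by (intro subspace_scale subspace_diff K0_sub)

text \<open>The double relation for z and the grouplike a^k compares multiples of a^k z and of a^k
  (g - 1). The former is outside \<open>K0\<close> and the latter inside, so both coefficients
  vanish. \<open>R2\<close> is the mirror image, with the grouplike in the left leg.\<close>

lemma R1:
  assumes tg: "lf tg" "fL tg = g" and tz: "lf tz" "fL tz = z"
    and z: "sp g z" "z \<notin> K0" "eig \<alpha> z" and h: "a ^ k \<in> BB"
  shows "tg (a ^ k) * \<alpha> ^ k = 1" "tz (a ^ k) = 0"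
proof -
  have "z * (tg (a ^ k) *s a ^ k) + tz (a ^ k) *s a ^ k = tz (a ^ k) *s a ^ k * g + a ^ k * z"
    using double_sp[of tg tz "a ^ k"] assms by (simp add: gl_Rc gl_Lc a_pow_gl)
  then have eq: "(tg (a ^ k) * \<alpha> ^ k - 1) *s (a ^ k * z) = tz (a ^ k) *s (a ^ k * g - a ^ k)"
    using eig_pow[OF z(3), of k]
    by (simp add: smult_simps algebra_simps)
  then have "(tg (a ^ k) * \<alpha> ^ k - 1) *s (a ^ k * z) \<in> K0" using g_mult_diff by simp
  then show 1: "tg (a ^ k) * \<alpha> ^ k = 1"
    using subspace_neg_iff[OF K0_sub, of "tg (a ^ k) * \<alpha> ^ k - 1" "a ^ k * z"] z(2) K0_mult_iff by auto
  have "a ^ k * g - a ^ k \<noteq> 0" using a_pow_cancel[of k g 1] g_ne_one by simp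
  then show "tz (a ^ k) = 0" using eq 1 by simp
qed

lemma R2:
  assumes th: "lf th" "fL th = a ^ k" and w: "w \<in> BB" "sp g w" "w \<notin> K0" "eig \<beta> w"
  shows "th g = \<beta> ^ k" "th w = 0"
proof -
  have th1: "th 1 = 1" using one_pair[OF th(1)] th(2) by (simp add: eps_a)
  have "a ^ k * (th g *s w + th w *s 1) = (th w *s g + th 1 *s w) * a ^ k"
    using double_gl[of th w] th w by (simp add: a_pow_gl sp_Rc[OF w(2)] sp_Lc[OF w(2)])
  then have eq: "(th g - \<beta> ^ k) *s (a ^ k * w) = th w *s (a ^ k * g - a ^ k)"
    using eig_pow[OF w(4), of k] a_commute_g[of k]
    by (simp add: th1 smult_simps algebra_simps)
  then have "(th g - \<beta> ^ k) *s (a ^ k * w) \<in> K0" using g_mult_diff by simp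
  then show 1: "th g = \<beta> ^ k"
    using subspace_neg_iff[OF K0_sub, of "th g - \<beta> ^ k" "a ^ k * w"] w(3) K0_mult_iff by auto
  have "a ^ k * g - a ^ k \<noteq> 0" using a_pow_cancel[of k g 1] g_ne_one by simp
  then show "th w = 0" using eq 1 by simp
qed

text \<open>\<open>R1\<close> and \<open>R2\<close> remove the pairings of z with g and of g with w,
  so only the pairing of z with w survives; it is the constant in the commutation rule.\<close>

lemma R3:
  assumes tg: "lf tg" "fL tg = g" and tz: "lf tz" "fL tz = z"
    and z: "sp g z" "z \<notin> K0" "eig \<alpha> z"
    and w: "w \<in> BB" "sp g w" "w \<notin> K0" "eig \<beta> w"
  shows "tg g *s (z * w) - w * z = tz w *s (g * g - 1)"
proof -
  have tzg: "tz g = 0" using R1(2)[OF tg tz z, of \<nu>] g_BB by (simp add: g_def)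
  have tgw: "tg w = 0" using R2(2)[OF tg(1) _ w, of \<nu>] tg(2) by (simp add: g_def)
  have tz1: "tz 1 = 0" using one_pair[OF tz(1)] tz(2) sp_eps[OF z(1) g_nz] by simp
  have "z * (tg g *s w + tg w *s 1) + (tz g *s w + tz w *s 1) = (tz w *s g + tz 1 *s w) * g + w * z"
    using double_sp[of tg tz w] assms by (simp add: sp_Rc[OF w(2)] sp_Lc[OF w(2)])
  then show ?thesis by (simp add: tzg tgw tz1 smult_simps algebra_simps)
qed

text \<open>The pairing is invariant under conjugation by \<open>a\<close>, while conjugating both
  arguments multiplies it by \<alpha> \<beta>.\<close>

lemma R4:
  assumes tz: "lf tz" "fL tz = z" and z: "eig \<alpha> z" and w: "w \<in> BB" "eig \<beta> w" and ne: "tz w \<noteq> 0"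
  shows "\<alpha> * \<beta> = 1"
proof -
  obtain p where p: "lf p" "fR p = w" using BB_E[OF w(1)] by blast
  define p' where "p' = (\<lambda>u. p (ai * u))"
  have p': "lf p'" unfolding p'_def using p(1) by (rule lf_mult_left)
  define X where "X = fR (\<lambda>u. p' (u * a))"
  from comm_gl[OF a_gl p'] have 1: "a * w = X * a"
    by (simp add: p'_def X_def mult.assoc ai_cancel p(2))
  have "w * a = \<beta> *s (X * a)" using w(2) 1 by (simp add: eig_def)
  then have "w * a * ai = \<beta> *s (X * a) * ai" by simp
  then have wX: "w = \<beta> *s X" by (simp add: mult.assoc ai ai_cancel smult_simps)
  have "tz X = p' (z * a)" unfolding X_def using pair[OF tz(1) lf_mult_right[OF p', of a]] tz(2) by simp
  also have "\<dots> = \<alpha> * p z"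
    using z by (simp add: p'_def eig_def smult_simps lf_scale[OF p(1)] mult.assoc ai_cancel)
  also have "p z = tz w" using pair[OF tz(1) p(1)] tz(2) p(2) by simp
  finally have "tz w = \<beta> * (\<alpha> * tz w)" using wX lf_scale[OF tz(1), of \<beta> X] by simp
  then show ?thesis using ne by (simp add: mult.commute)
qed

end

section \<open>Gaussian binomial coefficients and powers of skew primitives\<close>

fun gb :: "'a::comm_ring_1 \<Rightarrow> nat \<Rightarrow> nat \<Rightarrow> 'a" where
  "gb q n 0 = 1"
| "gb q 0 (Suc k) = 0"
| "gb q (Suc n) (Suc k) = gb q n k + q ^ Suc k * gb q n (Suc k)"

lemma gb_above: "n < k \<Longrightarrow> gb q n k = 0"
  by (induction q n k rule: gb.induct) auto

lemma gb_self: "gb q n n = 1"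
  by (induction n) (auto simp: gb_above)

text \<open>The quotient formula with the denominator multiplied out: at a root of unity factors 1 -
  q^i vanish, so it cannot be stated with division.\<close>

lemma gb_factorial:
  "gb q (n + m) n * ((\<Prod>i<n. 1 - q ^ Suc i) * (\<Prod>i<m. 1 - q ^ Suc i)) = (\<Prod>i<n + m. 1 - q ^ Suc i)"
proof (induction "n + m" arbitrary: n m)
  case (Suc s)
  show ?case
  proof (cases n)
    case 0 then show ?thesis by simp
  next
    case n: (Suc n')
    show ?thesis
    proof (cases m)
      case 0 then show ?thesis by (simp add: gb_self del: gb.simps)
    next
      case m: (Suc m')
      let ?f = "\<lambda>n. \<Prod>i<n. 1 - q ^ Suc i"
      have s: "s = n' + m" "s = n + m'" using Suc n m by auto
      have 1: "gb q s n' * (?f n' * ?f m) = ?f s" using Suc(1)[OF s(1)] s by simp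
      have 2: "gb q s n * (?f n * ?f m') = ?f s" using Suc(1)[OF s(2)] s by simp
      have "gb q (n + m) n * (?f n * ?f m) = (gb q s n' + q ^ n * gb q s n) * (?f n * ?f m)"
        using Suc(2)[symmetric] n by simp
      also have "\<dots> = gb q s n' * (?f n' * ?f m) * (1 - q ^ n) + q ^ n * (gb q s n * (?f n * ?f m')) * (1 - q ^ m)"
        by (simp add: n m algebra_simps)
      also have "\<dots> = ?f s * (1 - q ^ (n + m))" unfolding 1 2 by (simp add: algebra_simps power_add)
      also have "\<dots> = ?f (n + m)" using Suc(2)[symmetric] by simp
      finally show ?thesis .
    qed
  qed
qed simp

lemma gb_nonzero:
  fixes q :: "'a::idom"
  assumes "k \<le> n" "n < r" "\<And>i. 0 < i \<Longrightarrow> i < r \<Longrightarrow> q ^ i \<noteq> 1"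
  shows "gb q n k \<noteq> 0"
proof -
  have "1 - q ^ Suc i \<noteq> 0" if "i < n" for i using assms(3)[of "Suc i"] assms(2) that by simp
  then have "(\<Prod>i<n. 1 - q ^ Suc i) \<noteq> 0" by (subst prod_zero_iff) blast+
  then show ?thesis using gb_factorial[of q k "n - k"] assms(1) by auto
qed

lemma gb_root:
  fixes q :: "'a::idom"
  assumes "0 < k" "k < r" "q ^ r = 1" "\<And>i. 0 < i \<Longrightarrow> i < r \<Longrightarrow> q ^ i \<noteq> 1"
  shows "gb q r k = 0"
proof -
  have ne: "(\<Prod>i<n. 1 - q ^ Suc i) \<noteq> 0" if "n < r" for n
  proof -
    have "1 - q ^ Suc i \<noteq> 0" if "i < n" for i using assms(4)[of "Suc i"] \<open>n < r\<close> that by simp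
    then show ?thesis by (subst prod_zero_iff) blast+
  qed
  have "Suc (r - 1) = r" using assms by simp
  then have z: "(\<Prod>i<r. 1 - q ^ Suc i) = 0"
    using assms(1-3) by (intro prod_zero bexI[of _ "r - 1"]) (auto simp del: power_Suc)
  have "k + (r - k) = r" using assms by simp
  then have "gb q r k * ((\<Prod>i<k. 1 - q ^ Suc i) * (\<Prod>i<r - k. 1 - q ^ Suc i)) = 0"
    using gb_factorial[of q k "r - k"] z by simp
  then show ?thesis using ne[OF assms(2)] ne[of "r - k"] assms(1,2) by simp
qed

context kalg begin

lemma qcomm_pow: assumes "z * h = c *s (h * z)" shows "z * h ^ n = c ^ n *s (h ^ n * z)"
proof (induction n)
  case (Suc n)
  have "z * h ^ Suc n = (z * h) * h ^ n" by (simp add: mult.assoc)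
  also have "\<dots> = c *s (h * (z * h ^ n))" by (simp only: assms smult_simps mult.assoc)
  also have "\<dots> = c ^ Suc n *s (h ^ Suc n * z)" by (simp add: Suc smult_simps mult.assoc)
  finally show ?case .
qed simp

lemma qcomm_pow_left: assumes "z * h = c *s (h * z)" shows "z ^ n * h = c ^ n *s (h * z ^ n)"
proof (induction n)
  case (Suc n)
  have "z ^ Suc n * h = z * (z ^ n * h)" by (simp add: mult.assoc)
  also have "\<dots> = c ^ n *s ((z * h) * z ^ n)" by (simp only: Suc smult_simps mult.assoc)
  also have "\<dots> = c ^ Suc n *s (h * z ^ Suc n)" by (simp add: assms smult_simps mult.assoc mult.commute)
  finally show ?case .
qed simp

lemma qcomm_pow2: assumes "z * h = c *s (h * z)" shows "z ^ m * h ^ n = c ^ (m * n) *s (h ^ n * z ^ m)"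
  using qcomm_pow[OF qcomm_pow_left[OF assms], of m n] by (simp add: power_mult)

end

context hopf_data begin

text \<open>The q-binomial theorem for the j-th power of z \<otimes> h + 1 \<otimes> z, whose
  summands q-commute because z h = q h z. The trailing factor u lets the formula act on products
  such as x^j y^k.\<close>

lemma Lc_pow:
  assumes z: "sp h z" "z * h = q *s (h * z)" and u: "u \<in> C"
  shows "lf p \<Longrightarrow> Lc p (z ^ j * u) = (\<Sum>k\<le>j. gb q j k *s (h ^ k * z ^ (j - k) * Lc (\<lambda>v. p (z ^ k * v)) u))"
proof (induction j arbitrary: p)
  case (Suc j)
  define T where "T k = Lc (\<lambda>v. p (z ^ k * v)) u" for k
  have zu: "z ^ j * u \<in> C" by (intro mult_C C_power sp_C[OF z(1)] u)
  have p': "lf (\<lambda>v. p (z * v))" using Suc.prems by (rule lf_mult_left)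
  have 1: "Lc (\<lambda>v. p (z * v)) (z ^ j * u) = (\<Sum>k\<le>j. gb q j k *s (h ^ k * z ^ (j - k) * T (Suc k)))"
    unfolding Suc.IH[OF p'] T_def by (simp add: mult.assoc)
  have 2: "z * Lc p (z ^ j * u) = (\<Sum>k\<le>j. (q ^ k * gb q j k) *s (h ^ k * z ^ (Suc j - k) * T k))"
  proof -
    have "z * (h ^ k * z ^ (j - k) * T k) = q ^ k *s (h ^ k * z ^ (Suc j - k) * T k)" if "k \<le> j" for k
    proof -
      have "z * (h ^ k * z ^ (j - k) * T k) = (z * h ^ k) * (z ^ (j - k) * T k)" by (simp only: mult.assoc)
      also have "\<dots> = q ^ k *s (h ^ k * (z * z ^ (j - k)) * T k)"
        by (simp only: qcomm_pow[OF z(2)] smult_simps mult.assoc)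
      also have "z * z ^ (j - k) = z ^ (Suc j - k)" using that by (simp add: Suc_diff_le)
      finally show ?thesis .
    qed
    then show ?thesis
      unfolding Suc.IH[OF Suc.prems] T_def[symmetric] sum_distrib_left scale_mult_right
      by (intro sum.cong) (simp_all add: mult.commute)
  qed
  have 3: "(\<Sum>k\<le>j. (q ^ k * gb q j k) *s (h ^ k * z ^ (Suc j - k) * T k)) =
      z ^ Suc j * T 0 + (\<Sum>k\<le>j. (q ^ Suc k * gb q j (Suc k)) *s (h ^ Suc k * z ^ (j - k) * T (Suc k)))"
  proof -
    have "(\<Sum>k\<le>j. (q ^ k * gb q j k) *s (h ^ k * z ^ (Suc j - k) * T k)) =
        (\<Sum>k\<le>Suc j. (q ^ k * gb q j k) *s (h ^ k * z ^ (Suc j - k) * T k))"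
      by (simp add: gb_above)
    then show ?thesis by (simp only: sum.atMost_Suc_shift) simp
  qed
  have "Lc p (z ^ Suc j * u) = h * Lc (\<lambda>v. p (z * v)) (z ^ j * u) + z * Lc p (z ^ j * u)"
    using Lc_sp_mult[OF z(1) zu Suc.prems] by (simp add: mult.assoc)
  also have "\<dots> = (\<Sum>k\<le>j. gb q j k *s (h ^ Suc k * z ^ (j - k) * T (Suc k))) + (z ^ Suc j * T 0 +
      (\<Sum>k\<le>j. (q ^ Suc k * gb q j (Suc k)) *s (h ^ Suc k * z ^ (j - k) * T (Suc k))))"
    unfolding 1 2 3 sum_distrib_left scale_mult_right by (simp add: mult.assoc)
  also have "\<dots> = z ^ Suc j * T 0 + (\<Sum>k\<le>j. gb q (Suc j) (Suc k) *s (h ^ Suc k * z ^ (j - k) * T (Suc k)))"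
    by (simp only: gb.simps scale_left_distrib sum.distrib) (simp only: ac_simps)
  also have "\<dots> = (\<Sum>k\<le>Suc j. gb q (Suc j) k *s (h ^ k * z ^ (Suc j - k) * T k))"
    by (simp only: sum.atMost_Suc_shift) simp
  finally show ?case unfolding T_def .
qed simp

end

definition ordk :: "'k::field \<Rightarrow> nat" where "ordk c = (LEAST n. 0 < n \<and> c ^ n = 1)"

lemma ordk:
  fixes c :: "'k::field"
  assumes "c ^ M = 1" "0 < M"
  shows "0 < ordk c" "c ^ ordk c = 1" "\<And>i. 0 < i \<Longrightarrow> i < ordk c \<Longrightarrow> c ^ i \<noteq> 1"
proof -
  have "0 < ordk c \<and> c ^ ordk c = 1" unfolding ordk_def by (rule LeastI[of _ M]) (use assms in auto)
  then show "0 < ordk c" "c ^ ordk c = 1" by auto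
  show "c ^ i \<noteq> 1" if "0 < i" "i < ordk c" for i
    using not_less_Least[of i "\<lambda>n. 0 < n \<and> c ^ n = 1"] that unfolding ordk_def by auto
qed

lemma ordk_inverse: "ordk (inverse c) = ordk c"
  by (simp add: ordk_def power_inverse)

context hopf_gen begin

lemma eig_ord: assumes "eig c z" "z \<noteq> 0"
  shows "0 < ordk (c ^ \<nu>)" "(c ^ \<nu>) ^ ordk (c ^ \<nu>) = 1" "\<And>i. 0 < i \<Longrightarrow> i < ordk (c ^ \<nu>) \<Longrightarrow> (c ^ \<nu>) ^ i \<noteq> 1"
proof -
  have "(c ^ \<nu>) ^ N = 1" using eig_order[OF assms] by (metis mult.commute power_mult power_one)
  from ordk[OF this N_pos]
  show "0 < ordk (c ^ \<nu>)" "(c ^ \<nu>) ^ ordk (c ^ \<nu>) = 1" "\<And>i. 0 < i \<Longrightarrow> i < ordk (c ^ \<nu>) \<Longrightarrow> (c ^ \<nu>) ^ i \<noteq> 1"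
    by blast+
qed

text \<open>With r the order of c^\<nu>, all inner Gaussian binomials of row r vanish, so z^r is
  skew primitive for g^r. The exponent \<nu> r is not congruent to \<nu>, since g^r = g would force
  c^\<nu> = 1; hence triviality applies.\<close>

lemma eig_pow_trivial:
  assumes z: "sp g z" "eig c z" "z \<notin> K0" and ne: "c ^ \<nu> \<noteq> 1"
  shows "\<exists>d. z ^ ordk (c ^ \<nu>) = d *s (g ^ ordk (c ^ \<nu>) - 1)"
proof -
  have z0: "z \<noteq> 0" using z(3) subspace_0[OF K0_sub] by auto
  define r where "r = ordk (c ^ \<nu>)"
  note r = eig_ord[OF z(2) z0, folded r_def]
  have "sp (g ^ r) (z ^ r)"
  proof (rule spI)
    show "z ^ r \<in> C" using z(1) by (intro C_power sp_C)
    fix p assume p: "lf p"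
    have "Lc p (z ^ r * 1) = (\<Sum>k\<le>r. gb (c ^ \<nu>) r k *s (g ^ k * z ^ (r - k) * Lc (\<lambda>v. p (z ^ k * v)) 1))"
      by (rule Lc_pow[OF z(1) eig_g[OF z(2)] one_C p])
    also have "\<dots> = (\<Sum>k\<in>{0, r}. gb (c ^ \<nu>) r k *s (g ^ k * z ^ (r - k) * Lc (\<lambda>v. p (z ^ k * v)) 1))"
      by (rule sum.mono_neutral_right) (use gb_root[OF _ _ r(2,3)] in auto)
    also have "\<dots> = p (z ^ r) *s g ^ r + p 1 *s z ^ r"
      using r(1) p gl_Lc[OF gl_one p] gl_Lc[OF gl_one lf_mult_left[OF p, of "z ^ r"]]
      by (simp add: gb_self scale_mult_right)
    finally show "Lc p (z ^ r) = p (z ^ r) *s g ^ r + p 1 *s z ^ r" by simp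
  qed
  then have sp: "sp (a ^ (\<nu> * r)) (z ^ r)" by (simp add: g_power)
  have "\<not> [\<nu> * r = \<nu>] (mod N)"
  proof
    assume "[\<nu> * r = \<nu>] (mod N)"
    then have gr: "g ^ r = g" unfolding g_power by (simp add: a_pow_cong g_def)
    have "z * g = (c ^ \<nu>) ^ r *s (g ^ r * z)" using qcomm_pow[OF eig_g[OF z(2)], of r] gr by simp
    then have "(c ^ \<nu> - 1) *s (g * z) = 0" using eig_g[OF z(2)] r(2) gr by (simp add: scale_left_diff_distrib)
    then have "g * z = 0" using ne by simp
    then show False using z0 a_pow_cancel[of \<nu> z 0] by (simp add: g_def)
  qed
  moreover have "0 < \<nu> * r" using r(1) nu by simp
  ultimately have "z ^ r \<in> span {a ^ (\<nu> * r) - 1}" using sp_trivial sp by blast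
  then show ?thesis unfolding r_def[symmetric] g_power by (auto simp: span_singleton)
qed

end

context kalg begin

lemma kernel_subspace: "lf p \<Longrightarrow> subspace {u. p u = 0}"
  by (rule subspaceI) (simp_all add: lf_zero lf_add lf_scale)

end

section \<open>Monomial bases\<close>

text \<open>Only (\<alpha> \<beta>)^\<nu> = 1 is assumed, not \<alpha> \<beta> = 1: the monomial
  basis is already needed to find the generators of the legs while the eigenvalues are still being
  matched.\<close>

locale hopf_pair = hopf_gen scale C dl eps S a N \<nu> g
  for scale :: "'k::{alg_closed_field, field_char_0} \<Rightarrow> 'b::ring_1 \<Rightarrow> 'b" (infixr \<open>*s\<close> 75)
    and C dl eps S a N \<nu> g +
  fixes x y :: 'b and \<alpha> \<beta> :: 'k
  assumes PB: "P_basis x y \<alpha> \<beta>" and pq: "(\<alpha> * \<beta>) ^ \<nu> = 1" and p1: "\<alpha> ^ \<nu> \<noteq> 1"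
begin

abbreviation "P \<equiv> \<alpha> ^ \<nu>"
abbreviation "Q \<equiv> \<beta> ^ \<nu>"
abbreviation "r \<equiv> ordk (\<alpha> ^ \<nu>)"

lemmas sp_x = P_basisD(1)[OF PB] and sp_y = P_basisD(2)[OF PB]
  and eig_x = P_basisD(3)[OF PB] and eig_y = P_basisD(4)[OF PB]
  and x_K0 = P_basisD(7)[OF PB] and y_K0 = P_basisD(8)[OF PB]

lemma PQ: "P * Q = 1" using pq by (simp add: power_mult_distrib)

lemma Q_inv: "Q = inverse P"
  using PQ by (metis inverse_unique)

lemma xg: "x * g = P *s (g * x)" and yg: "y * g = Q *s (g * y)"
  by (rule eig_g[OF eig_x], rule eig_g[OF eig_y])

lemma x_nz: "x \<noteq> 0" and y_nz: "y \<noteq> 0" using x_K0 y_K0 subspace_0[OF K0_sub] by auto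

lemma x_C: "x \<in> C" and y_C: "y \<in> C" by (rule sp_C[OF sp_x], rule sp_C[OF sp_y])

lemmas r_pos = eig_ord(1)[OF eig_x x_nz] and P_r = eig_ord(2)[OF eig_x x_nz] and P_ne = eig_ord(3)[OF eig_x x_nz]

lemma r_gt1: "1 < r"
proof -
  have "r \<noteq> 1" using P_r p1 by (metis power_one_right)
  then show ?thesis using r_pos by simp
qed

lemma Q_ne: "0 < i \<Longrightarrow> i < r \<Longrightarrow> Q ^ i \<noteq> 1"
  using P_ne[of i] by (simp add: Q_inv power_inverse)

lemma Q_ne1: "Q \<noteq> 1" using Q_ne[of 1] r_gt1 by simp

lemma x_r: "\<exists>d. x ^ r = d *s (g ^ r - 1)" and y_r: "\<exists>d. y ^ r = d *s (g ^ r - 1)"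
  using eig_pow_trivial[OF sp_x eig_x x_K0 p1] eig_pow_trivial[OF sp_y eig_y y_K0 Q_ne1]
  by (simp_all add: Q_inv ordk_inverse)

text \<open>The cross terms of the coproduct cancel because P Q = 1, leaving a skew primitive for
  g^2, and 2 \<nu> is not congruent to \<nu>. The constant c may be zero here; it is computed from R
  in the end.\<close>

lemma yx: "\<exists>c. y * x = Q *s (x * y) + c *s (g * g - 1)"
proof -
  let ?z = "y * x - Q *s (x * y)"
  have "sp (g * g) ?z"
  proof (rule spI)
    show "?z \<in> C" by (intro C_intros x_C y_C)
    fix p assume p: "lf p"
    have 1: "Lc p (y * x) = p (y * x) *s (g * g) + p y *s (g * x) + p x *s (y * g) + p 1 *s (y * x)"
      using Lc_sp_mult[OF sp_y x_C p] sp_Lc[OF sp_x p] sp_Lc[OF sp_x lf_mult_left[OF p, of y]]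
      by (simp add: distrib_left scale_mult_right)
    have 2: "Lc p (x * y) = p (x * y) *s (g * g) + p x *s (g * y) + p y *s (x * g) + p 1 *s (x * y)"
      using Lc_sp_mult[OF sp_x y_C p] sp_Lc[OF sp_y p] sp_Lc[OF sp_y lf_mult_left[OF p, of x]]
      by (simp add: distrib_left scale_mult_right)
    have "Q * (p y * P) = p y" using PQ by (simp add: mult.commute mult.left_commute)
    then show "Lc p ?z = p ?z *s (g * g) + p 1 *s ?z"
      unfolding Lc_diff[OF p] Lc_scale[OF p] 1 2 xg yg
      by (simp add: lf_diff[OF p] lf_scale[OF p] scale_right_distrib scale_left_distrib scale_right_diff_distrib
          scale_left_diff_distrib mult.commute mult.left_commute)
  qed
  then have sp: "sp (a ^ (\<nu> + \<nu>)) ?z" by (simp add: g_def power_add)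
  have "\<not> [\<nu> + \<nu> = \<nu>] (mod N)"
  proof
    assume "[\<nu> + \<nu> = \<nu>] (mod N)"
    then have "[\<nu> = 0] (mod N)" by (metis add_0_right cong_add_lcancel_nat)
    then show False using nu by (simp add: cong_def)
  qed
  then have "?z \<in> span {a ^ (\<nu> + \<nu>) - 1}" using sp_trivial[of "\<nu> + \<nu>" ?z] sp nu by simp
  then obtain c where "?z = c *s (g * g - 1)" by (auto simp: span_singleton g_def power_add)
  then have "y * x = Q *s (x * y) + c *s (g * g - 1)" by (simp add: algebra_simps)
  then show ?thesis by blast
qed

text \<open>Only the shape matters: moving y through x^j costs terms with one x fewer and
  coefficients in the span of 1 and g^2. The clause for j = 0 guards the truncated subtraction j -
  1.\<close>

lemma y_xpow: "\<exists>u v. y * x ^ j = Q ^ j *s (x ^ j * y) + (u *s 1 + v *s (g * g)) * x ^ (j - 1) \<and> (j = 0 \<longrightarrow> u = 0 \<and> v = 0)"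
proof (induction j)
  case 0 show ?case by (intro exI[of _ 0]) simp
next
  case (Suc j)
  then obtain u v where uv: "y * x ^ j = Q ^ j *s (x ^ j * y) + (u *s 1 + v *s (g * g)) * x ^ (j - 1)"
    "j = 0 \<longrightarrow> u = 0 \<and> v = 0" by blast
  obtain c where c: "y * x = Q *s (x * y) + c *s (g * g - 1)" using yx by blast
  have gg: "x * (g * g) = (P * P) *s (g * g * x)"
    using qcomm_pow[OF xg, of 2] by (simp add: power2_eq_square mult.assoc)
  have 1: "x * ((u *s 1 + v *s (g * g)) * x ^ (j - 1)) = (u *s 1 + (v * (P * P)) *s (g * g)) * x ^ j"
  proof (cases j)
    case 0 then show ?thesis using uv(2) by simp
  next
    case (Suc n)
    have "x * ((u *s 1 + v *s (g * g)) * x ^ n) = u *s (x * x ^ n) + v *s ((x * (g * g)) * x ^ n)"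
      by (simp add: distrib_left distrib_right smult_simps mult.assoc)
    also have "\<dots> = (u *s 1 + (v * (P * P)) *s (g * g)) * x ^ j"
      unfolding gg by (simp add: Suc distrib_left distrib_right smult_simps mult.assoc)
    finally show ?thesis using Suc by simp
  qed
  have "y * x ^ Suc j = (y * x) * x ^ j" by (simp add: mult.assoc)
  also have "\<dots> = Q *s (x * (y * x ^ j)) + c *s ((g * g - 1) * x ^ j)"
    unfolding c by (simp add: distrib_right smult_simps mult.assoc)
  also have "x * (y * x ^ j) = Q ^ j *s (x ^ Suc j * y) + (u *s 1 + (v * (P * P)) *s (g * g)) * x ^ j"
    unfolding uv(1) distrib_left 1 by (simp add: smult_simps mult.assoc)
  also have "Q *s (Q ^ j *s (x ^ Suc j * y) + (u *s 1 + (v * (P * P)) *s (g * g)) * x ^ j) + c *s ((g * g - 1) * x ^ j) =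
      Q ^ Suc j *s (x ^ Suc j * y) + ((Q * u - c) *s 1 + (Q * (v * (P * P)) + c) *s (g * g)) * x ^ (Suc j - 1)"
    by (simp add: distrib_right left_diff_distrib smult_simps scale_right_distrib scale_left_distrib
        scale_right_diff_distrib scale_left_diff_distrib)
  finally show ?case by blast
qed

definition mon :: "nat \<Rightarrow> nat \<Rightarrow> nat \<Rightarrow> 'b" where "mon i j k = a ^ i * x ^ j * y ^ k"

lemma a_mon: "a ^ m * mon i j k = mon (m + i) j k" by (simp add: mon_def power_add mult.assoc)

lemma a_g: "a ^ i * g ^ n = a ^ (i + \<nu> * n)" by (simp add: g_power power_add)

lemma mon_cong: "[i = i'] (mod N) \<Longrightarrow> mon i j k = mon i' j k" by (simp add: mon_def a_pow_cong[of i i'])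

text \<open>The set I of admissible exponents of \<open>a\<close> is kept variable. The relations
  shift exponents only by multiples of \<nu>, so a suitable proper I yields a subalgebra that misses
  \<open>a\<close>.\<close>

definition M :: "nat set \<Rightarrow> 'b set" where "M I = span {mon i j k | i j k. i \<in> I \<and> j < r \<and> k < r}"

lemma M_subspace: "subspace (M I)" by (simp add: M_def)

lemma mon_M: "i \<in> I \<Longrightarrow> j < r \<Longrightarrow> k < r \<Longrightarrow> mon i j k \<in> M I"
  unfolding M_def by (rule span_base) blast

lemma M_left:
  assumes "\<And>i j k. i \<in> I \<Longrightarrow> j < r \<Longrightarrow> k < r \<Longrightarrow> s * mon i j k \<in> M I" "u \<in> M I"
  shows "s * u \<in> M I"
proof -
  have "s * u \<in> span {mon i j k | i j k. i \<in> I \<and> j < r \<and> k < r}"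
    by (rule span_mult_left[where E = "{mon i j k | i j k. i \<in> I \<and> j < r \<and> k < r}"])
      (use assms in \<open>auto simp: M_def\<close>)
  then show ?thesis by (simp add: M_def)
qed

lemma a_M: "(\<And>i. i \<in> I \<Longrightarrow> m + i \<in> I) \<Longrightarrow> u \<in> M I \<Longrightarrow> a ^ m * u \<in> M I"
  by (rule M_left) (simp_all add: a_mon mon_M)

lemma shift_closed:
  assumes "\<And>i. i \<in> I \<Longrightarrow> i + \<nu> \<in> I" "i \<in> I" shows "i + \<nu> * n \<in> I"
proof (induction n)
  case (Suc n) then show ?case using assms(1)[of "i + \<nu> * n"] by (simp add: algebra_simps)
qed (simp add: assms)

lemma x_M: assumes I: "\<And>i. i \<in> I \<Longrightarrow> i + \<nu> \<in> I" shows "u \<in> M I \<Longrightarrow> x * u \<in> M I"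
proof (rule M_left)
  fix i j k assume ij: "i \<in> I" "j < r" "k < r"
  have e: "x * mon i j k = \<alpha> ^ i *s (a ^ i * x ^ Suc j * y ^ k)"
  proof -
    have "x * mon i j k = (x * a ^ i) * (x ^ j * y ^ k)" by (simp add: mon_def mult.assoc)
    then show ?thesis by (simp add: eig_pow[OF eig_x] smult_simps mult.assoc)
  qed
  show "x * mon i j k \<in> M I"
  proof (cases "Suc j < r")
    case True
    then show ?thesis unfolding e using mon_M[OF ij(1) True ij(3)]
      by (intro subspace_scale[OF M_subspace]) (simp add: mon_def)
  next
    case False
    then have j: "Suc j = r" using ij by simp
    obtain d where d: "x ^ r = d *s (g ^ r - 1)" using x_r by blast
    have "a ^ i * x ^ Suc j * y ^ k = d *s (mon (i + \<nu> * r) 0 k - mon i 0 k)"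
      unfolding j d by (simp add: mon_def smult_simps left_diff_distrib right_diff_distrib a_g)
    then show ?thesis unfolding e
      using mon_M[OF shift_closed[OF I ij(1)] r_pos ij(3), of r] mon_M[OF ij(1) r_pos ij(3)]
      by (simp add: subspace_scale[OF M_subspace] subspace_diff[OF M_subspace])
  qed
qed

lemma y_M: assumes I: "\<And>i. i \<in> I \<Longrightarrow> i + \<nu> \<in> I" shows "u \<in> M I \<Longrightarrow> y * u \<in> M I"
proof (rule M_left)
  fix i j k assume ij: "i \<in> I" "j < r" "k < r"
  obtain u v where uv: "y * x ^ j = Q ^ j *s (x ^ j * y) + (u *s 1 + v *s (g * g)) * x ^ (j - 1)"
    using y_xpow by blast
  have "y * mon i j k = (y * a ^ i) * (x ^ j * y ^ k)" by (simp add: mon_def mult.assoc)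
  also have "\<dots> = \<beta> ^ i *s (a ^ i * ((y * x ^ j) * y ^ k))"
    by (simp add: eig_pow[OF eig_y] smult_simps mult.assoc)
  also have "a ^ i * ((y * x ^ j) * y ^ k) = Q ^ j *s (a ^ i * x ^ j * y ^ Suc k) +
      (u *s mon i (j - 1) k + v *s mon (i + \<nu> * 2) (j - 1) k)"
    unfolding uv by (simp add: mon_def distrib_left distrib_right smult_simps mult.assoc power_add power_mult g_def power2_eq_square)
  finally have e: "y * mon i j k = \<beta> ^ i *s (Q ^ j *s (a ^ i * x ^ j * y ^ Suc k) +
      (u *s mon i (j - 1) k + v *s mon (i + \<nu> * 2) (j - 1) k))" .
  have j1: "j - 1 < r" using ij by simp
  have low: "u *s mon i (j - 1) k + v *s mon (i + \<nu> * 2) (j - 1) k \<in> M I"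
    using mon_M[OF shift_closed[OF I ij(1)] j1 ij(3), of 2] mon_M[OF ij(1) j1 ij(3)]
    by (simp add: subspace_add[OF M_subspace] subspace_scale[OF M_subspace])
  have "a ^ i * x ^ j * y ^ Suc k \<in> M I"
  proof (cases "Suc k < r")
    case True
    then show ?thesis using mon_M[OF ij(1,2) True] by (simp add: mon_def)
  next
    case False
    then have k: "Suc k = r" using ij by simp
    obtain d where d: "y ^ r = d *s (g ^ r - 1)" using y_r by blast
    \<comment> \<open>As P^r = 1, the element g^r commutes with x^j, so the multiple of g^r - 1 that
      replaces y^r can be moved to the front.\<close>
    have "P ^ (j * r) = 1" using P_r by (metis mult.commute power_mult power_one)
    then have "x ^ j * g ^ r = g ^ r * x ^ j" using qcomm_pow2[OF xg, of j r] by simp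
    then have "a ^ i * x ^ j * y ^ Suc k = d *s (mon (i + \<nu> * r) j 0 - mon i j 0)"
      unfolding k d by (simp add: mon_def smult_simps right_diff_distrib left_diff_distrib mult.assoc)
        (simp add: a_g flip: mult.assoc)
    then show ?thesis
      using mon_M[OF shift_closed[OF I ij(1)] ij(2) r_pos, of r] mon_M[OF ij(1,2) r_pos]
      by (simp add: subspace_scale[OF M_subspace] subspace_diff[OF M_subspace])
  qed
  then show "y * mon i j k \<in> M I"
    unfolding e
    by (rule subspace_scale[OF M_subspace subspace_add[OF M_subspace subspace_scale[OF M_subspace] low]])
qed

lemma C_gn: "C \<subseteq> gn {a, x, y}"
proof (rule gen)
  show a: "a \<in> gn {a, x, y}" by (rule gn_base) simp
  then have g: "g \<in> gn {a, x, y}" unfolding g_def by (rule gn_power)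
  have xy: "x \<in> gn {a, x, y}" "y \<in> gn {a, x, y}" by (rule gn_base, simp)+
  fix z assume "sp g z"
  then obtain b c d where z: "z = b *s (g - 1) + c *s x + d *s y" using P_basisD(6)[OF PB] by blast
  show "z \<in> gn {a, x, y}"
    unfolding z using g xy by (intro subspace_add subspace_scale subspace_diff gn_subspace gn_one)
qed (auto simp: gn_subspace gn_one gn_mult)

lemma C_M: "C \<subseteq> M UNIV"
proof -
  have "1 \<in> M UNIV" using mon_M[of 0 UNIV 0 0] r_pos by (simp add: mon_def)
  moreover have "a * u \<in> M UNIV" if "u \<in> M UNIV" for u using a_M[of UNIV 1 u] that by simp
  ultimately have "gn {a, x, y} \<subseteq> M UNIV"
    by (intro gn_subset M_subspace) (auto intro: x_M y_M)
  then show ?thesis using C_gn by blast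
qed

text \<open>The coproduct of a monomial as a product of two q-binomial expansions; the power of P
  arises when g^k1 is moved past x^(j - j1).\<close>

lemma Lc_mon:
  assumes p: "lf p"
  shows "Lc p (mon i j k) = (\<Sum>j1\<le>j. \<Sum>k1\<le>k. (gb P j j1 * gb Q k k1 * P ^ ((j - j1) * k1) * p (mon i j1 k1)) *s
    mon (i + \<nu> * (j1 + k1)) (j - j1) (k - k1))"
proof -
  have yC: "y ^ k \<in> C" "x ^ j * y ^ k \<in> C" by (intro mult_C C_power x_C y_C)+
  have 1: "Lc q (y ^ k) = (\<Sum>k1\<le>k. (gb Q k k1 * q (y ^ k1)) *s (g ^ k1 * y ^ (k - k1)))" if q: "lf q" for q
  proof -
    have "Lc q (y ^ k * 1) = (\<Sum>k1\<le>k. gb Q k k1 *s (g ^ k1 * y ^ (k - k1) * Lc (\<lambda>v. q (y ^ k1 * v)) 1))"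
      by (rule Lc_pow[OF sp_y yg one_C q])
    then show ?thesis
      using gl_Lc[OF gl_one lf_mult_left[OF q]] by (simp add: scale_mult_right mult.commute)
  qed
  have comb: "a ^ i * (g ^ j1 * x ^ (j - j1) * (g ^ k1 * y ^ (k - k1))) =
      P ^ ((j - j1) * k1) *s mon (i + \<nu> * (j1 + k1)) (j - j1) (k - k1)" for j1 k1
  proof -
    have "a ^ i * (g ^ j1 * x ^ (j - j1) * (g ^ k1 * y ^ (k - k1))) =
        a ^ i * g ^ j1 * (x ^ (j - j1) * g ^ k1) * y ^ (k - k1)" by (simp add: mult.assoc)
    also have "\<dots> = P ^ ((j - j1) * k1) *s ((a ^ i * (g ^ j1 * g ^ k1)) * x ^ (j - j1) * y ^ (k - k1))"
      unfolding qcomm_pow2[OF xg] by (simp add: smult_simps mult.assoc)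
    also have "a ^ i * (g ^ j1 * g ^ k1) = a ^ (i + \<nu> * (j1 + k1))" by (simp add: a_g flip: power_add)
    finally show ?thesis by (simp add: mon_def)
  qed
  have p': "lf (\<lambda>u. p (a ^ i * u))" "lf (\<lambda>v. p (a ^ i * (x ^ j1 * v)))" for j1
    using lf_mult_left[OF lf_mult_left[OF p, of "a ^ i"], of "x ^ j1"] p by simp_all
  have "Lc p (mon i j k) = a ^ i * Lc (\<lambda>u. p (a ^ i * u)) (x ^ j * y ^ k)"
    unfolding mon_def mult.assoc by (rule Lc_gl_mult[OF a_pow_gl yC(2) p])
  also have "Lc (\<lambda>u. p (a ^ i * u)) (x ^ j * y ^ k) =
      (\<Sum>j1\<le>j. gb P j j1 *s (g ^ j1 * x ^ (j - j1) * Lc (\<lambda>v. p (a ^ i * (x ^ j1 * v))) (y ^ k)))"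
    by (rule Lc_pow[OF sp_x xg yC(1) p'(1)])
  also have "a ^ i * \<dots> = (\<Sum>j1\<le>j. \<Sum>k1\<le>k. (gb P j j1 * (gb Q k k1 * p (a ^ i * (x ^ j1 * y ^ k1)))) *s
      (a ^ i * (g ^ j1 * x ^ (j - j1) * (g ^ k1 * y ^ (k - k1)))))"
    unfolding 1[OF p'(2)] by (simp add: sum_distrib_left smult_simps scale_sum_right)
  also have "\<dots> = (\<Sum>j1\<le>j. \<Sum>k1\<le>k. (gb P j j1 * gb Q k k1 * P ^ ((j - j1) * k1) * p (mon i j1 k1)) *s
    mon (i + \<nu> * (j1 + k1)) (j - j1) (k - k1))"
    unfolding comb by (intro sum.cong refl) (simp add: mon_def mult.assoc mult.commute mult.left_commute)
  finally show ?thesis .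
qed

lemma cv_mon:
  assumes p: "lf p" and q: "lf q"
  shows "cv p q (mon i j k) = (\<Sum>j1\<le>j. \<Sum>k1\<le>k. gb P j j1 * gb Q k k1 * P ^ ((j - j1) * k1) * p (mon i j1 k1) *
    q (mon (i + \<nu> * (j1 + k1)) (j - j1) (k - k1)))"
  unfolding Lc_pair[OF q, symmetric] Lc_mon[OF p] lf_sum[OF q] lf_scale[OF q] ..

text \<open>Coordinate functionals for monomials, controlled only up to total degree d. Constructing
  them degree by degree is the proof that the monomials are independent.\<close>

definition is_dual :: "nat \<Rightarrow> nat \<Rightarrow> nat \<Rightarrow> nat \<Rightarrow> ('b \<Rightarrow> 'k) \<Rightarrow> bool" where
  "is_dual d i j k \<psi> \<longleftrightarrow> lf \<psi> \<and> (\<forall>i' j' k'. j' < r \<longrightarrow> k' < r \<longrightarrow> j' + k' \<le> d \<longrightarrow>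
     \<psi> (mon i' j' k') = (if [i' = i] (mod N) \<and> j' = j \<and> k' = k then 1 else 0))"

lemma is_dualI: "lf \<psi> \<Longrightarrow> (\<And>i' j' k'. j' < r \<Longrightarrow> k' < r \<Longrightarrow> j' + k' \<le> d \<Longrightarrow>
     \<psi> (mon i' j' k') = (if [i' = i] (mod N) \<and> j' = j \<and> k' = k then 1 else 0)) \<Longrightarrow> is_dual d i j k \<psi>"
  and is_dual_lf: "is_dual d i j k \<psi> \<Longrightarrow> lf \<psi>"
  and is_dual_eq: "is_dual d i j k \<psi> \<Longrightarrow> j' < r \<Longrightarrow> k' < r \<Longrightarrow> j' + k' \<le> d \<Longrightarrow>
     \<psi> (mon i' j' k') = (if [i' = i] (mod N) \<and> j' = j \<and> k' = k then 1 else 0)"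
  unfolding is_dual_def by blast+

text \<open>f reads off one letter and kills \<open>K0\<close>. Convolving \<open>dual i\<close>
  with the translate of f by the inverse of a^i adds the condition on the power of \<open>a\<close>:
  in the coproduct of a^i' z only the term a^i' \<otimes> a^i' z survives.\<close>

lemma dual_one:
  assumes f: "lf f" "\<And>u. u \<in> K0 \<Longrightarrow> f u = 0" and fxy: "f x = (if j = 1 then 1 else 0)" "f y = (if j = 1 then 0 else 1)"
    and jk: "j + k = 1"
  shows "\<exists>\<psi>. is_dual 1 i j k \<psi>"
proof -
  define b where "b = a ^ (N - i mod N)"
  define h where "h = (\<lambda>u. f (b * u))"
  have h: "lf h" unfolding h_def using f(1) by (rule lf_mult_left)
  have hK: "h u = 0" if "u \<in> K0" for u unfolding h_def b_def using f(2) K0_mult[OF that] by blast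
  have hi: "h (a ^ i' * z) = f z" if "[i' = i] (mod N)" for i' z
  proof -
    have "b * a ^ i' = 1" unfolding a_pow_cong[OF that] b_def by (rule a_inv)
    then show ?thesis by (simp add: h_def flip: mult.assoc)
  qed
  let ?\<psi> = "cv (dual i) h"
  have lf: "lf ?\<psi>" using dual(1) h by (rule lf_cv)
  have val: "?\<psi> (a ^ i' * z) = (if [i' = i] (mod N) then f z else 0)" if z: "sp g z" for i' z
  proof -
    have gi: "g * a ^ i' \<in> K0" "a ^ i' * g \<in> K0" using K0_mult[OF a_pow_K0, of \<nu> i'] K0_mult[OF g_K0] by (auto simp: g_def)
    have "?\<psi> (a ^ i' * z) = cv (\<lambda>c. dual i (a ^ i' * c)) (\<lambda>c. h (a ^ i' * c)) z"
      using dual(1) h by (intro cv_gl_mult a_pow_gl sp_C[OF z])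
    also have "\<dots> = dual i (a ^ i' * z) * h (a ^ i' * g) + dual i (a ^ i') * h (a ^ i' * z)"
      using sp_cv[OF z lf_mult_left[OF dual(1)] lf_mult_left[OF h], of i "a ^ i'" "a ^ i'"] by simp
    finally show ?thesis using hK[OF gi(2)] hi by (simp add: dual(2))
  qed
  have val0: "?\<psi> (a ^ i') = 0" for i' using gl_cv[OF a_pow_gl dual(1) h] hK[OF a_pow_K0] by simp
  have "is_dual 1 i j k ?\<psi>"
  proof (rule is_dualI[OF lf])
    fix i' j' k' assume "j' + k' \<le> (1::nat)"
    then consider "j' = 0" "k' = 0" | "j' = 1" "k' = 0" | "j' = 0" "k' = 1" by linarith
    then show "?\<psi> (mon i' j' k') = (if [i' = i] (mod N) \<and> j' = j \<and> k' = k then 1 else 0)"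
      using jk val0[of i'] val[OF sp_x, of i'] val[OF sp_y, of i'] fxy
      by cases (auto simp: mon_def)
  qed
  then show ?thesis by blast
qed

lemma dual_one_x: "\<exists>\<psi>. is_dual 1 i 1 0 \<psi>"
proof -
  have "x \<notin> span (insert y K0)"
  proof
    assume "x \<in> span (insert y K0)"
    then obtain c where "x - c *s y \<in> span K0" by (auto simp: span_breakdown_eq)
    then have "1 *s x + (- c) *s y \<in> K0" unfolding span_eq_iff[THEN iffD2, OF K0_sub] by simp
    then show False using P_basisD(5)[OF PB] by fastforce
  qed
  then obtain f where f: "lf f" "\<And>w. w \<in> span (insert y K0) \<Longrightarrow> f w = 0" "f x = 1"
    using lf_separate[OF subspace_span] by blast
  show ?thesis by (rule dual_one[OF f(1)]) (use f in \<open>auto intro: span_base\<close>)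
qed

lemma dual_one_y: "\<exists>\<psi>. is_dual 1 i 0 1 \<psi>"
proof -
  have "y \<notin> span (insert x K0)"
  proof
    assume "y \<in> span (insert x K0)"
    then obtain c where "y - c *s x \<in> span K0" by (auto simp: span_breakdown_eq)
    then have "(- c) *s x + 1 *s y \<in> K0" unfolding span_eq_iff[THEN iffD2, OF K0_sub] by (simp add: add.commute)
    then show False using P_basisD(5)[OF PB] by fastforce
  qed
  then obtain f where f: "lf f" "\<And>w. w \<in> span (insert x K0) \<Longrightarrow> f w = 0" "f y = 1"
    using lf_separate[OF subspace_span] by blast
  show ?thesis by (rule dual_one[OF f(1)]) (use f in \<open>auto intro: span_base\<close>)
qed

text \<open>A monomial of degree d + 1 is split into a letter and a rest of degree d. Convolving
  their coordinate functionals singles it out among all monomials of degree at most d + 1, with a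
  weight made of Gaussian binomials and a power of P that is nonzero because the exponents stay
  below r. The shift to i + \<nu> is the g that the letter contributes to the right tensor
  factor.\<close>

lemma dual_step:
  assumes d: "1 \<le> d" and IH: "\<And>i j k. j < r \<Longrightarrow> k < r \<Longrightarrow> j + k \<le> d \<Longrightarrow> \<exists>\<psi>. is_dual d i j k \<psi>"
    and jk: "j < r" "k < r" "j + k = Suc d"
  shows "\<exists>\<psi>. is_dual (Suc d) i j k \<psi>"
proof -
  define e1 e2 where e: "e1 = (if 0 < j then 1 else 0 :: nat)" "e2 = (if 0 < j then 0 else 1 :: nat)"
  have e_sum: "e1 + e2 = 1" "e1 \<le> j" "e2 \<le> k" using jk d by (auto simp: e)
  have low: "j - e1 + (k - e2) = d" using e_sum jk by linarith
  obtain \<psi> where \<psi>: "is_dual d i e1 e2 \<psi>"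
    using IH[of e1 e2 i] e_sum d r_gt1 by auto
  obtain \<phi> where \<phi>: "is_dual d (i + \<nu>) (j - e1) (k - e2) \<phi>"
    using IH[of "j - e1" "k - e2" "i + \<nu>"] low jk by (auto simp: less_imp_diff_less)
  note lf\<psi> = is_dual_lf[OF \<psi>] and lf\<phi> = is_dual_lf[OF \<phi>]
  define w where "w = gb P j e1 * gb Q k e2 * P ^ ((j - e1) * e2)"
  have "P \<noteq> 0" by (metis PQ mult_zero_left zero_neq_one)
  then have w: "w \<noteq> 0"
    using gb_nonzero[OF e_sum(2) jk(1) P_ne] gb_nonzero[OF e_sum(3) jk(2) Q_ne] by (simp add: w_def)
  have val: "cv \<psi> \<phi> (mon i' j' k') = (if [i' = i] (mod N) \<and> j' = j \<and> k' = k then w else 0)"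
    if *: "j' < r" "k' < r" "j' + k' \<le> Suc d" for i' j' k'
  proof -
    define F where "F j1 k1 = gb P j' j1 * gb Q k' k1 * P ^ ((j' - j1) * k1) * \<psi> (mon i' j1 k1) *
      \<phi> (mon (i' + \<nu> * (j1 + k1)) (j' - j1) (k' - k1))" for j1 k1
    have F: "F j1 k1 = (if [i' = i] (mod N) \<and> j' = j \<and> k' = k \<and> j1 = e1 \<and> k1 = e2 then w else 0)"
      if jk1: "j1 \<le> j'" "k1 \<le> k'" for j1 k1
    proof (cases "j1 + k1 \<le> d")
      case True
      have \<psi>v: "\<psi> (mon i' j1 k1) = (if [i' = i] (mod N) \<and> j1 = e1 \<and> k1 = e2 then 1 else 0)"
        using is_dual_eq[OF \<psi>, of j1 k1] True jk1 * by simp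
      show ?thesis
      proof (cases "[i' = i] (mod N) \<and> j1 = e1 \<and> k1 = e2")
        case eq: True
        have "j' - e1 + (k' - e2) \<le> d" using * e_sum eq jk1 by linarith
        then have "\<phi> (mon (i' + \<nu>) (j' - e1) (k' - e2)) =
            (if [i' + \<nu> = i + \<nu>] (mod N) \<and> j' - e1 = j - e1 \<and> k' - e2 = k - e2 then 1 else 0)"
          using is_dual_eq[OF \<phi>, of "j' - e1" "k' - e2"] * by simp
        moreover have "j' - e1 = j - e1 \<longleftrightarrow> j' = j" "k' - e2 = k - e2 \<longleftrightarrow> k' = k"
          using eq jk1 e_sum by linarith+
        moreover have "[i' + \<nu> = i + \<nu>] (mod N)" using eq by (simp add: cong_add)
        ultimately show ?thesis using eq \<psi>v by (simp add: F_def w_def e_sum(1))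
      next
        case False
        then show ?thesis using \<psi>v by (auto simp: F_def)
      qed
    next
      \<comment> \<open>Here the left tensor factor takes the whole monomial, whose degree d + 1 is
        out of control for \<psi>; the right factor is then a power of \<open>a\<close>, on which
        \<phi> vanishes because d \<ge> 1.\<close>
      case False
      then have "j1 = j'" "k1 = k'" using jk1 * by linarith+
      moreover have "\<phi> (mon (i' + \<nu> * (j' + k')) 0 0) = 0"
        using is_dual_eq[OF \<phi>, of 0 0] r_pos low d by auto
      moreover have "\<not> (j1 = e1 \<and> k1 = e2)" using False e_sum d by auto
      ultimately show ?thesis by (auto simp: F_def)
    qed
    have "cv \<psi> \<phi> (mon i' j' k') = (\<Sum>j1\<le>j'. \<Sum>k1\<le>k'. F j1 k1)"
      unfolding cv_mon[OF lf\<psi> lf\<phi>] F_def ..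
    also have "\<dots> = (\<Sum>j1\<le>j'. \<Sum>k1\<le>k'. if j1 = e1 then (if k1 = e2 then
        (if [i' = i] (mod N) \<and> j' = j \<and> k' = k then w else 0) else 0) else 0)"
      by (intro sum.cong refl) (auto simp: F)
    also have "\<dots> = (if [i' = i] (mod N) \<and> j' = j \<and> k' = k then w else 0)"
      using e_sum by (cases "j' = j \<and> k' = k") (auto simp: sum.If_cases)
    finally show ?thesis .
  qed
  have "is_dual (Suc d) i j k (\<lambda>u. inverse w * cv \<psi> \<phi> u)"
    by (rule is_dualI) (use w val lf\<psi> lf\<phi> in auto)
  then show ?thesis by blast
qed

text \<open>A functional that is dual up to degree d may take any values in degree d + 1; they are
  subtracted by means of the coordinate functionals of that degree.\<close>

lemma dual_correct:
  assumes top: "\<And>i j k. j < r \<Longrightarrow> k < r \<Longrightarrow> j + k = Suc d \<Longrightarrow> \<exists>\<psi>. is_dual (Suc d) i j k \<psi>"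
    and \<psi>: "is_dual d i j k \<psi>" and jk: "j + k \<le> d"
  shows "\<exists>\<psi>. is_dual (Suc d) i j k \<psi>"
proof -
  define T where "T = {(j', k'). j' < r \<and> k' < r \<and> j' + k' = Suc d}"
  have finT: "finite T" by (rule finite_subset[of _ "{..<r} \<times> {..<r}"]) (auto simp: T_def)
  define \<tau> where "\<tau> i' t = (SOME \<psi>. is_dual (Suc d) i' (fst t) (snd t) \<psi>)" for i' and t :: "nat \<times> nat"
  have \<tau>: "is_dual (Suc d) i' (fst t) (snd t) (\<tau> i' t)" if "t \<in> T" for i' t
  proof -
    have "\<exists>\<psi>. is_dual (Suc d) i' (fst t) (snd t) \<psi>" using that by (intro top) (auto simp: T_def)
    from someI_ex[OF this] show ?thesis unfolding \<tau>_def .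
  qed
  define \<psi>' where "\<psi>' u = \<psi> u - (\<Sum>i'<N. \<Sum>t\<in>T. \<psi> (mon i' (fst t) (snd t)) * \<tau> i' t u)" for u
  have lf: "lf \<psi>'"
    unfolding \<psi>'_def[abs_def]
    by (intro lf_minus lf_sums lf_cmult is_dual_lf[OF \<psi>] is_dual_lf[OF \<tau>])
  have "is_dual (Suc d) i j k \<psi>'"
  proof (rule is_dualI[OF lf])
    fix i' j' k' assume *: "j' < r" "k' < r" "j' + k' \<le> Suc d"
    have \<tau>v: "\<tau> i'' t (mon i' j' k') = (if i'' = i' mod N \<and> t = (j', k') then 1 else 0)" if "t \<in> T" "i'' < N" for i'' t
      using is_dual_eq[OF \<tau>[OF that(1)] *] that by (auto simp: cong_def prod_eq_iff)
    have "(\<Sum>i''<N. \<Sum>t\<in>T. \<psi> (mon i'' (fst t) (snd t)) * \<tau> i'' t (mon i' j' k')) =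
        (\<Sum>i''<N. \<Sum>t\<in>T. if t = (j', k') then (if i'' = i' mod N then \<psi> (mon i' j' k') else 0) else 0)"
      using mon_cong[of "i' mod N" i'] by (intro sum.cong refl) (auto simp: \<tau>v)
    also have "\<dots> = (if (j', k') \<in> T then \<psi> (mon i' j' k') else 0)"
      using finT N_pos by simp
    finally have "\<psi>' (mon i' j' k') = \<psi> (mon i' j' k') - (if (j', k') \<in> T then \<psi> (mon i' j' k') else 0)"
      by (simp add: \<psi>'_def)
    moreover have "\<psi> (mon i' j' k') = (if [i' = i] (mod N) \<and> j' = j \<and> k' = k then 1 else 0)" if "(j', k') \<notin> T"
      using is_dual_eq[OF \<psi>, of j' k' i'] * that by (auto simp: T_def)
    ultimately show "\<psi>' (mon i' j' k') = (if [i' = i] (mod N) \<and> j' = j \<and> k' = k then 1 else 0)"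
      using jk * by (auto simp: T_def)
  qed
  then show ?thesis by blast
qed

lemma dual_exists: "j < r \<Longrightarrow> k < r \<Longrightarrow> j + k \<le> d \<Longrightarrow> \<exists>\<psi>. is_dual d i j k \<psi>"
proof (induction d arbitrary: i j k)
  case 0
  have "is_dual 0 i 0 0 (dual i)" by (rule is_dualI) (auto simp: dual mon_def)
  then show ?case using 0 by auto
next
  case (Suc d)
  have top: "\<exists>\<psi>. is_dual (Suc d) i j k \<psi>" if "j < r" "k < r" "j + k = Suc d" for i j k
  proof (cases "d = 0")
    case True
    then have "j = 1 \<and> k = 0 \<or> j = 0 \<and> k = 1" using that by linarith
    then show ?thesis using True dual_one_x dual_one_y by auto
  next
    case False
    then show ?thesis using dual_step[OF _ Suc.IH that] by simp
  qed
  show ?case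
  proof (cases "j + k = Suc d")
    case True then show ?thesis using top Suc.prems by blast
  next
    case False
    then have jk: "j + k \<le> d" using Suc.prems by simp
    obtain \<psi> where "is_dual d i j k \<psi>" using Suc.IH[OF Suc.prems(1,2) jk] by blast
    then show ?thesis using dual_correct[OF top _ jk] by blast
  qed
qed

text \<open>The bound 2 r exceeds the total degree of every monomial with both exponents below r, so
  these are coordinates on the full basis.\<close>

definition ED :: "nat \<Rightarrow> nat \<Rightarrow> nat \<Rightarrow> 'b \<Rightarrow> 'k" where
  "ED i j k = (SOME \<psi>. is_dual (2 * r) i j k \<psi>)"

lemma ED:
  assumes "j < r" "k < r"
  shows "lf (ED i j k)" "j' < r \<Longrightarrow> k' < r \<Longrightarrow>
     ED i j k (mon i' j' k') = (if [i' = i] (mod N) \<and> j' = j \<and> k' = k then 1 else 0)"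
proof -
  have "\<exists>\<psi>. is_dual (2 * r) i j k \<psi>" using assms by (intro dual_exists) auto
  then have *: "is_dual (2 * r) i j k (ED i j k)" unfolding ED_def by (rule someI_ex)
  show "lf (ED i j k)" using * by (rule is_dual_lf)
  show "j' < r \<Longrightarrow> k' < r \<Longrightarrow>
     ED i j k (mon i' j' k') = (if [i' = i] (mod N) \<and> j' = j \<and> k' = k then 1 else 0)"
    using is_dual_eq[OF *, of j' k'] by simp
qed

definition idx :: "(nat \<times> nat \<times> nat) set" where "idx = {..<N} \<times> {..<r} \<times> {..<r}"

lemma finite_idx: "finite idx" by (simp add: idx_def)

lemma expansion:
  assumes "u \<in> C"
  shows "u = (\<Sum>(i, j, k)\<in>idx. ED i j k u *s mon i j k)"
proof -
  define F where "F u = (\<Sum>(i, j, k)\<in>idx. ED i j k u *s mon i j k)" for u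
  have lfE: "lf (ED i j k)" if "(i, j, k) \<in> idx" for i j k using that ED(1)[of j k] by (auto simp: idx_def)
  have "F (mon i' j' k') = mon i' j' k'" if "j' < r" "k' < r" for i' j' k'
  proof -
    have "F (mon i' j' k') = (\<Sum>t\<in>idx. if t = (i' mod N, j', k') then mon i' j' k' else 0)"
      unfolding F_def using that mon_cong[of "i' mod N" i']
      by (intro sum.cong refl) (auto simp: idx_def ED(2) cong_def split: if_splits)
    also have "\<dots> = mon i' j' k'" using that N_pos by (simp add: finite_idx) (simp add: idx_def)
    finally show ?thesis .
  qed
  moreover have "subspace {u. F u = u}"
  proof (rule subspaceI)
    have F_add: "F (u + v) = F u + F v" for u v
      unfolding F_def sum.distrib[symmetric] by (rule sum.cong) (auto simp: lf_add[OF lfE] scale_left_distrib)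
    have F_scale: "F (c *s u) = c *s F u" for c u
      unfolding F_def scale_sum_right by (rule sum.cong) (auto simp: lf_scale[OF lfE])
    show "0 \<in> {u. F u = u}" using F_scale[of 0 0] by simp
    show "u + v \<in> {u. F u = u}" if "u \<in> {u. F u = u}" "v \<in> {u. F u = u}" for u v
      using that by (simp add: F_add)
    show "c *s u \<in> {u. F u = u}" if "u \<in> {u. F u = u}" for c u using that by (simp add: F_scale)
  qed
  ultimately have "M UNIV \<subseteq> {u. F u = u}" unfolding M_def by (intro span_minimal) blast+
  then have "F u = u" using assms C_M by blast
  then show ?thesis unfolding F_def by (rule sym)
qed

lemma Lc_ED:
  assumes jk: "j0 < r" "k0 < r" and t: "j < r" "k < r"
  shows "Lc (ED i0 j0 k0) (mon i j k) = (if [i = i0] (mod N) \<and> j0 \<le> j \<and> k0 \<le> k then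
    (gb P j j0 * gb Q k k0 * P ^ ((j - j0) * k0)) *s mon (i + \<nu> * (j0 + k0)) (j - j0) (k - k0) else 0)"
proof -
  let ?R = "if [i = i0] (mod N) then
    (gb P j j0 * gb Q k k0 * P ^ ((j - j0) * k0)) *s mon (i + \<nu> * (j0 + k0)) (j - j0) (k - k0) else 0"
  have "Lc (ED i0 j0 k0) (mon i j k) = (\<Sum>j1\<le>j. \<Sum>k1\<le>k. if k1 = k0 then (if j1 = j0 then ?R else 0) else 0)"
    unfolding Lc_mon[OF ED(1)[OF jk]] by (intro sum.cong refl) (use t in \<open>auto simp: ED(2)[OF jk]\<close>)
  also have "\<dots> = (if [i = i0] (mod N) \<and> j0 \<le> j \<and> k0 \<le> k then
    (gb P j j0 * gb Q k k0 * P ^ ((j - j0) * k0)) *s mon (i + \<nu> * (j0 + k0)) (j - j0) (k - k0) else 0)"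
    by (auto intro!: sum.neutral)
  finally show ?thesis .
qed

text \<open>Slicing by a coordinate functional keeps the monomials of u with the given power of
  \<open>a\<close>, lowers their exponents by (j0, k0) and drops those that cannot be lowered.
  Choosing (j0, k0) near the top of u extracts generators.\<close>

lemma subbi_shift:
  assumes X: "subbi X" and u: "u \<in> X" and t: "i < N" "j0 < r" "k0 < r"
  shows "(\<Sum>j\<in>{j0..<r}. \<Sum>k\<in>{k0..<r}. (ED i j k u * (gb P j j0 * gb Q k k0 * P ^ ((j - j0) * k0))) *s
    mon (i + \<nu> * (j0 + k0)) (j - j0) (k - k0)) \<in> X"
proof -
  let ?G = "\<lambda>j k. (ED i j k u * (gb P j j0 * gb Q k k0 * P ^ ((j - j0) * k0))) *s mon (i + \<nu> * (j0 + k0)) (j - j0) (k - k0)"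
  have lf: "lf (ED i j0 k0)" using ED(1) t by blast
  have "Lc (ED i j0 k0) u = Lc (ED i j0 k0) (\<Sum>(i, j, k)\<in>idx. ED i j k u *s mon i j k)"
    using expansion[OF subbi_C[OF X u]] by simp
  also have "\<dots> = (\<Sum>(i', j, k)\<in>idx. ED i' j k u *s Lc (ED i j0 k0) (mon i' j k))"
    unfolding Lc_sum[OF lf] by (intro sum.cong refl) (auto simp: Lc_scale[OF lf])
  also have "\<dots> = (\<Sum>(i', j, k)\<in>idx. if i' = i then (if j0 \<le> j \<and> k0 \<le> k then ?G j k else 0) else 0)"
    by (intro sum.cong refl) (use t in \<open>auto simp: idx_def Lc_ED cong_def\<close>)
  also have "\<dots> = (\<Sum>i'<N. if i' = i then (\<Sum>j<r. \<Sum>k<r. if j0 \<le> j \<and> k0 \<le> k then ?G j k else 0) else 0)"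
    unfolding idx_def sum.cartesian_product[symmetric] by (intro sum.cong refl) auto
  also have "\<dots> = (\<Sum>j<r. \<Sum>k<r. if j0 \<le> j \<and> k0 \<le> k then ?G j k else 0)" using t by simp
  also have "\<dots> = (\<Sum>j<r. if j0 \<le> j then (\<Sum>k\<in>{k0..<r}. ?G j k) else 0)"
  proof (intro sum.cong refl)
    fix j
    have "(\<Sum>k<r. if j0 \<le> j \<and> k0 \<le> k then ?G j k else 0) = (\<Sum>k\<in>{k0..<r}. if j0 \<le> j then ?G j k else 0)"
      by (rule sum.mono_neutral_cong_right) auto
    then show "(\<Sum>k<r. if j0 \<le> j \<and> k0 \<le> k then ?G j k else 0) = (if j0 \<le> j then (\<Sum>k\<in>{k0..<r}. ?G j k) else 0)"
      by simp
  qed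
  also have "\<dots> = (\<Sum>j\<in>{j0..<r}. \<Sum>k\<in>{k0..<r}. ?G j k)"
    by (rule sum.mono_neutral_cong_right) auto
  finally show ?thesis using subbi_Lc[OF X lf u] by simp
qed

definition coef :: "'b \<Rightarrow> nat \<Rightarrow> nat \<Rightarrow> nat \<Rightarrow> bool" where
  "coef u i j k \<longleftrightarrow> i < N \<and> j < r \<and> k < r \<and> ED i j k u \<noteq> 0"

lemma expansion_in:
  assumes u: "u \<in> C" and W: "subspace W" and sup: "\<And>i j k. coef u i j k \<Longrightarrow> mon i j k \<in> W"
  shows "u \<in> W"
proof -
  have "ED i j k u *s mon i j k \<in> W" if "(i, j, k) \<in> idx" for i j k
    using that sup[of i j k] subspace_0[OF W] subspace_scale[OF W]
    by (cases "ED i j k u = 0") (auto simp: idx_def coef_def)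
  then have "(\<Sum>(i, j, k)\<in>idx. ED i j k u *s mon i j k) \<in> W" by (intro subspace_sum[OF W]) auto
  then show ?thesis using expansion[OF u] by simp
qed

lemma gb_coef: "j0 \<le> j \<Longrightarrow> k0 \<le> k \<Longrightarrow> j < r \<Longrightarrow> k < r \<Longrightarrow> gb P j j0 * gb Q k k0 * P ^ ((j - j0) * k0) \<noteq> 0"
proof -
  assume "j0 \<le> j" "k0 \<le> k" "j < r" "k < r"
  then have "gb P j j0 \<noteq> 0" "gb Q k k0 \<noteq> 0" using gb_nonzero[OF _ _ P_ne] gb_nonzero[OF _ _ Q_ne] by blast+
  moreover have "P \<noteq> 0" by (metis PQ mult_zero_left zero_neq_one)
  ultimately show ?thesis by simp
qed

lemma g_shift_cancel:
  assumes X: "subbi X" and g: "g \<in> X" shows "a ^ (i + \<nu> * n) * w \<in> X \<Longrightarrow> a ^ i * w \<in> X"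
proof -
  assume *: "a ^ (i + \<nu> * n) * w \<in> X"
  have gN: "g ^ N = 1" by (simp add: g_power mult.commute[of \<nu>] power_mult a_order)
  have "(N - 1) * n + n = N * n" using N_pos by (cases N) auto
  then have "g ^ ((N - 1) * n) * g ^ n = g ^ (N * n)" by (metis power_add)
  then have inv: "g ^ ((N - 1) * n) * g ^ n = 1" by (simp only: power_mult gN power_one)
  have "a ^ (i + \<nu> * n) * w = g ^ n * (a ^ i * w)"
    by (simp add: g_power add.commute flip: power_add mult.assoc)
  then have "g ^ ((N - 1) * n) * (a ^ (i + \<nu> * n) * w) = a ^ i * w"
    by (metis inv mult.assoc mult_1_left)
  moreover have "g ^ ((N - 1) * n) * (a ^ (i + \<nu> * n) * w) \<in> X"
    by (rule subbi_mult[OF X subbi_power[OF X g] *])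
  ultimately show ?thesis by simp
qed

text \<open>Slice by a monomial of maximal total degree among those of u with this i. Nothing else
  survives, a power of \<open>a\<close> with exponent i + \<nu> (j0 + k0) remains, and g \<in> X
  undoes the shift.\<close>

lemma subbi_group:
  assumes X: "subbi X" and g: "g \<in> X" and u: "u \<in> X" and c: "coef u i j k"
  shows "a ^ i \<in> X"
proof -
  let ?S = "{(j, k). coef u i j k}"
  have fin: "finite ?S" by (rule finite_subset[of _ "{..<r} \<times> {..<r}"]) (auto simp: coef_def)
  define m where "m = Max ((\<lambda>(j, k). j + k) ` ?S)"
  have "m \<in> (\<lambda>(j, k). j + k) ` ?S" unfolding m_def using fin c by (intro Max_in) auto
  then obtain j0 k0 where jk: "coef u i j0 k0" "j0 + k0 = m" by auto
  have max: "j + k \<le> j0 + k0" if "coef u i j k" for j k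
    unfolding jk(2) m_def using fin that by (intro Max_ge) auto
  have t: "i < N" "j0 < r" "k0 < r" using jk by (auto simp: coef_def)
  let ?G = "\<lambda>j k. (ED i j k u * (gb P j j0 * gb Q k k0 * P ^ ((j - j0) * k0))) *s mon (i + \<nu> * (j0 + k0)) (j - j0) (k - k0)"
  define G where "G j k = ?G j k" for j k
  have zero: "G j k = 0" if "j \<in> {j0..<r}" "k \<in> {k0..<r}" "(j, k) \<noteq> (j0, k0)" for j k
  proof -
    have "\<not> coef u i j k" using max[of j k] that by auto
    then show ?thesis using that t by (auto simp: coef_def G_def)
  qed
  have "(\<Sum>j\<in>{j0..<r}. \<Sum>k\<in>{k0..<r}. G j k) = (\<Sum>j\<in>{j0..<r}. \<Sum>k\<in>{k0..<r}. if k = k0 then (if j = j0 then G j0 k0 else 0) else 0)"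
    by (intro sum.cong refl) (use zero in auto)
  also have "\<dots> = G j0 k0" using t by simp
  finally have "?G j0 k0 \<in> X" using subbi_shift[OF X u t] unfolding G_def by simp
  moreover have "ED i j0 k0 u * (gb P j0 j0 * gb Q k0 k0 * P ^ ((j0 - j0) * k0)) \<noteq> 0"
    using jk(1) t by (simp add: coef_def gb_self)
  ultimately have "a ^ (i + \<nu> * (j0 + k0)) * 1 \<in> X"
    using subbi_scale_iff[OF X] by (simp add: mon_def)
  then show ?thesis using g_shift_cancel[OF X g, of i "j0 + k0" 1] by simp
qed

lemma a_pow_cancel_in:
  assumes X: "subbi X" and "a ^ i \<in> X" "a ^ i * w \<in> X" shows "w \<in> X"
proof -
  have "(a ^ i) ^ (N - 1) * a ^ i = 1"
    using N_pos by (metis a_order(1) mult.commute power_Suc2 power_mult power_one Suc_pred')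
  then have "w = (a ^ i) ^ (N - 1) * (a ^ i * w)" by (simp flip: mult.assoc)
  then show ?thesis using subbi_mult[OF X subbi_power[OF X assms(2)] assms(3)] by metis
qed

text \<open>The slice stops one y short of the largest exponents, k being maximised before j. What
  remains, up to a power of \<open>a\<close>, is a polynomial in x, which lies in X, plus a nonzero
  multiple of y.\<close>

lemma subbi_y:
  assumes X: "subbi X" and g: "g \<in> X" and x: "x \<in> X" and u: "u \<in> X" and c: "coef u i j k" "0 < k"
  shows "y \<in> X"
proof -
  let ?K = "{k. \<exists>j. coef u i j k}"
  have finK: "finite ?K" by (rule finite_subset[of _ "{..<r}"]) (auto simp: coef_def)
  define k0 where "k0 = Max ?K"
  have "k0 \<in> ?K" unfolding k0_def using finK c by (intro Max_in) auto
  have maxk: "k' \<le> k0" if "coef u i j' k'" for j' k' unfolding k0_def using finK that by (intro Max_ge) auto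
  let ?J = "{j. coef u i j k0}"
  have finJ: "finite ?J" by (rule finite_subset[of _ "{..<r}"]) (auto simp: coef_def)
  define j0 where "j0 = Max ?J"
  have c0: "coef u i j0 k0" unfolding j0_def using finJ \<open>k0 \<in> ?K\<close> Max_in[of ?J] by auto
  have maxj: "j' \<le> j0" if "coef u i j' k0" for j' unfolding j0_def using finJ that by (intro Max_ge) auto
  have k0: "0 < k0" using maxk[OF c(1)] c(2) by simp
  have t: "i < N" "j0 < r" "k0 < r" "k0 - 1 < r" using c0 by (auto simp: coef_def)
  have aX: "a ^ i \<in> X" by (rule subbi_group[OF X g u c(1)])
  define n where "n = j0 + (k0 - 1)"
  define w where "w j k = ED i j k u * (gb P j j0 * gb Q k (k0 - 1) * P ^ ((j - j0) * (k0 - 1)))" for j k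
  have sumX: "(\<Sum>j\<in>{j0..<r}. \<Sum>k\<in>{k0 - 1..<r}. w j k *s mon (i + \<nu> * n) (j - j0) (k - (k0 - 1))) \<in> X"
    unfolding w_def n_def by (rule subbi_shift[OF X u t(1,2,4)])
  have inner: "(\<Sum>k\<in>{k0 - 1..<r}. w j k *s mon (i + \<nu> * n) (j - j0) (k - (k0 - 1))) =
      a ^ (i + \<nu> * n) * (w j (k0 - 1) *s x ^ (j - j0) + (if j = j0 then w j0 k0 *s y else 0))" if j: "j \<in> {j0..<r}" for j
  proof -
    have z: "w j k = 0" if "k \<in> {k0 - 1..<r}" "k \<noteq> k0 - 1" "k \<noteq> k0 \<or> j \<noteq> j0" for k
    proof -
      have "\<not> coef u i j k"
      proof
        assume cc: "coef u i j k"
        then have "k = k0" using maxk[OF cc] that by auto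
        then show False using maxj[of j] cc j that by auto
      qed
      then show ?thesis using that j t by (auto simp: w_def coef_def)
    qed
    have "(\<Sum>k\<in>{k0 - 1..<r}. w j k *s mon (i + \<nu> * n) (j - j0) (k - (k0 - 1))) =
      (\<Sum>k\<in>{k0 - 1, k0}. w j k *s mon (i + \<nu> * n) (j - j0) (k - (k0 - 1)))"
      by (rule sum.mono_neutral_right) (use z t k0 in auto)
    also have "\<dots> = w j (k0 - 1) *s mon (i + \<nu> * n) (j - j0) 0 + w j k0 *s mon (i + \<nu> * n) (j - j0) 1"
      using k0 by simp
    finally show ?thesis using z[of k0] k0 t
      by (auto simp: mon_def distrib_left smult_simps)
  qed
  have "(\<Sum>j\<in>{j0..<r}. \<Sum>k\<in>{k0 - 1..<r}. w j k *s mon (i + \<nu> * n) (j - j0) (k - (k0 - 1))) =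
      a ^ (i + \<nu> * n) * ((\<Sum>j\<in>{j0..<r}. w j (k0 - 1) *s x ^ (j - j0)) + w j0 k0 *s y)"
  proof -
    have "(\<Sum>j\<in>{j0..<r}. \<Sum>k\<in>{k0 - 1..<r}. w j k *s mon (i + \<nu> * n) (j - j0) (k - (k0 - 1))) =
      (\<Sum>j\<in>{j0..<r}. a ^ (i + \<nu> * n) * (w j (k0 - 1) *s x ^ (j - j0) + (if j = j0 then w j0 k0 *s y else 0)))"
      by (intro sum.cong refl inner)
    then show ?thesis unfolding sum_distrib_left[symmetric] sum.distrib using t by simp
  qed
  with sumX have "a ^ i * ((\<Sum>j\<in>{j0..<r}. w j (k0 - 1) *s x ^ (j - j0)) + w j0 k0 *s y) \<in> X"
    using g_shift_cancel[OF X g] by metis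
  then have 1: "(\<Sum>j\<in>{j0..<r}. w j (k0 - 1) *s x ^ (j - j0)) + w j0 k0 *s y \<in> X"
    by (rule a_pow_cancel_in[OF X aX])
  have "(\<Sum>j\<in>{j0..<r}. w j (k0 - 1) *s x ^ (j - j0)) \<in> X"
    by (intro subspace_sum[OF subbi_subspace[OF X]] subbi_scale[OF X] subbi_power[OF X x])
  from subbi_diff[OF X 1 this] have "w j0 k0 *s y \<in> X" by simp
  moreover have "w j0 k0 \<noteq> 0"
    using gb_coef[of j0 j0 "k0 - 1" k0] t c0 by (simp add: w_def coef_def)
  ultimately show ?thesis using subbi_scale_iff[OF X] by blast
qed

text \<open>The mirror image of \<open>subbi_y\<close>: now j is maximised before k and the slice
  stops one x short.\<close>

lemma subbi_x:
  assumes X: "subbi X" and g: "g \<in> X" and y: "y \<in> X" and u: "u \<in> X" and c: "coef u i j k" "0 < j"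
  shows "x \<in> X"
proof -
  let ?J = "{j. \<exists>k. coef u i j k}"
  have finJ: "finite ?J" by (rule finite_subset[of _ "{..<r}"]) (auto simp: coef_def)
  define j0 where "j0 = Max ?J"
  have "j0 \<in> ?J" unfolding j0_def using finJ c by (intro Max_in) auto
  have maxj: "j' \<le> j0" if "coef u i j' k'" for j' k' unfolding j0_def using finJ that by (intro Max_ge) auto
  let ?K = "{k. coef u i j0 k}"
  have finK: "finite ?K" by (rule finite_subset[of _ "{..<r}"]) (auto simp: coef_def)
  define k0 where "k0 = Max ?K"
  have c0: "coef u i j0 k0" unfolding k0_def using finK \<open>j0 \<in> ?J\<close> Max_in[of ?K] by auto
  have maxk: "k' \<le> k0" if "coef u i j0 k'" for k' unfolding k0_def using finK that by (intro Max_ge) auto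
  have j0: "0 < j0" using maxj[OF c(1)] c(2) by simp
  have t: "i < N" "j0 < r" "k0 < r" "j0 - 1 < r" using c0 by (auto simp: coef_def)
  have aX: "a ^ i \<in> X" by (rule subbi_group[OF X g u c(1)])
  define n where "n = j0 - 1 + k0"
  define w where "w j k = ED i j k u * (gb P j (j0 - 1) * gb Q k k0 * P ^ ((j - (j0 - 1)) * k0))" for j k
  have "(\<Sum>j\<in>{j0 - 1..<r}. \<Sum>k\<in>{k0..<r}. w j k *s mon (i + \<nu> * n) (j - (j0 - 1)) (k - k0)) \<in> X"
    unfolding w_def n_def by (rule subbi_shift[OF X u t(1,4,3)])
  then have sumX: "(\<Sum>k\<in>{k0..<r}. \<Sum>j\<in>{j0 - 1..<r}. w j k *s mon (i + \<nu> * n) (j - (j0 - 1)) (k - k0)) \<in> X"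
    by (subst sum.swap)
  have inner: "(\<Sum>j\<in>{j0 - 1..<r}. w j k *s mon (i + \<nu> * n) (j - (j0 - 1)) (k - k0)) =
      a ^ (i + \<nu> * n) * (w (j0 - 1) k *s y ^ (k - k0) + (if k = k0 then w j0 k0 *s x else 0))" if k: "k \<in> {k0..<r}" for k
  proof -
    have z: "w j k = 0" if "j \<in> {j0 - 1..<r}" "j \<noteq> j0 - 1" "j \<noteq> j0 \<or> k \<noteq> k0" for j
    proof -
      have "\<not> coef u i j k"
      proof
        assume cc: "coef u i j k"
        then have "j = j0" using maxj[OF cc] that by auto
        then show False using maxk[of k] cc k that by auto
      qed
      then show ?thesis using that k t by (auto simp: w_def coef_def)
    qed
    have "(\<Sum>j\<in>{j0 - 1..<r}. w j k *s mon (i + \<nu> * n) (j - (j0 - 1)) (k - k0)) =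
      (\<Sum>j\<in>{j0 - 1, j0}. w j k *s mon (i + \<nu> * n) (j - (j0 - 1)) (k - k0))"
      by (rule sum.mono_neutral_right) (use z t j0 in auto)
    also have "\<dots> = w (j0 - 1) k *s mon (i + \<nu> * n) 0 (k - k0) + w j0 k *s mon (i + \<nu> * n) 1 (k - k0)"
      using j0 by simp
    finally show ?thesis using z[of j0] j0 t
      by (auto simp: mon_def distrib_left smult_simps)
  qed
  have "(\<Sum>k\<in>{k0..<r}. \<Sum>j\<in>{j0 - 1..<r}. w j k *s mon (i + \<nu> * n) (j - (j0 - 1)) (k - k0)) =
      a ^ (i + \<nu> * n) * ((\<Sum>k\<in>{k0..<r}. w (j0 - 1) k *s y ^ (k - k0)) + w j0 k0 *s x)"
  proof -
    have "(\<Sum>k\<in>{k0..<r}. \<Sum>j\<in>{j0 - 1..<r}. w j k *s mon (i + \<nu> * n) (j - (j0 - 1)) (k - k0)) =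
      (\<Sum>k\<in>{k0..<r}. a ^ (i + \<nu> * n) * (w (j0 - 1) k *s y ^ (k - k0) + (if k = k0 then w j0 k0 *s x else 0)))"
      by (intro sum.cong refl inner)
    then show ?thesis unfolding sum_distrib_left[symmetric] sum.distrib using t by simp
  qed
  with sumX have "a ^ i * ((\<Sum>k\<in>{k0..<r}. w (j0 - 1) k *s y ^ (k - k0)) + w j0 k0 *s x) \<in> X"
    using g_shift_cancel[OF X g] by metis
  then have 1: "(\<Sum>k\<in>{k0..<r}. w (j0 - 1) k *s y ^ (k - k0)) + w j0 k0 *s x \<in> X"
    by (rule a_pow_cancel_in[OF X aX])
  have "(\<Sum>k\<in>{k0..<r}. w (j0 - 1) k *s y ^ (k - k0)) \<in> X"
    by (intro subspace_sum[OF subbi_subspace[OF X]] subbi_scale[OF X] subbi_power[OF X y])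
  from subbi_diff[OF X 1 this] have "w j0 k0 *s x \<in> X" by simp
  moreover have "w j0 k0 \<noteq> 0"
    using gb_coef[of "j0 - 1" j0 k0 k0] t c0 by (simp add: w_def coef_def)
  ultimately show ?thesis using subbi_scale_iff[OF X] by blast
qed

definition gens where "gens X = X \<inter> (range (\<lambda>i. a ^ i) \<union> {x, y})"

text \<open>Every monomial occurring in an element of X has its factors in X: the power of
  \<open>a\<close> always, and each letter as soon as the other one is available. One letter in X at
  the outset is thus enough.\<close>

lemma subbi_generated:
  assumes X: "subbi X" and g: "g \<in> X" and xy: "x \<in> X \<or> y \<in> X"
  shows "X \<subseteq> gn (gens X)"
proof
  fix u assume u: "u \<in> X"
  have pow: "z ^ n \<in> gn (gens X)" if "z \<in> {x, y}" "z \<in> X" for z n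
    using that by (intro gn_power gn_base) (auto simp: gens_def)
  show "u \<in> gn (gens X)"
  proof (rule expansion_in[OF subbi_C[OF X u] gn_subspace])
    fix i j k assume c: "coef u i j k"
    have "a ^ i \<in> gn (gens X)"
      using subbi_group[OF X g u c] by (intro gn_base) (auto simp: gens_def)
    moreover have "x ^ j \<in> gn (gens X)"
      using pow[of x j] subbi_x[OF X g _ u c] xy by (cases "j = 0") (auto intro: gn_one)
    moreover have "y ^ k \<in> gn (gens X)"
      using pow[of y k] subbi_y[OF X g _ u c] xy by (cases "k = 0") (auto intro: gn_one)
    ultimately show "mon i j k \<in> gn (gens X)" unfolding mon_def by (intro gn_mult)
  qed
qed

lemma gn_M:
  assumes I: "\<And>i. i \<in> I \<Longrightarrow> i + \<nu> \<in> I" "0 \<in> I" "\<And>i j. i \<in> I \<Longrightarrow> j \<in> I \<Longrightarrow> i + j \<in> I"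
  shows "gn ({a ^ i | i. i \<in> I} \<union> {x, y}) \<subseteq> M I"
proof (rule gn_subset[OF M_subspace])
  show "1 \<in> M I" using mon_M[OF I(2) r_pos r_pos] by (simp add: mon_def)
  show "s * u \<in> M I" if "s \<in> {a ^ i | i. i \<in> I} \<union> {x, y}" "u \<in> M I" for s u
    using that a_M[of I _ u] I x_M[OF I(1)] y_M[OF I(1)] by auto
qed

lemma a_notin_M: assumes "\<And>i. i \<in> I \<Longrightarrow> \<not> [i = 1] (mod N)" shows "a \<notin> M I"
proof
  assume "a \<in> M I"
  have lf: "lf (ED 1 0 0)" using ED(1) r_pos by blast
  have "subspace {u. ED 1 0 0 u = 0}" using lf by (rule kernel_subspace)
  then have "M I \<subseteq> {u. ED 1 0 0 u = 0}"
    unfolding M_def using assms r_pos by (intro span_minimal) (auto simp: ED(2))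
  then have "ED 1 0 0 a = 0" using \<open>a \<in> M I\<close> by blast
  moreover have "ED 1 0 0 (mon 1 0 0) = 1" using ED(2)[OF r_pos r_pos r_pos r_pos] by simp
  ultimately show False by (simp add: mon_def)
qed

text \<open>The monomials without y span a subspace stable under left multiplication by
  \<open>a\<close> and x, and the coordinate functional of y vanishes on it.\<close>

lemma y_notin: "y \<notin> gn (range (\<lambda>i. a ^ i) \<union> {x})"
proof
  let ?E = "{mon i j 0 | i j. j < r}"
  assume *: "y \<in> gn (range (\<lambda>i. a ^ i) \<union> {x})"
  have "gn (range (\<lambda>i. a ^ i) \<union> {x}) \<subseteq> span ?E"
  proof (rule gn_subset[OF subspace_span])
    have "1 = mon 0 0 0" by (simp add: mon_def)
    then have "1 \<in> ?E" using r_pos by blast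
    then show "1 \<in> span ?E" by (rule span_base)
    have "s * e \<in> span ?E" if s: "s \<in> range (\<lambda>i. a ^ i) \<union> {x}" and e': "e \<in> ?E" for s e
    proof -
      obtain i j where e: "e = mon i j 0" "j < r" using e' by blast
      consider m where "s = a ^ m" | "s = x" using s by blast
      then show ?thesis
      proof cases
        case 1 then show ?thesis using e by (auto simp: a_mon intro!: span_base)
      next
        case 2
        have "x * e = (x * a ^ i) * x ^ j" by (simp add: e mon_def mult.assoc)
        also have "\<dots> = \<alpha> ^ i *s (a ^ i * x ^ Suc j)" by (simp add: eig_pow[OF eig_x] smult_simps mult.assoc)
        finally have xe: "x * e = \<alpha> ^ i *s (a ^ i * x ^ Suc j)" .
        show ?thesis
        proof (cases "Suc j < r")
          case True
          then have "a ^ i * x ^ Suc j \<in> ?E" by (force simp: mon_def simp del: power_Suc)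
          then show ?thesis unfolding 2 xe by (intro span_scale span_base)
        next
          case False
          then have j: "Suc j = r" using e by simp
          obtain d where d: "x ^ r = d *s (g ^ r - 1)" using x_r by blast
          have "a ^ i * x ^ Suc j = d *s (mon (i + \<nu> * r) 0 0 - mon i 0 0)"
            unfolding j d by (simp add: mon_def smult_simps right_diff_distrib a_g)
          moreover have "mon i' 0 0 \<in> span ?E" for i' using r_pos by (intro span_base) blast
          ultimately show ?thesis unfolding 2 xe by (simp add: span_scale span_diff)
        qed
      qed
    qed
    then show "s * u \<in> span ?E" if "s \<in> range (\<lambda>i. a ^ i) \<union> {x}" "u \<in> span ?E" for s u
      using that span_mult_left[of ?E s ?E u] by blast
  qed
  then have "y \<in> span ?E" using * by blast
  have lf: "lf (ED 0 0 1)" using ED(1) r_gt1 r_pos by blast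
  have "subspace {u. ED 0 0 1 u = 0}" using lf by (rule kernel_subspace)
  moreover have "ED 0 0 1 (mon i j 0) = 0" if "j < r" for i j using ED(2)[of 0 1 j 0] r_gt1 r_pos that by simp
  ultimately have "span ?E \<subseteq> {u. ED 0 0 1 u = 0}" by (intro span_minimal) auto
  then have "ED 0 0 1 y = 0" using \<open>y \<in> span ?E\<close> by blast
  moreover have "ED 0 0 1 (mon 0 0 1) = 1" using ED(2)[of 0 1 0 1] r_gt1 r_pos by simp
  ultimately show False by (simp add: mon_def)
qed

end

section \<open>Matching eigenvectors in the two legs\<close>

lemma gb_one: "gb (1::'a::comm_ring_1) n k = of_nat (n choose k)"
  by (induction "1::'a" n k rule: gb.induct) auto

context hopf_qt begin

text \<open>If z commuted with g, the Gaussian binomials would be ordinary ones, nonzero in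
  characteristic zero. The left leg is finite-dimensional, so some z^m depends on lower powers;
  slicing by a functional that reads off z^(m-1) and kills lower powers would put m g^(m-1) z into
  \<open>K0\<close>.\<close>

lemma AA_noncommuting:
  assumes z: "z \<in> AA" "sp g z" "z \<notin> K0" "eig c z"
  shows "c ^ \<nu> \<noteq> 1"
proof
  assume c: "c ^ \<nu> = 1"
  have zg: "z * g = 1 *s (g * z)" using eig_g[OF z(4)] c by simp
  let ?B = "\<lambda>m. (\<lambda>i. z ^ i) ` {..<m}"
  have "\<exists>m. z ^ m \<in> span (?B m)"
  proof (rule ccontr)
    assume "\<not> ?thesis"
    then have ni: "z ^ m \<notin> span (?B m)" for m by blast
    have "independent (?B m) \<and> card (?B m) = m" for m
    proof (induction m)
      case 0 then show ?case by (simp add: independent_empty)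
    next
      case (Suc m)
      have eq: "?B (Suc m) = insert (z ^ m) (?B m)" by (simp add: lessThan_Suc)
      have nB: "z ^ m \<notin> ?B m" by (rule notI) (rule notE[OF ni span_base])
      have "independent (insert (z ^ m) (?B m))"
        by (rule independent_insertI[OF ni conjunct1[OF Suc]])
      moreover have "card (insert (z ^ m) (?B m)) = Suc m"
        using card_insert_disjoint[OF finite_imageI[OF finite_lessThan] nB] conjunct2[OF Suc] by metis
      ultimately show ?case unfolding eq by (rule conjI)
    qed
    moreover have "?B m \<subseteq> span (fst ` set R)" for m
    proof -
      have "AA \<subseteq> span (fst ` set R)"
      proof
        fix u assume "u \<in> AA"
        then obtain t where t: "fL t = u" using AA_E by blast
        have "fL t \<in> span (fst ` set R)"
          unfolding fL_def by (rule sw_in[OF span_zero span_add]) (force intro: span_scale span_base)+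
        then show "u \<in> span (fst ` set R)" unfolding t .
      qed
      then show ?thesis using subbi_power[OF subbi_AA z(1)] by blast
    qed
    ultimately have "m \<le> card (fst ` set R)" for m
      using independent_span_bound[of "fst ` set R" "?B m"] by (metis List.finite_set finite_imageI)
    from this[of "Suc (card (fst ` set R))"] show False by simp
  qed
  then obtain m where m: "z ^ m \<in> span (?B m)" and least: "\<And>n. n < m \<Longrightarrow> z ^ n \<notin> span (?B n)"
    using exists_least_iff[of "\<lambda>m. z ^ m \<in> span (?B m)"] by blast
  have m0: "m \<noteq> 0" using m by (intro notI) simp
  have m1: "m \<noteq> 1"
  proof
    assume "m = 1"
    then have "z \<in> span {1}" using m by (simp add: lessThan_Suc)
    then show False using z(3) span_minimal[of "{1}" K0] one_K0 K0_sub by auto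
  qed
  define n where "n = m - 1"
  have mn: "m = Suc n" "0 < n" using m0 m1 by (auto simp: n_def)
  obtain \<psi> where \<psi>: "lf \<psi>" "\<And>w. w \<in> span (?B n) \<Longrightarrow> \<psi> w = 0" "\<psi> (z ^ n) = 1"
    using lf_separate[OF subspace_span least[of n]] mn by auto
  have \<psi>0: "\<psi> (z ^ i) = 0" if "i < n" for i using \<psi>(2) that by (simp add: span_base)
  have Lz: "Lc \<psi> (z ^ j) = (\<Sum>k\<le>j. (gb 1 j k * \<psi> (z ^ k)) *s (g ^ k * z ^ (j - k)))" for j
  proof -
    have "Lc \<psi> (z ^ j * 1) = (\<Sum>k\<le>j. gb 1 j k *s (g ^ k * z ^ (j - k) * Lc (\<lambda>v. \<psi> (z ^ k * v)) 1))"
      by (rule Lc_pow[OF z(2) zg one_C \<psi>(1)])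
    then show ?thesis using gl_Lc[OF gl_one lf_mult_left[OF \<psi>(1)]] by (simp add: scale_mult_right mult.commute)
  qed
  have gK: "g ^ k \<in> K0" for k by (simp add: g_power a_pow_K0)
  have "Lc \<psi> (z ^ i) \<in> K0" if "i < m" for i
  proof -
    have "(gb 1 i k * \<psi> (z ^ k)) *s (g ^ k * z ^ (i - k)) \<in> K0" if "k \<le> i" for k
    proof (cases "k = n")
      case True
      then have "i = n" using that \<open>i < m\<close> mn by simp
      then show ?thesis using True subspace_scale[OF K0_sub gK] by simp
    next
      case False
      then show ?thesis using \<psi>0[of k] that \<open>i < m\<close> mn subspace_0[OF K0_sub] by simp
    qed
    then show ?thesis unfolding Lz by (intro subspace_sum[OF K0_sub]) simp
  qed
  then have "span (?B m) \<subseteq> {u. Lc \<psi> u \<in> K0}"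
    by (intro span_minimal subspace_Lc[OF \<psi>(1) K0_sub]) auto
  then have "Lc \<psi> (z ^ m) \<in> K0" using m by blast
  moreover have "Lc \<psi> (z ^ m) = of_nat m *s (g ^ n * z) + \<psi> (z ^ m) *s g ^ m"
  proof -
    have "Lc \<psi> (z ^ m) = (\<Sum>k\<in>{n, m}. (gb 1 m k * \<psi> (z ^ k)) *s (g ^ k * z ^ (m - k)))"
      unfolding Lz by (rule sum.mono_neutral_right) (use \<psi>0 mn in auto)
    then show ?thesis using mn \<psi>(3) by (simp add: gb_one)
  qed
  ultimately have "of_nat m *s (g ^ n * z) \<in> K0"
    using subspace_diff[OF K0_sub _ subspace_scale[OF K0_sub gK[of m], of "\<psi> (z ^ m)"]] by fastforce
  then have "g ^ n * z \<in> K0" using subspace_neg_iff[OF K0_sub, of "of_nat m" "g ^ n * z"] m0 by simp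
  then show False using z(3) K0_mult_iff[of "\<nu> * n" z] by (simp add: g_power)
qed

lemma tg_exists: obtains tg where "lf tg" "fL tg = g"
  using AA_E[OF g_AA] by blast

text \<open>If \<open>BB\<close> has an eigenvector independent of z modulo \<open>K0\<close>, then
  \<open>R1\<close> and \<open>R2\<close> relate its eigenvalue to that of z. Otherwise z itself
  lies in \<open>BB\<close> and y is taken as a third eigenvector, not in \<open>BB\<close>. The
  q-commutator of y with z still lies in \<open>BB\<close>, and a slice that reads off z turns it
  into a multiple of g y modulo g^2, so that multiple must be zero.\<close>

lemma adapted_basis:
  obtains x y \<alpha> \<beta> where "P_basis x y \<alpha> \<beta>" "(\<alpha> * \<beta>) ^ \<nu> = 1" "\<alpha> ^ \<nu> \<noteq> 1" "x \<in> AA" "x \<in> BB \<or> y \<in> BB"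
proof -
  obtain c z where z: "z \<in> AA" "sp g z" "eig c z" "z \<notin> K0" by (rule eig_AA)
  have c: "c ^ \<nu> \<noteq> 1" by (rule AA_noncommuting[OF z(1,2,4,3)])
  obtain tg where tg: "lf tg" "fL tg = g" by (rule tg_exists)
  obtain tz where tz: "lf tz" "fL tz = z" using AA_E[OF z(1)] by blast
  have tgc: "tg g * c ^ \<nu> = 1" using R1(1)[OF tg tz z(2,4,3), of \<nu>] g_BB by (simp add: g_def)
  show ?thesis
  proof (cases "\<exists>w d. w \<in> BB \<and> sp g w \<and> eig d w \<and> (\<forall>e. w - e *s z \<notin> K0)")
    case True
    then obtain w d where w: "w \<in> BB" "sp g w" "eig d w" "\<And>e. w - e *s z \<notin> K0" by blast
    have wK: "w \<notin> K0" using w(4)[of 0] by simp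
    have "tg g = d ^ \<nu>" using R2(1)[OF tg(1) _ w(1,2) wK w(3), of \<nu>] tg(2) by (simp add: g_def)
    then have "(c * d) ^ \<nu> = 1" using tgc by (simp add: power_mult_distrib mult.commute)
    then show ?thesis using that[OF P_basisI[OF z(2,3,4) w(2,3,4)]] c z(1) w(1) by blast
  next
    case no: False
    obtain d0 w0 where w0: "w0 \<in> BB" "sp g w0" "eig d0 w0" "w0 \<notin> K0" by (rule eig_BB)
    then obtain e where e: "w0 - e *s z \<in> K0" using no by blast
    then have e0: "e \<noteq> 0" using w0(4) by auto
    obtain b where b: "w0 - e *s z = b *s (g - 1)" using K0_sp[OF e sp_diff[OF w0(2) sp_scale[OF z(2)]]] by blast
    have "e *s z = w0 - b *s (g - 1)" using b by (simp add: algebra_simps)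
    also have "\<dots> \<in> BB"
      by (rule subbi_diff[OF subbi_BB w0(1) subbi_scale[OF subbi_BB subbi_diff[OF subbi_BB g_BB subbi_one[OF subbi_BB]]]])
    finally have zB: "z \<in> BB" using subbi_scale_iff[OF subbi_BB e0] by simp
    obtain s y where y: "sp g y" "eig s y" "y \<notin> span {z, g - 1}"
      by (rule exists_eig_outside[of "{z, g - 1}"]) (simp add: card_insert_if, simp, blast)
    have yz: "y - e *s z \<notin> K0" for e
    proof
      assume *: "y - e *s z \<in> K0"
      obtain b where "y - e *s z = b *s (g - 1)" using K0_sp[OF * sp_diff[OF y(1) sp_scale[OF z(2)]]] by blast
      then show False using y(3) by (auto simp: span_breakdown_eq intro: span_scale span_base)
    qed
    have yB: "y \<notin> BB" using no y yz by blast
    have tgz: "tg g = c ^ \<nu>" "tg z = 0"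
      using R2[OF tg(1) _ zB z(2,4,3), of \<nu>] tg(2) by (simp_all add: g_def)
    obtain p where p: "lf p" "fR p = z" using BB_E[OF zB] by blast
    have "fR (\<lambda>u. p (g * u)) = tg g *s z"
      using Rc_fR[OF p(1) tg(1)] sp_Rc[OF z(2) tg(1)] by (simp add: tg p tgz)
    then have "tg g *s (y * z) + fR (\<lambda>u. p (y * u)) = fR (\<lambda>u. p (u * y)) * g + z * y"
      using comm_sp[OF y(1) p(1)] by (simp add: p scale_mult_right)
    then have m: "tg g *s (y * z) - z * y = fR (\<lambda>u. p (u * y)) * g - fR (\<lambda>u. p (y * u))"
      by (simp add: algebra_simps)
    have "fR (\<lambda>u. p (u * y)) \<in> BB" "fR (\<lambda>u. p (y * u)) \<in> BB"
      using p(1) unfolding BB_def by (auto intro!: imageI)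
    then have mB: "tg g *s (y * z) - z * y \<in> BB"
      unfolding m by (intro subbi_diff[OF subbi_BB] subbi_mult[OF subbi_BB] g_BB)
    have "span {1} \<subseteq> K0" by (intro span_minimal K0_sub) (simp add: one_K0)
    then have "z \<notin> span {1}" using z(4) by blast
    then obtain \<psi> where \<psi>': "lf \<psi>" "\<And>w. w \<in> span {1} \<Longrightarrow> \<psi> w = 0" "\<psi> z = 1"
      using lf_separate[OF subspace_span] by blast
    then have \<psi>: "lf \<psi>" "\<psi> 1 = 0" "\<psi> z = 1" by (auto intro: span_base)
    have zC: "z \<in> C" "y \<in> C" using z y by (auto intro: sp_C)
    have 1: "Lc \<psi> (y * z) = \<psi> (y * z) *s (g * g) + \<psi> y *s (g * z) + y * g"
      using Lc_sp_mult[OF y(1) zC(1) \<psi>(1)] sp_Lc[OF z(2) \<psi>(1)] sp_Lc[OF z(2) lf_mult_left[OF \<psi>(1), of y]] \<psi>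
      by (simp add: distrib_left scale_mult_right)
    have 2: "Lc \<psi> (z * y) = \<psi> (z * y) *s (g * g) + g * y + \<psi> y *s (z * g)"
      using Lc_sp_mult[OF z(2) zC(2) \<psi>(1)] sp_Lc[OF y(1) \<psi>(1)] sp_Lc[OF y(1) lf_mult_left[OF \<psi>(1), of z]] \<psi>
      by (simp add: distrib_left scale_mult_right)
    \<comment> \<open>The terms in g z cancel because the factor tg g equals the c^\<nu> produced by
      moving g past z.\<close>
    have "Lc \<psi> (tg g *s (y * z) - z * y) = (tg g * \<psi> (y * z) - \<psi> (z * y)) *s (g * g) + (tg g * s ^ \<nu> - 1) *s (g * y)"
      unfolding Lc_diff[OF \<psi>(1)] Lc_scale[OF \<psi>(1)] 1 2 eig_g[OF z(3)] eig_g[OF y(2)] tgz(1)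
      by (simp add: algebra_simps)
    then have "(tg g * \<psi> (y * z) - \<psi> (z * y)) *s (g * g) + (tg g * s ^ \<nu> - 1) *s (g * y) \<in> BB"
      using subbi_Lc[OF subbi_BB \<psi>(1) mB] by simp
    from subbi_diff[OF subbi_BB this subbi_scale[OF subbi_BB subbi_mult[OF subbi_BB g_BB g_BB], of "tg g * \<psi> (y * z) - \<psi> (z * y)"]]
    have gyB: "(tg g * s ^ \<nu> - 1) *s (g * y) \<in> BB" by simp
    have "tg g * s ^ \<nu> = 1"
    proof (rule ccontr)
      assume "tg g * s ^ \<nu> \<noteq> 1"
      then have "g * y \<in> BB" using gyB subbi_scale_iff[OF subbi_BB, of "tg g * s ^ \<nu> - 1" "g * y"] by simp
      obtain M where M: "N = Suc M" using N_pos by (cases N) auto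
      have "g ^ M * (g * y) \<in> BB" by (rule subbi_mult[OF subbi_BB subbi_power[OF subbi_BB g_BB] \<open>g * y \<in> BB\<close>])
      moreover have "g ^ M * (g * y) = g ^ N * y" unfolding M by (simp only: power_Suc2 mult.assoc)
      moreover have "g ^ N = 1" unfolding g_def by (metis a_order power_mult mult.commute power_one)
      ultimately show False using yB by simp
    qed
    then have "(c * s) ^ \<nu> = 1" using tgz by (simp add: power_mult_distrib)
    then show ?thesis using that[OF P_basisI[OF z(2,3,4) y(1,2) yz]] c z(1) zB by blast
  qed
qed

text \<open>A functional representing a skew primitive is a skew derivation of \<open>BB\<close>,
  and one representing a grouplike is a character; both are determined by their values on
  generators.\<close>

lemma t_mult:
  assumes t: "lf t" "fL t = v" and b: "b \<in> BB" "b' \<in> BB"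
  shows "sp g v \<Longrightarrow> lf tg \<Longrightarrow> fL tg = g \<Longrightarrow> t (b * b') = t b * tg b' + eps b * t b'"
    and "gl v \<Longrightarrow> t (b * b') = t b * t b'"
proof -
  obtain p p' where p: "lf p" "fR p = b" "lf p'" "fR p' = b'" using b BB_E by metis
  have tb: "t (b * b') = cv p p' v" using fR_mult[OF p(1,3)] pair[OF t(1) lf_cv[OF p(1,3)]] by (simp add: p t)
  have "p 1 = eps b" using pair[OF eps_lf p(1)] by (simp add: p fL_eps)
  then show "sp g v \<Longrightarrow> lf tg \<Longrightarrow> fL tg = g \<Longrightarrow> t (b * b') = t b * tg b' + eps b * t b'"
    using tb sp_cv[of g v p p'] pair[OF t(1) p(1)] pair[OF t(1) p(3)] pair[of tg p'] by (simp add: p t)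
  show "gl v \<Longrightarrow> t (b * b') = t b * t b'"
    using tb gl_cv[of v p p'] pair[OF t(1) p(1)] pair[OF t(1) p(3)] by (simp add: p t)
qed

lemma p_mult:
  assumes p: "lf p" "fR p = w" and u: "u \<in> AA" "u' \<in> AA"
  shows "sp g w \<Longrightarrow> lf pg \<Longrightarrow> fR pg = g \<Longrightarrow> p (u * u') = p u' * pg u + eps u' * p u"
    and "gl w \<Longrightarrow> p (u * u') = p u' * p u"
proof -
  obtain t t' where t: "lf t" "fL t = u" "lf t'" "fL t' = u'" using u AA_E by metis
  have pu: "p (u * u') = cv t' t w" using fL_mult[OF t(1,3)] pair[OF lf_cv[OF t(3,1)] p(1)] by (simp add: p t)
  have "t' 1 = eps u'" using one_pair[OF t(3)] by (simp add: t)
  then show "sp g w \<Longrightarrow> lf pg \<Longrightarrow> fR pg = g \<Longrightarrow> p (u * u') = p u' * pg u + eps u' * p u"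
    using pu sp_cv[of g w t' t] pair[OF t(1) p(1)] pair[OF t(3) p(1)] pair[OF t(1), of pg] by (simp add: p t)
  show "gl w \<Longrightarrow> p (u * u') = p u' * p u"
    using pu gl_cv[of w t' t] pair[OF t(1) p(1)] pair[OF t(3) p(1)] by (simp add: p t)
qed

lemma gn_ext_BB:
  assumes Gs: "Gs \<subseteq> BB" "BB \<subseteq> gn Gs" and f: "lf f" and h: "lf h" "f 1 = h 1"
    and step: "\<And>s b. s \<in> Gs \<Longrightarrow> b \<in> BB \<Longrightarrow> f b = h b \<Longrightarrow> f (s * b) = h (s * b)" and b: "b \<in> BB"
  shows "f b = h b"
proof -
  have "gn Gs \<subseteq> {b \<in> BB. f b = h b}"
  proof (rule gn_subset)
    have "subspace {b. f b - h b = 0}" by (rule kernel_subspace[OF lf_minus[OF f h(1)]])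
    then have "subspace (BB \<inter> {b. f b - h b = 0})" by (rule subspace_inter[OF subbi_subspace[OF subbi_BB]])
    moreover have "BB \<inter> {b. f b - h b = 0} = {b \<in> BB. f b = h b}" by auto
    ultimately show "subspace {b \<in> BB. f b = h b}" by simp
  qed (use h step Gs subbi_one[OF subbi_BB] subbi_mult[OF subbi_BB] in auto)
  then show ?thesis using b Gs by blast
qed

lemma gn_ext_AA:
  assumes Gs: "Gs \<subseteq> AA" "AA \<subseteq> gn Gs" and f: "lf f" and h: "lf h" "f 1 = h 1"
    and step: "\<And>s b. s \<in> Gs \<Longrightarrow> b \<in> AA \<Longrightarrow> f b = h b \<Longrightarrow> f (s * b) = h (s * b)" and b: "b \<in> AA"
  shows "f b = h b"
proof -
  have "gn Gs \<subseteq> {b \<in> AA. f b = h b}"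
  proof (rule gn_subset)
    have "subspace {b. f b - h b = 0}" by (rule kernel_subspace[OF lf_minus[OF f h(1)]])
    then have "subspace (AA \<inter> {b. f b - h b = 0})" by (rule subspace_inter[OF subbi_subspace[OF subbi_AA]])
    moreover have "AA \<inter> {b. f b - h b = 0} = {b \<in> AA. f b = h b}" by auto
    ultimately show "subspace {b \<in> AA. f b = h b}" by simp
  qed (use h step Gs subbi_one[OF subbi_AA] subbi_mult[OF subbi_AA] in auto)
  then show ?thesis using b Gs by blast
qed

text \<open>By \<open>R1\<close> the powers of \<open>a\<close> pair to zero with t. If the
  remaining generators did too, the skew derivation t would vanish on all of \<open>BB\<close>, and
  duality would give v = 0.\<close>

lemma t_nonzero:
  assumes t: "lf t" "fL t = v" and v: "sp g v" "v \<notin> K0" "eig c v" and Gs: "Gs \<subseteq> BB" "BB \<subseteq> gn Gs"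
  shows "\<exists>s\<in>Gs. (\<forall>k. s \<noteq> a ^ k) \<and> t s \<noteq> 0"
proof (rule ccontr)
  assume "\<not> ?thesis"
  then have no: "t s = 0" if "s \<in> Gs" "\<And>k. s \<noteq> a ^ k" for s using that by blast
  obtain tg where tg: "lf tg" "fL tg = g" by (rule tg_exists)
  have ts: "t s = 0" if "s \<in> Gs" for s
    using no[OF that] R1(2)[OF tg t v] that Gs(1) by (cases "\<exists>k. s = a ^ k") blast+
  have "t b = (\<lambda>_. 0) b" if "b \<in> BB" for b
  proof (rule gn_ext_BB[OF Gs t(1) lf_const_zero _ _ that])
    show "t 1 = 0" using one_pair[OF t(1)] sp_eps[OF v(1) g_nz] t(2) by simp
    show "t (s * b) = 0" if "s \<in> Gs" "b \<in> BB" "t b = 0" for s b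
      using t_mult(1)[OF t _ that(2) v(1) tg] that ts Gs(1) by auto
  qed
  then have "p v = p 0" if "lf p" for p
    using pair[OF t(1) that] that t(2) by (simp add: BB_def lf_zero)
  then have "v = 0" by (rule lf_eqI)
  then show False using v(2) subspace_0[OF K0_sub] by simp
qed

lemma p_nonzero:
  assumes p: "lf p" "fR p = w" and w: "sp g w" "w \<notin> K0" "eig c w" and Gs: "Gs \<subseteq> AA" "AA \<subseteq> gn Gs"
  shows "\<exists>s\<in>Gs. (\<forall>k. s \<noteq> a ^ k) \<and> p s \<noteq> 0"
proof (rule ccontr)
  assume "\<not> ?thesis"
  then have no: "p s = 0" if "s \<in> Gs" "\<And>k. s \<noteq> a ^ k" for s using that by blast
  obtain pg where pg: "lf pg" "fR pg = g" using BB_E[OF g_BB] by blast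
  have wB: "w \<in> BB" using p by (auto simp: BB_def)
  have ps: "p s = 0" if "s \<in> Gs" for s
  proof (cases "\<exists>k. s = a ^ k")
    case True
    then obtain k where k: "s = a ^ k" by blast
    have "s \<in> AA" using that Gs(1) by blast
    then obtain t where "lf t" "fL t = s" by (rule AA_E)
    note t = this[unfolded k]
    have "t w = 0" by (rule R2(2)[OF t wB w])
    then show ?thesis using pair[OF t(1) p(1)] by (simp add: p t k)
  qed (use no that in blast)
  have "p b = (\<lambda>_. 0) b" if "b \<in> AA" for b
  proof (rule gn_ext_AA[OF Gs p(1) lf_const_zero _ _ that])
    show "p 1 = 0" using pair[OF eps_lf p(1)] sp_eps[OF w(1) g_nz] by (simp add: p fL_eps)
    show "p (s * b) = 0" if "s \<in> Gs" "b \<in> AA" "p b = 0" for s b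
      using p_mult(1)[OF p _ that(2) w(1) pg] that ps Gs(1) by auto
  qed
  then have "t w = t 0" if "lf t" for t
    using pair[OF that p(1)] that p(2) by (simp add: AA_def lf_zero)
  then have "w = 0" by (rule lf_eqI)
  then show False using w(2) subspace_0[OF K0_sub] by simp
qed

text \<open>An eigenvector in one leg pairs nontrivially with x or y in the other. If x meets y or y
  meets x, the eigenvalues are inverse by \<open>R4\<close>. In the remaining case x pairs with x
  and y with y, so both eigenvalues square to 1 and equal -1; then x + y is an eigenvector as well,
  and x pairs nontrivially with it.\<close>

lemma paired_basis:
  obtains x y \<alpha> \<beta> t where "P_basis x y \<alpha> \<beta>" "\<alpha> * \<beta> = 1" "\<alpha> ^ \<nu> \<noteq> 1" "x \<in> AA" "y \<in> BB"
    "lf t" "fL t = x" "t y \<noteq> 0"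
proof -
  obtain x y \<alpha> \<beta> where b: "P_basis x y \<alpha> \<beta>" "(\<alpha> * \<beta>) ^ \<nu> = 1" "\<alpha> ^ \<nu> \<noteq> 1" "x \<in> AA" "x \<in> BB \<or> y \<in> BB"
    by (rule adapted_basis)
  interpret hp: hopf_pair scale C dl eps S a N \<nu> g x y \<alpha> \<beta>
    by unfold_locales (use b g_def in auto)
  note pb = P_basisD[OF b(1)]
  have gA: "AA \<subseteq> gn (hp.gens AA)" using b(4) by (intro hp.subbi_generated subbi_AA g_AA) blast
  have gB: "BB \<subseteq> gn (hp.gens BB)" using b(5) by (intro hp.subbi_generated subbi_BB g_BB)
  have gensX: "hp.gens X \<subseteq> X" "s \<in> hp.gens X \<Longrightarrow> (\<forall>k. s \<noteq> a ^ k) \<Longrightarrow> s = x \<or> s = y" for X s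
    by (auto simp: hp.gens_def)
  define pr where "pr v w \<longleftrightarrow> v \<in> AA \<and> w \<in> BB \<and> (\<exists>t. lf t \<and> fL t = v \<and> t w \<noteq> 0)" for v w
  have L: "\<exists>w\<in>{x, y}. pr v w" if v: "v \<in> AA" "sp g v" "v \<notin> K0" "eig c v" for v c
  proof -
    obtain t where t: "lf t" "fL t = v" using AA_E[OF v(1)] by blast
    obtain s where s: "s \<in> hp.gens BB" "\<forall>k. s \<noteq> a ^ k" "t s \<noteq> 0"
      using t_nonzero[OF t v(2-4) gensX(1) gB] by blast
    then have "s \<in> BB" using gensX(1)[of BB] by blast
    then show ?thesis using gensX(2)[OF s(1,2)] s(3) v(1) t unfolding pr_def by blast
  qed
  have R: "\<exists>v\<in>{x, y}. pr v w" if w: "w \<in> BB" "sp g w" "w \<notin> K0" "eig c w" for w c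
  proof -
    obtain p where p: "lf p" "fR p = w" using BB_E[OF w(1)] by blast
    obtain s where s: "s \<in> hp.gens AA" "\<forall>k. s \<noteq> a ^ k" "p s \<noteq> 0"
      using p_nonzero[OF p w(2-4) gensX(1) gA] by blast
    have sA: "s \<in> AA" using s gensX(1)[of AA] by blast
    then obtain t where t: "lf t" "fL t = s" using AA_E by blast
    have "t w \<noteq> 0" using pair[OF t(1) p(1)] s(3) by (simp add: t p)
    then show ?thesis using t sA w(1) gensX(2)[OF s(1,2)] unfolding pr_def by blast
  qed
  \<comment> \<open>With y in neither leg, both legs would be generated by powers of
    \<open>a\<close> and x, and so would the whole algebra by minimality.\<close>
  have yAB: "y \<in> AA \<or> y \<in> BB"
  proof (rule ccontr)
    assume no: "\<not> (y \<in> AA \<or> y \<in> BB)"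
    let ?G = "range (\<lambda>i. a ^ i) \<union> {x}"
    have mono: "gn (hp.gens X) \<subseteq> gn ?G" if "y \<notin> X" for X
      by (rule gn_subset[OF gn_subspace gn_one]) (use that in \<open>auto simp: hp.gens_def intro: gn_gen\<close>)
    have "C \<subseteq> gn ?G"
    proof (rule minimal_gn)
      show "?G \<subseteq> C" using sp_C[OF pb(1)] a_pow_C by auto
      show "g \<in> gn ?G" unfolding g_def by (rule gn_base) blast
      show "AA \<subseteq> gn ?G" "BB \<subseteq> gn ?G" using gA gB mono no by blast+
      show "(gl s \<and> (\<exists>s'\<in>gn ?G. s * s' = 1)) \<or> sp g s" if s: "s \<in> ?G" for s
      proof (cases "s = x")
        case False
        then obtain i where i: "s = a ^ i" using s by blast
        have "a ^ (N - i mod N) \<in> gn ?G" by (rule gn_base) blast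
        then show ?thesis using i a_pow_gl a_inv(2) by blast
      qed (use pb in simp)
    qed
    then show False using hp.y_notin sp_C[OF pb(2)] by blast
  qed
  have ev: "\<alpha> * \<beta> = 1" if "pr x y"
    using that R4[OF _ _ pb(3) _ pb(4)] unfolding pr_def by blast
  show ?thesis
  proof (cases "pr x y")
    case True
    then show ?thesis using that[OF b(1) ev[OF True] b(3,4)] unfolding pr_def by blast
  next
    case nxy: False
    show ?thesis
    proof (cases "pr y x")
      case True
      then have ba: "\<beta> * \<alpha> = 1" using R4[OF _ _ pb(4) _ pb(3)] unfolding pr_def by blast
      have "P_basis y x \<beta> \<alpha>"
      proof (rule P_basisI[OF pb(2,4,8,1,3)])
        fix c show "x - c *s y \<notin> K0" using pb(5)[of 1 "- c"] by auto
      qed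
      then show ?thesis using that[of y x \<beta> \<alpha>] ba hp.Q_ne1 True unfolding pr_def by blast
    next
      case nyx: False
      have xx: "pr x x" using L[OF b(4) pb(1,7,3)] nxy by blast
      have yy: "pr y y"
      proof (cases "y \<in> AA")
        case True then show ?thesis using L[OF True pb(2,8,4)] nyx by blast
      next
        case False
        then have "y \<in> BB" using yAB by blast
        then show ?thesis using R[OF _ pb(2,8,4)] nxy by blast
      qed
      have "\<alpha> * \<alpha> = 1" using xx R4[OF _ _ pb(3) _ pb(3)] unfolding pr_def by blast
      moreover have "\<beta> * \<beta> = 1" using yy R4[OF _ _ pb(4) _ pb(4)] unfolding pr_def by blast
      moreover have "\<alpha> \<noteq> 1" "\<beta> \<noteq> 1" using b(3) hp.Q_ne1 by auto
      ultimately have ab: "\<alpha> = -1" "\<beta> = -1" by (simp_all add: square_eq_1_iff)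
      obtain t where t: "lf t" "fL t = x" "t x \<noteq> 0" using xx unfolding pr_def by blast
      have B: "x \<in> BB" "y \<in> BB" using xx yy unfolding pr_def by blast+
      have "t y = 0" using nxy t b(4) B unfolding pr_def by blast
      then have "t (x + y) \<noteq> 0" using t by (simp add: lf_add)
      moreover have "P_basis x (x + y) \<alpha> \<alpha>"
      proof (rule P_basisI[OF pb(1,3,7)])
        show "sp g (x + y)" by (rule sp_add[OF pb(1,2)])
        show "eig \<alpha> (x + y)" using eig_add[OF pb(3)] pb(4) ab by simp
        fix c show "x + y - c *s x \<notin> K0" using pb(5)[of "1 - c" 1] by (auto simp: algebra_simps)
      qed
      ultimately show ?thesis
        using that[of x "x + y" \<alpha> \<alpha> t] ab b(3,4) subbi_add[OF subbi_BB B] t by simp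
    qed
  qed
qed

theorem presentation:
  obtains x y \<alpha> where "hopf_pair scale C dl eps S a N \<nu> x y \<alpha> (inverse \<alpha>)"
    "y * x - inverse (\<alpha> ^ \<nu>) *s (x * y) = g * g - 1"
    "\<And>m. \<alpha> ^ m = 1 \<longleftrightarrow> g ^ m = 1"
    "x ^ ordk (\<alpha> ^ \<nu>) = 0" "y ^ ordk (\<alpha> ^ \<nu>) = 0"
proof -
  obtain x w \<alpha> \<beta> t where b: "P_basis x w \<alpha> \<beta>" "\<alpha> * \<beta> = 1" "\<alpha> ^ \<nu> \<noteq> 1" "x \<in> AA" "w \<in> BB"
    and t: "lf t" "fL t = x" "t w \<noteq> 0"
    by (rule paired_basis)
  have \<beta>: "\<beta> = inverse \<alpha>" using b(2) by (metis inverse_unique)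
  have \<alpha>0: "\<alpha> \<noteq> 0" using b(2) by auto
  interpret hp: hopf_pair scale C dl eps S a N \<nu> g x w \<alpha> \<beta>
    by unfold_locales (use b g_def in auto)
  note pb = P_basisD[OF b(1)]
  \<comment> \<open>The scaling turns the constant t w of \<open>R3\<close> into 1, and the sign
    accounts for the opposite order of the two products there.\<close>
  define y where "y = (- inverse (t w)) *s w"
  have PB: "P_basis x y \<alpha> (inverse \<alpha>)"
  proof (rule P_basisI[OF pb(1,3,7)])
    show "sp g y" "eig (inverse \<alpha>) y" using pb(2,4) by (simp_all only: y_def sp_scale eig_scale \<beta>)
    fix c
    have eq: "y - c *s x = (- c) *s x + (- inverse (t w)) *s w" by (simp add: y_def algebra_simps)
    show "y - c *s x \<notin> K0" unfolding eq using pb(5)[of "- c" "- inverse (t w)"] t(3) by auto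
  qed
  interpret hq: hopf_pair scale C dl eps S a N \<nu> g x y \<alpha> "inverse \<alpha>"
    by unfold_locales (use PB b(3) \<alpha>0 g_def in auto)
  obtain tg where tg: "lf tg" "fL tg = g" by (rule tg_exists)
  have tgP: "tg (a ^ k) * \<alpha> ^ k = 1" if "a ^ k \<in> BB" for k by (rule R1(1)[OF tg t(1,2) pb(1,7,3) that])
  have tgg: "tg g = inverse (\<alpha> ^ \<nu>)"
    using tgP[of \<nu>] g_BB by (simp add: g_def) (metis inverse_unique mult.commute)
  have rel: "y * x - inverse (\<alpha> ^ \<nu>) *s (x * y) = g * g - 1"
  proof -
    have R: "tg g *s (x * w) - w * x = t w *s (g * g - 1)"
      by (rule R3[OF tg t(1,2) pb(1,7,3) b(5) pb(2,8,4)])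
    have "y * x - tg g *s (x * y) = inverse (t w) *s (tg g *s (x * w) - w * x)"
      by (simp add: y_def smult_simps scale_right_diff_distrib mult.commute)
    also have "\<dots> = g * g - 1" unfolding R using t(3) by simp
    finally show ?thesis using tgg by simp
  qed
  have gA: "AA \<subseteq> gn (hp.gens AA)" using b(4) by (intro hp.subbi_generated subbi_AA g_AA) blast
  have gB: "BB \<subseteq> gn (hp.gens BB)" using b(5) by (intro hp.subbi_generated subbi_BB g_BB) blast
  have pk_pow: "p (u ^ m) = p u ^ m" if p: "lf p" "fR p = a ^ k" and u: "u \<in> AA" for p k u m
  proof (induction m)
    case 0
    show ?case using pair[OF eps_lf p(1)] by (simp add: p fL_eps eps_a)
  next
    case (Suc m)
    then show ?case using p_mult(2)[OF p u subbi_power[OF subbi_AA u]] a_pow_gl by (simp add: mult.commute)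
  qed
  \<comment> \<open>If \<alpha>^m = 1, the functional s representing g^m agrees with the counit on
    the generators of \<open>BB\<close>, hence on \<open>BB\<close>, and duality gives g^m = 1. The
    converse rests on minimality.\<close>
  have ord: "\<alpha> ^ m = 1 \<longleftrightarrow> g ^ m = 1" for m
  proof
    assume am: "\<alpha> ^ m = 1"
    have gm: "g ^ m \<in> AA" by (rule subbi_power[OF subbi_AA g_AA])
    then obtain s where s: "lf s" "fL s = g ^ m" using AA_E by blast
    have glg: "gl (g ^ m)" by (simp add: g_power a_pow_gl)
    have s1: "s 1 = 1" using one_pair[OF s(1)] s(2) by (simp add: g_power eps_a)
    have gen: "s z = eps z" if z: "z \<in> hp.gens BB" for z
    proof -
      have zB: "z \<in> BB" using z by (auto simp: hp.gens_def)
      consider k where "z = a ^ k" | "z = x" | "z = w" using z by (auto simp: hp.gens_def)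
      then show ?thesis
      proof cases
        case (1 k)
        obtain p where p: "lf p" "fR p = a ^ k" using BB_E[OF zB] 1 by blast
        have pg: "p g = tg (a ^ k)" using pair[OF tg(1) p(1)] by (simp add: p tg)
        have "s z = p (g ^ m)" using pair[OF s(1) p(1)] by (simp add: 1 s p)
        also have "\<dots> = tg (a ^ k) ^ m" using pk_pow[OF p g_AA] pg by simp
        also have "\<dots> = 1"
        proof -
          have "(tg (a ^ k) * \<alpha> ^ k) ^ m = 1" using tgP[of k] zB 1 by simp
          then have "tg (a ^ k) ^ m * (\<alpha> ^ m) ^ k = 1"
            by (simp add: power_mult_distrib mult.commute flip: power_mult)
          then show ?thesis using am by simp
        qed
        finally show ?thesis using 1 by (simp add: eps_a)
      next
        case 2
        then have "s z = 0" using R2(2)[OF s(1), of "\<nu> * m" x] s(2) zB pb by (simp add: g_power)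
        then show ?thesis using 2 sp_eps[OF pb(1) g_nz] by simp
      next
        case 3
        then have "s z = 0" using R2(2)[OF s(1), of "\<nu> * m" w] s(2) zB pb by (simp add: g_power)
        then show ?thesis using 3 sp_eps[OF pb(2) g_nz] by simp
      qed
    qed
    have gensB: "hp.gens BB \<subseteq> BB" by (auto simp: hp.gens_def)
    have sB: "s v = eps v" if "v \<in> BB" for v
    proof (rule gn_ext_BB[OF gensB gB s(1) eps_lf _ _ that])
      show "s 1 = eps 1" by (simp add: s1 eps_one)
      fix z v assume z: "z \<in> hp.gens BB" and v: "v \<in> BB" "s v = eps v"
      have "z \<in> BB" using z gensB by blast
      then show "s (z * v) = eps (z * v)"
        using t_mult(2)[OF s _ v(1) glg] gen[OF z] v eps_mult[of z v] subbi_C[OF subbi_BB] by simp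
    qed
    have "p (g ^ m) = p 1" if "lf p" for p
      using pair[OF s(1) that] pair[OF eps_lf that] sB[of "fR p"] that by (simp add: BB_def s fL_eps)
    then show "g ^ m = 1" by (rule lf_eqI)
  next
    assume gm: "g ^ m = 1"
    have \<beta>m: "\<beta> ^ n = 1 \<longleftrightarrow> \<alpha> ^ n = 1" for n by (simp add: \<beta> power_inverse)
    have aB: "\<alpha> ^ (k * m) = 1" if k: "a ^ k \<in> BB" for k
    proof -
      obtain p where p: "lf p" "fR p = a ^ k" using BB_E[OF k] by blast
      have pg: "p g = tg (a ^ k)" using pair[OF tg(1) p(1)] by (simp add: p tg)
      have "tg (a ^ k) ^ m = p (g ^ m)" using pk_pow[OF p g_AA] pg by simp
      also have "\<dots> = 1" using pair[OF eps_lf p(1)] by (simp add: gm p fL_eps eps_a)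
      finally have "(tg (a ^ k) * \<alpha> ^ k) ^ m = \<alpha> ^ (k * m)" by (simp add: power_mult_distrib power_mult)
      then show ?thesis using tgP[OF k] by simp
    qed
    have aA: "\<alpha> ^ (k * m) = 1" if k: "a ^ k \<in> AA" for k
    proof -
      obtain s where s: "lf s" "fL s = a ^ k" using AA_E[OF k] by blast
      have sg: "s g = \<beta> ^ k" by (rule R2(1)[OF s b(5) pb(2,8,4)])
      have s1: "s 1 = 1" using one_pair[OF s(1)] s(2) by (simp add: eps_a)
      have "s (g ^ n) = s g ^ n" for n
      proof (induction n)
        case (Suc n)
        then show ?case using t_mult(2)[OF s g_BB subbi_power[OF subbi_BB g_BB] a_pow_gl] by simp
      qed (simp add: s1)
      from this[of m] have "(\<beta> ^ k) ^ m = 1" using gm s1 sg by simp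
      then show ?thesis using \<beta>m[of "k * m"] by (simp add: power_mult)
    qed
    \<comment> \<open>When g^m = 1, every power a^k in one of the legs has its k in I. As I is
      closed under addition and under congruence modulo N and contains \<nu>, the powers with
      exponent in I together with x and w generate everything; the generated algebra would miss
      \<open>a\<close> if 1 were not in I.\<close>
    define I where "I = {k. \<alpha> ^ (k * m) = 1}"
    have \<alpha>N: "\<alpha> ^ N = 1" by (rule eig_order[OF pb(3) hp.x_nz])
    have \<nu>I: "\<nu> \<in> I" using aA[of \<nu>] g_AA by (simp add: I_def g_def)
    have I: "0 \<in> I" "\<And>i j. i \<in> I \<Longrightarrow> j \<in> I \<Longrightarrow> i + j \<in> I"
      by (auto simp: I_def power_add distrib_right)
    have congI: "i \<in> I" if "j \<in> I" "[i = j] (mod N)" for i j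
    proof -
      have red: "\<alpha> ^ (i mod N * m) = \<alpha> ^ (i * m)" for i
      proof -
        have "\<alpha> ^ (i * m) = \<alpha> ^ ((N * (i div N) + i mod N) * m)" by simp
        also have "\<dots> = (\<alpha> ^ N) ^ (i div N * m) * \<alpha> ^ (i mod N * m)"
          by (simp only: distrib_right power_add mult.assoc power_mult)
        finally show ?thesis using \<alpha>N by simp
      qed
      show ?thesis using that red[of i] red[of j] by (simp add: I_def cong_def)
    qed
    let ?G = "{a ^ i | i. i \<in> I} \<union> {x, w}"
    have mono: "gn (hp.gens X) \<subseteq> gn ?G" if "\<And>k. a ^ k \<in> X \<Longrightarrow> k \<in> I" for X
      by (rule gn_subset[OF gn_subspace gn_one]) (use that in \<open>auto simp: hp.gens_def intro!: gn_gen\<close>)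
    have "C \<subseteq> gn ?G"
    proof (rule minimal_gn)
      show "?G \<subseteq> C" using sp_C[OF pb(1)] sp_C[OF pb(2)] a_pow_C by auto
      show "g \<in> gn ?G" unfolding g_def using \<nu>I by (intro gn_base) blast
      show "AA \<subseteq> gn ?G" "BB \<subseteq> gn ?G" using gA gB mono[of AA] mono[of BB] aA aB by (auto simp: I_def)
      show "(gl s \<and> (\<exists>s'\<in>gn ?G. s * s' = 1)) \<or> sp g s" if s: "s \<in> ?G" for s
      proof (cases "s = x \<or> s = w")
        case False
        then obtain i where i: "s = a ^ i" "i \<in> I" using s by blast
        have "N - i mod N \<in> I"
        proof -
          have "i mod N \<in> I" using congI[OF i(2), of "i mod N"] by (simp add: cong_def)
          moreover have "\<alpha> ^ ((N - i mod N) * m) * \<alpha> ^ (i mod N * m) = 1"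
          proof -
            have "(N - i mod N) * m + i mod N * m = N * m"
              using N_pos by (simp add: less_imp_le flip: distrib_right)
            then show ?thesis using \<alpha>N by (metis power_add power_mult power_one)
          qed
          ultimately show ?thesis by (simp add: I_def)
        qed
        then have "a ^ (N - i mod N) \<in> gn ?G" by (intro gn_base) blast
        then show ?thesis using i a_pow_gl a_inv(2) by blast
      qed (use pb in auto)
    qed
    then have "a \<in> hp.M I" using hp.gn_M[of I] I \<nu>I gl_C[OF a_gl] by blast
    then obtain i where "i \<in> I" "[i = 1] (mod N)" using hp.a_notin_M[of I] by blast
    then have "1 \<in> I" using congI[of i 1] by (simp add: cong_sym)
    then show "\<alpha> ^ m = 1" by (simp add: I_def)
  qed
  \<comment> \<open>The r-th power is a multiple of g^r - 1, so it commutes with \<open>a\<close>.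
    On the other hand moving \<open>a\<close> past it produces c^r, which is not 1 unless g^r =
    1.\<close>
  have nil: "z ^ ordk (\<alpha> ^ \<nu>) = 0"
    if z: "eig c z" "z ^ ordk (\<alpha> ^ \<nu>) = d *s (g ^ ordk (\<alpha> ^ \<nu>) - 1)" and c: "c = \<alpha> \<or> c = inverse \<alpha>" for z c d
  proof (cases "g ^ ordk (\<alpha> ^ \<nu>) = 1")
    case True then show ?thesis using z by simp
  next
    case False
    let ?r = "ordk (\<alpha> ^ \<nu>)"
    have ne: "c ^ ?r \<noteq> 1" using False ord[of ?r] c by (auto simp: power_inverse)
    have "z * a = c *s (a * z)" using z(1) by (simp add: eig_def)
    then have "z ^ ?r * a = c ^ ?r *s (a * z ^ ?r)" by (rule qcomm_pow_left)
    moreover have "z ^ ?r * a = a * z ^ ?r"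
      unfolding z(2) by (simp add: smult_simps algebra_simps g_power power_commutes)
    ultimately have "(c ^ ?r - 1) *s (a * z ^ ?r) = 0" by (simp add: scale_left_diff_distrib)
    then have "a * z ^ ?r = 0" using ne by simp
    then show ?thesis using a_pow_cancel[of 1 "z ^ ?r" 0] by simp
  qed
  show ?thesis
  proof (rule that[OF _ rel ord])
    show "hopf_pair scale C dl eps S a N \<nu> x y \<alpha> (inverse \<alpha>)"
      using hq.hopf_pair_axioms unfolding g_def .
    show "x ^ ordk (\<alpha> ^ \<nu>) = 0" using nil[OF hq.eig_x] hq.x_r by blast
    show "y ^ ordk (\<alpha> ^ \<nu>) = 0" using nil[OF hq.eig_y] hq.y_r by blast
  qed
qed

end

section \<open>Finitely supported functions as free vector spaces\<close>

abbreviation "pkeys \<equiv> Poly_Mapping.keys"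
abbreviation "plookup \<equiv> Poly_Mapping.lookup"
abbreviation "psingle \<equiv> Poly_Mapping.single"

text \<open>The coefficient is handed to h instead of being multiplied in, so one definition serves
  scalar evaluation and the product of a monoid algebra.\<close>

definition pext :: "('p \<Rightarrow> 'k \<Rightarrow> 'c) \<Rightarrow> ('p \<Rightarrow>\<^sub>0 'k::zero) \<Rightarrow> 'c::comm_monoid_add" where
  "pext h f = (\<Sum>p\<in>pkeys f. h p (plookup f p))"

abbreviation pscale :: "'k::field \<Rightarrow> ('p \<Rightarrow>\<^sub>0 'k) \<Rightarrow> ('p \<Rightarrow>\<^sub>0 'k)" where
  "pscale c \<equiv> Poly_Mapping.map ((*) c)"

lemma plookup_pscale [simp]: "plookup (pscale c f) k = c * plookup f k"
  by (simp add: Poly_Mapping.map.rep_eq when_def)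

lemma pscale_single [simp]: "pscale c (psingle k d) = psingle k (c * d)"
  by (rule poly_mapping_eqI) (simp add: Poly_Mapping.lookup_single when_def)

lemma pscale_vspace: "vspace (pscale :: 'k::field \<Rightarrow> ('p \<Rightarrow>\<^sub>0 'k) \<Rightarrow> _)"
  by unfold_locales (auto intro!: poly_mapping_eqI simp: lookup_add algebra_simps)

interpretation pv: vspace "pscale :: 'k::field \<Rightarrow> ('p \<Rightarrow>\<^sub>0 'k) \<Rightarrow> _"
  by (rule pscale_vspace)

lemma pkeys_pscale: "pkeys (pscale c f) \<subseteq> pkeys f"
  by (auto simp: Poly_Mapping.in_keys_iff)

lemma pkeys_diff: "pkeys f \<subseteq> S \<Longrightarrow> pkeys g \<subseteq> S \<Longrightarrow> pkeys (f - g) \<subseteq> S"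
  and pkeys_add: "pkeys f \<subseteq> S \<Longrightarrow> pkeys g \<subseteq> S \<Longrightarrow> pkeys (f + g) \<subseteq> S"
  and pkeys_uminus: "pkeys (- (f :: _ \<Rightarrow>\<^sub>0 'k::field)) = pkeys f"
  for f g :: "'p \<Rightarrow>\<^sub>0 'k::field"
  using Poly_Mapping.keys_diff[of f g] Poly_Mapping.keys_add[of f g]
  by (auto simp: Poly_Mapping.in_keys_iff)

lemma pkeys_single: "k \<in> S \<Longrightarrow> pkeys (psingle k c) \<subseteq> S"
  by (auto simp: Poly_Mapping.in_keys_iff Poly_Mapping.lookup_single when_def)

lemma pm_eq_sum: "f = (\<Sum>k\<in>pkeys f. psingle k (plookup f k))" for f :: "'p \<Rightarrow>\<^sub>0 'k::field"
proof (rule poly_mapping_eqI)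
  fix k
  have "(\<Sum>x\<in>pkeys f. plookup f x when x = k) = plookup f k"
    by (cases "k \<in> pkeys f") (auto simp: when_def Poly_Mapping.in_keys_iff)
  then show "plookup f k = plookup (\<Sum>k\<in>pkeys f. psingle k (plookup f k)) k"
    by (simp add: Poly_Mapping.lookup_sum Poly_Mapping.lookup_single)
qed

lemma pm_induct [consumes 1, case_names zero add]:
  fixes f :: "'p \<Rightarrow>\<^sub>0 'k::field"
  assumes f: "pkeys f \<subseteq> S" and 0: "P 0"
    and step: "\<And>k c f. k \<in> S \<Longrightarrow> pkeys f \<subseteq> S \<Longrightarrow> P f \<Longrightarrow> P (psingle k c + f)"
  shows "P f"
proof -
  have "pkeys (\<Sum>k\<in>K. psingle k (plookup f k)) \<subseteq> S \<and> P (\<Sum>k\<in>K. psingle k (plookup f k))"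
    if "K \<subseteq> pkeys f" for K
    using finite_subset[OF that Poly_Mapping.finite_keys] that
  proof (induction K)
    case (insert k K)
    have kS: "k \<in> S" using insert f by auto
    have IH: "pkeys (\<Sum>k\<in>K. psingle k (plookup f k)) \<subseteq> S" "P (\<Sum>k\<in>K. psingle k (plookup f k))"
      using insert by auto
    show ?case
      using step[OF kS IH] pkeys_add[OF pkeys_single[OF kS] IH(1)] insert(1,2) by simp
  qed (use 0 in simp)
  from this[OF subset_refl] show ?thesis using pm_eq_sum[of f] by simp
qed

lemma pext_superset:
  assumes "finite P" "pkeys f \<subseteq> P" "\<And>p. h p 0 = 0"
  shows "pext h f = (\<Sum>p\<in>P. h p (plookup f p))"
  unfolding pext_def
  by (rule sum.mono_neutral_left[OF assms(1,2)]) (auto simp: assms(3) Poly_Mapping.in_keys_iff)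

lemma pext_add:
  fixes f g :: "'p \<Rightarrow>\<^sub>0 'k::field"
  assumes "\<And>p. h p 0 = 0" "\<And>p c d. h p (c + d) = h p c + h p d"
  shows "pext h (f + g) = pext h f + pext h g"
proof -
  let ?P = "pkeys f \<union> pkeys g"
  have "pext h (f + g) = (\<Sum>p\<in>?P. h p (plookup (f + g) p))"
    by (rule pext_superset) (auto simp: assms(1) Poly_Mapping.in_keys_iff lookup_add)
  moreover have "pext h f = (\<Sum>p\<in>?P. h p (plookup f p))" "pext h g = (\<Sum>p\<in>?P. h p (plookup g p))"
    by (rule pext_superset; simp add: assms(1))+
  ultimately show ?thesis by (simp add: lookup_add assms(2) sum.distrib)
qed

lemma pext_zero [simp]: "pext h 0 = 0"
  by (simp add: pext_def)

lemma pext_single: "h p 0 = 0 \<Longrightarrow> pext h (psingle p c) = h p c"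
  by (simp add: pext_def)

lemma pext_cong: "(\<And>p c. p \<in> pkeys f \<Longrightarrow> h p c = h' p c) \<Longrightarrow> pext h f = pext h' f"
  by (simp add: pext_def)

definition ev :: "('p \<Rightarrow> 'k) \<Rightarrow> ('p \<Rightarrow>\<^sub>0 'k::field) \<Rightarrow> 'k" where
  "ev \<beta> = pext (\<lambda>p c. c * \<beta> p)"

lemma ev_add: "ev \<beta> (f + g) = ev \<beta> f + ev \<beta> g"
  unfolding ev_def by (rule pext_add) (auto simp: algebra_simps)

lemma ev_single [simp]: "ev \<beta> (psingle p c) = c * \<beta> p"
  unfolding ev_def by (rule pext_single) simp

lemma ev_zero [simp]: "ev \<beta> 0 = 0"
  by (simp add: ev_def)

lemma ev_diff: "ev \<beta> (f - g) = ev \<beta> f - ev \<beta> g"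
  using ev_add[of \<beta> "f - g" g] by simp

lemma ev_pscale: "ev \<beta> (pscale c f) = c * ev \<beta> f"
proof -
  have "pkeys f \<subseteq> UNIV" by simp
  then show ?thesis
    by (induction f rule: pm_induct) (simp_all add: ev_add pv.scale_right_distrib distrib_left mult.assoc)
qed

lemma ev_cong: "(\<And>p. p \<in> pkeys f \<Longrightarrow> \<beta> p = \<beta>' p) \<Longrightarrow> ev \<beta> f = ev \<beta>' f"
  unfolding ev_def by (rule pext_cong) simp

section \<open>Algebras in record form and their linear functionals\<close>

lemma k_algebraI:
  fixes A :: "('k::field, 'a, 'm) module_scheme"
  assumes "ring A"
    and "\<And>c x. x \<in> carrier A \<Longrightarrow> c \<odot>\<^bsub>A\<^esub> x \<in> carrier A"
    and "\<And>c d x. x \<in> carrier A \<Longrightarrow> (c + d) \<odot>\<^bsub>A\<^esub> x = (c \<odot>\<^bsub>A\<^esub> x) \<oplus>\<^bsub>A\<^esub> (d \<odot>\<^bsub>A\<^esub> x)"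
    and "\<And>c x y. x \<in> carrier A \<Longrightarrow> y \<in> carrier A \<Longrightarrow> c \<odot>\<^bsub>A\<^esub> (x \<oplus>\<^bsub>A\<^esub> y) = (c \<odot>\<^bsub>A\<^esub> x) \<oplus>\<^bsub>A\<^esub> (c \<odot>\<^bsub>A\<^esub> y)"
    and "\<And>c d x. x \<in> carrier A \<Longrightarrow> (c * d) \<odot>\<^bsub>A\<^esub> x = c \<odot>\<^bsub>A\<^esub> (d \<odot>\<^bsub>A\<^esub> x)"
    and "\<And>x. x \<in> carrier A \<Longrightarrow> 1 \<odot>\<^bsub>A\<^esub> x = x"
    and "\<And>c x y. x \<in> carrier A \<Longrightarrow> y \<in> carrier A \<Longrightarrow> c \<odot>\<^bsub>A\<^esub> (x \<otimes>\<^bsub>A\<^esub> y) = (c \<odot>\<^bsub>A\<^esub> x) \<otimes>\<^bsub>A\<^esub> y"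
    and "\<And>c x y. x \<in> carrier A \<Longrightarrow> y \<in> carrier A \<Longrightarrow> c \<odot>\<^bsub>A\<^esub> (x \<otimes>\<^bsub>A\<^esub> y) = x \<otimes>\<^bsub>A\<^esub> (c \<odot>\<^bsub>A\<^esub> y)"
  shows "k_algebra A"
proof -
  have "Module.module (class_ring :: 'k ring) A"
    by (rule moduleI) (use assms class_cring.cring_axioms ring.is_abelian_group in \<open>auto\<close>)
  then show ?thesis
    unfolding k_algebra_def vectorspace_def using assms(1,7,8) class_field by blast
qed

locale kalgebra =
  fixes A :: "('k::field, 'a, 'm) module_scheme" (structure)
  assumes kA: "k_algebra A"

sublocale kalgebra \<subseteq> ring A
  using kA by (simp add: k_algebra_def)

context kalgebra begin

lemma vs: "vectorspace class_ring A"
  using kA by (simp add: k_algebra_def)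

lemma mdl: "Module.module (class_ring :: 'k ring) A"
  using vs by (simp add: vectorspace_def)

lemma sc_closed [simp, intro]: "x \<in> carrier A \<Longrightarrow> c \<odot> x \<in> carrier A"
  and sc_add_l: "x \<in> carrier A \<Longrightarrow> (c + d) \<odot> x = c \<odot> x \<oplus> d \<odot> x"
  and sc_add_r: "x \<in> carrier A \<Longrightarrow> y \<in> carrier A \<Longrightarrow> c \<odot> (x \<oplus> y) = c \<odot> x \<oplus> c \<odot> y"
  and sc_assoc: "x \<in> carrier A \<Longrightarrow> (c * d) \<odot> x = c \<odot> (d \<odot> x)"
  and sc_one [simp]: "x \<in> carrier A \<Longrightarrow> 1 \<odot> x = x"
  and sc_zero_l [simp]: "x \<in> carrier A \<Longrightarrow> 0 \<odot> x = \<zero>"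
  and sc_zero_r [simp]: "c \<odot> \<zero> = \<zero>"
  using Module.module.smult_closed[OF mdl, of c x] Module.module.smult_l_distr[OF mdl, of c d x]
    Module.module.smult_r_distr[OF mdl, of c x y] Module.module.smult_assoc1[OF mdl, of c d x]
    Module.module.smult_one[OF mdl, of x] Module.module.smult_l_null[OF mdl, of x]
    Module.module.smult_r_null[OF mdl, of c]
  by simp_all

lemma sc_mult_l: "x \<in> carrier A \<Longrightarrow> y \<in> carrier A \<Longrightarrow> (c \<odot> x) \<otimes> y = c \<odot> (x \<otimes> y)"
  and sc_mult_r: "x \<in> carrier A \<Longrightarrow> y \<in> carrier A \<Longrightarrow> x \<otimes> (c \<odot> y) = c \<odot> (x \<otimes> y)"
proof -
  assume "x \<in> carrier A" "y \<in> carrier A"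
  then have "c \<odot> (x \<otimes> y) = c \<odot> x \<otimes> y \<and> c \<odot> (x \<otimes> y) = x \<otimes> (c \<odot> y)"
    using kA unfolding k_algebra_def by blast
  then show "(c \<odot> x) \<otimes> y = c \<odot> (x \<otimes> y)" "x \<otimes> (c \<odot> y) = c \<odot> (x \<otimes> y)" by metis+
qed

lemma sc_neg: "x \<in> carrier A \<Longrightarrow> (- 1) \<odot> x = \<ominus> x"
proof -
  assume x: "x \<in> carrier A"
  have "(- 1) \<odot> x \<oplus> x = \<zero>" using sc_add_l[OF x, of "- 1" 1] x by simp
  then show ?thesis using x by (metis minus_equality sc_closed)
qed

lemma submoduleI:
  assumes "N \<subseteq> carrier A" "\<zero> \<in> N" "\<And>x y. x \<in> N \<Longrightarrow> y \<in> N \<Longrightarrow> x \<oplus> y \<in> N" "\<And>c x. x \<in> N \<Longrightarrow> c \<odot> x \<in> N"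
  shows "submodule class_ring N A"
  unfolding submodule_def using assms mdl by simp

lemma lin_span_induct [consumes 2, case_names zero add scale base]:
  assumes "x \<in> lin_span A S" "S \<subseteq> carrier A"
    and "P \<zero>" "\<And>x y. x \<in> carrier A \<Longrightarrow> y \<in> carrier A \<Longrightarrow> P x \<Longrightarrow> P y \<Longrightarrow> P (x \<oplus> y)"
    "\<And>c x. x \<in> carrier A \<Longrightarrow> P x \<Longrightarrow> P (c \<odot> x)" "\<And>x. x \<in> S \<Longrightarrow> P x"
  shows "P x"
proof -
  have "lin_span A S \<subseteq> {x \<in> carrier A. P x}"
    by (rule LinearCombinations.module.span_is_subset[OF mdl _ submoduleI]) (use assms in auto)
  then show ?thesis using assms(1) by blast
qed

lemma lin_span_submodule: "S \<subseteq> carrier A \<Longrightarrow> submodule class_ring (lin_span A S) A"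
  by (rule LinearCombinations.module.span_is_submodule[OF mdl])

lemma lin_span_closed:
  assumes "S \<subseteq> carrier A"
  shows "lin_span A S \<subseteq> carrier A" "\<zero> \<in> lin_span A S"
    "x \<in> lin_span A S \<Longrightarrow> y \<in> lin_span A S \<Longrightarrow> x \<oplus> y \<in> lin_span A S"
    "x \<in> lin_span A S \<Longrightarrow> c \<odot> x \<in> lin_span A S" "S \<subseteq> lin_span A S"
  using lin_span_submodule[OF assms] LinearCombinations.module.in_own_span[OF mdl assms]
  by (auto simp: submodule_def)

definition lin :: "('a \<Rightarrow> 'k) \<Rightarrow> bool" where
  "lin \<phi> \<longleftrightarrow> (\<forall>x\<in>carrier A. \<forall>y\<in>carrier A. \<phi> (x \<oplus> y) = \<phi> x + \<phi> y) \<and> (\<forall>c. \<forall>x\<in>carrier A. \<phi> (c \<odot> x) = c * \<phi> x)"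

lemma lin_zero: "lin \<phi> \<Longrightarrow> \<phi> \<zero> = 0"
  unfolding lin_def by (metis sc_zero_l zero_closed mult_zero_left)

lemma lin_finsum: "lin \<phi> \<Longrightarrow> g \<in> K \<rightarrow> carrier A \<Longrightarrow> \<phi> (\<Oplus>p\<in>K. g p) = (\<Sum>p\<in>K. \<phi> (g p))"
proof (induction K rule: infinite_finite_induct)
  case (insert p K)
  have g: "g p \<in> carrier A" "g \<in> K \<rightarrow> carrier A" using insert.prems(2) by (simp_all add: Pi_def)
  then have "\<phi> (g p \<oplus> (\<Oplus>p\<in>K. g p)) = \<phi> (g p) + \<phi> (\<Oplus>p\<in>K. g p)"
    using insert.prems(1) finsum_closed[OF g(2)] unfolding lin_def by blast
  then show ?case using insert g by simp
qed (auto simp: lin_zero)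

lemma lin_ext_closed [intro]: "b \<in> pkeys f \<rightarrow> carrier A \<Longrightarrow> lin_ext A b f \<in> carrier A"
  unfolding lin_ext_def by (rule finsum_closed) auto

lemma lin_lin_ext:
  assumes "lin \<phi>" "b \<in> pkeys f \<rightarrow> carrier A"
  shows "\<phi> (lin_ext A b f) = ev (\<lambda>p. \<phi> (b p)) f"
proof -
  have "\<phi> (lin_ext A b f) = (\<Sum>p\<in>pkeys f. \<phi> (plookup f p \<odot> b p))"
    unfolding lin_ext_def by (rule lin_finsum) (use assms in auto)
  also have "\<dots> = ev (\<lambda>p. \<phi> (b p)) f" unfolding ev_def pext_def
    by (rule sum.cong) (use assms in \<open>auto simp: lin_def Pi_iff\<close>)
  finally show ?thesis .
qed

lemma lin_ext_superset:
  assumes "finite P" "pkeys f \<subseteq> P" "b \<in> P \<rightarrow> carrier A"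
  shows "lin_ext A b f = (\<Oplus>p\<in>P. plookup f p \<odot> b p)"
  unfolding lin_ext_def
  by (rule add.finprod_mono_neutral_cong_left[OF assms(1,2)])
     (use assms in \<open>auto simp: Poly_Mapping.in_keys_iff Pi_iff\<close>)

lemma lin_ext_zero [simp]: "lin_ext A b 0 = \<zero>"
  by (simp add: lin_ext_def)

lemma lin_ext_single: "b p \<in> carrier A \<Longrightarrow> lin_ext A b (psingle p c) = c \<odot> b p"
  using lin_ext_superset[of "{p}" "psingle p c" b] by simp

lemma lin_ext_add:
  assumes "b \<in> pkeys f \<rightarrow> carrier A" "b \<in> pkeys g \<rightarrow> carrier A"
  shows "lin_ext A b (f + g) = lin_ext A b f \<oplus> lin_ext A b g"
proof -
  let ?P = "pkeys f \<union> pkeys g"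
  have b: "b \<in> ?P \<rightarrow> carrier A" using assms by auto
  have "lin_ext A b (f + g) = (\<Oplus>p\<in>?P. plookup (f + g) p \<odot> b p)"
    by (rule lin_ext_superset[OF _ _ b]) (auto simp: Poly_Mapping.in_keys_iff lookup_add)
  also have "\<dots> = (\<Oplus>p\<in>?P. plookup f p \<odot> b p \<oplus> plookup g p \<odot> b p)"
    by (rule add.finprod_cong') (use b in \<open>auto simp: lookup_add sc_add_l Pi_iff\<close>)
  also have "\<dots> = (\<Oplus>p\<in>?P. plookup f p \<odot> b p) \<oplus> (\<Oplus>p\<in>?P. plookup g p \<odot> b p)"
    by (rule add.finprod_multf) (use b in auto)
  also have "\<dots> = lin_ext A b f \<oplus> lin_ext A b g"
    using lin_ext_superset[of ?P f b] lin_ext_superset[of ?P g b] b by simp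
  finally show ?thesis .
qed

lemma lin_ext_scale:
  assumes "b \<in> pkeys f \<rightarrow> carrier A"
  shows "lin_ext A b (pscale c f) = c \<odot> lin_ext A b f"
proof -
  have "pkeys f \<subseteq> {p. b p \<in> carrier A}" using assms by auto
  then show ?thesis using assms
  proof (induction f rule: pm_induct)
    case (add k d f)
    have b: "b \<in> pkeys (psingle k e) \<rightarrow> carrier A" "b \<in> pkeys f \<rightarrow> carrier A" "b \<in> pkeys (pscale c f) \<rightarrow> carrier A" for e
      using add pkeys_pscale[of c f] by (auto simp: Poly_Mapping.in_keys_iff Poly_Mapping.lookup_single when_def)
    have k: "b k \<in> carrier A" using add by simp
    show ?case
      unfolding pv.scale_right_distrib pscale_single lin_ext_add[OF b(1,2)] lin_ext_add[OF b(1,3)]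
        lin_ext_single[where b = b and p = k, OF k] add(3)[OF b(2)] using b(2) k by (simp add: sc_add_r sc_assoc lin_ext_closed)
  qed simp
qed

end

section \<open>Monoid algebras and quotient algebras\<close>

lemma ma_sel:
  "carrier (monoid_algebra M) = {f. pkeys f \<subseteq> carrier M}"
  "\<one>\<^bsub>monoid_algebra M\<^esub> = psingle \<one>\<^bsub>M\<^esub> 1"
  "\<zero>\<^bsub>monoid_algebra M\<^esub> = 0"
  "f \<oplus>\<^bsub>monoid_algebra M\<^esub> g = f + g"
  "c \<odot>\<^bsub>monoid_algebra M\<^esub> f = pscale c f"
  by (simp_all add: monoid_algebra_def)

abbreviation "MAlg \<equiv> monoid_algebra"

lemma ma_mult:
  "f \<otimes>\<^bsub>MAlg M\<^esub> g = pext (\<lambda>p c. pext (\<lambda>q d. psingle (p \<otimes>\<^bsub>M\<^esub> q) (c * d)) g) f"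
  by (simp add: monoid_algebra_def pext_def)

lemma ma_add_mult:
  fixes f g h :: "'a \<Rightarrow>\<^sub>0 'k::field"
  shows "f \<otimes>\<^bsub>MAlg M\<^esub> (g + h) = f \<otimes>\<^bsub>MAlg M\<^esub> g + f \<otimes>\<^bsub>MAlg M\<^esub> h"
    "(f + g) \<otimes>\<^bsub>MAlg M\<^esub> h = f \<otimes>\<^bsub>MAlg M\<^esub> h + g \<otimes>\<^bsub>MAlg M\<^esub> h"
proof -
  have 0: "pext (\<lambda>q d. psingle (p \<otimes>\<^bsub>M\<^esub> q) (c * d)) (g + h)
    = pext (\<lambda>q d. psingle (p \<otimes>\<^bsub>M\<^esub> q) (c * d)) g + pext (\<lambda>q d. psingle (p \<otimes>\<^bsub>M\<^esub> q) (c * d)) h"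
    for p c and g h :: "'a \<Rightarrow>\<^sub>0 'k"
    by (rule pext_add) (auto simp: distrib_left Poly_Mapping.single_add)
  show "f \<otimes>\<^bsub>MAlg M\<^esub> (g + h) = f \<otimes>\<^bsub>MAlg M\<^esub> g + f \<otimes>\<^bsub>MAlg M\<^esub> h"
    unfolding ma_mult 0 by (simp add: pext_def sum.distrib)
  show "(f + g) \<otimes>\<^bsub>MAlg M\<^esub> h = f \<otimes>\<^bsub>MAlg M\<^esub> h + g \<otimes>\<^bsub>MAlg M\<^esub> h"
    unfolding ma_mult
    by (rule pext_add) (auto simp: pext_def distrib_right Poly_Mapping.single_add sum.distrib)
qed

lemma ma_zero_mult [simp]:
  "f \<otimes>\<^bsub>MAlg M\<^esub> (0 :: 'a \<Rightarrow>\<^sub>0 'k::field) = 0" "0 \<otimes>\<^bsub>MAlg M\<^esub> (f :: 'a \<Rightarrow>\<^sub>0 'k::field) = 0"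
  by (simp_all add: ma_mult pext_def)

lemma ma_single_mult [simp]:
  "psingle p c \<otimes>\<^bsub>MAlg M\<^esub> psingle q d = psingle (p \<otimes>\<^bsub>M\<^esub> q) (c * d :: 'k::field)"
  by (simp add: ma_mult pext_single)

lemma ma_scale_mult:
  fixes f g :: "'a \<Rightarrow>\<^sub>0 'k::field"
  shows "pscale c f \<otimes>\<^bsub>MAlg M\<^esub> g = pscale c (f \<otimes>\<^bsub>MAlg M\<^esub> g)"
    "f \<otimes>\<^bsub>MAlg M\<^esub> pscale c g = pscale c (f \<otimes>\<^bsub>MAlg M\<^esub> g)"
proof -
  have fg: "pkeys f \<subseteq> UNIV" "pkeys g \<subseteq> UNIV" by simp_all
  have 1: "pscale c (psingle p d) \<otimes>\<^bsub>MAlg M\<^esub> g = pscale c (psingle p d \<otimes>\<^bsub>MAlg M\<^esub> g)"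
     and 2: "psingle p d \<otimes>\<^bsub>MAlg M\<^esub> pscale c g = pscale c (psingle p d \<otimes>\<^bsub>MAlg M\<^esub> g)" for p d
    using fg(2) by (induction g rule: pm_induct)
      (simp_all add: ma_add_mult pv.scale_right_distrib mult_ac)
  have 1: "psingle p (c * d) \<otimes>\<^bsub>MAlg M\<^esub> g = pscale c (psingle p d \<otimes>\<^bsub>MAlg M\<^esub> g)" for p d
    using 1[of p d] by simp
  show "pscale c f \<otimes>\<^bsub>MAlg M\<^esub> g = pscale c (f \<otimes>\<^bsub>MAlg M\<^esub> g)"
    using fg(1) by (induction f rule: pm_induct)
      (simp_all add: ma_add_mult pv.scale_right_distrib 1)
  show "f \<otimes>\<^bsub>MAlg M\<^esub> pscale c g = pscale c (f \<otimes>\<^bsub>MAlg M\<^esub> g)"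
    using fg(1) by (induction f rule: pm_induct)
      (simp_all add: ma_add_mult pv.scale_right_distrib 2 del: pscale_single)
qed

lemma k_algebra_monoid_algebra:
  assumes "Group.monoid M"
  shows "k_algebra (monoid_algebra M :: ('k::field, 'a \<Rightarrow>\<^sub>0 'k) module)"
proof -
  interpret Group.monoid M by fact
  let ?A = "monoid_algebra M :: ('k, 'a \<Rightarrow>\<^sub>0 'k) module"
  have closed: "pkeys (f \<otimes>\<^bsub>?A\<^esub> g) \<subseteq> carrier M" if fg: "pkeys f \<subseteq> carrier M" "pkeys g \<subseteq> carrier M" for f g
  proof -
    have 1: "pkeys (psingle p d \<otimes>\<^bsub>?A\<^esub> g) \<subseteq> carrier M" if "p \<in> carrier M" for p d
      using fg(2)
    proof (induction g rule: pm_induct)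
      case (add k c f)
      then show ?case unfolding ma_add_mult ma_single_mult
        by (intro pkeys_add pkeys_single m_closed that)
    qed simp
    show ?thesis using fg(1)
    proof (induction f rule: pm_induct)
      case (add k c f)
      then show ?case unfolding ma_add_mult by (intro pkeys_add 1)
    qed simp
  qed
  have assoc: "(f \<otimes>\<^bsub>?A\<^esub> g) \<otimes>\<^bsub>?A\<^esub> h = f \<otimes>\<^bsub>?A\<^esub> (g \<otimes>\<^bsub>?A\<^esub> h)"
    if f: "pkeys f \<subseteq> carrier M" and g: "pkeys g \<subseteq> carrier M" and h: "pkeys h \<subseteq> carrier M" for f g h
  proof -
    have 1: "(psingle p c \<otimes>\<^bsub>?A\<^esub> psingle q d) \<otimes>\<^bsub>?A\<^esub> h = psingle p c \<otimes>\<^bsub>?A\<^esub> (psingle q d \<otimes>\<^bsub>?A\<^esub> h)"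
      if "p \<in> carrier M" "q \<in> carrier M" for p q c d
      using h by (induction h rule: pm_induct)
        (auto simp: ma_add_mult that m_assoc mult.assoc)
    have 2: "(psingle p c \<otimes>\<^bsub>?A\<^esub> g) \<otimes>\<^bsub>?A\<^esub> h = psingle p c \<otimes>\<^bsub>?A\<^esub> (g \<otimes>\<^bsub>?A\<^esub> h)"
      if "p \<in> carrier M" for p c
      using g by (induction g rule: pm_induct)
        (auto simp: ma_add_mult that 1 simp del: ma_single_mult)
    show ?thesis using f by (induction f rule: pm_induct) (auto simp: ma_add_mult 2)
  qed
  have one: "psingle \<one>\<^bsub>M\<^esub> 1 \<otimes>\<^bsub>?A\<^esub> f = f" "f \<otimes>\<^bsub>?A\<^esub> psingle \<one>\<^bsub>M\<^esub> 1 = f" if "pkeys f \<subseteq> carrier M" for f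
    using that by (induction f rule: pm_induct) (auto simp: ma_add_mult)
  have "ring ?A"
  proof (rule ringI)
    show "abelian_group ?A"
    proof (rule abelian_groupI)
      fix x assume "x \<in> carrier ?A"
      then show "\<exists>y\<in>carrier ?A. y \<oplus>\<^bsub>?A\<^esub> x = \<zero>\<^bsub>?A\<^esub>"
        by (intro bexI[of _ "- x"]) (auto simp: ma_sel pkeys_uminus)
    qed (auto simp: ma_sel add_ac intro: subsetD[OF pkeys_add])
    show "Group.monoid ?A"
      by (rule Group.monoidI) (auto simp: ma_sel assoc one simp del: Poly_Mapping.keys_single
          intro: subsetD[OF closed] subsetD[OF pkeys_single])
  qed (auto simp: ma_sel ma_add_mult)
  then show ?thesis
    by (rule k_algebraI)
       (auto simp: ma_sel ma_scale_mult pv.scale_left_distrib pv.scale_right_distrib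
         intro: subsetD[OF order_trans[OF pkeys_pscale]])
qed

text \<open>The quotient algebra and the factor ring are records of different shape with the same
  operations; the ring laws are carried over field by field.\<close>

lemma ring_cong_sel:
  assumes "ring R" "carrier R = carrier S" "mult R = mult S" "one R = one S" "zero R = zero S" "add R = add S"
  shows "ring S"
proof -
  interpret ring R by fact
  have C: "carrier S = carrier R" "\<And>x y. x \<otimes>\<^bsub>S\<^esub> y = x \<otimes>\<^bsub>R\<^esub> y" "\<one>\<^bsub>S\<^esub> = \<one>\<^bsub>R\<^esub>" "\<zero>\<^bsub>S\<^esub> = \<zero>\<^bsub>R\<^esub>"
    "\<And>x y. x \<oplus>\<^bsub>S\<^esub> y = x \<oplus>\<^bsub>R\<^esub> y" using assms by simp_all
  show ?thesis
  proof (rule ringI)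
    show "abelian_group S"
      by (rule abelian_groupI) (auto simp: C a_ac intro!: bexI[of _ "\<ominus>\<^bsub>R\<^esub> _"] l_neg)
    show "Group.monoid S" by (rule Group.monoidI) (auto simp: C m_assoc)
  qed (auto simp: C l_distr r_distr)
qed

locale kquotient = kalgebra A + ideal I A for A :: "('k::field, 'a, 'm) module_scheme" (structure) and I
begin

abbreviation "Q \<equiv> quotient_algebra A I"
abbreviation "cls \<equiv> (+>) I"

text \<open>As c x = (c 1) x in a unital algebra, a ring ideal is automatically a subspace.\<close>

lemma ideal_scale: "x \<in> I \<Longrightarrow> c \<odot> x \<in> I"
  using I_l_closed[of x "c \<odot> \<one>"] a_subset by (auto simp: sc_mult_l)

lemma asub: "abelian_subgroup I A"
  by (rule abelian_subgroupI3[OF is_additive_subgroup is_abelian_group])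

lemma cls_self: "x \<in> carrier A \<Longrightarrow> x \<in> cls x"
  by (rule abelian_subgroup.a_rcos_self[OF asub])

lemma in_cls: "x \<in> carrier A \<Longrightarrow> y \<in> cls x \<longleftrightarrow> y \<in> carrier A \<and> cls y = cls x"
  using cls_self[of y] abelian_subgroup.a_elemrcos_carrier[OF asub, of x y]
    a_repr_independence'[of y x] by metis

lemma cls_eq: "x \<in> carrier A \<Longrightarrow> y \<in> carrier A \<Longrightarrow> cls x = cls y \<longleftrightarrow> x \<ominus> y \<in> I"
  using in_cls[of y x] abelian_subgroup.a_rcos_module[OF asub, of y x] by (simp add: minus_eq)

lemma Q_sel: "carrier Q = cls ` carrier A" "\<one>\<^bsub>Q\<^esub> = cls \<one>" "\<zero>\<^bsub>Q\<^esub> = cls \<zero>"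
proof -
  have "cls \<zero> = I" using abelian_subgroup.a_rcos_const[OF asub additive_subgroup.zero_closed[OF is_additive_subgroup]] .
  then show "carrier Q = cls ` carrier A" "\<one>\<^bsub>Q\<^esub> = cls \<one>" "\<zero>\<^bsub>Q\<^esub> = cls \<zero>"
    by (auto simp: quotient_algebra_def FactRing_def A_RCOSETS_defs a_r_coset_def)
qed

lemma Q_ops:
  assumes "x \<in> carrier A" "y \<in> carrier A"
  shows "cls x \<otimes>\<^bsub>Q\<^esub> cls y = cls (x \<otimes> y)" "cls x \<oplus>\<^bsub>Q\<^esub> cls y = cls (x \<oplus> y)" "c \<odot>\<^bsub>Q\<^esub> cls x = cls (c \<odot> x)"
proof -
  show "cls x \<otimes>\<^bsub>Q\<^esub> cls y = cls (x \<otimes> y)" "cls x \<oplus>\<^bsub>Q\<^esub> cls y = cls (x \<oplus> y)"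
    using rcoset_mult_add a_rcos_sum assms by (simp_all add: quotient_algebra_def FactRing_def)
  \<comment> \<open>The scalar action on a coset is a union over all its representatives; the union
    collapses because they all yield the same coset.\<close>
  have "cls (c \<odot> z) = cls (c \<odot> x)" if "z \<in> cls x" for z
  proof -
    have z: "z \<in> carrier A" "z \<ominus> x \<in> I" using that assms in_cls[of x z] cls_eq[of z x] by auto
    have "c \<odot> z \<ominus> c \<odot> x = c \<odot> (z \<ominus> x)"
      using z assms by (simp add: minus_eq sc_add_r flip: sc_neg sc_assoc)
    then show ?thesis using ideal_scale[OF z(2), of c] z assms by (simp add: cls_eq)
  qed
  moreover have "x \<in> cls x" using assms(1) by (rule cls_self)
  ultimately have "(\<Union>z\<in>cls x. cls (c \<odot> z)) = cls (c \<odot> x)" by blast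
  then show "c \<odot>\<^bsub>Q\<^esub> cls x = cls (c \<odot> x)" by (simp add: quotient_algebra_def)
qed

lemma k_algebra_Q: "k_algebra Q"
proof (rule k_algebraI)
  have "ring (A Quot I)" by (rule quotient_is_ring)
  then show "ring Q"
    by (rule ring_cong_sel) (simp_all add: quotient_algebra_def)
qed (auto simp: Q_sel Q_ops sc_add_l sc_add_r sc_assoc sc_mult_l sc_mult_r)

end

context kalgebra begin

lemma lin_simps:
  assumes "lin p" "x \<in> carrier A"
  shows "y \<in> carrier A \<Longrightarrow> p (x \<oplus> y) = p x + p y" "p (c \<odot> x) = c * p x"
    "p (\<ominus> x) = - p x" "y \<in> carrier A \<Longrightarrow> p (x \<ominus> y) = p x - p y"
proof -
  have 1: "p (x \<oplus> y) = p x + p y" "p (c \<odot> x) = c * p x" if "x \<in> carrier A" "y \<in> carrier A" for x y c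
    using assms(1) that unfolding lin_def by blast+
  have 2: "p (\<ominus> x) = - p x" if "x \<in> carrier A" for x
    using 1(2)[OF that that, of "- 1"] that by (simp add: sc_neg)
  show "y \<in> carrier A \<Longrightarrow> p (x \<oplus> y) = p x + p y" "p (c \<odot> x) = c * p x" "p (\<ominus> x) = - p x"
    "y \<in> carrier A \<Longrightarrow> p (x \<ominus> y) = p x - p y"
    using 1 2 assms(2) by (simp_all add: minus_eq)
qed

text \<open>The carrier is only a subset of its type, so the functional is built on the free vector
  space over the type: formal combinations of carrier elements that evaluate into the span form a
  subspace there, and a functional vanishing on it descends to the carrier.\<close>

lemma lin_separate:
  assumes S: "S \<subseteq> carrier A" and u: "u \<in> carrier A" "u \<notin> lin_span A S"
  obtains p where "lin p" "p u = 1" "\<And>s. s \<in> S \<Longrightarrow> p s = 0"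
proof -
  note sp = lin_span_closed[OF S]
  let ?D = "{f. pkeys f \<subseteq> carrier A \<and> lin_ext A id f \<in> lin_span A S}"
  have id: "id \<in> pkeys f \<rightarrow> carrier A" if "pkeys f \<subseteq> carrier A" for f :: "'a \<Rightarrow>\<^sub>0 'k"
    using that by auto
  have add_id: "lin_ext A id (f + g) = lin_ext A id f \<oplus> lin_ext A id g"
    if "pkeys f \<subseteq> carrier A" "pkeys g \<subseteq> carrier A" for f g :: "'a \<Rightarrow>\<^sub>0 'k"
    by (rule lin_ext_add[OF id[OF that(1)] id[OF that(2)]])
  have D: "pv.subspace ?D"
  proof (rule pv.subspaceI)
    fix f g assume "f \<in> ?D" "g \<in> ?D"
    then show "f + g \<in> ?D" using add_id[of f g] pkeys_add[of f "carrier A" g] sp(3) by simp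
  next
    fix c f assume f: "f \<in> ?D"
    then have "pkeys (pscale c f) \<subseteq> carrier A" using order_trans[OF pkeys_pscale] by blast
    then show "pscale c f \<in> ?D" using f lin_ext_scale[OF id, of f c] sp(4) by simp
  qed (simp add: sp)
  have single: "lin_ext A id (psingle x c) = c \<odot> x" "pkeys (psingle x c) \<subseteq> carrier A" if "x \<in> carrier A" for x c
    using that pkeys_single[OF that, of c] lin_ext_single[of id x c] by (simp_all del: Poly_Mapping.keys_single)
  have nD: "psingle u 1 \<notin> ?D" using single(1)[OF u(1), of 1] u by simp
  obtain P where P: "pv.lf P" "\<And>f. f \<in> ?D \<Longrightarrow> P f = 0" "P (psingle u 1) = 1"
    using pv.lf_separate[OF D nD] by blast
  have Ps: "P (psingle x c) = c * P (psingle x 1)" for x c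
    using pv.lf_scale[OF P(1), of c "psingle x 1"] by simp
  have PE: "P f = 0" if "pkeys f \<subseteq> carrier A" "lin_ext A id f = \<zero>" for f
    using P(2) that sp(2) by simp
  have "lin (\<lambda>x. P (psingle x 1))"
    unfolding lin_def
  proof (intro conjI ballI allI)
    fix x y c assume x: "x \<in> carrier A"
    have "P (psingle (c \<odot> x) 1 + psingle x (- c)) = 0"
    proof (rule PE)
      show "pkeys (psingle (c \<odot> x) 1 + psingle x (- c)) \<subseteq> carrier A"
        by (intro pkeys_add single(2)) (use x in auto)
      show "lin_ext A id (psingle (c \<odot> x) 1 + psingle x (- c)) = \<zero>"
        using x sc_add_l[OF x, of c "- c"] by (simp add: lin_ext_add id single del: Poly_Mapping.keys_single)
    qed
    then show "P (psingle (c \<odot> x) 1) = c * P (psingle x 1)"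
      using Ps[of x "- c"] by (simp add: pv.lf_add[OF P(1)])
    assume y: "y \<in> carrier A"
    have xy: "x \<oplus> y \<in> carrier A" using x y by simp
    have k: "pkeys (psingle x (- 1 :: 'k) + psingle y (- 1)) \<subseteq> carrier A"
      by (rule pkeys_add[OF single(2)[OF x] single(2)[OF y]])
    have "P (psingle (x \<oplus> y) 1 + (psingle x (- 1) + psingle y (- 1))) = 0"
    proof (rule PE)
      show "pkeys (psingle (x \<oplus> y) (1 :: 'k) + (psingle x (- 1) + psingle y (- 1))) \<subseteq> carrier A"
        by (rule pkeys_add[OF single(2)[OF xy] k])
      have "lin_ext A id (psingle (x \<oplus> y) 1 + (psingle x (- 1) + psingle y (- 1)))
        = 1 \<odot> (x \<oplus> y) \<oplus> ((- 1) \<odot> x \<oplus> (- 1) \<odot> y)"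
        unfolding add_id[OF single(2)[OF xy] k] add_id[OF single(2)[OF x] single(2)[OF y]]
          single(1)[OF x] single(1)[OF y] single(1)[OF xy] ..
      also have "(- 1) \<odot> x \<oplus> (- 1) \<odot> y = \<ominus> (x \<oplus> y)"
        unfolding sc_add_r[OF x y, symmetric] by (rule sc_neg[OF xy])
      also have "1 \<odot> (x \<oplus> y) \<oplus> \<ominus> (x \<oplus> y) = \<zero>" using xy by (simp add: r_neg)
      finally show "lin_ext A id (psingle (x \<oplus> y) 1 + (psingle x (- 1) + psingle y (- 1))) = \<zero>" .
    qed
    then have "P (psingle (x \<oplus> y) 1) + (- P (psingle x 1) + - P (psingle y 1)) = 0"
      using Ps[of x "- 1"] Ps[of y "- 1"] by (simp only: pv.lf_add[OF P(1)] mult_minus1)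
    moreover have "a = b + c" if "a + (- b + - c) = 0" for a b c :: 'k
    proof -
      have "a - (b + c) = a + (- b + - c)" by simp
      then have "a - (b + c) = 0" unfolding that .
      then show ?thesis by (rule right_minus_eq[THEN iffD1])
    qed
    ultimately show "P (psingle (x \<oplus> y) 1) = P (psingle x 1) + P (psingle y 1)" by blast
  qed
  moreover have "P (psingle s 1) = 0" if "s \<in> S" for s
  proof -
    have s: "s \<in> carrier A" using that S by blast
    then have "psingle s 1 \<in> ?D"
      using single(1)[OF s, of 1] single(2)[OF s, of 1] subsetD[OF sp(5) that]
      by (simp del: Poly_Mapping.keys_single)
    then show ?thesis by (rule P(2))
  qed
  ultimately show ?thesis using that P(3) by blast
qed

lemma lin_zeroI:
  assumes "x \<in> carrier A" "\<And>p. lin p \<Longrightarrow> p x = 0"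
  shows "x = \<zero>"
proof (rule ccontr)
  assume "x \<noteq> \<zero>"
  then have "x \<notin> lin_span A {}"
    using lin_span_induct[of x "{}" "\<lambda>x. x = \<zero>"] by auto
  then obtain p where p: "lin p" "p x = 1" using lin_separate[of "{}" x] assms(1) by blast
  then show False using assms(2)[OF p(1)] by simp
qed

lemma lin_eqI:
  assumes "x \<in> carrier A" "y \<in> carrier A" "\<And>p. lin p \<Longrightarrow> p x = p y"
  shows "x = y"
  using lin_zeroI[of "x \<ominus> y"] assms by (simp add: lin_simps)

lemma idealI_sub:
  assumes N: "N \<subseteq> carrier A" "\<zero> \<in> N" "\<And>x y. x \<in> N \<Longrightarrow> y \<in> N \<Longrightarrow> x \<oplus> y \<in> N" "\<And>x c. x \<in> N \<Longrightarrow> c \<odot> x \<in> N"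
    and m: "\<And>x y. x \<in> N \<Longrightarrow> y \<in> carrier A \<Longrightarrow> y \<otimes> x \<in> N" "\<And>x y. x \<in> N \<Longrightarrow> y \<in> carrier A \<Longrightarrow> x \<otimes> y \<in> N"
  shows "ideal N A"
proof (rule idealI[OF ring_axioms])
  have "\<ominus> x \<in> N" if "x \<in> N" for x using N(4)[OF that, of "- 1"] N(1) that sc_neg[of x] by auto
  then show "subgroup N (add_monoid A)"
    by (intro add.subgroupI) (use N in auto)
qed (use m in auto)

end

lemma (in kquotient) some_rep:
  assumes "X \<in> carrier Q"
  shows "(SOME f. f \<in> X) \<in> carrier A" "cls (SOME f. f \<in> X) = X"
proof -
  obtain x where x: "x \<in> carrier A" "X = cls x" using assms Q_sel by auto
  have "(SOME f. f \<in> X) \<in> X" by (rule someI[of _ x]) (use x cls_self in simp)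
  then show "(SOME f. f \<in> X) \<in> carrier A" "cls (SOME f. f \<in> X) = X"
    using in_cls[OF x(1), of "SOME f. f \<in> X"] unfolding x(2)[symmetric] by auto
qed

section \<open>Tensor products of algebras\<close>

lemma ma_diff_mult:
  fixes f g h :: "'a \<Rightarrow>\<^sub>0 'k::field"
  shows "f \<otimes>\<^bsub>MAlg M\<^esub> (g - h) = f \<otimes>\<^bsub>MAlg M\<^esub> g - f \<otimes>\<^bsub>MAlg M\<^esub> h"
    "(f - g) \<otimes>\<^bsub>MAlg M\<^esub> h = f \<otimes>\<^bsub>MAlg M\<^esub> h - g \<otimes>\<^bsub>MAlg M\<^esub> h"
  using ma_add_mult(1)[where f = f and g = "g - h" and h = h and M = M]
    ma_add_mult(2)[where f = "f - g" and g = g and h = h and M = M] by simp_all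

text \<open>The scalar-valued case of \<open>tensor_lift\<close>, with ordinary addition in place of
  a codomain record; identities between tensors are checked through it.\<close>

definition tl :: "('a \<Rightarrow> 'b \<Rightarrow> 'k) \<Rightarrow> ('a \<times> 'b \<Rightarrow>\<^sub>0 'k::field) set \<Rightarrow> 'k" where
  "tl \<beta> X = ev (\<lambda>(v, w). \<beta> v w) (SOME f. f \<in> X)"

locale kalgebra2 = A: kalgebra A + B: kalgebra B
  for A :: "('k::field, 'a, 'm) module_scheme" and B :: "('k, 'b, 'n) module_scheme"
begin

abbreviation MA :: "('k, 'a \<times> 'b \<Rightarrow>\<^sub>0 'k) module" where "MA \<equiv> monoid_algebra (A \<times>\<times> B)"
abbreviation T where "T \<equiv> tensor A B"
abbreviation ts where "ts \<equiv> tens A B"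

end

sublocale kalgebra2 \<subseteq> M: kalgebra "monoid_algebra (A \<times>\<times> B) :: ('k, 'a \<times> 'b \<Rightarrow>\<^sub>0 'k) module"
  by unfold_locales (rule k_algebra_monoid_algebra[OF DirProd_monoid[OF A.monoid_axioms B.monoid_axioms]])

context kalgebra2 begin

abbreviation "AB \<equiv> carrier A \<times> carrier B"

lemma carrier_MA: "carrier MA = {f. pkeys f \<subseteq> AB}"
  by (simp add: ma_sel DirProd_def)

lemma single_MA: "v \<in> carrier A \<Longrightarrow> w \<in> carrier B \<Longrightarrow> psingle (v, w) c \<in> carrier MA"
  unfolding carrier_MA using pkeys_single[of "(v, w)"] by blast

text \<open>The bilinearity relations in inductive form, so that proofs can go by cases on the kind
  of relation.\<close>

inductive_set tgens :: "('a \<times> 'b \<Rightarrow>\<^sub>0 'k) set" where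
  tg1: "v \<in> carrier A \<Longrightarrow> v' \<in> carrier A \<Longrightarrow> w \<in> carrier B \<Longrightarrow>
    psingle (v \<oplus>\<^bsub>A\<^esub> v', w) 1 - psingle (v, w) 1 - psingle (v', w) 1 \<in> tgens"
| tg2: "v \<in> carrier A \<Longrightarrow> w \<in> carrier B \<Longrightarrow> w' \<in> carrier B \<Longrightarrow>
    psingle (v, w \<oplus>\<^bsub>B\<^esub> w') 1 - psingle (v, w) 1 - psingle (v, w') 1 \<in> tgens"
| tg3: "v \<in> carrier A \<Longrightarrow> w \<in> carrier B \<Longrightarrow> psingle (c \<odot>\<^bsub>A\<^esub> v, w) 1 - psingle (v, w) c \<in> tgens"
| tg4: "v \<in> carrier A \<Longrightarrow> w \<in> carrier B \<Longrightarrow> psingle (v, c \<odot>\<^bsub>B\<^esub> w) 1 - psingle (v, w) c \<in> tgens"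

abbreviation "rel \<equiv> tensor_relations A B"

lemma rel_eq: "rel = lin_span MA tgens"
  unfolding tensor_relations_def
  by (rule arg_cong[where f = "lin_span MA"], rule equalityI, blast intro: tgens.intros, blast elim!: tgens.cases)

lemma tgens_carrier: "tgens \<subseteq> carrier MA"
proof
  fix x assume "x \<in> tgens"
  then show "x \<in> carrier MA" unfolding carrier_MA mem_Collect_eq
    by cases (hypsubst, (rule pkeys_diff pkeys_single SigmaI A.add.m_closed B.add.m_closed A.sc_closed B.sc_closed | assumption)+)+
qed

lemma MA_closed: "f \<in> carrier MA \<Longrightarrow> g \<in> carrier MA \<Longrightarrow> f + g \<in> carrier MA"
  "f \<in> carrier MA \<Longrightarrow> pscale c f \<in> carrier MA"
  using M.add.m_closed[of f g] M.sc_closed[of f c] by (simp_all add: ma_sel(4,5))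

lemmas rel_closed = M.lin_span_closed[OF tgens_carrier, folded rel_eq, unfolded ma_sel(3-)]

text \<open>By distributivity, a bilinearity relation multiplied by a basis pair is a bilinearity
  relation of the same kind; general factors follow by linearity.\<close>

lemma rel_ideal: "ideal rel MA"
proof (rule M.idealI_sub)
  have sg: "psingle (m, m') 1 \<otimes>\<^bsub>MA\<^esub> x \<in> tgens \<and> x \<otimes>\<^bsub>MA\<^esub> psingle (m, m') 1 \<in> tgens"
    if x: "x \<in> tgens" and m: "m \<in> carrier A" "m' \<in> carrier B" for x m m'
    using x
  proof cases
    case (tg1 v v' w)
    then show ?thesis using tgens.tg1[of "m \<otimes>\<^bsub>A\<^esub> v" "m \<otimes>\<^bsub>A\<^esub> v'" "m' \<otimes>\<^bsub>B\<^esub> w"]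
        tgens.tg1[of "v \<otimes>\<^bsub>A\<^esub> m" "v' \<otimes>\<^bsub>A\<^esub> m" "w \<otimes>\<^bsub>B\<^esub> m'"] m
      by (simp add: ma_diff_mult A.l_distr A.r_distr)
  next
    case (tg2 v w w')
    then show ?thesis using tgens.tg2[of "m \<otimes>\<^bsub>A\<^esub> v" "m' \<otimes>\<^bsub>B\<^esub> w" "m' \<otimes>\<^bsub>B\<^esub> w'"]
        tgens.tg2[of "v \<otimes>\<^bsub>A\<^esub> m" "w \<otimes>\<^bsub>B\<^esub> m'" "w' \<otimes>\<^bsub>B\<^esub> m'"] m
      by (simp add: ma_diff_mult B.l_distr B.r_distr)
  next
    case (tg3 v w c)
    then show ?thesis using tgens.tg3[of "m \<otimes>\<^bsub>A\<^esub> v" "m' \<otimes>\<^bsub>B\<^esub> w" c] tgens.tg3[of "v \<otimes>\<^bsub>A\<^esub> m" "w \<otimes>\<^bsub>B\<^esub> m'" c] m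
      by (simp add: ma_diff_mult A.sc_mult_l A.sc_mult_r)
  next
    case (tg4 v w c)
    then show ?thesis using tgens.tg4[of "m \<otimes>\<^bsub>A\<^esub> v" "m' \<otimes>\<^bsub>B\<^esub> w" c] tgens.tg4[of "v \<otimes>\<^bsub>A\<^esub> m" "w \<otimes>\<^bsub>B\<^esub> m'" c] m
      by (simp add: ma_diff_mult B.sc_mult_l B.sc_mult_r)
  qed
  have gen: "f \<otimes>\<^bsub>MA\<^esub> x \<in> rel \<and> x \<otimes>\<^bsub>MA\<^esub> f \<in> rel" if x: "x \<in> tgens" and f: "f \<in> carrier MA" for x f
  proof -
    have "pkeys f \<subseteq> AB" using f by (simp add: carrier_MA)
    then show ?thesis
    proof (induction f rule: pm_induct)
      case (add k c f)
      obtain m m' where k: "k = (m, m')" "m \<in> carrier A" "m' \<in> carrier B" using add(1) by auto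
      have e: "psingle k c = pscale c (psingle k 1)" by simp
      have "pscale c (psingle k 1) \<otimes>\<^bsub>MA\<^esub> x \<in> rel" "x \<otimes>\<^bsub>MA\<^esub> pscale c (psingle k 1) \<in> rel"
        unfolding ma_scale_mult k(1)
        using sg[OF x k(2,3)] rel_closed(4,5) by blast+
      then show ?case using add(3) rel_closed(3) by (simp add: ma_add_mult flip: e)
    qed (use rel_closed in simp)
  qed
  have "\<forall>f\<in>carrier MA. f \<otimes>\<^bsub>MA\<^esub> x \<in> rel \<and> x \<otimes>\<^bsub>MA\<^esub> f \<in> rel" if "x \<in> rel" for x
    using that[unfolded rel_eq] tgens_carrier
  proof (induction x rule: M.lin_span_induct)
    case zero then show ?case using rel_closed(2) by (simp add: ma_sel)
  next
    case (add x y)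
    then show ?case using rel_closed(3) by (simp add: ma_sel ma_add_mult)
  next
    case (scale c x)
    then show ?case using rel_closed(4) by (simp add: ma_sel ma_scale_mult)
  qed (use gen in blast)
  then show "\<And>x y. x \<in> rel \<Longrightarrow> y \<in> carrier MA \<Longrightarrow> y \<otimes>\<^bsub>MA\<^esub> x \<in> rel" "\<And>x y. x \<in> rel \<Longrightarrow> y \<in> carrier MA \<Longrightarrow> x \<otimes>\<^bsub>MA\<^esub> y \<in> rel"
    by blast+
qed (use rel_closed in \<open>auto simp: ma_sel(3-)\<close>)

end

sublocale kalgebra2 \<subseteq> P: kquotient "monoid_algebra (A \<times>\<times> B) :: ('k, 'a \<times> 'b \<Rightarrow>\<^sub>0 'k) module" "tensor_relations A B"
  by (intro kquotient.intro M.kalgebra_axioms rel_ideal)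

sublocale kalgebra2 \<subseteq> T: kalgebra "tensor A B"
  by unfold_locales (unfold tensor_def, rule P.k_algebra_Q)

context kalgebra2 begin

lemmas T_sel = P.Q_sel[folded tensor_def]
lemmas T_ops = P.Q_ops[folded tensor_def]
lemmas T_rep = P.some_rep[folded tensor_def]

lemma ts_cls: "ts v w = P.cls (psingle (v, w) 1)"
  by (simp add: tens_def)

lemma ts_closed [simp, intro]: "v \<in> carrier A \<Longrightarrow> w \<in> carrier B \<Longrightarrow> ts v w \<in> carrier T"
  by (simp add: ts_cls T_sel single_MA)

lemma MA_minus: "f \<in> carrier MA \<Longrightarrow> g \<in> carrier MA \<Longrightarrow> f \<ominus>\<^bsub>MA\<^esub> g = f - g"
  using M.sc_neg[of g] by (simp add: M.minus_eq ma_sel(4-))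

lemma cls_relI: "f \<in> carrier MA \<Longrightarrow> g \<in> carrier MA \<Longrightarrow> f - g \<in> tgens \<Longrightarrow> P.cls f = P.cls g"
  using P.cls_eq[of f g] MA_minus[of f g] rel_closed(5) by auto

lemma ts_add:
  assumes "v \<in> carrier A" "w \<in> carrier B"
  shows "v' \<in> carrier A \<Longrightarrow> ts (v \<oplus>\<^bsub>A\<^esub> v') w = ts v w \<oplus>\<^bsub>T\<^esub> ts v' w"
    "w' \<in> carrier B \<Longrightarrow> ts v (w \<oplus>\<^bsub>B\<^esub> w') = ts v w \<oplus>\<^bsub>T\<^esub> ts v w'"
proof -
  note s = single_MA[of _ _ 1]
  have plus: "P.cls f \<oplus>\<^bsub>T\<^esub> P.cls g = P.cls (f + g)" if "f \<in> carrier MA" "g \<in> carrier MA" for f g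
    using T_ops(2)[OF that] by (simp only: ma_sel(4))
  show "ts (v \<oplus>\<^bsub>A\<^esub> v') w = ts v w \<oplus>\<^bsub>T\<^esub> ts v' w" if v': "v' \<in> carrier A"
    unfolding ts_cls plus[OF s[OF assms] s[OF v' assms(2)]]
    by (rule cls_relI[OF s[OF A.add.m_closed[OF assms(1) v'] assms(2)] MA_closed(1)[OF s[OF assms] s[OF v' assms(2)]]])
      (use tg1[OF assms(1) v' assms(2)] in \<open>simp only: diff_diff_add\<close>)
  show "ts v (w \<oplus>\<^bsub>B\<^esub> w') = ts v w \<oplus>\<^bsub>T\<^esub> ts v w'" if w': "w' \<in> carrier B"
    unfolding ts_cls plus[OF s[OF assms] s[OF assms(1) w']]
    by (rule cls_relI[OF s[OF assms(1) B.add.m_closed[OF assms(2) w']] MA_closed(1)[OF s[OF assms] s[OF assms(1) w']]])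
      (use tg2[OF assms w'] in \<open>simp only: diff_diff_add\<close>)
qed

lemma ts_scale:
  assumes "v \<in> carrier A" "w \<in> carrier B"
  shows "ts (c \<odot>\<^bsub>A\<^esub> v) w = c \<odot>\<^bsub>T\<^esub> ts v w" "ts v (c \<odot>\<^bsub>B\<^esub> w) = c \<odot>\<^bsub>T\<^esub> ts v w"
proof -
  note s = single_MA[of _ _ 1]
  have e: "c \<odot>\<^bsub>T\<^esub> P.cls (psingle (v, w) 1) = P.cls (psingle (v, w) c)"
    using T_ops(3)[OF s[OF assms] s[OF assms], of c] by (simp add: ma_sel(5))
  show "ts (c \<odot>\<^bsub>A\<^esub> v) w = c \<odot>\<^bsub>T\<^esub> ts v w"
    unfolding ts_cls e by (rule cls_relI[OF s[OF A.sc_closed[OF assms(1)] assms(2)] single_MA[OF assms] tg3[OF assms]])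
  show "ts v (c \<odot>\<^bsub>B\<^esub> w) = c \<odot>\<^bsub>T\<^esub> ts v w"
    unfolding ts_cls e by (rule cls_relI[OF s[OF assms(1) B.sc_closed[OF assms(2)]] single_MA[OF assms] tg4[OF assms]])
qed

lemma ts_mult:
  "v \<in> carrier A \<Longrightarrow> w \<in> carrier B \<Longrightarrow> v' \<in> carrier A \<Longrightarrow> w' \<in> carrier B \<Longrightarrow>
    ts v w \<otimes>\<^bsub>T\<^esub> ts v' w' = ts (v \<otimes>\<^bsub>A\<^esub> v') (w \<otimes>\<^bsub>B\<^esub> w')"
  by (simp add: ts_cls T_ops single_MA)

lemma T_one: "\<one>\<^bsub>T\<^esub> = ts \<one>\<^bsub>A\<^esub> \<one>\<^bsub>B\<^esub>"
  by (simp add: T_sel ts_cls ma_sel)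

definition bil :: "('a \<Rightarrow> 'b \<Rightarrow> 'k) \<Rightarrow> bool" where
  "bil \<beta> \<longleftrightarrow> (\<forall>w\<in>carrier B. A.lin (\<lambda>v. \<beta> v w)) \<and> (\<forall>v\<in>carrier A. B.lin (\<beta> v))"

lemma bil_prod: "A.lin p \<Longrightarrow> B.lin q \<Longrightarrow> bil (prd p q)"
  by (auto simp: bil_def A.lin_def B.lin_def algebra_simps)

lemma ev_rel:
  assumes b: "bil \<beta>" and f: "f \<in> rel"
  shows "ev (\<lambda>(v, w). \<beta> v w) f = 0"
  using f[unfolded rel_eq] tgens_carrier
proof (induction f rule: M.lin_span_induct)
  case (base x)
  have l: "A.lin (\<lambda>v. \<beta> v w)" "v \<in> carrier A \<Longrightarrow> B.lin (\<beta> v)" if "w \<in> carrier B" for v w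
    using b that by (auto simp: bil_def)
  show ?case using base
    by cases (auto simp: ev_diff A.lin_simps[OF l(1)] B.lin_simps[OF l(2)])
qed (auto simp: ma_sel ev_add ev_pscale)

lemma tl_cls:
  assumes "bil \<beta>" "f \<in> carrier MA"
  shows "tl \<beta> (P.cls f) = ev (\<lambda>(v, w). \<beta> v w) f"
proof -
  let ?g = "SOME g. g \<in> P.cls f"
  have "P.cls f \<in> carrier T" using assms by (simp add: T_sel)
  note g = T_rep[OF this]
  have "?g - f \<in> rel" using P.cls_eq[OF g(1) assms(2)] g MA_minus[OF g(1) assms(2)] by simp
  from ev_rel[OF assms(1) this] show ?thesis by (simp add: tl_def ev_diff)
qed

lemma tl_ts: "bil \<beta> \<Longrightarrow> v \<in> carrier A \<Longrightarrow> w \<in> carrier B \<Longrightarrow> tl \<beta> (ts v w) = \<beta> v w"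
  by (simp add: ts_cls tl_cls single_MA)

lemma tl_lin: "bil \<beta> \<Longrightarrow> T.lin (tl \<beta>)"
  unfolding T.lin_def T_sel by (auto simp: T_ops tl_cls ma_sel(4-) ev_add ev_pscale MA_closed
      simp flip: ma_sel(1))

lemma tl_cong:
  assumes "X \<in> carrier T" "\<And>v w. v \<in> carrier A \<Longrightarrow> w \<in> carrier B \<Longrightarrow> \<beta> v w = \<beta>' v w"
  shows "tl \<beta> X = tl \<beta>' X"
  unfolding tl_def using T_rep(1)[OF assms(1)] assms(2) by (auto simp: carrier_MA intro!: ev_cong)

lemma tensor_lift_closed:
  assumes "kalgebra Z" "X \<in> carrier T" "\<And>v w. v \<in> carrier A \<Longrightarrow> w \<in> carrier B \<Longrightarrow> b v w \<in> carrier Z"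
  shows "tensor_lift Z b X \<in> carrier Z"
  unfolding tensor_lift_def using T_rep(1)[OF assms(2)] assms(3)
  by (auto simp: carrier_MA intro!: kalgebra.lin_ext_closed[OF assms(1)])

lemma lin_lift:
  assumes "kalgebra Z" "kalgebra.lin Z \<phi>" "X \<in> carrier T"
    "\<And>v w. v \<in> carrier A \<Longrightarrow> w \<in> carrier B \<Longrightarrow> b v w \<in> carrier Z"
  shows "\<phi> (tensor_lift Z b X) = tl (\<lambda>v w. \<phi> (b v w)) X"
proof -
  have "\<phi> (tensor_lift Z b X) = ev (\<lambda>p. \<phi> (case p of (v, w) \<Rightarrow> b v w)) (SOME f. f \<in> X)"
    unfolding tensor_lift_def using T_rep(1)[OF assms(3)] assms(4)
    by (intro kalgebra.lin_lin_ext[OF assms(1,2)]) (auto simp: carrier_MA)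
  then show ?thesis by (simp add: tl_def case_prod_unfold)
qed

definition texp :: "('a \<times> 'b) list \<Rightarrow> ('a \<times> 'b \<Rightarrow>\<^sub>0 'k) set" where
  "texp ps = (\<Oplus>\<^bsub>T\<^esub>i\<in>{..<length ps}. ts (fst (ps ! i)) (snd (ps ! i)))"

lemma texp_Nil [simp]: "texp [] = \<zero>\<^bsub>T\<^esub>"
  by (simp add: texp_def)

lemma texp_closed [intro]: "set ps \<subseteq> AB \<Longrightarrow> texp ps \<in> carrier T"
  unfolding texp_def by (rule T.finsum_closed) (auto simp: mem_Times_iff dest!: subsetD[OF _ nth_mem])

lemma texp_snoc:
  assumes "set ps \<subseteq> AB" "u \<in> carrier A" "v \<in> carrier B"
  shows "texp (ps @ [(u, v)]) = ts u v \<oplus>\<^bsub>T\<^esub> texp ps"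
proof -
  let ?f = "\<lambda>i. ts (fst ((ps @ [(u, v)]) ! i)) (snd ((ps @ [(u, v)]) ! i))"
  have m: "ps ! i \<in> AB" if "i < length ps" for i using assms(1) that nth_mem by blast
  have "(\<Oplus>\<^bsub>T\<^esub>i\<in>insert (length ps) {..<length ps}. ?f i) = ?f (length ps) \<oplus>\<^bsub>T\<^esub> (\<Oplus>\<^bsub>T\<^esub>i\<in>{..<length ps}. ?f i)"
    by (rule T.finsum_insert) (use m assms in \<open>auto simp: nth_append mem_Times_iff\<close>)
  also have "(\<Oplus>\<^bsub>T\<^esub>i\<in>{..<length ps}. ?f i) = texp ps"
    unfolding texp_def by (rule T.add.finprod_cong') (use m in \<open>auto simp: nth_append mem_Times_iff\<close>)
  finally show ?thesis unfolding texp_def by (simp add: lessThan_Suc)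
qed

lemma texp_mid:
  assumes "set (xs @ ys) \<subseteq> AB" "u \<in> carrier A" "v \<in> carrier B"
  shows "texp (xs @ (u, v) # ys) = ts u v \<oplus>\<^bsub>T\<^esub> texp (xs @ ys)"
  using assms(1)
proof (induction ys rule: rev_induct)
  case Nil then show ?case using texp_snoc[of xs u v] assms by simp
next
  case (snoc z ys)
  obtain z1 z2 where z: "z = (z1, z2)" "z1 \<in> carrier A" "z2 \<in> carrier B" using snoc.prems by auto
  have s: "set (xs @ (u, v) # ys) \<subseteq> AB" "set (xs @ ys) \<subseteq> AB"
    using snoc.prems assms by auto
  have "texp (xs @ (u, v) # ys @ [z]) = ts z1 z2 \<oplus>\<^bsub>T\<^esub> (ts u v \<oplus>\<^bsub>T\<^esub> texp (xs @ ys))"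
    using texp_snoc[OF s(1) z(2,3)] snoc.IH[OF s(2)] z(1) by simp
  also have "\<dots> = ts u v \<oplus>\<^bsub>T\<^esub> (ts z1 z2 \<oplus>\<^bsub>T\<^esub> texp (xs @ ys))"
    using z assms texp_closed[OF s(2)] by (simp add: T.a_lcomm)
  finally show ?case using texp_snoc[OF s(2) z(2,3)] z(1) by simp
qed

lemma tl_texp: "bil \<beta> \<Longrightarrow> set ps \<subseteq> AB \<Longrightarrow> tl \<beta> (texp ps) = sw ps \<beta>"
proof (induction ps rule: rev_induct)
  case Nil then show ?case using T.lin_zero[OF tl_lin] by simp
next
  case (snoc z ps)
  then show ?case
    by (cases z) (auto simp: texp_snoc T.lin_simps[OF tl_lin] texp_closed tl_ts sw_append)
qed

lemma ex_texp:
  assumes "X \<in> carrier T"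
  shows "\<exists>ps. set ps \<subseteq> AB \<and> X = texp ps"
proof -
  obtain f where f: "pkeys f \<subseteq> AB" "X = P.cls f" using assms by (auto simp: T_sel carrier_MA)
  have "\<exists>ps. set ps \<subseteq> AB \<and> P.cls f = texp ps" using f(1)
  proof (induction f rule: pm_induct)
    case zero
    show ?case by (rule exI[of _ "[]"]) (simp add: T_sel ma_sel)
  next
    case (add k c f)
    obtain v w where k: "k = (v, w)" "v \<in> carrier A" "w \<in> carrier B" using add(1) by auto
    obtain ps where ps: "set ps \<subseteq> AB" "P.cls f = texp ps" using add by blast
    have "psingle k c \<oplus>\<^bsub>MA\<^esub> f = psingle k c + f" by (rule ma_sel)
    then have "P.cls (psingle k c + f) = P.cls (psingle k c) \<oplus>\<^bsub>T\<^esub> texp ps"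
      using add(2) k by (simp add: T_ops single_MA carrier_MA flip: ps(2))
    also have "P.cls (psingle k c) = ts (c \<odot>\<^bsub>A\<^esub> v) w"
      unfolding ts_cls k(1) by (rule cls_relI[symmetric]) (use k tg3 single_MA in auto)
    finally show ?case
      using texp_snoc[OF ps(1), of "c \<odot>\<^bsub>A\<^esub> v" w] k ps by (intro exI[of _ "ps @ [(c \<odot>\<^bsub>A\<^esub> v, w)]"]) auto
  qed
  then show ?thesis using f(2) by simp
qed

text \<open>If u depends on the left entries of the list, u \<otimes> v can be distributed over the
  right entries without lengthening it. The claim quantifies over v and the list because the sum and
  scalar cases change them.\<close>

lemma texp_absorb:
  assumes u: "u \<in> lin_span A S" and S: "S \<subseteq> carrier A"
  shows "\<forall>v ys. fst ` set ys = S \<longrightarrow> set ys \<subseteq> AB \<longrightarrow> v \<in> carrier B \<longrightarrow>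
    (\<exists>zs. length zs = length ys \<and> fst ` set zs = S \<and> set zs \<subseteq> AB \<and>
      texp zs = ts u v \<oplus>\<^bsub>T\<^esub> texp ys)"
  using u S
proof (induction u rule: A.lin_span_induct)
  case zero
  show ?case
  proof (intro allI impI)
    fix v ys assume a: "fst ` set ys = S" "set ys \<subseteq> AB" "v \<in> carrier B"
    have "ts \<zero>\<^bsub>A\<^esub> v = \<zero>\<^bsub>T\<^esub>" using ts_scale(1)[of "\<zero>\<^bsub>A\<^esub>" v 0] a by simp
    then show "\<exists>zs. length zs = length ys \<and> fst ` set zs = S \<and> set zs \<subseteq> AB \<and>
      texp zs = ts \<zero>\<^bsub>A\<^esub> v \<oplus>\<^bsub>T\<^esub> texp ys"
      using a texp_closed[OF a(2)] by (intro exI[of _ ys]) simp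
  qed
next
  case (add x y)
  show ?case
  proof (intro allI impI)
    fix v ys assume a: "fst ` set ys = S" "set ys \<subseteq> AB" "v \<in> carrier B"
    obtain zs where zs: "length zs = length ys" "fst ` set zs = S" "set zs \<subseteq> AB"
      "texp zs = ts y v \<oplus>\<^bsub>T\<^esub> texp ys" using add(4)[rule_format, OF a] by blast
    obtain zs' where zs': "length zs' = length zs" "fst ` set zs' = S" "set zs' \<subseteq> AB"
      "texp zs' = ts x v \<oplus>\<^bsub>T\<^esub> texp zs" using add(3)[rule_format, OF zs(2,3) a(3)] by blast
    show "\<exists>zs. length zs = length ys \<and> fst ` set zs = S \<and> set zs \<subseteq> AB \<and>
      texp zs = ts (x \<oplus>\<^bsub>A\<^esub> y) v \<oplus>\<^bsub>T\<^esub> texp ys"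
    proof (intro exI conjI)
      have "ts (x \<oplus>\<^bsub>A\<^esub> y) v = ts x v \<oplus>\<^bsub>T\<^esub> ts y v" by (rule ts_add(1)[OF add(1) a(3) add(2)])
      then show "texp zs' = ts (x \<oplus>\<^bsub>A\<^esub> y) v \<oplus>\<^bsub>T\<^esub> texp ys"
        unfolding zs'(4) zs(4) using T.a_assoc[OF ts_closed[OF add(1) a(3)] ts_closed[OF add(2) a(3)] texp_closed[OF a(2)]]
        by metis
    qed (use zs zs' in auto)
  qed
next
  case (scale c x)
  show ?case
  proof (intro allI impI)
    fix v ys assume a: "fst ` set ys = S" "set ys \<subseteq> AB" "v \<in> carrier B"
    have "ts (c \<odot>\<^bsub>A\<^esub> x) v = ts x (c \<odot>\<^bsub>B\<^esub> v)" using scale(1) a(3) by (simp add: ts_scale)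
    then show "\<exists>zs. length zs = length ys \<and> fst ` set zs = S \<and> set zs \<subseteq> AB \<and>
      texp zs = ts (c \<odot>\<^bsub>A\<^esub> x) v \<oplus>\<^bsub>T\<^esub> texp ys" using scale(2) a by simp
  qed
next
  case (base u)
  show ?case
  proof (intro allI impI)
    fix v ys assume a: "fst ` set ys = S" "set ys \<subseteq> AB" "v \<in> carrier B"
    then obtain w where "(u, w) \<in> set ys" using base by force
    then obtain xs xs' where ys: "ys = xs @ (u, w) # xs'" by (meson split_list)
    have c: "u \<in> carrier A" "w \<in> carrier B" "set (xs @ xs') \<subseteq> AB" using a(2) ys by auto
    show "\<exists>zs. length zs = length ys \<and> fst ` set zs = S \<and> set zs \<subseteq> AB \<and>
      texp zs = ts u v \<oplus>\<^bsub>T\<^esub> texp ys"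
    proof (intro exI conjI)
      show "texp (xs @ (u, v \<oplus>\<^bsub>B\<^esub> w) # xs') = ts u v \<oplus>\<^bsub>T\<^esub> texp ys"
        unfolding ys using c a(3) texp_closed[OF c(3)] by (simp add: texp_mid ts_add T.a_assoc del: set_append)
    qed (use a c ys in auto)
  qed
qed

text \<open>Induction on the length. A last left entry that depends on the others is absorbed, which
  shortens the expression; an independent one is isolated by a functional, which forces its right
  partner to vanish.\<close>

lemma texp_zeroI:
  assumes "set ps \<subseteq> AB"
    and "\<And>p q. A.lin p \<Longrightarrow> B.lin q \<Longrightarrow> sw ps (prd p q) = 0"
  shows "texp ps = \<zero>\<^bsub>T\<^esub>"
  using assms
proof (induction "length ps" arbitrary: ps)
  case (Suc n)
  then obtain ys u v where ps: "ps = ys @ [(u, v)]" by (cases ps rule: rev_cases) auto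
  have c: "u \<in> carrier A" "v \<in> carrier B" "set ys \<subseteq> AB" "length ys = n"
    using Suc(2,3) ps by auto
  then have S: "fst ` set ys \<subseteq> carrier A" by auto
  show ?case
  proof (cases "u \<in> lin_span A (fst ` set ys)")
    case True
    obtain zs where zs: "length zs = length ys" "set zs \<subseteq> AB" "texp zs = ts u v \<oplus>\<^bsub>T\<^esub> texp ys"
      using texp_absorb[OF True S, rule_format, OF refl c(3,2)] by blast
    then have eq: "texp ps = texp zs" using ps c texp_snoc by simp
    have "sw zs (prd p q) = 0" if pq: "A.lin p" "B.lin q" for p q
      using tl_texp[OF bil_prod[OF pq] zs(2)] tl_texp[OF bil_prod[OF pq] Suc(3)] Suc(4)[OF pq] eq by simp
    then show ?thesis using Suc(1)[of zs] zs c eq by simp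
  next
    case False
    obtain p where p: "A.lin p" "p u = 1" "\<And>s. s \<in> fst ` set ys \<Longrightarrow> p s = 0"
      using A.lin_separate[OF S c(1) False] by blast
    have "q v = 0" if "B.lin q" for q
    proof -
      have "sw ys (prd p q) = sw ys (\<lambda>u v. 0)" by (rule sw_cong) (use p(3) in force)
      then show ?thesis using Suc(4)[OF p(1) that] ps p(2) by (simp add: sw_append)
    qed
    then have v: "v = \<zero>\<^bsub>B\<^esub>" using B.lin_zeroI c(2) by blast
    then have "ts u v = \<zero>\<^bsub>T\<^esub>" using ts_scale(2)[of u "\<zero>\<^bsub>B\<^esub>" 0] c by simp
    moreover have "texp ys = \<zero>\<^bsub>T\<^esub>"
    proof (rule Suc(1))
      show "sw ys (prd p q) = 0" if "A.lin p" "B.lin q" for p q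
        using Suc(4)[OF that] ps v B.lin_zero[OF that(2)] by (simp add: sw_append)
    qed (use c in auto)
    ultimately show ?thesis using ps c texp_snoc by simp
  qed
qed simp

text \<open>The way back from functionals to equality in the quotient: the difference of the two
  tensors has a list expression to which \<open>texp_zeroI\<close> applies.\<close>

lemma T_eqI:
  assumes "X \<in> carrier T" "Y \<in> carrier T"
    and "\<And>p q. A.lin p \<Longrightarrow> B.lin q \<Longrightarrow> tl (prd p q) X = tl (prd p q) Y"
  shows "X = Y"
proof -
  have "X \<ominus>\<^bsub>T\<^esub> Y \<in> carrier T" using assms by simp
  from ex_texp[OF this] obtain ps where ps: "set ps \<subseteq> AB" "X \<ominus>\<^bsub>T\<^esub> Y = texp ps" by blast
  have "texp ps = \<zero>\<^bsub>T\<^esub>"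
  proof (rule texp_zeroI[OF ps(1)])
    fix p q assume pq: "A.lin p" "B.lin q"
    show "sw ps (prd p q) = 0"
      using tl_texp[OF bil_prod[OF pq] ps(1)] T.lin_simps(4)[OF tl_lin[OF bil_prod[OF pq]] assms(1,2)] assms(3)[OF pq]
      by (simp add: ps(2))
  qed
  then show ?thesis using ps assms by simp
qed

lemma tl_mult:
  assumes b: "bil \<beta>" and X: "X \<in> carrier T" and Y: "Y \<in> carrier T"
  shows "tl \<beta> (X \<otimes>\<^bsub>T\<^esub> Y) = tl (\<lambda>u v. tl (\<lambda>u' v'. \<beta> (u \<otimes>\<^bsub>A\<^esub> u') (v \<otimes>\<^bsub>B\<^esub> v')) Y) X"
proof -
  obtain ps where ps: "set ps \<subseteq> AB" "X = texp ps" using ex_texp[OF X] by blast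
  have bl: "bil (\<lambda>u v. tl (\<lambda>u' v'. \<beta> (u \<otimes>\<^bsub>A\<^esub> u') (v \<otimes>\<^bsub>B\<^esub> v')) Y)" and bs: "bil (\<lambda>u' v'. \<beta> (u \<otimes>\<^bsub>A\<^esub> u') (v \<otimes>\<^bsub>B\<^esub> v'))"
    if uv: "u \<in> carrier A" "v \<in> carrier B" for u v
  proof -
    have l: "A.lin (\<lambda>v. \<beta> v w)" "v \<in> carrier A \<Longrightarrow> B.lin (\<beta> v)" if "w \<in> carrier B" for v w
      using b that by (auto simp: bil_def)
    have bs: "bil (\<lambda>u' v'. \<beta> (u \<otimes>\<^bsub>A\<^esub> u') (v \<otimes>\<^bsub>B\<^esub> v'))" if "u \<in> carrier A" "v \<in> carrier B" for u v
      unfolding bil_def A.lin_def B.lin_def using that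
      by (auto simp: A.r_distr B.r_distr A.sc_mult_r B.sc_mult_r A.lin_simps[OF l(1)] B.lin_simps[OF l(2)])
    then show "bil (\<lambda>u' v'. \<beta> (u \<otimes>\<^bsub>A\<^esub> u') (v \<otimes>\<^bsub>B\<^esub> v'))" using uv .
    obtain qs where qs: "set qs \<subseteq> AB" "Y = texp qs" using ex_texp[OF Y] by blast
    have q: "(u', v') \<in> set qs \<Longrightarrow> u' \<in> carrier A \<and> v' \<in> carrier B" for u' v' using qs(1) by auto
    have e: "tl (\<lambda>u' v'. \<beta> (u \<otimes>\<^bsub>A\<^esub> u') (v \<otimes>\<^bsub>B\<^esub> v')) Y = sw qs (\<lambda>u' v'. \<beta> (u \<otimes>\<^bsub>A\<^esub> u') (v \<otimes>\<^bsub>B\<^esub> v'))"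
      if "u \<in> carrier A" "v \<in> carrier B" for u v
      unfolding qs(2) by (rule tl_texp[OF bs[OF that] qs(1)])
    show "bil (\<lambda>u v. tl (\<lambda>u' v'. \<beta> (u \<otimes>\<^bsub>A\<^esub> u') (v \<otimes>\<^bsub>B\<^esub> v')) Y)"
      unfolding bil_def A.lin_def B.lin_def
      by (auto simp: e sw_distrib_left simp flip: sw_add intro!: sw_cong)
         (auto dest!: q simp: A.l_distr B.l_distr A.sc_mult_l B.sc_mult_l A.lin_simps[OF l(1)] B.lin_simps[OF l(2)])
  qed
  show ?thesis using ps(1) unfolding ps(2)
  proof (induction ps rule: rev_induct)
    case Nil
    have "tl (\<lambda>u v. tl (\<lambda>u' v'. \<beta> (u \<otimes>\<^bsub>A\<^esub> u') (v \<otimes>\<^bsub>B\<^esub> v')) Y) \<zero>\<^bsub>T\<^esub> = 0"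
      by (rule T.lin_zero[OF tl_lin[OF bl[OF A.zero_closed B.zero_closed]]])
    then show ?case using Y T.lin_zero[OF tl_lin[OF b]] by simp
  next
    case (snoc z ps)
    obtain u v where z: "z = (u, v)" "u \<in> carrier A" "v \<in> carrier B" using snoc.prems by auto
    have ps: "set ps \<subseteq> AB" using snoc.prems by simp
    have uv: "tl \<beta> (ts u v \<otimes>\<^bsub>T\<^esub> Y) = tl (\<lambda>u' v'. \<beta> (u \<otimes>\<^bsub>A\<^esub> u') (v \<otimes>\<^bsub>B\<^esub> v')) Y"
    proof -
      obtain g where g: "g \<in> carrier MA" "Y = P.cls g" using Y T_sel by auto
      have "tl \<beta> (ts u v \<otimes>\<^bsub>T\<^esub> Y) = ev (\<lambda>(v, w). \<beta> v w) (psingle (u, v) 1 \<otimes>\<^bsub>MA\<^esub> g)"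
        using g z by (simp add: ts_cls T_ops single_MA tl_cls[OF b])
      also have "\<dots> = ev (\<lambda>(u', v'). \<beta> (u \<otimes>\<^bsub>A\<^esub> u') (v \<otimes>\<^bsub>B\<^esub> v')) g"
      proof -
        have "pkeys g \<subseteq> UNIV" by simp
        then show ?thesis
          by (induction g rule: pm_induct) (auto simp: ma_add_mult ev_add)
      qed
      finally show ?thesis using tl_cls[OF bs[OF z(2,3)] g(1)] g(2) by simp
    qed
    have "tl \<beta> (texp (ps @ [z]) \<otimes>\<^bsub>T\<^esub> Y) = tl \<beta> (ts u v \<otimes>\<^bsub>T\<^esub> Y) + tl \<beta> (texp ps \<otimes>\<^bsub>T\<^esub> Y)"
      using z ps Y texp_closed[OF ps] by (simp add: texp_snoc T.l_distr T.lin_simps[OF tl_lin[OF b]])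
    also have "\<dots> = tl (\<lambda>u v. tl (\<lambda>u' v'. \<beta> (u \<otimes>\<^bsub>A\<^esub> u') (v \<otimes>\<^bsub>B\<^esub> v')) Y) (texp (ps @ [z]))"
      using z ps texp_closed[OF ps] snoc.IH[OF ps] bl[OF A.zero_closed B.zero_closed]
      by (simp add: texp_snoc T.lin_simps[OF tl_lin] uv tl_ts)
    finally show ?case .
  qed
qed

text \<open>In a shortest expression each left entry is independent of the others, for otherwise it
  could be absorbed. A functional isolating it shows that its right partner is a slice of the
  tensor.\<close>

lemma shortest_fst:
  assumes ps: "set ps \<subseteq> AB"
    and least: "\<And>zs. set zs \<subseteq> AB \<Longrightarrow> texp zs = texp ps \<Longrightarrow> length ps \<le> length zs"
    and e: "\<And>p. A.lin p \<Longrightarrow> \<exists>e\<in>carrier B. e \<in> D \<and> (\<forall>q. B.lin q \<longrightarrow> q e = sw ps (\<lambda>r s. p r * q s))"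
  shows "snd ` set ps \<subseteq> D"
proof
  fix v assume "v \<in> snd ` set ps"
  then obtain u xs ys where s: "ps = xs @ (u, v) # ys" by (metis imageE split_list surjective_pairing)
  have c: "u \<in> carrier A" "v \<in> carrier B" "set (xs @ ys) \<subseteq> AB" using ps s by auto
  then have S: "fst ` set (xs @ ys) \<subseteq> carrier A" by auto
  have "u \<notin> lin_span A (fst ` set (xs @ ys))"
  proof
    assume "u \<in> lin_span A (fst ` set (xs @ ys))"
    from texp_absorb[OF this S] obtain zs where "length zs = length (xs @ ys)"
      "set zs \<subseteq> AB" "texp zs = ts u v \<oplus>\<^bsub>T\<^esub> texp (xs @ ys)" using c by blast
    then show False using least[of zs] texp_mid[OF c(3,1,2)] s by simp
  qed
  then obtain p where p: "A.lin p" "p u = 1" "\<And>s. s \<in> fst ` set (xs @ ys) \<Longrightarrow> p s = 0"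
    using A.lin_separate[OF S c(1)] by blast
  obtain e where ee: "e \<in> carrier B" "e \<in> D" "\<And>q. B.lin q \<Longrightarrow> q e = sw ps (\<lambda>r s. p r * q s)" using e[OF p(1)] by blast
  have "q e = q v" if "B.lin q" for q
  proof -
    have "sw (xs @ ys) (prd p q) = sw (xs @ ys) (\<lambda>u v. 0)" by (rule sw_cong) (use p(3) in force)
    then show ?thesis using ee(3)[OF that] s p(2) by (simp add: sw_append)
  qed
  then have "e = v" using B.lin_eqI ee(1) c(2) by blast
  then show "v \<in> D" using ee by simp
qed

end

section \<open>Faithful linear representations\<close>

text \<open>The operators act on the free vector space over the type and not on the carrier: a type
  cannot depend on a carrier set, and 1 \<noteq> 0 must hold in every instance of
  \<open>ring_1\<close>.\<close>

typedef (overloaded) ('k::field, 'a) lop =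
  "{F :: ('a \<Rightarrow>\<^sub>0 'k) \<Rightarrow> ('a \<Rightarrow>\<^sub>0 'k). (\<forall>x y. F (x + y) = F x + F y) \<and> (\<forall>c x. F (pscale c x) = pscale c (F x))}"
  morphisms app Lop
  by (rule exI[of _ id]) simp

lemma app_add: "app F (x + y) = app F x + app F y" and app_scale: "app F (pscale c x) = pscale c (app F x)"
  using app[of F] by auto

lemma app_zero [simp]: "app F 0 = 0"
  using app_add[of F 0 0] by simp

lemma app_Lop:
  "(\<And>x y. F (x + y) = F x + F y) \<Longrightarrow> (\<And>c x. F (pscale c x) = pscale c (F x)) \<Longrightarrow> app (Lop F) = F"
  by (rule Lop_inverse) auto

lemma lop_eqI: "(\<And>x. app F x = app G x) \<Longrightarrow> F = G"
  by (metis app_inject ext)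

instantiation lop :: (field, type) ring_1
begin

definition "0 = Lop (\<lambda>x. 0)"
definition "1 = Lop (\<lambda>x. x)"
definition "F + G = Lop (\<lambda>x. app F x + app G x)"
definition "F - G = Lop (\<lambda>x. app F x - app G x)"
definition "- F = Lop (\<lambda>x. - app F x)"
definition "F * G = Lop (\<lambda>x. app F (app G x))"

lemma app_simps [simp]:
  "app 0 x = 0" "app 1 x = x" "app (F + G) x = app F x + app G x" "app (F - G) x = app F x - app G x"
  "app (- F) x = - app F x" "app (F * G) x = app F (app G x)"
  unfolding zero_lop_def one_lop_def plus_lop_def minus_lop_def uminus_lop_def times_lop_def
  by (subst app_Lop; simp add: app_add app_scale pv.scale_right_distrib pv.scale_right_diff_distrib)+

instance
proof
  have "app (0 :: ('a, 'b) lop) (psingle undefined 1) \<noteq> app 1 (psingle undefined 1)"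
    by (metis app_simps(1,2) Poly_Mapping.lookup_single_eq lookup_zero zero_neq_one)
  then show "(0 :: ('a, 'b) lop) \<noteq> 1" by metis
qed (auto intro!: lop_eqI simp: app_add)

end

definition lscale :: "'k::field \<Rightarrow> ('k, 'a) lop \<Rightarrow> ('k, 'a) lop" where
  "lscale c F = Lop (\<lambda>x. pscale c (app F x))"

lemma app_lscale [simp]: "app (lscale c F) x = pscale c (app F x)"
  unfolding lscale_def
  by (subst app_Lop) (simp_all add: app_add app_scale pv.scale_right_distrib mult.commute)

interpretation L: kalg "lscale :: 'k::field \<Rightarrow> ('k, 'a) lop \<Rightarrow> _"
  by unfold_locales
    (auto intro!: lop_eqI simp: app_scale pv.scale_right_distrib pv.scale_left_distrib)

lemma L_lf_rmult [simp]: "L.lf p \<Longrightarrow> L.lf (\<lambda>u. p u * c)"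
  by (auto simp: L.lf_def algebra_simps)

lemma L_lf_sw: "(\<And>u' v'. L.lf (\<lambda>u. k u u' v')) \<Longrightarrow> L.lf (\<lambda>u. sw xs (k u))"
  by (induction xs) auto

locale kcharacter = kalgebra A for A :: "('k::field, 'a, 'm) module_scheme" (structure) +
  fixes e :: "'a \<Rightarrow> 'k"
  assumes e_lin: "lin e" and e_mult: "x \<in> carrier A \<Longrightarrow> y \<in> carrier A \<Longrightarrow> e (x \<otimes> y) = e x * e y"
    and e_one: "e \<one> = 1"
begin

definition prj :: "('a \<Rightarrow>\<^sub>0 'k) \<Rightarrow> 'a" where
  "prj = lin_ext A (\<lambda>x. if x \<in> carrier A then x else \<zero>)"

lemma prj_closed [simp, intro]: "prj f \<in> carrier A"
  unfolding prj_def by (rule lin_ext_closed) auto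

lemma prj_add: "prj (f + g) = prj f \<oplus> prj g"
  unfolding prj_def by (rule lin_ext_add) auto

lemma prj_scale: "prj (pscale c f) = c \<odot> prj f"
  unfolding prj_def by (rule lin_ext_scale) auto

lemma prj_single: "x \<in> carrier A \<Longrightarrow> prj (psingle x 1) = x"
  using lin_ext_single[of "\<lambda>x. if x \<in> carrier A then x else \<zero>" x 1] by (simp add: prj_def)

lemma prj_diff: "prj f = prj g \<Longrightarrow> prj (f - g) = \<zero>"
proof -
  assume eq: "prj f = prj g"
  have 1: "prj (f - g) \<oplus> prj g = prj f" unfolding prj_add[symmetric] by (simp only: diff_add_cancel)
  have "prj (f - g) = (prj (f - g) \<oplus> prj g) \<oplus> \<ominus> prj g"
    unfolding a_assoc[OF prj_closed prj_closed a_inv_closed[OF prj_closed]] r_neg[OF prj_closed] r_zero[OF prj_closed] ..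
  also have "\<dots> = \<zero>" unfolding 1 eq by (rule r_neg[OF prj_closed])
  finally show ?thesis .
qed

lemma prj_zero [simp]: "prj 0 = \<zero>"
  using prj_diff[of 0 0] by simp

text \<open>A basis of the kernel of \<open>prj\<close> is extended to the whole space. The linear
  map that kills the former and fixes the added vectors depends only on the image under
  \<open>prj\<close>, so applied to points of the carrier it becomes linear.\<close>

lemma ex_section:
  "\<exists>\<sigma>. (\<forall>x\<in>carrier A. \<forall>y\<in>carrier A. \<sigma> (x \<oplus> y) = \<sigma> x + \<sigma> y) \<and>
    (\<forall>c. \<forall>x\<in>carrier A. \<sigma> (c \<odot> x) = pscale c (\<sigma> x)) \<and> (\<forall>x\<in>carrier A. prj (\<sigma> x) = x)"
proof -
  let ?K = "{f. prj f = \<zero>}"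
  have K: "pv.subspace ?K" by (rule pv.subspaceI) (auto simp: prj_add prj_scale)
  obtain B0 where B0: "B0 \<subseteq> ?K" "pv.independent B0" "?K \<subseteq> pv.span B0"
    using pv.maximal_independent_subset by blast
  obtain B where "B0 \<subseteq> B" "B \<subseteq> UNIV" "pv.independent B" "UNIV \<subseteq> pv.span B"
    by (rule pv.maximal_independent_subset_extend[OF subset_UNIV B0(2)])
  note B = this(1,3,4)
  interpret pp: vector_space_pair "pscale :: 'k \<Rightarrow> ('a \<Rightarrow>\<^sub>0 'k) \<Rightarrow> _" "pscale :: 'k \<Rightarrow> ('a \<Rightarrow>\<^sub>0 'k) \<Rightarrow> _"
    by unfold_locales
  obtain E where E: "Vector_Spaces.linear pscale pscale E" "\<forall>x\<in>B. E x = (if x \<in> B0 then 0 else x)"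
    using pp.linear_independent_extend[OF B(2), of "\<lambda>x. if x \<in> B0 then 0 else x"] by blast
  interpret E: Vector_Spaces.linear "pscale :: 'k \<Rightarrow> ('a \<Rightarrow>\<^sub>0 'k) \<Rightarrow> _" "pscale :: 'k \<Rightarrow> ('a \<Rightarrow>\<^sub>0 'k) \<Rightarrow> _" E by fact
  have "pv.subspace {f. E f - f \<in> ?K}"
  proof (rule pv.subspaceI)
    fix f g assume "f \<in> {f. E f - f \<in> ?K}" "g \<in> {f. E f - f \<in> ?K}"
    then have "(E f - f) + (E g - g) \<in> ?K" using pv.subspace_add[OF K] by blast
    then show "f + g \<in> {f. E f - f \<in> ?K}" by (simp add: E.add add_diff_add)
  next
    fix c f assume "f \<in> {f. E f - f \<in> ?K}"
    then have "pscale c (E f - f) \<in> ?K" using pv.subspace_scale[OF K] by blast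
    then show "pscale c f \<in> {f. E f - f \<in> ?K}" by (simp add: E.scale pv.scale_right_diff_distrib)
  qed (simp add: E.zero)
  moreover have "B \<subseteq> {f. E f - f \<in> ?K}"
  proof
    fix f assume "f \<in> B"
    then show "f \<in> {f. E f - f \<in> ?K}"
      using E(2) B0(1) pv.subspace_neg[OF K, of f] by (cases "f \<in> B0") auto
  qed
  ultimately have EK: "E f - f \<in> ?K" for f using pv.span_minimal B(3) by blast
  have "pv.subspace {f. E f = 0}"
    by (rule pv.subspaceI) (simp_all add: E.add E.scale E.zero)
  moreover have "B0 \<subseteq> {f. E f = 0}" using E(2) B(1) by auto
  ultimately have E0: "E f = 0" if "f \<in> ?K" for f using pv.span_minimal B0(3) that by blast
  have pE: "prj (E f) = prj f" for f using prj_add[of "E f - f" f] EK[of f] by simp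
  have Eeq: "E f = E g" if "prj f = prj g" for f g
    using E0[of "f - g"] prj_diff[OF that] by (simp add: E.diff)
  show ?thesis
  proof (intro exI[of _ "\<lambda>x. E (psingle x 1)"] conjI ballI allI)
    fix x y assume "x \<in> carrier A" "y \<in> carrier A"
    then show "E (psingle (x \<oplus> y) 1) = E (psingle x 1) + E (psingle y 1)"
      unfolding E.add[symmetric] by (intro Eeq) (simp add: prj_add prj_single)
  next
    fix c x assume "x \<in> carrier A"
    then show "E (psingle (c \<odot> x) 1) = pscale c (E (psingle x 1))"
      unfolding E.scale[symmetric] by (intro Eeq) (simp only: prj_scale prj_single sc_closed)
  qed (simp add: pE prj_single)
qed

definition sec :: "'a \<Rightarrow> ('a \<Rightarrow>\<^sub>0 'k)" where
  "sec = (SOME \<sigma>. (\<forall>x\<in>carrier A. \<forall>y\<in>carrier A. \<sigma> (x \<oplus> y) = \<sigma> x + \<sigma> y) \<and>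
    (\<forall>c. \<forall>x\<in>carrier A. \<sigma> (c \<odot> x) = pscale c (\<sigma> x)) \<and> (\<forall>x\<in>carrier A. prj (\<sigma> x) = x))"

lemma sec_add: "x \<in> carrier A \<Longrightarrow> y \<in> carrier A \<Longrightarrow> sec (x \<oplus> y) = sec x + sec y"
  and sec_scale: "x \<in> carrier A \<Longrightarrow> sec (c \<odot> x) = pscale c (sec x)"
  and prj_sec: "x \<in> carrier A \<Longrightarrow> prj (sec x) = x"
  using someI_ex[OF ex_section] unfolding sec_def[symmetric] by blast+

text \<open>On the complement of the section, \<open>u\<close> acts as the scalar \<open>e u\<close>: this makes the
  representation unital although the carrier is only a quotient of the representation space.\<close>

definition rho :: "'a \<Rightarrow> ('k, 'a) lop" where
  "rho u = Lop (\<lambda>v. sec (u \<otimes> prj v) + pscale (e u) (v - sec (prj v)))"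

lemma app_rho: "u \<in> carrier A \<Longrightarrow> app (rho u) v = sec (u \<otimes> prj v) + pscale (e u) (v - sec (prj v))"
proof -
  assume u: "u \<in> carrier A"
  have "app (Lop (\<lambda>v. sec (u \<otimes> prj v) + pscale (e u) (v - sec (prj v)))) = (\<lambda>v. sec (u \<otimes> prj v) + pscale (e u) (v - sec (prj v)))"
  proof (rule app_Lop)
    fix x y
    show "sec (u \<otimes> prj (x + y)) + pscale (e u) (x + y - sec (prj (x + y))) =
      sec (u \<otimes> prj x) + pscale (e u) (x - sec (prj x)) + (sec (u \<otimes> prj y) + pscale (e u) (y - sec (prj y)))"
      using u by (simp add: prj_add r_distr sec_add pv.scale_right_distrib pv.scale_right_diff_distrib)
  next
    fix c x
    show "sec (u \<otimes> prj (pscale c x)) + pscale (e u) (pscale c x - sec (prj (pscale c x))) =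
      pscale c (sec (u \<otimes> prj x) + pscale (e u) (x - sec (prj x)))"
      using u by (simp add: prj_scale sc_mult_r sec_scale pv.scale_right_distrib pv.scale_right_diff_distrib mult.commute[of c])
  qed
  then show ?thesis by (simp add: rho_def)
qed

lemma prj_rho: "u \<in> carrier A \<Longrightarrow> prj (app (rho u) v) = u \<otimes> prj v"
  by (simp add: app_rho prj_add prj_scale prj_sec prj_diff)

lemma rho_add: "u \<in> carrier A \<Longrightarrow> v \<in> carrier A \<Longrightarrow> rho (u \<oplus> v) = rho u + rho v"
  by (rule lop_eqI) (simp add: app_rho l_distr sec_add lin_simps[OF e_lin] pv.scale_left_distrib)

lemma rho_scale: "u \<in> carrier A \<Longrightarrow> rho (c \<odot> u) = lscale c (rho u)"
  by (rule lop_eqI) (simp add: app_rho sc_mult_l sec_scale lin_simps[OF e_lin] pv.scale_right_distrib)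

lemma rho_mult: "u \<in> carrier A \<Longrightarrow> v \<in> carrier A \<Longrightarrow> rho (u \<otimes> v) = rho u * rho v"
proof (rule lop_eqI)
  fix x assume u: "u \<in> carrier A" and v: "v \<in> carrier A"
  have "app (rho u * rho v) x = sec (u \<otimes> (v \<otimes> prj x)) + pscale (e u) (app (rho v) x - sec (v \<otimes> prj x))"
    using u v by (simp add: app_rho[OF u] prj_rho)
  also have "app (rho v) x - sec (v \<otimes> prj x) = pscale (e v) (x - sec (prj x))" by (simp add: app_rho[OF v])
  finally show "app (rho (u \<otimes> v)) x = app (rho u * rho v) x"
    using u v by (simp add: app_rho m_assoc e_mult)
qed

lemma rho_one: "rho \<one> = 1"
  by (rule lop_eqI) (simp add: app_rho e_one)

text \<open>Evaluation at the unit recovers an element from its operator. It is linear on all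
  operators, so composing with it extends the structure maps of the Hopf algebra linearly beyond the
  image of the representation.\<close>

definition dn :: "('k, 'a) lop \<Rightarrow> 'a" where "dn F = prj (app F (psingle \<one> 1))"

lemma dn_closed [simp, intro]: "dn F \<in> carrier A"
  and dn_add: "dn (F + G) = dn F \<oplus> dn G" and dn_scale: "dn (lscale c F) = c \<odot> dn F"
  by (simp_all add: dn_def prj_add prj_scale)

lemma dn_rho: "u \<in> carrier A \<Longrightarrow> dn (rho u) = u"
  by (simp add: dn_def prj_rho prj_single)

lemma dn_one: "dn 1 = \<one>"
  using dn_rho[of \<one>] by (simp add: rho_one)

lemma rho_inj: "u \<in> carrier A \<Longrightarrow> v \<in> carrier A \<Longrightarrow> rho u = rho v \<longleftrightarrow> u = v"
  using dn_rho by metis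

lemma rho_zero: "rho \<zero> = 0"
  using rho_add[of \<zero> \<zero>] by simp

lemma rho_minus: "u \<in> carrier A \<Longrightarrow> v \<in> carrier A \<Longrightarrow> rho (u \<ominus> v) = rho u - rho v"
  using rho_add[of "u \<ominus> v" v] by (simp add: minus_eq a_assoc l_neg)

lemma rho_pow: "u \<in> carrier A \<Longrightarrow> rho (u [^] (n::nat)) = rho u ^ n"
  by (induction n) (simp_all add: rho_one rho_mult power_commutes)

lemma rho_subspace: "L.subspace (rho ` carrier A)"
proof (rule L.subspaceI)
  show "0 \<in> rho ` carrier A" using rho_zero[symmetric] by blast
qed (auto simp flip: rho_add rho_scale)

lemma lf_rho: "L.lf p \<Longrightarrow> lin (\<lambda>u. p (rho u))"
  by (auto simp: lin_def rho_add rho_scale L.lf_add L.lf_scale)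

lemma lf_dn: "lin p \<Longrightarrow> L.lf (\<lambda>F. p (dn F))"
  by (auto simp: L.lf_def dn_add dn_scale lin_simps)

end

section \<open>Hopf algebras as algebras of operators\<close>

locale hopf_alg =
  fixes U :: "('k::field, 'u) hopf" (structure)
  assumes hU: "hopf_algebra U"

sublocale hopf_alg \<subseteq> UU: kalgebra2 U U
  using hU by unfold_locales (simp_all add: hopf_algebra_def)

sublocale hopf_alg \<subseteq> TU: kalgebra2 "tensor U U" U
  by unfold_locales

sublocale hopf_alg \<subseteq> UT: kalgebra2 U "tensor U U"
  by unfold_locales

lemma (in hopf_alg) counit_hom:
  "UU.A.lin (counit U)" "x \<in> carrier U \<Longrightarrow> y \<in> carrier U \<Longrightarrow> counit U (x \<otimes> y) = counit U x * counit U y"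
  "counit U \<one> = 1"
proof -
  have "counit U \<in> alg_hom U base_algebra" using hU by (simp add: hopf_algebra_def)
  then have h: "counit U \<in> Ring.ring_hom U base_algebra" "counit U \<in> module_hom class_ring U base_algebra"
    by (simp_all add: alg_hom_def)
  show "UU.A.lin (counit U)"
    using module_hom_add[OF h(2)] module_hom_smult[OF h(2)] by (simp add: UU.A.lin_def base_algebra_def)
  show "counit U \<one> = 1" "x \<in> carrier U \<Longrightarrow> y \<in> carrier U \<Longrightarrow> counit U (x \<otimes> y) = counit U x * counit U y"
    using ring_hom_one[OF h(1)] ring_hom_mult[OF h(1), of x y] by (simp_all add: base_algebra_def)
qed

sublocale hopf_alg \<subseteq> H: kcharacter U "counit U"
  by unfold_locales (use counit_hom in auto)

context hopf_alg begin

abbreviation "\<Delta> \<equiv> comult U"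
abbreviation "T \<equiv> tensor U U"
abbreviation "cU \<equiv> carrier U"

lemma comult_hom:
  "h \<in> cU \<Longrightarrow> \<Delta> h \<in> carrier T" "h \<in> cU \<Longrightarrow> h' \<in> cU \<Longrightarrow> \<Delta> (h \<oplus> h') = \<Delta> h \<oplus>\<^bsub>T\<^esub> \<Delta> h'"
  "h \<in> cU \<Longrightarrow> \<Delta> (c \<odot> h) = c \<odot>\<^bsub>T\<^esub> \<Delta> h" "h \<in> cU \<Longrightarrow> h' \<in> cU \<Longrightarrow> \<Delta> (h \<otimes> h') = \<Delta> h \<otimes>\<^bsub>T\<^esub> \<Delta> h'"
  "\<Delta> \<one> = \<one>\<^bsub>T\<^esub>"
proof -
  have "\<Delta> \<in> alg_hom U T" using hU by (simp add: hopf_algebra_def)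
  then have h: "\<Delta> \<in> Ring.ring_hom U T" "\<Delta> \<in> module_hom class_ring U T" by (simp_all add: alg_hom_def)
  show "\<Delta> \<one> = \<one>\<^bsub>T\<^esub>" "h \<in> cU \<Longrightarrow> \<Delta> h \<in> carrier T" "h \<in> cU \<Longrightarrow> h' \<in> cU \<Longrightarrow> \<Delta> (h \<oplus> h') = \<Delta> h \<oplus>\<^bsub>T\<^esub> \<Delta> h'"
    "h \<in> cU \<Longrightarrow> h' \<in> cU \<Longrightarrow> \<Delta> (h \<otimes> h') = \<Delta> h \<otimes>\<^bsub>T\<^esub> \<Delta> h'" "h \<in> cU \<Longrightarrow> \<Delta> (c \<odot> h) = c \<odot>\<^bsub>T\<^esub> \<Delta> h"
    using ring_hom_one[OF h(1)] ring_hom_closed[OF h(1), of h] ring_hom_add[OF h(1), of h h']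
      ring_hom_mult[OF h(1), of h h'] module_hom_smult[OF h(2), of c h] by simp_all
qed

lemma antipode_hom:
  "h \<in> cU \<Longrightarrow> antipode U h \<in> cU"
  "h \<in> cU \<Longrightarrow> h' \<in> cU \<Longrightarrow> antipode U (h \<oplus> h') = antipode U h \<oplus> antipode U h'"
  "h \<in> cU \<Longrightarrow> antipode U (c \<odot> h) = c \<odot> antipode U h"
proof -
  have h: "antipode U \<in> module_hom class_ring U U" using hU by (simp add: hopf_algebra_def)
  show "h \<in> cU \<Longrightarrow> antipode U h \<in> cU" "h \<in> cU \<Longrightarrow> h' \<in> cU \<Longrightarrow> antipode U (h \<oplus> h') = antipode U h \<oplus> antipode U h'"
    "h \<in> cU \<Longrightarrow> antipode U (c \<odot> h) = c \<odot> antipode U h"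
    using module_hom_closed[OF h] module_hom_add[OF h, of h h'] module_hom_smult[OF h, of c h] by auto
qed

abbreviation "\<rho> \<equiv> H.rho"

definition lst :: "('u \<times> 'u \<Rightarrow>\<^sub>0 'k) set \<Rightarrow> ('u \<times> 'u) list" where
  "lst X = (SOME ps. set ps \<subseteq> cU \<times> cU \<and> X = UU.texp ps)"

definition LX :: "('u \<times> 'u \<Rightarrow>\<^sub>0 'k) set \<Rightarrow> (('k, 'u) lop \<times> ('k, 'u) lop) list" where
  "LX X = map (\<lambda>(u, v). (\<rho> u, \<rho> v)) (lst X)"

definition CL :: "('k, 'u) lop set" where "CL = \<rho> ` cU"
definition dl :: "('k, 'u) lop \<Rightarrow> (('k, 'u) lop \<times> ('k, 'u) lop) list" where "dl F = LX (\<Delta> (H.dn F))"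
definition eps :: "('k, 'u) lop \<Rightarrow> 'k" where "eps F = counit U (H.dn F)"
definition SL :: "('k, 'u) lop \<Rightarrow> ('k, 'u) lop" where "SL F = \<rho> (antipode U (H.dn F))"

lemma lst: "X \<in> carrier T \<Longrightarrow> set (lst X) \<subseteq> cU \<times> cU" "X \<in> carrier T \<Longrightarrow> UU.texp (lst X) = X"
  using someI_ex[OF UU.ex_texp[of X]] unfolding lst_def[symmetric] by auto

lemma LX_in: "X \<in> carrier T \<Longrightarrow> set (LX X) \<subseteq> CL \<times> CL"
  using lst(1)[of X] by (auto simp: LX_def CL_def)

lemma bil_lf:
  assumes "\<And>y. L.lf (\<lambda>u. b u y)" "\<And>x. L.lf (b x)"
  shows "UU.bil (\<lambda>u v. b (\<rho> u) (\<rho> v))"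
  using H.lf_rho[OF assms(1)] H.lf_rho[OF assms(2)] by (simp add: UU.bil_def)

lemma sw_LX:
  assumes "X \<in> carrier T" "\<And>y. L.lf (\<lambda>u. b u y)" "\<And>x. L.lf (b x)"
  shows "sw (LX X) b = tl (\<lambda>u v. b (\<rho> u) (\<rho> v)) X"
  using UU.tl_texp[OF bil_lf[where b = b, OF assms(2,3)] lst(1)[OF assms(1)]] lst(2)[OF assms(1)]
  by (simp add: LX_def sw_map)

lemma sw_LX2:
  assumes X: "X \<in> carrier T" and Y: "Y \<in> carrier T"
    and b: "\<And>v u' v'. L.lf (\<lambda>u. b u v u' v')" "\<And>u u' v'. L.lf (\<lambda>v. b u v u' v')"
      "\<And>u v v'. L.lf (\<lambda>u'. b u v u' v')" "\<And>u v u'. L.lf (\<lambda>v'. b u v u' v')"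
  shows "sw (LX X) (\<lambda>u v. sw (LX Y) (b u v)) = tl (\<lambda>u v. tl (\<lambda>u' v'. b (\<rho> u) (\<rho> v) (\<rho> u') (\<rho> v')) Y) X"
proof -
  have "sw (LX X) (\<lambda>u v. sw (LX Y) (b u v)) = tl (\<lambda>u v. sw (LX Y) (b (\<rho> u) (\<rho> v))) X"
    by (rule sw_LX[OF X]; rule L_lf_sw; rule b)
  moreover have "sw (LX Y) (b (\<rho> u) (\<rho> v)) = tl (\<lambda>u' v'. b (\<rho> u) (\<rho> v) (\<rho> u') (\<rho> v')) Y" for u v
    by (rule sw_LX[OF Y]; rule b)
  ultimately show ?thesis by simp
qed

lemma dl_lf:
  assumes "\<And>y. L.lf (\<lambda>u. b u y)" "\<And>x. L.lf (b x)"
  shows "L.lf (\<lambda>F. sw (dl F) b)"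
proof -
  have e: "sw (dl F) b = tl (\<lambda>u v. b (\<rho> u) (\<rho> v)) (\<Delta> (H.dn F))" for F
    unfolding dl_def by (rule sw_LX[OF comult_hom(1)[OF H.dn_closed] assms])
  note l = UU.tl_lin[OF bil_lf[where b = b, OF assms]]
  show ?thesis unfolding L.lf_def e
    by (simp add: H.dn_add H.dn_scale comult_hom UU.T.lin_simps[OF l])
qed

lemma dl_rho:
  assumes "h \<in> cU" "\<And>y. L.lf (\<lambda>u. b u y)" "\<And>x. L.lf (b x)"
  shows "sw (dl (\<rho> h)) b = tl (\<lambda>u v. b (\<rho> u) (\<rho> v)) (\<Delta> h)"
  unfolding dl_def H.dn_rho[OF assms(1)] by (rule sw_LX[OF comult_hom(1)[OF assms(1)] assms(2,3)])

lemma L_eqI: "(\<And>p. L.lf p \<Longrightarrow> p F = p G) \<Longrightarrow> F = G"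
  by (rule L.lf_eqI)

text \<open>A trilinear form viewed as a bilinear form on (U \<otimes> U) \<times> U and on U
  \<times> (U \<otimes> U). Identities in triple tensor products are tested through these two
  readings.\<close>

lemma bil_TU:
  assumes t: "\<And>x y. L.lf (\<lambda>u. t u x y)" "\<And>x y. L.lf (\<lambda>u. t x u y)" "\<And>x y. L.lf (\<lambda>u. t x y u)"
  shows "TU.bil (\<lambda>X w. tl (\<lambda>u v. t (\<rho> u) (\<rho> v) (\<rho> w)) X)"
    "UT.bil (\<lambda>u X. tl (\<lambda>v w. t (\<rho> u) (\<rho> v) (\<rho> w)) X)"
proof -
  have 1: "UU.T.lin (tl (\<lambda>u v. t (\<rho> u) (\<rho> v) (\<rho> w)))" for w
    by (rule UU.tl_lin[OF bil_lf[where b = "\<lambda>u v. t u v (\<rho> w)"]]; rule t)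
  have 2: "UU.T.lin (tl (\<lambda>v w. t (\<rho> u) (\<rho> v) (\<rho> w)))" for u
    by (rule UU.tl_lin[OF bil_lf[where b = "\<lambda>v w. t (\<rho> u) v w"]]; rule t)
  have "UU.A.lin (\<lambda>w. tl (\<lambda>u v. t (\<rho> u) (\<rho> v) (\<rho> w)) X)" if X: "X \<in> carrier T" for X
  proof -
    have "tl (\<lambda>u v. t (\<rho> u) (\<rho> v) (\<rho> w)) X = sw (LX X) (\<lambda>u v. t u v (\<rho> w))" for w
      by (rule sw_LX[OF X, symmetric]; rule t)
    then show ?thesis using H.lf_rho[OF L_lf_sw[where k = "\<lambda>w u v. t u v w", OF t(3)]] by simp
  qed
  then show "TU.bil (\<lambda>X w. tl (\<lambda>u v. t (\<rho> u) (\<rho> v) (\<rho> w)) X)" using 1 by (simp add: TU.bil_def)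
  have "UU.A.lin (\<lambda>w. tl (\<lambda>u v. t (\<rho> w) (\<rho> u) (\<rho> v)) X)" if X: "X \<in> carrier T" for X
  proof -
    have "tl (\<lambda>u v. t (\<rho> w) (\<rho> u) (\<rho> v)) X = sw (LX X) (\<lambda>u v. t (\<rho> w) u v)" for w
      by (rule sw_LX[OF X, symmetric]; rule t)
    then show ?thesis using H.lf_rho[OF L_lf_sw[where k = "\<lambda>w u v. t w u v", OF t(1)]] by simp
  qed
  then show "UT.bil (\<lambda>u X. tl (\<lambda>v w. t (\<rho> u) (\<rho> v) (\<rho> w)) X)" using 2 by (simp add: UT.bil_def)
qed

lemma tensor_map_closed:
  "X \<in> carrier T \<Longrightarrow> tensor_map T U \<Delta> id X \<in> carrier (tensor T U)"
  unfolding tensor_map_def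
  by (rule UU.tensor_lift_closed[OF TU.T.kalgebra_axioms]) (auto simp: comult_hom)

text \<open>The coassociativity axiom is evaluated by one trilinear form; the associator disappears
  because on pure tensors both bracketings give the same value.\<close>

lemma coassoc:
  assumes h: "h \<in> cU"
    and t: "\<And>x y. L.lf (\<lambda>u. t u x y)" "\<And>x y. L.lf (\<lambda>u. t x u y)" "\<And>x y. L.lf (\<lambda>u. t x y u)"
  shows "tl (\<lambda>x w. tl (\<lambda>u v. t (\<rho> u) (\<rho> v) (\<rho> w)) (\<Delta> x)) (\<Delta> h) =
    tl (\<lambda>u x. tl (\<lambda>v w. t (\<rho> u) (\<rho> v) (\<rho> w)) (\<Delta> x)) (\<Delta> h)"
proof -
  let ?b1 = "\<lambda>X w. tl (\<lambda>u v. t (\<rho> u) (\<rho> v) (\<rho> w)) X" and ?b2 = "\<lambda>u X. tl (\<lambda>v w. t (\<rho> u) (\<rho> v) (\<rho> w)) X"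
  note b = bil_TU[of t, OF t]
  have \<Delta>h: "\<Delta> h \<in> carrier T" using h by (rule comult_hom)
  define X where "X = tensor_map T U \<Delta> id (\<Delta> h)"
  have X: "X \<in> carrier (tensor T U)" unfolding X_def by (rule tensor_map_closed[OF \<Delta>h])
  have ax: "tensor_assoc U U U X = tensor_map U T id \<Delta> (\<Delta> h)"
    using hU h by (simp add: hopf_algebra_def X_def)
  have in1: "tensor_lift (tensor U T) (\<lambda>u v. tens U T u (tens U U v w)) Y \<in> carrier (tensor U T)"
    if "Y \<in> carrier T" "w \<in> cU" for Y w
    by (rule UU.tensor_lift_closed[OF UT.T.kalgebra_axioms that(1)]) (use that in auto)
  have "tl ?b2 (tensor_assoc U U U X) = tl (\<lambda>Y w. tl ?b2 (tensor_lift (tensor U T) (\<lambda>u v. tens U T u (tens U U v w)) Y)) X"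
    unfolding tensor_assoc_def
    by (rule TU.lin_lift[OF UT.T.kalgebra_axioms UT.tl_lin[OF b(2)] X in1])
  also have "\<dots> = tl ?b1 X"
  proof (rule TU.tl_cong[OF X])
    fix Y w assume Y: "Y \<in> carrier T" and w: "w \<in> cU"
    have "tl ?b2 (tensor_lift (tensor U T) (\<lambda>u v. tens U T u (tens U U v w)) Y)
      = tl (\<lambda>u v. tl ?b2 (tens U T u (tens U U v w))) Y"
      by (rule UU.lin_lift[OF UT.T.kalgebra_axioms UT.tl_lin[OF b(2)] Y]) (use w in auto)
    also have "\<dots> = ?b1 Y w"
    proof (rule UU.tl_cong[OF Y])
      fix u v assume u: "u \<in> cU" and v: "v \<in> cU"
      have "UU.bil (\<lambda>v w. t (\<rho> u) (\<rho> v) (\<rho> w))" by (rule bil_lf[where b = "\<lambda>v w. t (\<rho> u) v w"]; rule t)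
      then show "tl ?b2 (tens U T u (tens U U v w)) = t (\<rho> u) (\<rho> v) (\<rho> w)"
        using u v w by (simp add: UT.tl_ts[OF b(2)] UU.tl_ts)
    qed
    finally show "tl ?b2 (tensor_lift (tensor U T) (\<lambda>u v. tens U T u (tens U U v w)) Y) = ?b1 Y w" .
  qed
  also have "\<dots> = tl (\<lambda>x w. tl ?b1 (tens T U (\<Delta> x) (id w))) (\<Delta> h)"
    unfolding X_def tensor_map_def
    by (rule UU.lin_lift[OF TU.T.kalgebra_axioms TU.tl_lin[OF b(1)] \<Delta>h]) (auto simp: comult_hom)
  also have "\<dots> = tl (\<lambda>x w. ?b1 (\<Delta> x) w) (\<Delta> h)"
    by (rule UU.tl_cong[OF \<Delta>h]) (simp add: TU.tl_ts[OF b(1)] comult_hom)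
  finally have L: "tl ?b2 (tensor_assoc U U U X) = tl (\<lambda>x w. ?b1 (\<Delta> x) w) (\<Delta> h)" .
  have "tl ?b2 (tensor_map U T id \<Delta> (\<Delta> h)) = tl (\<lambda>u x. tl ?b2 (tens U T (id u) (\<Delta> x))) (\<Delta> h)"
    unfolding tensor_map_def
    by (rule UU.lin_lift[OF UT.T.kalgebra_axioms UT.tl_lin[OF b(2)] \<Delta>h]) (auto simp: comult_hom)
  also have "\<dots> = tl (\<lambda>u x. ?b2 u (\<Delta> x)) (\<Delta> h)"
    by (rule UU.tl_cong[OF \<Delta>h]) (simp add: UT.tl_ts[OF b(2)] comult_hom)
  finally show ?thesis using L ax by simp
qed

text \<open>Converts the element-valued lifts in the counit, antipode and R axioms into list sums of
  operators; the comparison is made one functional at a time.\<close>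

lemma sw_LX_lift:
  assumes X: "X \<in> carrier T"
    and c: "\<And>u v. u \<in> cU \<Longrightarrow> v \<in> cU \<Longrightarrow> c u v \<in> cU \<and> \<rho> (c u v) = b (\<rho> u) (\<rho> v)"
    and b: "\<And>p y. L.lf p \<Longrightarrow> L.lf (\<lambda>u. p (b u y))" "\<And>p x. L.lf p \<Longrightarrow> L.lf (\<lambda>v. p (b x v))"
  shows "sw (LX X) b = \<rho> (tensor_lift U c X)"
proof (rule L_eqI)
  fix p :: "('k, 'u) lop \<Rightarrow> 'k" assume p: "L.lf p"
  have "p (sw (LX X) b) = sw (LX X) (\<lambda>u v. p (b u v))" by (rule L.lf_sw[OF p])
  also have "\<dots> = tl (\<lambda>u v. p (b (\<rho> u) (\<rho> v))) X" by (rule sw_LX[OF X b(1)[OF p] b(2)[OF p]])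
  also have "\<dots> = tl (\<lambda>u v. p (\<rho> (c u v))) X" by (rule UU.tl_cong[OF X]) (simp add: c)
  also have "\<dots> = p (\<rho> (tensor_lift U c X))"
    by (rule UU.lin_lift[OF UU.A.kalgebra_axioms H.lf_rho[OF p] X, symmetric]) (use c in blast)
  finally show "p (sw (LX X) b) = p (\<rho> (tensor_lift U c X))" .
qed

lemma eps_rho: "h \<in> cU \<Longrightarrow> eps (\<rho> h) = counit U h"
  and SL_rho: "h \<in> cU \<Longrightarrow> SL (\<rho> h) = \<rho> (antipode U h)"
  by (simp_all add: eps_def SL_def H.dn_rho)

lemma eps_lf: "L.lf eps"
  unfolding eps_def by (rule H.lf_dn[OF counit_hom(1)])

lemma SL_lin: "SL (x + y) = SL x + SL y" "SL (lscale c x) = lscale c (SL x)"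
  by (simp_all add: SL_def H.dn_add H.dn_scale antipode_hom H.rho_add H.rho_scale)

lemma SL_lf: "L.lf p \<Longrightarrow> L.lf (\<lambda>u. p (SL u * y))" "L.lf p \<Longrightarrow> L.lf (\<lambda>u. p (y * SL u))"
  by (auto simp: L.lf_def SL_lin algebra_simps L.scale_mult_left L.scale_mult_right)

lemma hopf_data: "hopf_data lscale CL dl eps SL"
proof unfold_locales
  show "L.subspace CL" unfolding CL_def by (rule H.rho_subspace)
  show "1 \<in> CL" unfolding CL_def using H.rho_one by (metis UU.A.one_closed image_eqI)
  show "x * y \<in> CL" if "x \<in> CL" "y \<in> CL" for x y using that by (auto simp: CL_def simp flip: H.rho_mult)
  show "set (dl h) \<subseteq> CL \<times> CL" for h unfolding dl_def by (rule LX_in) (simp add: comult_hom)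
  fix p q :: "('k, 'u) lop \<Rightarrow> 'k" and x y c assume p: "L.lf p" and q: "L.lf q"
  have pq: "L.lf (\<lambda>F. sw (dl F) (prd p q))" by (rule dl_lf) (use p q in auto)
  show "sw (dl (x + y)) (prd p q) = sw (dl x) (prd p q) + sw (dl y) (prd p q)"
    "sw (dl (lscale c x)) (prd p q) = c * sw (dl x) (prd p q)"
    using L.lf_add[OF pq] L.lf_scale[OF pq] by simp_all
  show "sw (dl 1) (prd p q) = p 1 * q 1"
  proof -
    have "sw (dl (\<rho> \<one>)) (prd p q) = tl (\<lambda>u v. p (\<rho> u) * q (\<rho> v)) (\<Delta> \<one>)"
      by (rule dl_rho) (use p q in auto)
    then show ?thesis
      using UU.tl_ts[OF UU.bil_prod[OF H.lf_rho[OF p] H.lf_rho[OF q]], of "\<one>" "\<one>"]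
      by (simp add: H.rho_one comult_hom UU.T_one)
  qed
  show "sw (dl (h * h')) (prd p q) = sw (dl h) (\<lambda>u v. sw (dl h') (\<lambda>u' v'. p (u * u') * q (v * v')))"
    if h: "h \<in> CL" and h': "h' \<in> CL" for h h'
  proof -
    obtain u v where u: "u \<in> cU" "h = \<rho> u" and v: "v \<in> cU" "h' = \<rho> v" using h h' by (auto simp: CL_def)
    have "sw (dl (\<rho> (u \<otimes> v))) (prd p q) = tl (\<lambda>u v. p (\<rho> u) * q (\<rho> v)) (\<Delta> (u \<otimes> v))"
      by (rule dl_rho) (use p q u v in auto)
    also have "\<dots> = tl (\<lambda>x y. tl (\<lambda>x' y'. p (\<rho> (x \<otimes> x')) * q (\<rho> (y \<otimes> y'))) (\<Delta> v)) (\<Delta> u)"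
      unfolding comult_hom(4)[OF u(1) v(1)]
      by (rule UU.tl_mult[OF UU.bil_prod[OF H.lf_rho[OF p] H.lf_rho[OF q]]]) (use u v comult_hom in auto)
    also have "\<dots> = tl (\<lambda>x y. tl (\<lambda>x' y'. p (\<rho> x * \<rho> x') * q (\<rho> y * \<rho> y')) (\<Delta> v)) (\<Delta> u)"
      by (intro UU.tl_cong) (use u v comult_hom in \<open>auto simp: H.rho_mult\<close>)
    also have "\<dots> = sw (LX (\<Delta> u)) (\<lambda>x y. sw (LX (\<Delta> v)) (\<lambda>x' y'. p (x * x') * q (y * y')))"
      by (rule sw_LX2[symmetric]) (use u v comult_hom p q in auto)
    finally show ?thesis using u v by (simp add: H.rho_mult dl_def H.dn_rho)
  qed
next
  fix h and t :: "('k, 'u) lop \<Rightarrow> ('k, 'u) lop \<Rightarrow> ('k, 'u) lop \<Rightarrow> 'k"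
  assume h: "h \<in> CL" and t: "\<And>x y. L.lf (\<lambda>u. t u x y)" "\<And>x y. L.lf (\<lambda>u. t x u y)" "\<And>x y. L.lf (\<lambda>u. t x y u)"
  obtain u where u: "u \<in> cU" "h = \<rho> u" using h by (auto simp: CL_def)
  have \<Delta>u: "\<Delta> u \<in> carrier T" using u by (simp add: comult_hom)
  have "sw (dl h) (\<lambda>u v. sw (dl u) (\<lambda>u1 u2. t u1 u2 v)) = tl (\<lambda>x w. sw (dl (\<rho> x)) (\<lambda>u1 u2. t u1 u2 (\<rho> w))) (\<Delta> u)"
    unfolding u(2) by (rule dl_rho[OF u(1)]) (intro dl_lf L_lf_sw t)+
  also have "\<dots> = tl (\<lambda>x w. tl (\<lambda>u v. t (\<rho> u) (\<rho> v) (\<rho> w)) (\<Delta> x)) (\<Delta> u)"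
    by (rule UU.tl_cong[OF \<Delta>u], rule dl_rho, assumption) (rule t)+
  also have "\<dots> = tl (\<lambda>u x. tl (\<lambda>v w. t (\<rho> u) (\<rho> v) (\<rho> w)) (\<Delta> x)) (\<Delta> u)" by (rule coassoc[OF u(1) t])
  also have "\<dots> = tl (\<lambda>x w. sw (dl (\<rho> w)) (\<lambda>v1 v2. t (\<rho> x) v1 v2)) (\<Delta> u)"
    by (rule UU.tl_cong[OF \<Delta>u], rule dl_rho[symmetric], assumption) (rule t)+
  also have "\<dots> = sw (dl h) (\<lambda>u v. sw (dl v) (\<lambda>v1 v2. t u v1 v2))"
    unfolding u(2) by (rule dl_rho[OF u(1), symmetric]) (intro dl_lf L_lf_sw t)+
  finally show "sw (dl h) (\<lambda>u v. sw (dl u) (\<lambda>u1 u2. t u1 u2 v)) = sw (dl h) (\<lambda>u v. sw (dl v) (\<lambda>v1 v2. t u v1 v2))" .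
next
  show "L.lf eps" by (rule eps_lf)
  show "eps 1 = 1" by (simp add: eps_def H.dn_one counit_hom)
  show "SL (x + y) = SL x + SL y" "SL (lscale c x) = lscale c (SL x)" for x y c by (rule SL_lin)+
  show "SL x \<in> CL" for x by (simp add: SL_def CL_def antipode_hom)
  show "eps (x * y) = eps x * eps y" if xy: "x \<in> CL" "y \<in> CL" for x y
  proof -
    obtain u v where "u \<in> cU" "x = \<rho> u" "v \<in> cU" "y = \<rho> v" using xy by (auto simp: CL_def)
    then show ?thesis by (simp add: eps_rho counit_hom flip: H.rho_mult)
  qed
next
  fix h assume "h \<in> CL"
  then obtain u where u: "u \<in> cU" "h = \<rho> u" by (auto simp: CL_def)
  have d: "dl h = LX (\<Delta> u)" and \<Delta>u: "\<Delta> u \<in> carrier T" using u by (simp_all add: dl_def H.dn_rho comult_hom)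
  have ax: "tensor_lift U (\<lambda>u v. counit U u \<odot> v) (\<Delta> u) = u" "tensor_lift U (\<lambda>u v. counit U v \<odot> u) (\<Delta> u) = u"
    "tensor_lift U (\<lambda>u v. antipode U u \<otimes> v) (\<Delta> u) = counit U u \<odot> \<one>"
    "tensor_lift U (\<lambda>u v. u \<otimes> antipode U v) (\<Delta> u) = counit U u \<odot> \<one>"
    using hU u(1) by (simp_all add: hopf_algebra_def)
  have lf: "L.lf (\<lambda>u. p (lscale (eps u) y))" "L.lf (\<lambda>u. p (lscale c u))" if "L.lf p" for p :: "('k, 'u) lop \<Rightarrow> 'k" and y c
    using that eps_lf by (auto simp: L.lf_def algebra_simps)
  have "sw (dl h) (\<lambda>u v. lscale (eps u) v) = \<rho> (tensor_lift U (\<lambda>u v. counit U u \<odot> v) (\<Delta> u))"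
    unfolding d by (rule sw_LX_lift[OF \<Delta>u]) (auto simp: H.rho_scale eps_rho lf)
  then show "sw (dl h) (\<lambda>u v. lscale (eps u) v) = h" using ax u by simp
  have "sw (dl h) (\<lambda>u v. lscale (eps v) u) = \<rho> (tensor_lift U (\<lambda>u v. counit U v \<odot> u) (\<Delta> u))"
    unfolding d by (rule sw_LX_lift[OF \<Delta>u]) (auto simp: H.rho_scale eps_rho lf)
  then show "sw (dl h) (\<lambda>u v. lscale (eps v) u) = h" using ax u by simp
  have "sw (dl h) (\<lambda>u v. SL u * v) = \<rho> (tensor_lift U (\<lambda>u v. antipode U u \<otimes> v) (\<Delta> u))"
    unfolding d by (rule sw_LX_lift[OF \<Delta>u]) (auto simp: H.rho_mult SL_rho SL_lf antipode_hom)
  then show "sw (dl h) (\<lambda>u v. SL u * v) = lscale (eps h) 1" using ax u by (simp add: H.rho_scale H.rho_one eps_rho)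
  have "sw (dl h) (\<lambda>u v. u * SL v) = \<rho> (tensor_lift U (\<lambda>u v. u \<otimes> antipode U v) (\<Delta> u))"
    unfolding d by (rule sw_LX_lift[OF \<Delta>u]) (auto simp: H.rho_mult SL_rho SL_lf antipode_hom)
  then show "sw (dl h) (\<lambda>u v. u * SL v) = lscale (eps h) 1" using ax u by (simp add: H.rho_scale H.rho_one eps_rho)
qed

end

sublocale hopf_alg \<subseteq> hd: hopf_data lscale CL dl eps SL
  by (rule hopf_data)

context hopf_alg begin

lemma cv_rho:
  assumes "h \<in> cU" "L.lf p" "L.lf q"
  shows "hd.cv p q (\<rho> h) = tl (\<lambda>u v. p (\<rho> u) * q (\<rho> v)) (\<Delta> h)"
  unfolding hd.cv_def by (rule dl_rho) (use assms in auto)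

lemma tl_prod_lin:
  assumes "X \<in> carrier T" "UU.A.lin p" "UU.A.lin q"
  shows "tl (prd p q) X = tl (\<lambda>u v. p (H.dn (\<rho> u)) * q (H.dn (\<rho> v))) X"
  by (rule UU.tl_cong[OF assms(1)]) (simp add: H.dn_rho)

lemma gl_rho:
  assumes "h \<in> grouplikes U"
  shows "hd.gl (\<rho> h)"
proof (rule hd.glI)
  have h: "h \<in> cU" "\<Delta> h = tens U U h h" using assms by (auto simp: grouplikes_def)
  show "\<rho> h \<in> CL" using h by (simp add: CL_def)
  fix p :: "('k, 'u) lop \<Rightarrow> 'k" assume p: "L.lf p"
  show "hd.Lc p (\<rho> h) = lscale (p (\<rho> h)) (\<rho> h)"
  proof (rule L_eqI)
    fix q :: "('k, 'u) lop \<Rightarrow> 'k" assume q: "L.lf q"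
    show "q (hd.Lc p (\<rho> h)) = q (lscale (p (\<rho> h)) (\<rho> h))"
      unfolding hd.Lc_pair[OF q] cv_rho[OF h(1) p q] h(2)
      using UU.tl_ts[OF UU.bil_prod[OF H.lf_rho[OF p] H.lf_rho[OF q]] h(1) h(1)] by (simp add: L.lf_scale[OF q])
  qed
qed

lemma tl_sp:
  assumes "L.lf p" "L.lf q" "z \<in> cU" "h \<in> cU"
  shows "tl (\<lambda>u v. p (\<rho> u) * q (\<rho> v)) (tens U U z h \<oplus>\<^bsub>T\<^esub> tens U U \<one> z) =
    p (\<rho> z) * q (\<rho> h) + p 1 * q (\<rho> z)"
proof -
  note b = UU.bil_prod[OF H.lf_rho[OF assms(1)] H.lf_rho[OF assms(2)]]
  show ?thesis using assms(3,4)
    by (simp add: UU.T.lin_simps[OF UU.tl_lin[OF b]] UU.tl_ts[OF b] H.rho_one)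
qed

lemma sp_rho:
  assumes h: "h \<in> cU" and z: "z \<in> cU"
  shows "hd.sp (\<rho> h) (\<rho> z) \<longleftrightarrow> z \<in> skew_primitives U h \<one>"
proof
  assume "z \<in> skew_primitives U h \<one>"
  then have D: "\<Delta> z = tens U U z h \<oplus>\<^bsub>T\<^esub> tens U U \<one> z" by (simp add: skew_primitives_def)
  show "hd.sp (\<rho> h) (\<rho> z)"
    unfolding hd.sp_def
  proof (intro conjI allI impI)
    show "\<rho> z \<in> CL" using z by (simp add: CL_def)
    fix p :: "('k, 'u) lop \<Rightarrow> 'k" assume p: "L.lf p"
    show "hd.Lc p (\<rho> z) = lscale (p (\<rho> z)) (\<rho> h) + lscale (p 1) (\<rho> z)"
    proof (rule L_eqI)
      fix q :: "('k, 'u) lop \<Rightarrow> 'k" assume q: "L.lf q"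
      show "q (hd.Lc p (\<rho> z)) = q (lscale (p (\<rho> z)) (\<rho> h) + lscale (p 1) (\<rho> z))"
        unfolding hd.Lc_pair[OF q] cv_rho[OF z p q] D tl_sp[OF p q z h]
        by (simp add: L.lf_add[OF q] L.lf_scale[OF q])
    qed
  qed
next
  assume s: "hd.sp (\<rho> h) (\<rho> z)"
  have \<Delta>z: "\<Delta> z \<in> carrier T" using z by (rule comult_hom)
  have r: "tens U U z h \<oplus>\<^bsub>T\<^esub> tens U U \<one> z \<in> carrier T" using z h by simp
  have "\<Delta> z = tens U U z h \<oplus>\<^bsub>T\<^esub> tens U U \<one> z"
  proof (rule UU.T_eqI[OF \<Delta>z r])
    fix p q assume pq: "UU.A.lin p" "UU.A.lin q"
    note P = H.lf_dn[OF pq(1)] and Q = H.lf_dn[OF pq(2)]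
    have "(\<lambda>F. q (H.dn F)) (hd.Lc (\<lambda>F. p (H.dn F)) (\<rho> z)) =
      p (H.dn (\<rho> z)) * q (H.dn (\<rho> h)) + p (H.dn 1) * q (H.dn (\<rho> z))"
      using s P by (simp add: hd.sp_def L.lf_add[OF Q] L.lf_scale[OF Q])
    then show "tl (prd p q) (\<Delta> z) = tl (prd p q) (tens U U z h \<oplus>\<^bsub>T\<^esub> tens U U \<one> z)"
      unfolding tl_prod_lin[OF \<Delta>z pq] tl_prod_lin[OF r pq] tl_sp[OF P Q z h] hd.Lc_pair[OF Q] cv_rho[OF z P Q] .
  qed
  then show "z \<in> skew_primitives U h \<one>" using z by (simp add: skew_primitives_def)
qed

lemma sp_rho_set:
  assumes "h \<in> cU"
  shows "{z. hd.sp (\<rho> h) z} = \<rho> ` skew_primitives U h \<one>"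
proof -
  have "z \<in> \<rho> ` cU" if "hd.sp (\<rho> h) z" for z
    using that unfolding hd.sp_def by (simp add: CL_def[symmetric])
  moreover have "skew_primitives U h \<one> \<subseteq> cU" by (auto simp: skew_primitives_def)
  ultimately show ?thesis using sp_rho[OF assms] by blast
qed

lemma rho_submodule:
  assumes P: "submodule class_ring P U"
  shows "L.subspace (\<rho> ` P)"
proof -
  note PU = submodule.subset[OF P]
  show ?thesis
  proof (rule L.subspaceI)
    show "0 \<in> \<rho> ` P" using H.rho_zero[symmetric] P by (simp add: submodule_def)
  next
    fix x y assume "x \<in> \<rho> ` P" "y \<in> \<rho> ` P"
    then obtain u v where u: "u \<in> P" "x = \<rho> u" and v: "v \<in> P" "y = \<rho> v" by blast
    then have "x + y = \<rho> (u \<oplus> v)" using H.rho_add[OF subsetD[OF PU] subsetD[OF PU], of u v] by simp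
    moreover have "u \<oplus> v \<in> P" using u v P by (simp add: submodule_def)
    ultimately show "x + y \<in> \<rho> ` P" by blast
  next
    fix c x assume "x \<in> \<rho> ` P"
    then obtain u where u: "u \<in> P" "x = \<rho> u" by blast
    then have "lscale c x = \<rho> (c \<odot> u)" "c \<odot> u \<in> P" using PU H.rho_scale[of u c] P by (auto simp: submodule_def)
    then show "lscale c x \<in> \<rho> ` P" by blast
  qed
qed

lemma rho_span:
  assumes S: "S \<subseteq> cU"
  shows "\<rho> ` lin_span U S = L.span (\<rho> ` S)"
proof
  note sp = UU.A.lin_span_closed[OF S]
  show "\<rho> ` lin_span U S \<subseteq> L.span (\<rho> ` S)"
  proof
    fix y assume "y \<in> \<rho> ` lin_span U S"
    then obtain x where x: "x \<in> lin_span U S" "y = \<rho> x" by blast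
    have "\<rho> x \<in> L.span (\<rho> ` S)" using x(1) S
      by (induction x rule: UU.A.lin_span_induct)
         (auto simp: H.rho_zero H.rho_add H.rho_scale intro: L.span_zero L.span_add L.span_scale L.span_base)
    then show "y \<in> L.span (\<rho> ` S)" using x by simp
  qed
  have "L.subspace (\<rho> ` lin_span U S)" by (rule rho_submodule[OF UU.A.lin_span_submodule[OF S]])
  then show "L.span (\<rho> ` S) \<subseteq> \<rho> ` lin_span U S" by (rule L.span_minimal[rotated]) (use sp(5) in blast)
qed

lemma preimage_subalgebra:
  assumes D: "L.subspace D" "1 \<in> D" "\<And>x y. x \<in> D \<Longrightarrow> y \<in> D \<Longrightarrow> x * y \<in> D"
  shows "subalgebra_of {u \<in> cU. \<rho> u \<in> D} U"
proof -
  let ?B = "{u \<in> cU. \<rho> u \<in> D}"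
  have add: "u \<in> ?B \<Longrightarrow> v \<in> ?B \<Longrightarrow> u \<oplus> v \<in> ?B" for u v using L.subspace_add[OF D(1)] by (simp add: H.rho_add)
  have sc: "u \<in> ?B \<Longrightarrow> c \<odot> u \<in> ?B" for u c using L.subspace_scale[OF D(1)] by (simp add: H.rho_scale)
  have "subring ?B U"
  proof (rule UU.A.subringI)
    show "\<one> \<in> ?B" using D(2) by (simp add: H.rho_one)
    show "\<ominus> h \<in> ?B" if "h \<in> ?B" for h using sc[OF that, of "- 1"] that by (simp add: UU.A.sc_neg)
    show "h1 \<otimes> h2 \<in> ?B" if "h1 \<in> ?B" "h2 \<in> ?B" for h1 h2 using that D(3) by (simp add: H.rho_mult)
    show "h1 \<oplus> h2 \<in> ?B" if "h1 \<in> ?B" "h2 \<in> ?B" for h1 h2 by (rule add[OF that])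
  qed auto
  moreover have "submodule class_ring ?B U"
    by (rule UU.A.submoduleI) (use add sc L.subspace_0[OF D(1)] H.rho_zero in auto)
  ultimately show ?thesis using UU.A.vs by (simp add: subalgebra_of_def VectorSpace.subspace_def)
qed

text \<open>The dimension of a record vector space is the least size of a spanning set, so a maximal
  independent set is compared with a smallest spanning set in both directions.\<close>

lemma dim_rho:
  assumes P: "submodule class_ring P U"
    and fd: "vectorspace.fin_dim class_ring (U\<lparr>carrier := P\<rparr>)" and d: "vectorspace.dim class_ring (U\<lparr>carrier := P\<rparr>) = n"
  shows "\<exists>B. finite B \<and> card B = n \<and> L.independent B \<and> L.span B = \<rho> ` P"
proof -
  have PU: "P \<subseteq> cU" using P by (simp add: submodule_def)
  have vsP: "vectorspace class_ring (U\<lparr>carrier := P\<rparr>)"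
    by (rule vectorspace.subspace_is_vs[OF UU.A.vs]) (simp add: VectorSpace.subspace_def UU.A.vs P)
  have sub: "L.subspace (\<rho> ` P)" by (rule rho_submodule[OF P])
  have gen: "LinearCombinations.module.span class_ring (U\<lparr>carrier := P\<rparr>) A = P \<longleftrightarrow> L.span (\<rho> ` A) = \<rho> ` P" if "A \<subseteq> P" for A
  proof -
    have "LinearCombinations.module.span class_ring (U\<lparr>carrier := P\<rparr>) A = lin_span U A"
      by (rule LinearCombinations.module.span_li_not_depend[OF UU.A.mdl that P])
    moreover have "lin_span U A \<subseteq> cU" using UU.A.lin_span_closed(1)[of A] that PU by auto
    ultimately show ?thesis using rho_span[of A] that PU inj_on_image_eq_iff[of \<rho> cU "lin_span U A" P] H.rho_inj
      by (auto simp: inj_on_def)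
  qed
  let ?G = "\<lambda>n. \<exists>A. finite A \<and> card A = n \<and> A \<subseteq> P \<and> L.span (\<rho> ` A) = \<rho> ` P"
  have dim: "(LEAST n. ?G n) = n" using d gen unfolding vectorspace.dim_def[OF vsP] by (simp cong: conj_cong)
  have "\<exists>n. ?G n" using fd gen unfolding vectorspace.fin_dim_def[OF vsP] by auto
  then have "?G n" using LeastI_ex[of ?G] dim by simp
  then obtain A where A: "finite A" "card A = n" "A \<subseteq> P" "L.span (\<rho> ` A) = \<rho> ` P" by blast
  obtain B where B: "B \<subseteq> \<rho> ` P" "L.independent B" "\<rho> ` P \<subseteq> L.span B"
    using L.maximal_independent_subset by blast
  have sB: "L.span B = \<rho> ` P" using L.span_minimal[OF B(1) sub] B(3) by blast
  have fB: "finite B" "card B \<le> card (\<rho> ` A)"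
    using L.independent_span_bound[of "\<rho> ` A" B] A B by auto
  then have "card B \<le> n" using card_image_le[OF A(1), of \<rho>] A(2) by linarith
  moreover have "n \<le> card B"
  proof -
    define B' where "B' = H.dn ` B"
    have dn: "\<rho> (H.dn x) = x \<and> H.dn x \<in> P" if xB: "x \<in> B" for x
    proof -
      obtain u where u: "u \<in> P" "x = \<rho> u" using xB B(1) by blast
      then show ?thesis using H.dn_rho[OF subsetD[OF PU u(1)]] by simp
    qed
    have B'B: "\<rho> ` B' = B" unfolding B'_def image_image by (simp add: dn cong: image_cong_simp)
    have "B' \<subseteq> P" unfolding B'_def using dn by blast
    moreover have "card B' = card B"
    proof (rule antisym)
      show "card B' \<le> card B" unfolding B'_def by (rule card_image_le[OF fB(1)])
      show "card B \<le> card B'" using card_image_le[of B' \<rho>] fB(1) B'B by (simp add: B'_def)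
    qed
    ultimately have "?G (card B)" using fB(1) B'B sB by (intro exI[of _ B']) (auto simp: B'_def)
    then show ?thesis using Least_le[of ?G "card B"] dim by simp
  qed
  ultimately show ?thesis using fB(1) B(2) sB by auto
qed

text \<open>On a grouplike the antipode axioms evaluate to S(h) h = 1 = h S(h), since the coproduct
  is a single pure tensor.\<close>

lemma unit_inverse:
  assumes "h \<in> grouplikes U"
  shows "h \<in> Units U" "antipode U h \<otimes> h = \<one>" "h \<otimes> antipode U h = \<one>"
proof -
  have h: "h \<in> cU" "\<Delta> h = tens U U h h" "counit U h = 1" using assms by (auto simp: grouplikes_def)
  have ax: "tensor_lift U (\<lambda>u v. antipode U u \<otimes> v) (\<Delta> h) = \<one>"
    "tensor_lift U (\<lambda>u v. u \<otimes> antipode U v) (\<Delta> h) = \<one>"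
  proof -
    have "tensor_lift U (\<lambda>u v. antipode U u \<otimes> v) (\<Delta> h) = counit U h \<odot> \<one>"
      "tensor_lift U (\<lambda>u v. u \<otimes> antipode U v) (\<Delta> h) = counit U h \<odot> \<one>"
      using hU h(1) unfolding hopf_algebra_def by blast+
    then show "tensor_lift U (\<lambda>u v. antipode U u \<otimes> v) (\<Delta> h) = \<one>"
      "tensor_lift U (\<lambda>u v. u \<otimes> antipode U v) (\<Delta> h) = \<one>" unfolding h(3) by simp_all
  qed
  have ev: "tensor_lift U b (tens U U h h) = b h h"
    if b: "\<And>u v. u \<in> cU \<Longrightarrow> v \<in> cU \<Longrightarrow> b u v \<in> cU" "\<And>\<phi>. UU.A.lin \<phi> \<Longrightarrow> UU.bil (\<lambda>u v. \<phi> (b u v))" for b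
  proof (rule UU.A.lin_eqI)
    show "tensor_lift U b (tens U U h h) \<in> cU"
      by (rule UU.tensor_lift_closed[OF UU.A.kalgebra_axioms]) (use h b in auto)
    fix \<phi> assume \<phi>: "UU.A.lin \<phi>"
    show "\<phi> (tensor_lift U b (tens U U h h)) = \<phi> (b h h)"
      using UU.lin_lift[OF UU.A.kalgebra_axioms \<phi>, of "tens U U h h" b] b(1) h
        UU.tl_ts[OF b(2)[OF \<phi>] h(1) h(1)] by simp
  qed (use b h in auto)
  have "UU.bil (\<lambda>u v. \<phi> (antipode U u \<otimes> v))" "UU.bil (\<lambda>u v. \<phi> (u \<otimes> antipode U v))" if \<phi>: "UU.A.lin \<phi>" for \<phi>
    unfolding UU.bil_def UU.A.lin_def
    by (auto simp: antipode_hom UU.A.l_distr UU.A.r_distr UU.A.sc_mult_l UU.A.sc_mult_r UU.A.lin_simps[OF \<phi>])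
  then show 1: "antipode U h \<otimes> h = \<one>" "h \<otimes> antipode U h = \<one>"
    using ev[of "\<lambda>u v. antipode U u \<otimes> v"] ev[of "\<lambda>u v. u \<otimes> antipode U v"] ax h antipode_hom(1) by auto
  then show "h \<in> Units U" using h antipode_hom(1)[OF h(1)] by (auto simp: Units_def)
qed

lemma tl_map_left:
  assumes R: "R \<in> carrier T" and lf: "L.lf p" "L.lf q" "L.lf t"
  shows "tl (\<lambda>X w. tl (\<lambda>u v. p (\<rho> u) * q (\<rho> v) * t (\<rho> w)) X) (tensor_map T U \<Delta> id R) =
    tl (\<lambda>x w. hd.cv p q (\<rho> x) * t (\<rho> w)) R"
proof -
  have b: "TU.bil (\<lambda>X w. tl (\<lambda>u v. p (\<rho> u) * q (\<rho> v) * t (\<rho> w)) X)"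
    by (rule bil_TU(1)[of "\<lambda>u v w. p u * q v * t w"]) (use lf in auto)
  have "tl (\<lambda>X w. tl (\<lambda>u v. p (\<rho> u) * q (\<rho> v) * t (\<rho> w)) X) (tensor_map T U \<Delta> id R) =
    tl (\<lambda>x w. tl (\<lambda>X w. tl (\<lambda>u v. p (\<rho> u) * q (\<rho> v) * t (\<rho> w)) X) (tens T U (\<Delta> x) (id w))) R"
    unfolding tensor_map_def
    by (rule UU.lin_lift[OF TU.T.kalgebra_axioms TU.tl_lin[OF b] R]) (auto simp: comult_hom)
  also have "\<dots> = tl (\<lambda>x w. hd.cv p q (\<rho> x) * t (\<rho> w)) R"
  proof (rule UU.tl_cong[OF R])
    fix x w assume x: "x \<in> cU" "w \<in> cU"
    have "tl (\<lambda>u v. p (\<rho> u) * q (\<rho> v) * t (\<rho> w)) (\<Delta> x) = sw (dl (\<rho> x)) (\<lambda>u v. p u * q v * t (\<rho> w))"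
      by (rule dl_rho[symmetric]) (use x lf in auto)
    also have "\<dots> = hd.cv p q (\<rho> x) * t (\<rho> w)" by (simp add: hd.cv_def sw_distrib_right)
    finally show "tl (\<lambda>X w. tl (\<lambda>u v. p (\<rho> u) * q (\<rho> v) * t (\<rho> w)) X) (tens T U (\<Delta> x) (id w)) = hd.cv p q (\<rho> x) * t (\<rho> w)"
      using x by (simp add: TU.tl_ts[OF b] comult_hom)
  qed
  finally show ?thesis .
qed

lemma cocomult_closed: "h \<in> cU \<Longrightarrow> cocomult U h \<in> carrier T"
  unfolding cocomult_def
  by (rule UU.tensor_lift_closed[OF UU.T.kalgebra_axioms]) (auto simp: comult_hom)

lemma tl_cocomult:
  assumes "h \<in> cU" "UU.bil \<beta>"
  shows "tl \<beta> (cocomult U h) = tl (\<lambda>u v. \<beta> v u) (\<Delta> h)"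
proof -
  have \<Delta>h: "\<Delta> h \<in> carrier T" using assms by (simp add: comult_hom)
  have "tl \<beta> (cocomult U h) = tl (\<lambda>u v. tl \<beta> (tens U U v u)) (\<Delta> h)"
    unfolding cocomult_def
    by (rule UU.lin_lift[OF UU.T.kalgebra_axioms UU.tl_lin[OF assms(2)] \<Delta>h]) auto
  also have "\<dots> = tl (\<lambda>u v. \<beta> v u) (\<Delta> h)"
    by (rule UU.tl_cong[OF \<Delta>h]) (simp add: UU.tl_ts[OF assms(2)])
  finally show ?thesis .
qed

lemma tl_map_right:
  assumes R: "R \<in> carrier T" and lf: "L.lf p" "L.lf q" "L.lf t"
  shows "tl (\<lambda>u X. tl (\<lambda>v w. p (\<rho> u) * (q (\<rho> v) * t (\<rho> w))) X) (tensor_map U T id (cocomult U) R) =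
    tl (\<lambda>x w. p (\<rho> x) * hd.cv t q (\<rho> w)) R"
proof -
  have b: "UT.bil (\<lambda>u X. tl (\<lambda>v w. p (\<rho> u) * (q (\<rho> v) * t (\<rho> w))) X)"
    by (rule bil_TU(2)[of "\<lambda>u v w. p u * (q v * t w)"]) (use lf in auto)
  have "tl (\<lambda>u X. tl (\<lambda>v w. p (\<rho> u) * (q (\<rho> v) * t (\<rho> w))) X) (tensor_map U T id (cocomult U) R) =
    tl (\<lambda>x w. tl (\<lambda>u X. tl (\<lambda>v w. p (\<rho> u) * (q (\<rho> v) * t (\<rho> w))) X) (tens U T (id x) (cocomult U w))) R"
    unfolding tensor_map_def
    by (rule UU.lin_lift[OF UT.T.kalgebra_axioms UT.tl_lin[OF b] R]) (auto simp: cocomult_closed)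
  also have "\<dots> = tl (\<lambda>x w. p (\<rho> x) * hd.cv t q (\<rho> w)) R"
  proof (rule UU.tl_cong[OF R])
    fix x w assume x: "x \<in> cU" "w \<in> cU"
    have "UU.bil (\<lambda>v w. p (\<rho> x) * (q (\<rho> v) * t (\<rho> w)))"
      by (rule bil_lf[where b = "\<lambda>v w. p (\<rho> x) * (q v * t w)"]) (use lf in auto)
    then have "tl (\<lambda>v w. p (\<rho> x) * (q (\<rho> v) * t (\<rho> w))) (cocomult U w) = tl (\<lambda>u v. p (\<rho> x) * (q (\<rho> v) * t (\<rho> u))) (\<Delta> w)"
      by (rule tl_cocomult[OF x(2)])
    also have "\<dots> = sw (dl (\<rho> w)) (\<lambda>u v. p (\<rho> x) * (q v * t u))"
      by (rule dl_rho[symmetric]) (use x lf in auto)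
    also have "\<dots> = p (\<rho> x) * hd.cv t q (\<rho> w)"
      by (simp add: hd.cv_def mult.commute[of "q _"] flip: sw_distrib_left)
    finally show "tl (\<lambda>u X. tl (\<lambda>v w. p (\<rho> u) * (q (\<rho> v) * t (\<rho> w))) X) (tens U T (id x) (cocomult U w)) = p (\<rho> x) * hd.cv t q (\<rho> w)"
      using x by (simp add: UT.tl_ts[OF b] cocomult_closed)
  qed
  finally show ?thesis .
qed

context
  fixes R assumes qt: "quasitriangular U R"
begin

lemma R_closed: "R \<in> carrier T"
  using qt by (simp add: quasitriangular_def Let_def)

text \<open>The axiom that (\<Delta> \<otimes> id) R is the product of R in positions 13 and 23,
  evaluated by p \<otimes> q \<otimes> t. \<open>R2\<close> does the same for the other coproduct
  axiom, which involves the opposite coproduct.\<close>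

lemma R1:
  assumes lf: "L.lf p" "L.lf q" "L.lf t"
  shows "sw (LX R) (\<lambda>r s. hd.cv p q r * t s) = sw (LX R) (\<lambda>r s. sw (LX R) (\<lambda>r' s'. p r * q r' * t (s * s')))"
proof -
  let ?b = "\<lambda>X w. tl (\<lambda>u v. p (\<rho> u) * q (\<rho> v) * t (\<rho> w)) X"
  have b: "TU.bil ?b" by (rule bil_TU(1)[of "\<lambda>u v w. p u * q v * t w"]) (use lf in auto)
  have bu: "UU.bil (\<lambda>u v. p (\<rho> u) * q (\<rho> v) * t c)" for c
    by (rule bil_lf[where b = "\<lambda>u v. p u * q v * t c"]) (use lf in auto)
  let ?r = "tensor_lift (tensor T U) (\<lambda>R1 R2. tensor_lift (tensor T U) (\<lambda>r1 r2.
             tens T U (tens U U R1 r1) (R2 \<otimes> r2)) R) R"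
  have ax: "tensor_map T U \<Delta> id R = ?r" using qt by (simp add: quasitriangular_def Let_def)
  have "tl ?b ?r = tl (\<lambda>R1 R2. tl ?b (tensor_lift (tensor T U) (\<lambda>r1 r2. tens T U (tens U U R1 r1) (R2 \<otimes> r2)) R)) R"
    by (rule UU.lin_lift[OF TU.T.kalgebra_axioms TU.tl_lin[OF b] R_closed])
       (rule UU.tensor_lift_closed[OF TU.T.kalgebra_axioms R_closed], auto)
  also have "\<dots> = tl (\<lambda>R1 R2. tl (\<lambda>r1 r2. tl ?b (tens T U (tens U U R1 r1) (R2 \<otimes> r2))) R) R"
    by (rule UU.tl_cong[OF R_closed], rule UU.lin_lift[OF TU.T.kalgebra_axioms TU.tl_lin[OF b] R_closed]) auto
  also have "\<dots> = tl (\<lambda>R1 R2. tl (\<lambda>r1 r2. p (\<rho> R1) * q (\<rho> r1) * t (\<rho> R2 * \<rho> r2)) R) R"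
    by (rule UU.tl_cong[OF R_closed], rule UU.tl_cong[OF R_closed]) (simp add: TU.tl_ts[OF b] UU.tl_ts[OF bu] H.rho_mult)
  also have "\<dots> = sw (LX R) (\<lambda>r s. sw (LX R) (\<lambda>r' s'. p r * q r' * t (s * s')))"
    by (rule sw_LX2[OF R_closed R_closed, symmetric]) (use lf in auto)
  finally have 1: "tl ?b ?r = sw (LX R) (\<lambda>r s. sw (LX R) (\<lambda>r' s'. p r * q r' * t (s * s')))" .
  have "sw (LX R) (\<lambda>r s. hd.cv p q r * t s) = tl (\<lambda>x w. hd.cv p q (\<rho> x) * t (\<rho> w)) R"
    by (rule sw_LX[OF R_closed]) (use lf in auto)
  then show ?thesis using tl_map_left[OF R_closed lf] ax 1 by simp
qed

lemma R2:
  assumes lf: "L.lf p" "L.lf q" "L.lf t"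
  shows "sw (LX R) (\<lambda>r s. p r * hd.cv t q s) = sw (LX R) (\<lambda>r s. sw (LX R) (\<lambda>r' s'. p (r * r') * (q s * t s')))"
proof -
  let ?b = "\<lambda>u X. tl (\<lambda>v w. p (\<rho> u) * (q (\<rho> v) * t (\<rho> w))) X"
  have b: "UT.bil ?b" by (rule bil_TU(2)[of "\<lambda>u v w. p u * (q v * t w)"]) (use lf in auto)
  have bu: "UU.bil (\<lambda>u v. p c * (q (\<rho> u) * t (\<rho> v)))" for c
    by (rule bil_lf[where b = "\<lambda>u v. p c * (q u * t v)"]) (use lf in auto)
  let ?r = "tensor_lift (tensor U T) (\<lambda>R1 R2. tensor_lift (tensor U T) (\<lambda>r1 r2.
             tens U T (R1 \<otimes> r1) (tens U U R2 r2)) R) R"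
  have ax: "tensor_map U T id (cocomult U) R = ?r" using qt by (simp add: quasitriangular_def Let_def)
  have "tl ?b ?r = tl (\<lambda>R1 R2. tl ?b (tensor_lift (tensor U T) (\<lambda>r1 r2. tens U T (R1 \<otimes> r1) (tens U U R2 r2)) R)) R"
    by (rule UU.lin_lift[OF UT.T.kalgebra_axioms UT.tl_lin[OF b] R_closed])
       (rule UU.tensor_lift_closed[OF UT.T.kalgebra_axioms R_closed], auto)
  also have "\<dots> = tl (\<lambda>R1 R2. tl (\<lambda>r1 r2. tl ?b (tens U T (R1 \<otimes> r1) (tens U U R2 r2))) R) R"
    by (rule UU.tl_cong[OF R_closed], rule UU.lin_lift[OF UT.T.kalgebra_axioms UT.tl_lin[OF b] R_closed]) auto
  also have "\<dots> = tl (\<lambda>R1 R2. tl (\<lambda>r1 r2. p (\<rho> R1 * \<rho> r1) * (q (\<rho> R2) * t (\<rho> r2))) R) R"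
    by (rule UU.tl_cong[OF R_closed], rule UU.tl_cong[OF R_closed]) (simp add: UT.tl_ts[OF b] UU.tl_ts[OF bu] H.rho_mult)
  also have "\<dots> = sw (LX R) (\<lambda>r s. sw (LX R) (\<lambda>r' s'. p (r * r') * (q s * t s')))"
    by (rule sw_LX2[OF R_closed R_closed, symmetric]) (use lf in auto)
  finally have 1: "tl ?b ?r = sw (LX R) (\<lambda>r s. sw (LX R) (\<lambda>r' s'. p (r * r') * (q s * t s')))" .
  have "sw (LX R) (\<lambda>r s. p r * hd.cv t q s) = tl (\<lambda>x w. p (\<rho> x) * hd.cv t q (\<rho> w)) R"
    by (rule sw_LX[OF R_closed]) (use lf in auto)
  then show ?thesis using tl_map_right[OF R_closed lf] ax 1 by simp
qed

lemma R_eps: "sw (LX R) (\<lambda>r s. lscale (eps r) s) = 1" "sw (LX R) (\<lambda>r s. lscale (eps s) r) = 1"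
proof -
  have lf: "L.lf (\<lambda>u. p (lscale (eps u) y))" "L.lf (\<lambda>u. p (lscale c u))" if "L.lf p" for p :: "('k, 'u) lop \<Rightarrow> 'k" and y c
    using that eps_lf by (auto simp: L.lf_def algebra_simps)
  have ax: "tensor_lift U (\<lambda>u v. counit U u \<odot> v) R = \<one>" "tensor_lift U (\<lambda>u v. counit U v \<odot> u) R = \<one>"
    using qt by (simp_all add: quasitriangular_def Let_def)
  have "sw (LX R) (\<lambda>u v. lscale (eps u) v) = \<rho> (tensor_lift U (\<lambda>u v. counit U u \<odot> v) R)"
    by (rule sw_LX_lift[OF R_closed]) (auto simp: H.rho_scale eps_rho lf)
  then show "sw (LX R) (\<lambda>r s. lscale (eps r) s) = 1" by (simp add: ax H.rho_one)
  have "sw (LX R) (\<lambda>u v. lscale (eps v) u) = \<rho> (tensor_lift U (\<lambda>u v. counit U v \<odot> u) R)"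
    by (rule sw_LX_lift[OF R_closed]) (auto simp: H.rho_scale eps_rho lf)
  then show "sw (LX R) (\<lambda>r s. lscale (eps s) r) = 1" by (simp add: ax H.rho_one)
qed

lemma R_comm:
  assumes h: "h \<in> CL" and lf: "L.lf p" "L.lf q"
  shows "sw (LX R) (\<lambda>r s. hd.cv (\<lambda>u. q (u * s)) (\<lambda>v. p (v * r)) h) = sw (LX R) (\<lambda>r s. hd.cv (\<lambda>u. p (r * u)) (\<lambda>v. q (s * v)) h)"
proof -
  obtain x where x: "x \<in> cU" "h = \<rho> x" using h by (auto simp: CL_def)
  have \<Delta>x: "\<Delta> x \<in> carrier T" "cocomult U x \<in> carrier T" using x by (simp_all add: comult_hom cocomult_closed)
  have d: "dl h = LX (\<Delta> x)" using x by (simp add: dl_def H.dn_rho)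
  note b = UU.bil_prod[OF H.lf_rho[OF lf(1)] H.lf_rho[OF lf(2)]]
  have ax: "cocomult U x \<otimes>\<^bsub>T\<^esub> R = R \<otimes>\<^bsub>T\<^esub> \<Delta> x" using qt x by (simp add: quasitriangular_def Let_def)
  have "sw (LX R) (\<lambda>r s. hd.cv (\<lambda>u. p (r * u)) (\<lambda>v. q (s * v)) h) =
    tl (\<lambda>r s. tl (\<lambda>u v. p (\<rho> r * \<rho> u) * q (\<rho> s * \<rho> v)) (\<Delta> x)) R"
    unfolding hd.cv_def d by (rule sw_LX2[OF R_closed \<Delta>x(1)]) (use lf in auto)
  also have "\<dots> = tl (\<lambda>r s. tl (\<lambda>u v. p (\<rho> (r \<otimes> u)) * q (\<rho> (s \<otimes> v))) (\<Delta> x)) R"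
    by (rule UU.tl_cong[OF R_closed], rule UU.tl_cong[OF \<Delta>x(1)]) (simp add: H.rho_mult)
  also have "\<dots> = tl (\<lambda>u v. p (\<rho> u) * q (\<rho> v)) (cocomult U x \<otimes>\<^bsub>T\<^esub> R)"
    unfolding ax by (rule UU.tl_mult[OF b R_closed \<Delta>x(1), symmetric])
  also have "\<dots> = tl (\<lambda>u v. tl (\<lambda>r s. p (\<rho> (u \<otimes> r)) * q (\<rho> (v \<otimes> s))) R) (cocomult U x)"
    by (rule UU.tl_mult[OF b \<Delta>x(2) R_closed])
  also have "\<dots> = tl (\<lambda>u v. sw (LX R) (\<lambda>r s. p (\<rho> u * r) * q (\<rho> v * s))) (cocomult U x)"
  proof (rule UU.tl_cong[OF \<Delta>x(2)])
    fix u v assume uv: "u \<in> cU" "v \<in> cU"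
    have "sw (LX R) (\<lambda>r s. p (\<rho> u * r) * q (\<rho> v * s)) = tl (\<lambda>r s. p (\<rho> u * \<rho> r) * q (\<rho> v * \<rho> s)) R"
      by (rule sw_LX[OF R_closed]) (use lf in auto)
    also have "\<dots> = tl (\<lambda>r s. p (\<rho> (u \<otimes> r)) * q (\<rho> (v \<otimes> s))) R"
      by (rule UU.tl_cong[OF R_closed]) (use uv in \<open>simp add: H.rho_mult\<close>)
    finally show "tl (\<lambda>r s. p (\<rho> (u \<otimes> r)) * q (\<rho> (v \<otimes> s))) R = sw (LX R) (\<lambda>r s. p (\<rho> u * r) * q (\<rho> v * s))" by simp
  qed
  also have "\<dots> = tl (\<lambda>u v. sw (LX R) (\<lambda>r s. p (\<rho> v * r) * q (\<rho> u * s))) (\<Delta> x)"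
  proof (rule tl_cocomult[OF x(1)])
    show "UU.bil (\<lambda>u v. sw (LX R) (\<lambda>r s. p (\<rho> u * r) * q (\<rho> v * s)))"
      by (rule bil_lf[where b = "\<lambda>u v. sw (LX R) (\<lambda>r s. p (u * r) * q (v * s))"]; rule L_lf_sw) (use lf in auto)
  qed
  also have "\<dots> = sw (LX (\<Delta> x)) (\<lambda>u v. sw (LX R) (\<lambda>r s. p (v * r) * q (u * s)))"
    by (rule sw_LX[OF \<Delta>x(1), symmetric]; rule L_lf_sw) (use lf in auto)
  also have "\<dots> = sw (LX R) (\<lambda>r s. hd.cv (\<lambda>u. q (u * s)) (\<lambda>v. p (v * r)) h)"
    unfolding hd.cv_def d by (subst sw_swap) (simp add: mult.commute)
  finally show ?thesis by simp
qed

end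

end

section \<open>Roots of unity\<close>

text \<open>Take t as the product of the primes that divide N but not u. Then every prime divisor of
  N divides exactly one of u and t M, and hence not their sum.\<close>

lemma coprime_lift:
  fixes u M N :: nat
  assumes N: "0 < N" and M: "M dvd N" and u: "coprime u M"
  shows "\<exists>t. coprime (u + t * M) N"
proof -
  let ?Ps = "{p. prime p \<and> p dvd N \<and> \<not> p dvd u}"
  have fin: "finite ?Ps" by (rule finite_subset[of _ "{..N}"]) (use N dvd_imp_le in auto)
  define t where "t = \<Prod>?Ps"
  have "\<not> p dvd u + t * M" if p: "prime p" "p dvd N" for p
  proof
    assume d: "p dvd u + t * M"
    show False
    proof (cases "p dvd u")
      case True
      then have "p dvd t * M" using d by (metis dvd_add_right_iff)
      moreover have "\<not> p dvd M" using u True p(1) by (metis coprime_common_divisor_nat not_prime_1 One_nat_def)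
      ultimately have "p dvd t" using p(1) by (simp add: prime_dvd_mult_iff)
      then obtain p' where p': "p' \<in> ?Ps" "p dvd p'" unfolding t_def using prime_dvd_prod_iff[OF fin p(1), of id] by auto
      then have "p = p'" using p(1) primes_dvd_imp_eq by blast
      then show False using p' True by simp
    next
      case False
      then have "p \<in> ?Ps" using p by simp
      then have "p dvd t" unfolding t_def using dvd_prodI[OF fin, of p "\<lambda>x. x"] by simp
      then have "p dvd u" using d by (metis dvd_add_left_iff dvd_mult2)
      then show False using False by simp
    qed
  qed
  then have "coprime (u + t * M) N"
    by (intro coprimeI) (metis dvd_trans prime_factor_nat not_prime_unit is_unit_gcd One_nat_def nat_dvd_1_iff_1)
  then show ?thesis ..
qed

text \<open>The N distinct powers of w are roots of X^N - 1, which has at most N of them.\<close>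

lemma primitive_root_powers:
  fixes w :: "'k::field"
  assumes w: "\<And>i. w ^ i = 1 \<longleftrightarrow> N dvd i" and N: "0 < N" and z: "z ^ N = 1"
  obtains e where "z = w ^ e"
proof -
  let ?p = "Polynomial.monom 1 N - 1 :: 'k poly"
  have c: "coeff ?p N = 1" using N by simp
  then have p0: "?p \<noteq> 0" by (metis coeff_0 zero_neq_one)
  have roots: "{x. poly ?p x = 0} = {x. x ^ N = 1}" by (simp add: poly_monom)
  have "degree ?p \<le> N" by (rule degree_diff_le) (auto simp: degree_monom_le)
  then have card: "card {x::'k. x ^ N = 1} \<le> N" using card_poly_roots_bound[OF p0] roots by simp
  have fin: "finite {x::'k. x ^ N = 1}" using poly_roots_finite[OF p0] roots by simp
  have w0: "w \<noteq> 0" using w[of N] N by (auto simp: zero_power)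
  have "inj_on (\<lambda>i. w ^ i) {..<N}"
  proof (rule linorder_inj_onI')
    fix i j assume ij: "i \<in> {..<N}" "j \<in> {..<N}" "i < j"
    show "w ^ i \<noteq> w ^ j"
    proof
      assume "w ^ i = w ^ j"
      moreover have "w ^ j = w ^ i * w ^ (j - i)" using ij by (simp flip: power_add)
      ultimately have "w ^ (j - i) = 1" using w0 by simp
      then show False using w[of "j - i"] ij by (auto dest: dvd_imp_le)
    qed
  qed
  then have "card ((\<lambda>i. w ^ i) ` {..<N}) = N" by (simp add: card_image)
  moreover have "(\<lambda>i. w ^ i) ` {..<N} \<subseteq> {x. x ^ N = 1}"
    using w[of N] by (auto simp: power_mult mult.commute[of _ N] simp flip: power_mult) (simp add: power_mult)
  ultimately have "(\<lambda>i. w ^ i) ` {..<N} = {x. x ^ N = 1}" using card fin by (intro card_seteq) auto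
  then show ?thesis using that z by blast
qed

text \<open>Write \<alpha> = w^e for a primitive root w. The hypothesis on orders says gcd(N, e) =
  gcd(N, \<nu>), so e is congruent to u \<nu> modulo N for some u coprime to N divided by that gcd;
  \<open>coprime_lift\<close> makes u coprime to N, and \<omega> = w^u.\<close>

lemma primitive_root_with_power:
  fixes \<alpha> :: "'k::{alg_closed_field, field_char_0}"
  assumes N: "0 < N" and a: "\<And>m. \<alpha> ^ m = 1 \<longleftrightarrow> N dvd \<nu> * m"
  obtains \<omega> where "primitive_root_of_unity N \<omega>" "\<omega> ^ \<nu> = \<alpha>"
proof -
  obtain w :: 'k where w: "\<And>i. w ^ i = 1 \<longleftrightarrow> N dvd i" using primitive_root_exists[OF N] by blast
  obtain e where e: "\<alpha> = w ^ e" using primitive_root_powers[OF w N] a[of N] by auto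
  have iff: "N dvd e * m \<longleftrightarrow> N dvd \<nu> * m" for m using a[of m] w[of "e * m"] by (simp add: e power_mult)
  have g: "gcd N e dvd f" if iff: "\<And>m. N dvd e * m \<Longrightarrow> N dvd f * m" for e f :: nat
  proof -
    obtain M where M: "N = gcd N e * M" by (metis gcd_dvd1 dvdE)
    obtain e' where e': "e = gcd N e * e'" by (metis gcd_dvd2 dvdE)
    have "N dvd e * M" using M e' by (metis dvd_triv_left mult.assoc mult.commute)
    then have "gcd N e * M dvd f * M" using iff M by metis
    moreover have "M \<noteq> 0" using M N by (intro notI) simp
    ultimately show ?thesis by simp
  qed
  define d where "d = gcd N e"
  have d\<nu>: "d = gcd N \<nu>"
    using g[of e \<nu>] g[of \<nu> e] iff by (metis d_def dvd_antisym gcd_dvd1 gcd_greatest)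
  have d0: "0 < d" using N by (simp add: d_def)
  obtain M where M: "N = d * M" by (metis d_def gcd_dvd1 dvdE)
  obtain e' where e': "e = d * e'" by (metis d_def gcd_dvd2 dvdE)
  obtain n where n: "\<nu> = d * n" by (metis d\<nu> gcd_dvd2 dvdE)
  have M0: "0 < M" using M N by (cases M) auto
  have ce: "coprime e' M"
  proof -
    have "d * gcd M e' = d * 1" using M e' d_def by (metis gcd_mult_distrib_nat mult.right_neutral)
    then show ?thesis using d0 by (simp add: coprime_iff_gcd_eq_1 gcd.commute)
  qed
  have cn: "coprime n M"
  proof -
    have "d * gcd M n = d * 1" using M n d\<nu> by (metis gcd_mult_distrib_nat mult.right_neutral)
    then show ?thesis using d0 by (simp add: coprime_iff_gcd_eq_1 gcd.commute)
  qed
  obtain x where x: "[n * x = 1] (mod M)" using cong_solve_coprime_nat[OF cn] by auto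
  have nxe: "[n * (x * e') = e'] (mod M)" using cong_scalar_right[OF x, of e'] by (simp add: mult.assoc)
  have "coprime x M"
  proof -
    have "coprime (n * x) M" using x by (metis cong_imp_coprime cong_sym coprime_1_left)
    then show ?thesis by simp
  qed
  then have "coprime (x * e') M" using ce by simp
  then obtain t where t: "coprime (x * e' + t * M) N" using coprime_lift[OF N, of M "x * e'"] M by auto
  define u where "u = x * e' + t * M"
  have "[n * u = e'] (mod M)"
  proof -
    have "[n * u = n * (x * e') + (n * t) * M] (mod M)" by (simp add: u_def algebra_simps)
    also have "[n * (x * e') + (n * t) * M = n * (x * e')] (mod M)" by (simp add: cong_def)
    finally show ?thesis using nxe cong_trans by blast
  qed
  then have "[d * (n * u) = d * e'] (mod (d * M))" by (rule cong_cmult_leftI)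
  then have c: "[u * \<nu> = e] (mod N)" using n e' M by (simp add: mult_ac)
  have wm: "w ^ i = w ^ (i mod N)" for i
  proof -
    have "w ^ i = w ^ (N * (i div N) + i mod N)" by simp
    also have "\<dots> = w ^ (i mod N)" using w[of N] by (simp only: power_add power_mult power_one dvd_refl simp_thms mult_1_left)
    finally show ?thesis .
  qed
  have "(w ^ u) ^ \<nu> = \<alpha>" unfolding e power_mult[symmetric] using c wm[of "u * \<nu>"] wm[of e] by (simp add: cong_def)
  moreover have "primitive_root_of_unity N (w ^ u)"
  proof -
    have "(w ^ u) ^ m = 1 \<longleftrightarrow> N dvd m" for m
      using w[of "u * m"] t unfolding u_def[symmetric]
      by (simp add: power_mult coprime_dvd_mult_right_iff coprime_commute)
    then show ?thesis using N by (auto simp: primitive_root_of_unity_def dest: dvd_imp_le)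
  qed
  ultimately show ?thesis using that by blast
qed

lemma mult_order_eq_ordk:
  fixes c :: "'k::field"
  assumes "c ^ M = 1" "0 < M"
  shows "mult_order c = ordk c"
proof -
  have "Group.monoid (class_ring :: 'k ring)" by (rule Group.monoidI) (auto simp: mult.assoc)
  then interpret G: group "units_of (class_ring :: 'k ring)" by (rule Group.monoid.units_group)
  have c0: "c \<noteq> 0" using assms by (auto simp: zero_power)
  then have c: "c \<in> carrier (units_of (class_ring :: 'k ring))"
    by (auto simp: units_of_carrier Units_def intro!: exI[of _ "inverse c"])
  have pow: "c [^]\<^bsub>units_of (class_ring :: 'k ring)\<^esub> n = c ^ n" for n :: nat
    by (induction n) (simp_all add: units_of_one units_of_mult)
  have d: "c ^ n = 1 \<longleftrightarrow> mult_order c dvd n" for n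
    unfolding mult_order_def using G.pow_eq_id[OF c, of n] by (simp add: pow units_of_one)
  note o = ordk[OF assms(1,2)]
  have "mult_order c dvd ordk c" using d o(2) by blast
  moreover have "0 < mult_order c" using d[of M] assms by (metis dvd_0_left_iff gr0I)
  moreover have "c ^ mult_order c = 1" using d by simp
  ultimately show ?thesis using o(1) o(3)[of "mult_order c"] dvd_imp_le[of "mult_order c" "ordk c"] by force
qed

section \<open>The transferred quasitriangular structure\<close>

locale characterized = hopf_alg U
  for U :: "('k::{alg_closed_field, field_char_0}, 'u) hopf" (structure) +
  fixes N \<nu> :: nat and a :: 'u
  assumes nu: "1 \<le> \<nu>" "\<nu> < N" "\<not> N dvd \<nu>\<^sup>2"
    and a_grouplike: "a \<in> grouplikes U" and a_ord: "group.ord (units_of U) a = N"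
    and generated: "generated_subalgebra U (insert a (skew_primitives U (a [^] \<nu>) \<one>)) = carrier U"
    and fd: "vectorspace.fin_dim class_ring (U\<lparr>carrier := skew_primitives U (a [^] \<nu>) \<one>\<rparr>)"
    and dim3: "vectorspace.dim class_ring (U\<lparr>carrier := skew_primitives U (a [^] \<nu>) \<one>\<rparr>) = 3"
    and trivial: "\<And>i::nat. 0 < i \<Longrightarrow> \<not> [i = \<nu>] (mod N) \<Longrightarrow>
           skew_primitives U (a [^] i) \<one> = lin_span U {a [^] i \<ominus> \<one>}"
    and mqt: "minimal_quasitriangular U"
begin

lemma aU: "a \<in> cU" using a_grouplike by (simp add: grouplikes_def)

lemma a_pow: "a [^] m = \<one> \<longleftrightarrow> N dvd m" for m :: nat
proof -
  interpret G: group "units_of U" by (rule UU.A.units_group)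
  have "a \<in> carrier (units_of U)" using unit_inverse(1)[OF a_grouplike] by (simp add: units_of_carrier)
  from G.pow_eq_id[OF this, of m] show ?thesis
    by (simp add: a_ord units_of_one nat_pow_def units_of_mult)
qed

lemma rho_a_pow: "\<rho> a ^ m = 1 \<longleftrightarrow> N dvd m"
  using a_pow[of m] H.rho_inj[of "a [^] m" "\<one>"] aU by (simp add: H.rho_pow H.rho_one)

abbreviation "PP \<equiv> skew_primitives U (a [^] \<nu>) \<one>"

lemma PP_submodule: "submodule class_ring PP U"
proof (rule UU.A.submoduleI)
  have h: "a [^] \<nu> \<in> cU" using aU by simp
  have sub: "L.subspace (\<rho> ` PP)" unfolding sp_rho_set[OF h, symmetric]
    by (rule hd.subspace_sp)
  show PU: "PP \<subseteq> cU" by (auto simp: skew_primitives_def)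
  have mem: "u \<in> PP" if uP: "\<rho> u \<in> \<rho> ` PP" "u \<in> cU" for u
  proof -
    obtain w where w: "w \<in> PP" "\<rho> u = \<rho> w" using uP(1) by blast
    then show ?thesis using H.rho_inj[OF uP(2) subsetD[OF PU w(1)]] by simp
  qed
  show "\<zero> \<in> PP" by (rule mem) (use L.subspace_0[OF sub] H.rho_zero in auto)
  show "x \<oplus> y \<in> PP" if "x \<in> PP" "y \<in> PP" for x y
    by (rule mem) (use that PU L.subspace_add[OF sub, of "\<rho> x" "\<rho> y"] in \<open>auto simp: H.rho_add subset_iff\<close>)
  show "c \<odot> x \<in> PP" if "x \<in> PP" for x c
    by (rule mem) (use that PU L.subspace_scale[OF sub, of "\<rho> x" c] in \<open>auto simp: H.rho_scale subset_iff\<close>)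
qed

lemma hopf_gen: "hopf_gen lscale CL dl eps SL (\<rho> a) N \<nu>"
proof unfold_locales
  have gU: "a [^] i \<in> cU" for i :: nat using aU by simp
  show "hd.gl (\<rho> a)" by (rule gl_rho[OF a_grouplike])
  show "\<rho> a ^ N = 1" "\<And>m. 0 < m \<Longrightarrow> m < N \<Longrightarrow> \<rho> a ^ m \<noteq> 1" by (auto simp: rho_a_pow dest: dvd_imp_le)
  show "1 \<le> \<nu>" "\<nu> < N" "\<not> N dvd \<nu>\<^sup>2" by (rule nu)+
  show "CL \<subseteq> D" if D: "L.subspace D" "1 \<in> D" "\<And>x y. x \<in> D \<Longrightarrow> y \<in> D \<Longrightarrow> x * y \<in> D" "\<rho> a \<in> D"
    "\<And>z. hd.sp (\<rho> a ^ \<nu>) z \<Longrightarrow> z \<in> D" for D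
  proof -
    let ?B = "{u \<in> cU. \<rho> u \<in> D}"
    have "PP \<subseteq> ?B"
    proof
      fix z assume z: "z \<in> PP"
      then have zU: "z \<in> cU" by (simp add: skew_primitives_def)
      then have "hd.sp (\<rho> a ^ \<nu>) (\<rho> z)" using sp_rho[OF gU zU] z by (simp add: H.rho_pow aU)
      then show "z \<in> ?B" using D(5) zU by simp
    qed
    then have "insert a PP \<subseteq> ?B" using aU D(4) by simp
    then have "?B \<in> {B. subalgebra_of B U \<and> insert a PP \<subseteq> B}" using preimage_subalgebra[OF D(1-3)] by simp
    then have "cU \<subseteq> ?B" unfolding generated[symmetric] generated_subalgebra_def by (rule Inter_lower)
    then show ?thesis by (auto simp: CL_def)
  qed
  show "\<exists>B. finite B \<and> card B = 3 \<and> L.independent B \<and> L.span B = {z. hd.sp (\<rho> a ^ \<nu>) z}"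
    using dim_rho[OF PP_submodule fd dim3] sp_rho_set[OF gU, of \<nu>] by (simp add: H.rho_pow aU)
  show "z \<in> L.span {\<rho> a ^ i - 1}" if "0 < i" "\<not> [i = \<nu>] (mod N)" "hd.sp (\<rho> a ^ i) z" for i z
  proof -
    have "z \<in> \<rho> ` lin_span U {a [^] i \<ominus> \<one>}"
      using sp_rho_set[OF gU, of i] trivial[OF that(1,2)] that(3) by (auto simp: H.rho_pow aU)
    also have "\<dots> = L.span (\<rho> ` {a [^] i \<ominus> \<one>})" by (rule rho_span) (use gU in auto)
    finally show ?thesis using gU by (simp add: H.rho_minus H.rho_pow H.rho_one aU)
  qed
qed

text \<open>The legs are defined by a shortest expression of R, while the abstract argument knows
  only slices of R; this says that a set containing all slices contains the entries of the
  expression. Left entries are handled by swapping the tensor factors.\<close>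

lemma legs_subset:
  assumes qt: "quasitriangular U R" and D: "D \<subseteq> CL"
    and fL: "\<And>p. L.lf p \<Longrightarrow> sw (LX R) (\<lambda>r s. lscale (p s) r) \<in> D"
    and fR: "\<And>p. L.lf p \<Longrightarrow> sw (LX R) (\<lambda>r s. lscale (p r) s) \<in> D"
  shows "fst ` set (shortest_expression U R) \<subseteq> {u \<in> cU. \<rho> u \<in> D}"
    "snd ` set (shortest_expression U R) \<subseteq> {u \<in> cU. \<rho> u \<in> D}"
proof -
  let ?B = "{u \<in> cU. \<rho> u \<in> D}" and ?s = "map (\<lambda>(u, v). (v, u))"
  have R: "R \<in> carrier T" by (rule R_closed[OF qt])
  have te: "ps \<in> tensor_expressions U R \<longleftrightarrow> set ps \<subseteq> cU \<times> cU \<and> UU.texp ps = R" for ps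
    by (auto simp: tensor_expressions_def UU.texp_def)
  define ps where "ps = shortest_expression U R"
  have ex: "lst R \<in> tensor_expressions U R" using lst[OF R] te by blast
  have ps: "ps \<in> tensor_expressions U R" "\<And>zs. zs \<in> tensor_expressions U R \<Longrightarrow> length ps \<le> length zs"
    unfolding ps_def shortest_expression_def
    using arg_min_nat_lemma[of "\<lambda>ps. ps \<in> tensor_expressions U R", OF ex, of length] by blast+
  have psC: "set ps \<subseteq> cU \<times> cU" "UU.texp ps = R" using ps(1) te by blast+
  have ev: "sw (LX R) (\<lambda>r s. p r * q s) = sw ps (\<lambda>r s. p (\<rho> r) * q (\<rho> s))" if "L.lf p" "L.lf q" for p q
    using sw_LX[OF R, of "\<lambda>r s. p r * q s"] UU.tl_texp[OF UU.bil_prod[OF H.lf_rho[OF that(1)] H.lf_rho[OF that(2)]] psC(1)] psC(2) that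
    by simp
  have inC: "F \<in> D \<Longrightarrow> \<exists>u\<in>cU. F = \<rho> u" for F using D by (auto simp: CL_def)
  have psm: "(r, s) \<in> set ps \<Longrightarrow> r \<in> cU \<and> s \<in> cU" for r s using psC(1) by auto
  have "snd ` set ps \<subseteq> ?B"
  proof (rule UU.shortest_fst[OF psC(1)])
    show "length ps \<le> length zs" if "set zs \<subseteq> cU \<times> cU" "UU.texp zs = UU.texp ps" for zs
      using ps(2)[of zs] te[of zs] that psC(2) by simp
    fix p assume p: "UU.A.lin p"
    let ?F = "sw (LX R) (\<lambda>r s. lscale (p (H.dn r)) s)"
    obtain u where u: "u \<in> cU" "?F = \<rho> u" using inC[OF fR[OF H.lf_dn[OF p]]] by blast
    have "q u = sw ps (\<lambda>r s. p r * q s)" if q: "UU.A.lin q" for q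
    proof -
      note Q = H.lf_dn[OF q] and P = H.lf_dn[OF p]
      have "q u = q (H.dn ?F)" using u by (simp add: H.dn_rho)
      also have "\<dots> = sw (LX R) (\<lambda>r s. p (H.dn r) * q (H.dn s))"
        using L.lf_sw[OF Q, of "LX R" "\<lambda>r s. lscale (p (H.dn r)) s"] by (simp add: L.lf_scale[OF Q])
      also have "\<dots> = sw ps (\<lambda>r s. p (H.dn (\<rho> r)) * q (H.dn (\<rho> s)))" by (rule ev[OF P Q])
      also have "\<dots> = sw ps (\<lambda>r s. p r * q s)" by (rule sw_cong) (simp add: H.dn_rho psm)
      finally show ?thesis .
    qed
    moreover have "\<rho> u \<in> D" using fR[OF H.lf_dn[OF p]] u by simp
    ultimately show "\<exists>e\<in>cU. e \<in> ?B \<and> (\<forall>q. UU.A.lin q \<longrightarrow> q e = sw ps (\<lambda>r s. p r * q s))" using u(1) by blast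
  qed
  then show "snd ` set (shortest_expression U R) \<subseteq> ?B" by (simp add: ps_def)
  have swp: "set (?s zs) \<subseteq> cU \<times> cU" if "set zs \<subseteq> cU \<times> cU" for zs using that by auto
  have sws: "sw (?s zs) b = sw zs (\<lambda>u v. b v u)" for zs and b :: "'u \<Rightarrow> 'u \<Rightarrow> 'k" by (induction zs) auto
  \<comment> \<open>The swapped list is again shortest: a shorter expression of the swapped tensor
    would swap back to a shorter expression of R.\<close>
  have "snd ` set (?s ps) \<subseteq> ?B"
  proof (rule UU.shortest_fst[OF swp[OF psC(1)]])
    show "length (?s ps) \<le> length zs" if zs: "set zs \<subseteq> cU \<times> cU" "UU.texp zs = UU.texp (?s ps)" for zs
    proof -
      have "UU.texp (?s zs) = UU.texp ps"
      proof (rule UU.T_eqI)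
        fix p q assume pq: "UU.A.lin p" "UU.A.lin q"
        have "sw zs (\<lambda>u v. q u * p v) = sw (?s ps) (\<lambda>u v. q u * p v)"
          using UU.tl_texp[OF UU.bil_prod[OF pq(2,1)] zs(1)] UU.tl_texp[OF UU.bil_prod[OF pq(2,1)] swp[OF psC(1)]] zs(2) by simp
        then show "tl (prd p q) (UU.texp (?s zs)) = tl (prd p q) (UU.texp ps)"
          unfolding UU.tl_texp[OF UU.bil_prod[OF pq] swp[OF zs(1)]] UU.tl_texp[OF UU.bil_prod[OF pq] psC(1)] sws
          by (simp add: mult.commute)
      qed (use zs psC swp UU.texp_closed in auto)
      then show ?thesis using ps(2)[of "?s zs"] te[of "?s zs"] swp[OF zs(1)] psC(2) by simp
    qed
    fix p assume p: "UU.A.lin p"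
    let ?F = "sw (LX R) (\<lambda>r s. lscale (p (H.dn s)) r)"
    obtain u where u: "u \<in> cU" "?F = \<rho> u" using inC[OF fL[OF H.lf_dn[OF p]]] by blast
    have "q u = sw (?s ps) (\<lambda>r s. p r * q s)" if q: "UU.A.lin q" for q
    proof -
      note Q = H.lf_dn[OF q] and P = H.lf_dn[OF p]
      have "q u = q (H.dn ?F)" using u by (simp add: H.dn_rho)
      also have "\<dots> = sw (LX R) (\<lambda>r s. q (H.dn r) * p (H.dn s))"
        using L.lf_sw[OF Q, of "LX R" "\<lambda>r s. lscale (p (H.dn s)) r"] by (simp add: L.lf_scale[OF Q] mult.commute)
      also have "\<dots> = sw ps (\<lambda>r s. q (H.dn (\<rho> r)) * p (H.dn (\<rho> s)))" by (rule ev[OF Q P])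
      also have "\<dots> = sw (?s ps) (\<lambda>r s. p r * q s)" unfolding sws by (rule sw_cong) (simp add: H.dn_rho psm mult.commute)
      finally show ?thesis .
    qed
    moreover have "\<rho> u \<in> D" using fL[OF H.lf_dn[OF p]] u by simp
    ultimately show "\<exists>e\<in>cU. e \<in> ?B \<and> (\<forall>q. UU.A.lin q \<longrightarrow> q e = sw (?s ps) (\<lambda>r s. p r * q s))" using u(1) by blast
  qed
  moreover have "snd ` set (?s ps) = fst ` set ps" by force
  ultimately show "fst ` set (shortest_expression U R) \<subseteq> ?B" by (simp add: ps_def)
qed

lemma hopf_qt_exists: "\<exists>R. hopf_qt lscale CL dl eps SL (\<rho> a) N \<nu> R"
proof -
  obtain R where qt: "quasitriangular U R" and min: "minimal_part U R = cU"
    using mqt by (auto simp: minimal_quasitriangular_def)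
  interpret hg: hopf_gen lscale CL dl eps SL "\<rho> a" N \<nu> "\<rho> a ^ \<nu>" by (rule hopf_gen) simp
  have R: "R \<in> carrier T" by (rule R_closed[OF qt])
  have "hopf_qt lscale CL dl eps SL (\<rho> a) N \<nu> (LX R)"
  proof unfold_locales
    show "set (LX R) \<subseteq> CL \<times> CL" by (rule LX_in[OF R])
    show "sw (LX R) (\<lambda>r s. hd.cv p q r * t s) = sw (LX R) (\<lambda>r s. sw (LX R) (\<lambda>r' s'. p r * q r' * t (s * s')))"
      "sw (LX R) (\<lambda>r s. p r * hd.cv t q s) = sw (LX R) (\<lambda>r s. sw (LX R) (\<lambda>r' s'. p (r * r') * (q s * t s')))"
      if "L.lf p" "L.lf q" "L.lf t" for p q t by (rule R1[OF qt that] R2[OF qt that])+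
    show "sw (LX R) (\<lambda>r s. lscale (eps r) s) = 1" "sw (LX R) (\<lambda>r s. lscale (eps s) r) = 1" by (rule R_eps[OF qt])+
    show "sw (LX R) (\<lambda>r s. hd.cv (\<lambda>u. q (u * s)) (\<lambda>v. p (v * r)) h) = sw (LX R) (\<lambda>r s. hd.cv (\<lambda>u. p (r * u)) (\<lambda>v. q (s * v)) h)"
      if "h \<in> CL" "L.lf p" "L.lf q" for h p q by (rule R_comm[OF qt that])
    show "CL \<subseteq> D" if D: "L.subspace D" "1 \<in> D" "\<And>x y. x \<in> D \<Longrightarrow> y \<in> D \<Longrightarrow> x * y \<in> D" "D \<subseteq> CL"
      "\<And>u. u \<in> D \<Longrightarrow> \<exists>xs. set xs \<subseteq> D \<times> D \<and> (\<forall>p q. L.lf p \<longrightarrow> L.lf q \<longrightarrow> hd.cv p q u = sw xs (prd p q))"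
      "\<And>u. u \<in> D \<Longrightarrow> SL u \<in> D" "\<And>p. L.lf p \<Longrightarrow> sw (LX R) (\<lambda>r s. lscale (p s) r) \<in> D"
      "\<And>p. L.lf p \<Longrightarrow> sw (LX R) (\<lambda>r s. lscale (p r) s) \<in> D" for D
    proof -
      \<comment> \<open>The preimage of D is a Hopf subalgebra containing both legs, so it contains
        the minimal part, which is the whole carrier.\<close>
      let ?B = "{u \<in> cU. \<rho> u \<in> D}"
      have sa: "subalgebra_of ?B U" by (rule preimage_subalgebra[OF D(1-3)])
      have sm: "submodule class_ring ?B U" using sa by (simp add: subalgebra_of_def VectorSpace.subspace_def)
      let ?G = "{tens U U u v | u v. u \<in> ?B \<and> v \<in> ?B}"
      have G: "?G \<subseteq> carrier T" by auto
      note sp = UU.T.lin_span_closed[OF G]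
      have "\<Delta> u \<in> lin_span T ?G" if u: "u \<in> ?B" for u
      proof -
        have uU: "u \<in> cU" "\<rho> u \<in> D" using u by auto
        then obtain xs where xs: "set xs \<subseteq> D \<times> D"
          "\<And>p q. L.lf p \<Longrightarrow> L.lf q \<Longrightarrow> hd.cv p q (\<rho> u) = sw xs (prd p q)" using D(5) by blast
        define ys where "ys = map (\<lambda>(u, v). (H.dn u, H.dn v)) xs"
        have dnB: "H.dn F \<in> ?B" if "F \<in> D" for F
        proof -
          obtain w where "w \<in> cU" "F = \<rho> w" using \<open>F \<in> D\<close> D(4) by (auto simp: CL_def)
          then show ?thesis using \<open>F \<in> D\<close> by (simp add: H.dn_rho)
        qed
        have ysB: "set ys \<subseteq> ?B \<times> ?B" unfolding ys_def using xs(1) dnB by fastforce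
        then have ysU: "set ys \<subseteq> cU \<times> cU" by auto
        have "\<Delta> u = UU.texp ys"
        proof (rule UU.T_eqI)
          show "\<Delta> u \<in> carrier T" "UU.texp ys \<in> carrier T" using uU ysU by (auto simp: comult_hom)
          fix p q assume pq: "UU.A.lin p" "UU.A.lin q"
          note P = H.lf_dn[OF pq(1)] and Q = H.lf_dn[OF pq(2)]
          have "tl (prd p q) (\<Delta> u) = hd.cv (\<lambda>F. p (H.dn F)) (\<lambda>F. q (H.dn F)) (\<rho> u)"
            unfolding cv_rho[OF uU(1) P Q] by (rule tl_prod_lin[OF comult_hom(1)[OF uU(1)] pq])
          also have "\<dots> = sw ys (prd p q)" unfolding xs(2)[OF P Q] ys_def sw_map ..
          also have "\<dots> = tl (prd p q) (UU.texp ys)" by (rule UU.tl_texp[OF UU.bil_prod[OF pq] ysU, symmetric])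
          finally show "tl (prd p q) (\<Delta> u) = tl (prd p q) (UU.texp ys)" .
        qed
        moreover have "UU.texp ys \<in> lin_span T ?G" using ysB
        proof (induction ys rule: rev_induct)
          case Nil then show ?case using sp(2) by simp
        next
          case (snoc z ys)
          obtain v w where z: "z = (v, w)" by (cases z)
          have c: "v \<in> ?B" "w \<in> ?B" "set ys \<subseteq> ?B \<times> ?B" using snoc.prems z by auto
          then have "UU.texp (ys @ [(v, w)]) = tens U U v w \<oplus>\<^bsub>T\<^esub> UU.texp ys" by (intro UU.texp_snoc) auto
          moreover have "tens U U v w \<in> lin_span T ?G" using sp(5) c by blast
          ultimately show ?case using sp(3) snoc.IH[OF c(3)] z by simp
        qed
        ultimately show ?thesis by simp
      qed
      moreover have "antipode U u \<in> ?B" if "u \<in> ?B" for u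
        using D(6)[of "\<rho> u"] that by (simp add: SL_rho antipode_hom)
      ultimately have "hopf_subalgebra ?B U" using sa by (auto simp: hopf_subalgebra_def)
      moreover have "left_leg U R \<subseteq> ?B" "right_leg U R \<subseteq> ?B"
        unfolding left_leg_def right_leg_def
        using LinearCombinations.module.span_is_subset[OF UU.A.mdl legs_subset(1)[OF qt D(4,7,8)] sm]
          LinearCombinations.module.span_is_subset[OF UU.A.mdl legs_subset(2)[OF qt D(4,7,8)] sm] by simp_all
      ultimately have "minimal_part U R \<subseteq> ?B" unfolding minimal_part_def by blast
      then show ?thesis using min by (auto simp: CL_def)
    qed
  qed
  then show ?thesis ..
qed

end

section \<open>The algebras presented by generators and relations\<close>

text \<open>With concatenation as addition, the convolution product of finitely supported functions
  on words is the product of the free algebra, whose ring laws are then available by type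
  class.\<close>

instantiation list :: (type) monoid_add
begin

definition "0 = []"
definition "xs + ys = xs @ ys"

instance by standard (simp_all add: zero_list_def plus_list_def)

end

abbreviation FA :: "('k::field, U_gen list \<Rightarrow>\<^sub>0 'k) module" where "FA \<equiv> free_algebra"

interpretation FA: kalgebra "free_algebra :: ('k::field, U_gen list \<Rightarrow>\<^sub>0 'k) module"
  unfolding free_algebra_def
  by (intro kalgebra.intro k_algebra_monoid_algebra Group.monoidI) auto

lemma free_mult: "f \<otimes>\<^bsub>FA\<^esub> g = f * (g :: U_gen list \<Rightarrow>\<^sub>0 'k::field)"
proof -
  have fg: "pkeys f \<subseteq> UNIV" "pkeys g \<subseteq> UNIV" by simp_all
  have s: "psingle p c \<otimes>\<^bsub>FA\<^esub> g = psingle p c * g" for p and c :: 'k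
    using fg(2) by (induction g rule: pm_induct)
      (simp_all add: free_algebra_def ma_add_mult distrib_left Poly_Mapping.mult_single plus_list_def)
  show ?thesis using fg(1)
  proof (induction f rule: pm_induct)
    case (add k c f)
    then show ?case using s[of k c] by (simp add: free_algebra_def ma_add_mult distrib_right)
  qed (simp add: free_algebra_def)
qed

lemma free_sel [simp]:
  "carrier FA = (UNIV :: (U_gen list \<Rightarrow>\<^sub>0 'k::field) set)" "\<one>\<^bsub>FA\<^esub> = (1 :: U_gen list \<Rightarrow>\<^sub>0 'k)" "\<zero>\<^bsub>FA\<^esub> = (0 :: U_gen list \<Rightarrow>\<^sub>0 'k)"
  "f \<otimes>\<^bsub>FA\<^esub> g = f * (g :: U_gen list \<Rightarrow>\<^sub>0 'k)" "f \<oplus>\<^bsub>FA\<^esub> g = f + (g :: U_gen list \<Rightarrow>\<^sub>0 'k)" "c \<odot>\<^bsub>FA\<^esub> f = pscale c (f :: U_gen list \<Rightarrow>\<^sub>0 'k)"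
proof -
  have "psingle [] (1::'k) = 1" unfolding zero_list_def[symmetric] by (rule Poly_Mapping.single_one)
  then show "carrier FA = (UNIV :: (U_gen list \<Rightarrow>\<^sub>0 'k::field) set)" "\<one>\<^bsub>FA\<^esub> = (1 :: U_gen list \<Rightarrow>\<^sub>0 'k)" "\<zero>\<^bsub>FA\<^esub> = (0 :: U_gen list \<Rightarrow>\<^sub>0 'k)"
    "f \<oplus>\<^bsub>FA\<^esub> g = f + g" "c \<odot>\<^bsub>FA\<^esub> f = pscale c f"
    by (simp_all add: free_algebra_def ma_sel)
qed (rule free_mult)

lemma free_more [simp]: "f \<ominus>\<^bsub>FA\<^esub> g = f - (g :: U_gen list \<Rightarrow>\<^sub>0 'k::field)" "f [^]\<^bsub>FA\<^esub> (n::nat) = (f :: U_gen list \<Rightarrow>\<^sub>0 'k) ^ n"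
proof -
  show "f [^]\<^bsub>FA\<^esub> (n::nat) = f ^ n" by (induction n) (simp_all add: power_commutes)
  have "pscale (- 1) g = - g" by (rule poly_mapping_eqI) simp
  then have "\<ominus>\<^bsub>FA\<^esub> g = - g" using FA.sc_neg[of g] by simp
  then show "f \<ominus>\<^bsub>FA\<^esub> g = f - g" by (simp add: a_minus_def)
qed

interpretation FL: kalg "pscale :: 'k::field \<Rightarrow> (U_gen list \<Rightarrow>\<^sub>0 'k) \<Rightarrow> _"
  by unfold_locales (use FA.sc_mult_l FA.sc_mult_r in simp_all)

locale U_pres =
  fixes N \<nu> :: nat and \<omega> :: "'k::field"
begin

abbreviation "I \<equiv> U_ideal N \<nu> \<omega>"
abbreviation "gen s \<equiv> psingle [s] (1::'k)"
abbreviation "q \<equiv> \<omega> ^ \<nu>"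
abbreviation "r \<equiv> mult_order (q ^ \<nu>)"

lemma I_ideal: "ideal I FA"
  unfolding U_ideal_def by (rule FA.genideal_ideal) simp

end

sublocale U_pres \<subseteq> Q: kquotient "free_algebra :: ('k, U_gen list \<Rightarrow>\<^sub>0 'k) module" "U_ideal N \<nu> \<omega>"
  by (intro kquotient.intro FA.kalgebra_axioms I_ideal)

sublocale U_pres \<subseteq> KQ: kalgebra2 "U_algebra N \<nu> \<omega>" "U_algebra N \<nu> \<omega>"
  by unfold_locales (simp_all add: U_algebra_def Q.k_algebra_Q)

context U_pres begin

lemmas Q_sel = Q.Q_sel[folded U_algebra_def, unfolded free_sel]
lemmas Q_ops = Q.Q_ops[folded U_algebra_def, unfolded free_sel, OF UNIV_I UNIV_I]
lemmas Q_eq = Q.cls_eq[unfolded free_sel free_more, OF UNIV_I UNIV_I]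
lemmas Q_rep = Q.some_rep[folded U_algebra_def]

lemma I_sub: "pv.subspace I"
proof (rule pv.subspaceI)
  show "0 \<in> I" using Q.zero_closed by simp
  show "x + y \<in> I" if "x \<in> I" "y \<in> I" for x y using Q.a_closed[OF that] by simp
  show "pscale c x \<in> I" if "x \<in> I" for c x using Q.ideal_scale[OF that, of c] by simp
qed

lemma I_mult: "f \<in> I \<Longrightarrow> g * f \<in> I" "f \<in> I \<Longrightarrow> f * g \<in> I"
  using Q.I_l_closed[of f g] Q.I_r_closed[of f g] by simp_all

lemma rels:
  "gen Gen_a ^ N - 1 \<in> I" "gen Gen_x ^ r \<in> I" "gen Gen_y ^ r \<in> I"
  "gen Gen_x * gen Gen_a - pscale q (gen Gen_a * gen Gen_x) \<in> I"
  "gen Gen_y * gen Gen_a - pscale (inverse q) (gen Gen_a * gen Gen_y) \<in> I"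
  "gen Gen_y * gen Gen_x - pscale (inverse (q ^ \<nu>)) (gen Gen_x * gen Gen_y) - (gen Gen_a ^ (2 * \<nu>) - 1) \<in> I"
  using FA.genideal_self[of "U_relations N \<nu> \<omega>"] unfolding U_ideal_def
  by (simp_all only: free_sel subset_UNIV simp_thms U_relations_def Let_def free_more insert_subset)

definition mn :: "nat \<Rightarrow> nat \<Rightarrow> nat \<Rightarrow> (U_gen list \<Rightarrow>\<^sub>0 'k)" where
  "mn i j k = gen Gen_a ^ i * gen Gen_x ^ j * gen Gen_y ^ k"

text \<open>The subspace I + span B; rewriting modulo the relations becomes membership in
  it.\<close>

definition Wof :: "(U_gen list \<Rightarrow>\<^sub>0 'k) set \<Rightarrow> (U_gen list \<Rightarrow>\<^sub>0 'k) set" where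
  "Wof B = {f. \<exists>g\<in>pv.span B. f - g \<in> I}"

lemma Wof_sub: "pv.subspace (Wof B)"
proof (rule pv.subspaceI)
  show "0 \<in> Wof B" unfolding Wof_def using pv.span_zero pv.subspace_0[OF I_sub] by force
next
  fix f f' assume "f \<in> Wof B" "f' \<in> Wof B"
  then obtain g g' where g: "g \<in> pv.span B" "f - g \<in> I" "g' \<in> pv.span B" "f' - g' \<in> I" by (auto simp: Wof_def)
  have "(f + f') - (g + g') \<in> I" using pv.subspace_add[OF I_sub g(2,4)] by (simp add: algebra_simps)
  then show "f + f' \<in> Wof B" unfolding Wof_def using pv.span_add[OF g(1,3)] by blast
next
  fix c f assume "f \<in> Wof B"
  then obtain g where g: "g \<in> pv.span B" "f - g \<in> I" by (auto simp: Wof_def)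
  have "pscale c f - pscale c g \<in> I" using pv.subspace_scale[OF I_sub g(2), of c] by (simp add: pv.scale_right_diff_distrib)
  then show "pscale c f \<in> Wof B" unfolding Wof_def using pv.span_scale[OF g(1)] by blast
qed

lemma Wof_base: "f \<in> B \<Longrightarrow> f \<in> Wof B"
  unfolding Wof_def using pv.span_base[of f B] pv.subspace_0[OF I_sub] by force

lemma Wof_I: "f \<in> I \<Longrightarrow> f \<in> Wof B"
  unfolding Wof_def using pv.span_zero[of B] by force

lemma Wof_cong: assumes "f - f' \<in> I" "f' \<in> Wof B" shows "f \<in> Wof B"
  using pv.subspace_add[OF Wof_sub Wof_I[OF assms(1)] assms(2)] by simp

lemma Wof_mono: assumes "B \<subseteq> Wof B'" shows "Wof B \<subseteq> Wof B'"
proof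
  fix f assume "f \<in> Wof B"
  then obtain g where g: "g \<in> pv.span B" "f - g \<in> I" by (auto simp: Wof_def)
  have "g \<in> Wof B'" using pv.span_minimal[OF assms Wof_sub] g by blast
  then show "f \<in> Wof B'" by (rule Wof_cong[OF g(2)])
qed

lemma Wof_left:
  assumes s: "\<And>b. b \<in> B \<Longrightarrow> s * b \<in> Wof B" and f: "f \<in> Wof B"
  shows "s * f \<in> Wof B"
proof -
  obtain g where g: "g \<in> pv.span B" "f - g \<in> I" using f by (auto simp: Wof_def)
  have "pv.span B \<subseteq> {g. s * g \<in> Wof B}"
    by (rule pv.span_minimal) (use s FL.subspace_mult_left[OF Wof_sub] in auto)
  then have "s * g \<in> Wof B" using g by blast
  moreover have "s * f - s * g \<in> I" using I_mult(1)[OF g(2), of s] by (simp add: right_diff_distrib)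
  ultimately show ?thesis using Wof_cong by blast
qed

lemma comm_pow:
  assumes z: "z * gen Gen_a - pscale c (gen Gen_a * z) \<in> I"
  shows "z * gen Gen_a ^ i - pscale (c ^ i) (gen Gen_a ^ i * z) \<in> I"
proof (induction i)
  case 0
  show ?case unfolding power_0 by (subst pv.scale_one) (simp add: pv.subspace_0[OF I_sub])
next
  case (Suc i)
  let ?a = "gen Gen_a"
  have "(z * ?a ^ i - pscale (c ^ i) (?a ^ i * z)) * ?a + pscale (c ^ i) (?a ^ i * (z * ?a - pscale c (?a * z))) \<in> I"
    using I_mult(2)[OF Suc] pv.subspace_scale[OF I_sub I_mult(1)[OF z]] pv.subspace_add[OF I_sub] by blast
  also have "(z * ?a ^ i - pscale (c ^ i) (?a ^ i * z)) * ?a + pscale (c ^ i) (?a ^ i * (z * ?a - pscale c (?a * z)))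
    = z * ?a ^ Suc i - pscale (c ^ Suc i) (?a ^ Suc i * z)"
    by (simp add: left_diff_distrib right_diff_distrib FL.smult_simps pv.scale_right_diff_distrib mult.assoc
        power_Suc2 del: power_Suc)
  finally show ?case .
qed

abbreviation "MM \<equiv> range (\<lambda>(i, j, k). mn i j k)"

lemma mn_W: "mn i j k \<in> Wof MM"
  by (rule Wof_base) (rule image_eqI[of _ _ "(i, j, k)"], simp_all)

lemma a_W: "f \<in> Wof MM \<Longrightarrow> gen Gen_a * f \<in> Wof MM"
proof (rule Wof_left)
  fix b assume "b \<in> MM"
  then obtain i j k where "b = mn i j k" by auto
  then have "gen Gen_a * b = mn (Suc i) j k" by (simp add: mn_def mult.assoc)
  then show "gen Gen_a * b \<in> Wof MM" by (simp only: mn_W)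
qed

lemma a_pow_W: "f \<in> Wof MM \<Longrightarrow> gen Gen_a ^ i * f \<in> Wof MM"
  by (induction i) (simp_all add: a_W mult.assoc)

text \<open>An element that q-commutes with \<open>a\<close> modulo I can be moved past the leading
  power of \<open>a\<close>, so it is enough to treat monomials in x and y alone.\<close>

lemma comm_W:
  assumes z: "z * gen Gen_a - pscale c (gen Gen_a * z) \<in> I"
    and w: "\<And>j k. z * (gen Gen_x ^ j * gen Gen_y ^ k) \<in> Wof MM" and f: "f \<in> Wof MM"
  shows "z * f \<in> Wof MM"
proof (rule Wof_left[OF _ f])
  fix b assume "b \<in> MM"
  then obtain i j k where b: "b = mn i j k" by auto
  let ?m = "gen Gen_x ^ j * gen Gen_y ^ k"
  have "z * mn i j k - pscale (c ^ i) (gen Gen_a ^ i * (z * ?m)) \<in> I"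
    using I_mult(2)[OF comm_pow[OF z, of i], of ?m]
    by (simp add: mn_def left_diff_distrib FL.smult_simps mult.assoc)
  then show "z * b \<in> Wof MM" unfolding b
    by (rule Wof_cong) (intro pv.subspace_scale[OF Wof_sub] a_pow_W w)
qed

lemma x_W: "f \<in> Wof MM \<Longrightarrow> gen Gen_x * f \<in> Wof MM"
proof (rule comm_W[OF rels(4)])
  fix j k
  have "gen Gen_x * (gen Gen_x ^ j * gen Gen_y ^ k) = mn 0 (Suc j) k" by (simp add: mn_def mult.assoc)
  then show "gen Gen_x * (gen Gen_x ^ j * gen Gen_y ^ k) \<in> Wof MM" by (simp only: mn_W)
qed

lemma y_W: "f \<in> Wof MM \<Longrightarrow> gen Gen_y * f \<in> Wof MM"
proof (rule comm_W[OF rels(5)])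
  fix j k
  show "gen Gen_y * (gen Gen_x ^ j * gen Gen_y ^ k) \<in> Wof MM"
  \<comment> \<open>Each use of the last relation moves y past one x, at the cost of terms with one
    x fewer.\<close>
  proof (induction j)
    case 0
    have "gen Gen_y * (gen Gen_x ^ 0 * gen Gen_y ^ k) = mn 0 0 (Suc k)" by (simp add: mn_def)
    then show ?case by (simp only: mn_W)
  next
    case (Suc j)
    let ?a = "gen Gen_a" and ?x = "gen Gen_x" and ?y = "gen Gen_y"
    let ?m = "?x ^ j * ?y ^ k"
    have m: "?m = mn 0 j k" by (simp add: mn_def)
    have "?y * (?x ^ Suc j * ?y ^ k) - (pscale (inverse (q ^ \<nu>)) (?x * (?y * ?m)) + (?a ^ (2 * \<nu>) * ?m - ?m)) \<in> I"
      using I_mult(2)[OF rels(6), of ?m] by (simp add: left_diff_distrib distrib_right FL.smult_simps mult.assoc diff_diff_eq)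
    moreover have "pscale (inverse (q ^ \<nu>)) (?x * (?y * ?m)) + (?a ^ (2 * \<nu>) * ?m - ?m) \<in> Wof MM"
      using x_W[OF Suc] a_pow_W[OF mn_W[of 0 j k], of "2 * \<nu>"] mn_W[of 0 j k] unfolding m
      by (intro pv.subspace_add[OF Wof_sub] pv.subspace_diff[OF Wof_sub] pv.subspace_scale[OF Wof_sub])
    ultimately show ?case by (rule Wof_cong)
  qed
qed

lemma W_all: "f \<in> Wof MM"
proof -
  have w: "psingle w 1 \<in> Wof MM" for w
  proof (induction w)
    case Nil
    have "psingle [] (1::'k) = mn 0 0 0" by (simp add: mn_def flip: zero_list_def)
    then show ?case by (simp only: mn_W)
  next
    case (Cons s w)
    have "psingle (s # w) (1::'k) = gen s * psingle w 1" by (simp add: Poly_Mapping.mult_single plus_list_def)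
    then show ?case using a_W[OF Cons] x_W[OF Cons] y_W[OF Cons] by (cases s) simp_all
  qed
  have "pkeys f \<subseteq> UNIV" by simp
  then show ?thesis
  proof (induction f rule: pm_induct)
    case (add k c f)
    have "pscale c (psingle k 1) + f \<in> Wof MM"
      by (rule pv.subspace_add[OF Wof_sub pv.subspace_scale[OF Wof_sub w] add(3)])
    then show ?case by simp
  qed (rule pv.subspace_0[OF Wof_sub])
qed

abbreviation "MB \<equiv> (\<lambda>(i, j, k). mn i j k) ` ({..<N} \<times> {..<r} \<times> {..<r})"

lemma a_mod: "gen Gen_a ^ i - gen Gen_a ^ (i mod N) \<in> I"
proof -
  let ?a = "gen Gen_a"
  have p: "(?a ^ N) ^ m - 1 \<in> I" for m
  proof (induction m)
    case (Suc m)
    have "?a ^ N * ((?a ^ N) ^ m - 1) + (?a ^ N - 1) \<in> I"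
      by (rule pv.subspace_add[OF I_sub I_mult(1)[OF Suc] rels(1)])
    then show ?case by (simp add: right_diff_distrib)
  qed (simp add: pv.subspace_0[OF I_sub])
  have "?a ^ i = ?a ^ (N * (i div N) + i mod N)" by simp
  also have "\<dots> = (?a ^ N) ^ (i div N) * ?a ^ (i mod N)" by (simp only: power_add power_mult)
  finally have "?a ^ i - ?a ^ (i mod N) = ((?a ^ N) ^ (i div N) - 1) * ?a ^ (i mod N)" by (simp add: left_diff_distrib)
  then show ?thesis using I_mult(2)[OF p] by simp
qed

text \<open>The exponent of \<open>a\<close> is reduced modulo N; a monomial in which x or y has
  exponent at least r lies in the ideal itself.\<close>

lemma mn_bounded: assumes N: "0 < N" shows "mn i j k \<in> Wof MB"
proof (cases "j < r \<and> k < r")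
  case True
  have "mn i j k - mn (i mod N) j k = (gen Gen_a ^ i - gen Gen_a ^ (i mod N)) * (gen Gen_x ^ j * gen Gen_y ^ k)"
    by (simp add: mn_def left_diff_distrib mult.assoc)
  then have "mn i j k - mn (i mod N) j k \<in> I" using I_mult(2)[OF a_mod] by simp
  moreover have "(i mod N, j, k) \<in> {..<N} \<times> {..<r} \<times> {..<r}" using True N by simp
  then have "mn (i mod N) j k \<in> MB" by (rule image_eqI[rotated]) simp
  ultimately show ?thesis by (rule Wof_cong[OF _ Wof_base])
next
  case False
  have hi: "z ^ n \<in> I" if "z ^ r \<in> I" "\<not> n < r" for z :: "U_gen list \<Rightarrow>\<^sub>0 'k" and n
  proof -
    have "z ^ n = z ^ r * z ^ (n - r)" using that(2) by (simp flip: power_add)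
    then show ?thesis using I_mult(2)[OF that(1)] by simp
  qed
  have "mn i j k \<in> I"
  proof (cases "j < r")
    case True
    then show ?thesis unfolding mn_def using False hi[OF rels(3)] by (intro I_mult(1)) simp
  next
    case False
    show ?thesis unfolding mn_def by (rule I_mult(2)[OF I_mult(1)[OF hi[OF rels(2) False]]])
  qed
  then show ?thesis by (rule Wof_I)
qed

lemma spanning:
  assumes "0 < N"
  obtains g where "g \<in> pv.span MB" "f - g \<in> I"
proof -
  have "MM \<subseteq> Wof MB" using mn_bounded[OF assms] by auto
  then have "f \<in> Wof MB" using Wof_mono W_all by blast
  then show ?thesis using that by (auto simp: Wof_def)
qed

end

lemma (in kalgebra2) T_induct [consumes 1, case_names zero add]:
  assumes "X \<in> carrier T" "P \<zero>\<^bsub>T\<^esub>"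
    and "\<And>u v X. u \<in> carrier A \<Longrightarrow> v \<in> carrier B \<Longrightarrow> X \<in> carrier T \<Longrightarrow> P X \<Longrightarrow> P (ts u v \<oplus>\<^bsub>T\<^esub> X)"
  shows "P X"
proof -
  obtain ps where ps: "set ps \<subseteq> AB" "X = texp ps" using ex_texp[OF assms(1)] by blast
  have "P (texp ps)" using ps(1)
  proof (induction ps rule: rev_induct)
    case (snoc z ps)
    obtain u v where "z = (u, v)" "u \<in> carrier A" "v \<in> carrier B" using snoc.prems by auto
    then show ?case using snoc assms(3) texp_snoc[of ps u v] texp_closed[of ps] by auto
  qed (simp add: assms(2))
  then show ?thesis using ps by simp
qed

lemma (in ring) word_prod_closed:
  "(\<And>s. g s \<in> carrier R) \<Longrightarrow> word_prod R g w \<in> carrier R"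
  by (induction w) (auto simp: word_prod_def)

lemma (in ring) word_prod_append:
  "(\<And>s. g s \<in> carrier R) \<Longrightarrow> word_prod R g (v @ w) = word_prod R g v \<otimes> word_prod R g w"
proof (induction v)
  case (Cons s v)
  note c = word_prod_closed[of g, OF Cons.prems]
  show ?case using Cons c[of v] c[of w] by (simp add: word_prod_def m_assoc)
qed (use word_prod_closed[of g w] in \<open>simp add: word_prod_def\<close>)

text \<open>\<open>U_hopf\<close> and \<open>U_algebra\<close> are different records with the same
  algebra operations, and tensor products depend on those alone.\<close>

lemma tensor_cong:
  fixes A :: "('k::field, 'a, 'm) module_scheme" and A' :: "('k, 'a, 'n) module_scheme"
  assumes "carrier A = carrier A'" "mult A = mult A'" "one A = one A'" "add A = add A'" "smult A = smult A'"
  shows "tensor A A = tensor A' A'" "tens A A = tens A' A'"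
proof -
  have M: "A \<times>\<times> A = A' \<times>\<times> A'" using assms by (simp add: DirProd_def)
  have rel: "tensor_relations A A = tensor_relations A' A'"
    unfolding tensor_relations_def M using assms by simp
  show "tensor A A = tensor A' A'" unfolding tensor_def M rel ..
  show "tens A A = tens A' A'" by (intro ext) (simp add: tens_def M rel)
qed

lemma kalgebra_base: "kalgebra (base_algebra :: ('k::field, 'k) module)"
proof (intro kalgebra.intro k_algebraI)
  show "ring (base_algebra :: ('k, 'k) module)"
    by (rule ring_cong_sel[OF class_ring.ring_axioms]) (simp_all add: base_algebra_def)
qed (simp_all add: base_algebra_def algebra_simps)

lemma Units_eqI:
  assumes "ring R" "x \<in> carrier R" "y \<in> carrier R" "x \<otimes>\<^bsub>R\<^esub> y = \<one>\<^bsub>R\<^esub>" "y \<otimes>\<^bsub>R\<^esub> x = \<one>\<^bsub>R\<^esub>"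
  shows "inv\<^bsub>R\<^esub> x = y"
proof -
  interpret ring R by fact
  show ?thesis using assms(2-) by (intro inv_char) auto
qed

section \<open>The isomorphism\<close>

locale presented = characterized U N \<nu> a + U_pres N \<nu> \<omega>
  for U :: "('k::{alg_closed_field, field_char_0}, 'u) hopf" (structure) and N \<nu> a and \<omega> :: 'k +
  fixes x y :: "('k, 'u) lop"
  assumes pair: "hopf_pair lscale CL dl eps SL (\<rho> a) N \<nu> x y (\<omega> ^ \<nu>) (inverse (\<omega> ^ \<nu>))"
    and prim: "primitive_root_of_unity N \<omega>"
    and yx_rel: "y * x - lscale (inverse ((\<omega> ^ \<nu>) ^ \<nu>)) (x * y) = \<rho> a ^ \<nu> * \<rho> a ^ \<nu> - 1"
    and x_nil: "x ^ ordk ((\<omega> ^ \<nu>) ^ \<nu>) = 0" and y_nil: "y ^ ordk ((\<omega> ^ \<nu>) ^ \<nu>) = 0"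

sublocale presented \<subseteq> hp: hopf_pair lscale CL dl eps SL "\<rho> a" N \<nu> "\<rho> a ^ \<nu>" x y "\<omega> ^ \<nu>" "inverse (\<omega> ^ \<nu>)"
  by (rule pair) simp

context presented begin

abbreviation "Qa \<equiv> U_algebra N \<nu> \<omega>"
abbreviation "TQ \<equiv> tensor Qa Qa"

lemma N0: "0 < N" using nu by simp

lemma r_eq: "r = ordk ((\<omega> ^ \<nu>) ^ \<nu>)"
proof -
  have "\<omega> ^ N = 1" using prim by (simp add: primitive_root_of_unity_def)
  then have "((\<omega> ^ \<nu>) ^ \<nu>) ^ N = 1" by (metis mult.commute power_mult power_one)
  then show ?thesis by (rule mult_order_eq_ordk[OF _ N0])
qed

abbreviation "wC \<equiv> word_prod TQ (U_comult_gen N \<nu> \<omega>)"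
abbreviation "wS \<equiv> word_prod Qa (U_antipode_gen N \<nu> \<omega>)"
abbreviation "Uh \<equiv> U_hopf N \<nu> \<omega>"

definition gam :: "U_gen \<Rightarrow> 'u" where
  "gam s = (case s of Gen_a \<Rightarrow> a | Gen_x \<Rightarrow> H.dn x | Gen_y \<Rightarrow> H.dn y)"

lemma gam_U [simp]: "gam s \<in> cU"
  by (cases s) (simp_all add: gam_def aU)

lemma rho_dn: "F \<in> CL \<Longrightarrow> \<rho> (H.dn F) = F"
  by (auto simp: CL_def H.dn_rho)

lemma rho_gam: "\<rho> (gam Gen_a) = \<rho> a" "\<rho> (gam Gen_x) = x" "\<rho> (gam Gen_y) = y"
  by (simp_all add: gam_def rho_dn hp.x_C hp.y_C)

abbreviation "wU \<equiv> word_prod U gam"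

lemma wU_U [simp]: "wU w \<in> cU"
  by (rule UU.A.word_prod_closed) simp

definition \<phi> :: "(U_gen list \<Rightarrow>\<^sub>0 'k) \<Rightarrow> 'u" where "\<phi> = lin_ext U wU"

lemma phi_U [simp]: "\<phi> f \<in> cU" unfolding \<phi>_def by (rule UU.A.lin_ext_closed) simp

lemma phi_add: "\<phi> (f + g) = \<phi> f \<oplus> \<phi> g" unfolding \<phi>_def by (rule UU.A.lin_ext_add) simp_all

lemma phi_scale: "\<phi> (pscale c f) = c \<odot> \<phi> f" unfolding \<phi>_def by (rule UU.A.lin_ext_scale) simp

lemma phi_zero [simp]: "\<phi> 0 = \<zero>" by (simp add: \<phi>_def)

lemma phi_single: "\<phi> (psingle w c) = c \<odot> wU w" unfolding \<phi>_def by (rule UU.A.lin_ext_single) simp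

lemma phi_mult: "\<phi> (f * g) = \<phi> f \<otimes> \<phi> g"
proof -
  have fg: "pkeys f \<subseteq> UNIV" "pkeys g \<subseteq> UNIV" by simp_all
  have s: "\<phi> (psingle p c * g) = \<phi> (psingle p c) \<otimes> \<phi> g" for p c
    using fg(2)
  proof (induction g rule: pm_induct)
    case (add k d g)
    have "\<phi> (psingle p c * psingle k d) = \<phi> (psingle p c) \<otimes> \<phi> (psingle k d)"
      by (simp add: Poly_Mapping.mult_single plus_list_def phi_single UU.A.word_prod_append UU.A.sc_mult_l UU.A.sc_mult_r)
         (simp add: mult.commute flip: UU.A.sc_assoc)
    then show ?case using add(3) by (simp add: distrib_left phi_add UU.A.r_distr)
  qed simp
  show ?thesis using fg(1)
    by (induction f rule: pm_induct) (simp_all add: distrib_right phi_add UU.A.l_distr s)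
qed

definition rf :: "(U_gen list \<Rightarrow>\<^sub>0 'k) \<Rightarrow> ('k, 'u) lop" where "rf f = \<rho> (\<phi> f)"

lemma rf_add: "rf (f + g) = rf f + rf g" and rf_scale: "rf (pscale c f) = lscale c (rf f)"
  and rf_mult: "rf (f * g) = rf f * rf g" and rf_zero [simp]: "rf 0 = 0"
  by (simp_all add: rf_def phi_add phi_scale phi_mult H.rho_add H.rho_scale H.rho_mult H.rho_zero)

lemma rf_diff: "rf (f - g) = rf f - rf g"
  using rf_add[of "f - g" g] by simp

lemma rf_gen: "rf (gen s) = \<rho> (gam s)"
  by (simp add: rf_def phi_single) (simp add: word_prod_def)

lemma rf_one: "rf 1 = 1"
proof -
  have e: "psingle [] (1::'k) = 1" unfolding zero_list_def[symmetric] by (rule Poly_Mapping.single_one)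
  have "wU [] = \<one>" by (simp add: word_prod_def)
  then have "rf (psingle [] 1) = 1" unfolding rf_def phi_single by (simp add: H.rho_one)
  then show ?thesis unfolding e .
qed

lemma rf_pow: "rf (f ^ n) = rf f ^ n"
  by (induction n) (simp_all add: rf_one rf_mult)

lemma rf_eq: "rf f = rf g \<longleftrightarrow> \<phi> f = \<phi> g"
  unfolding rf_def by (rule H.rho_inj) simp_all

lemma rf_mn: "rf (mn i j k) = hp.mon i j k"
  by (simp add: mn_def rf_mult rf_pow rf_gen rho_gam hp.mon_def)

lemma I_kernel: assumes "f \<in> I" shows "rf f = 0"
proof -
  let ?K = "{f. rf f = 0}"
  have "ideal ?K FA"
    by (rule FA.idealI_sub) (simp_all add: rf_add rf_scale rf_mult)
  moreover have "U_relations N \<nu> \<omega> \<subseteq> ?K"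
  proof -
    have xa: "x * \<rho> a = lscale q (\<rho> a * x)" and ya: "y * \<rho> a = lscale (inverse q) (\<rho> a * y)"
      using hp.eig_x hp.eig_y unfolding hp.eig_def by blast+
    note rs = rf_diff rf_scale rf_mult rf_pow rf_gen rf_one rho_gam
    have g2: "\<rho> a ^ (2 * \<nu>) = \<rho> a ^ \<nu> * \<rho> a ^ \<nu>" by (simp only: mult_2 power_add)
    have aN: "\<rho> a ^ N = 1" by (simp only: rho_a_pow dvd_refl)
    have 1: "rf (gen Gen_a ^ N - 1) = 0" unfolding rs aN by (rule diff_self)
    have 2: "rf (gen Gen_x ^ r) = 0" "rf (gen Gen_y ^ r) = 0" unfolding rs r_eq by (rule x_nil, rule y_nil)
    have 3: "rf (gen Gen_x * gen Gen_a - pscale q (gen Gen_a * gen Gen_x)) = 0"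
      "rf (gen Gen_y * gen Gen_a - pscale (inverse q) (gen Gen_a * gen Gen_y)) = 0"
      unfolding rs xa ya by (rule diff_self)+
    have 4: "rf (gen Gen_y * gen Gen_x - pscale (inverse (q ^ \<nu>)) (gen Gen_x * gen Gen_y) - (gen Gen_a ^ (2 * \<nu>) - 1)) = 0"
      unfolding rs yx_rel g2 by (rule diff_self)
    show ?thesis
      by (simp only: free_sel U_relations_def Let_def free_more insert_subset mem_Collect_eq 1 2 3 4 empty_subsetI simp_thms)
  qed
  ultimately have "I \<subseteq> ?K" unfolding U_ideal_def by (rule FA.genideal_minimal)
  then show ?thesis using assms by blast
qed

text \<open>Modulo I, f is a combination g of the bounded monomials. Their images are independent,
  with coordinate functionals \<open>hp.ED\<close>, so g is recovered from its image and vanishes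
  when that does.\<close>

lemma kernel_I: assumes "rf f = 0" shows "f \<in> I"
proof -
  obtain g where g: "g \<in> pv.span MB" "f - g \<in> I" by (rule spanning[OF N0])
  let ?J = "{..<N} \<times> {..<r} \<times> {..<r}"
  define G where "G h = (\<Sum>(i, j, k)\<in>?J. pscale (hp.ED i j k (rf h)) (mn i j k))" for h
  have lfE: "L.lf (hp.ED i j k)" if "(i, j, k) \<in> ?J" for i j k using that hp.ED(1)[of j k] by (auto simp: r_eq)
  have "pv.subspace {h. G h = h}"
  proof (rule pv.subspaceI)
    have G_add: "G (u + v) = G u + G v" for u v
      unfolding G_def sum.distrib[symmetric]
      by (rule sum.cong) (auto simp: rf_add L.lf_add[OF lfE] pv.scale_left_distrib)
    have G_scale: "G (pscale c u) = pscale c (G u)" for c u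
      unfolding G_def pv.scale_sum_right
      by (rule sum.cong) (auto simp: rf_scale L.lf_scale[OF lfE] pv.scale_scale)
    show "0 \<in> {h. G h = h}" using G_add[of 0 0] by simp
    show "u + v \<in> {h. G h = h}" if "u \<in> {h. G h = h}" "v \<in> {h. G h = h}" for u v using that by (simp add: G_add)
    show "pscale c u \<in> {h. G h = h}" if "u \<in> {h. G h = h}" for c u using that by (simp add: G_scale)
  qed
  moreover have "MB \<subseteq> {h. G h = h}"
  proof
    fix h assume "h \<in> MB"
    then obtain i j k where h: "h = mn i j k" "(i, j, k) \<in> ?J" by auto
    have "G h = (\<Sum>t\<in>?J. if t = (i, j, k) then mn i j k else 0)"
      unfolding G_def h(1) using h(2)
      by (intro sum.cong refl) (auto simp: rf_mn hp.ED(2) r_eq cong_def split: if_splits)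
    also have "\<dots> = mn i j k" using h(2) by simp
    finally show "h \<in> {h. G h = h}" using h by simp
  qed
  ultimately have "G g = g" using pv.span_minimal g(1) by blast
  moreover have "rf g = 0" using I_kernel[OF g(2)] assms by (simp add: rf_diff)
  then have "G g = 0" unfolding G_def by (intro sum.neutral) (auto simp: L.lf_zero[OF lfE])
  ultimately show ?thesis using g(2) by simp
qed

lemma cls_iff: "Q.cls f = Q.cls g \<longleftrightarrow> \<phi> f = \<phi> g"
  using Q_eq[of f g] I_kernel[of "f - g"] kernel_I[of "f - g"] rf_eq[of f g] by (auto simp: rf_diff)

text \<open>The kernel of \<phi> being exactly I, its fibres are the cosets of I. The inverse of the
  induced isomorphism is therefore given directly by taking fibres.\<close>

definition \<Phi> :: "'u \<Rightarrow> (U_gen list \<Rightarrow>\<^sub>0 'k) set" where "\<Phi> u = {f. \<phi> f = u}"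

lemma Phi_phi: "\<Phi> (\<phi> f) = Q.cls f"
proof -
  have "g \<in> \<Phi> (\<phi> f) \<longleftrightarrow> g \<in> Q.cls f" for g
    using Q.in_cls[of f g] cls_iff[of g f] by (simp add: \<Phi>_def)
  then show ?thesis by blast
qed

lemma phi_surj: assumes "u \<in> cU" obtains f where "u = \<phi> f"
proof -
  have "hd.gn {\<rho> a, x, y} \<subseteq> range rf"
  proof
    fix w assume "w \<in> hd.gn {\<rho> a, x, y}"
    then show "w \<in> range rf"
    proof (induction rule: hd.gn.induct)
      case gn_one
      show ?case by (rule range_eqI[of _ _ 1]) (rule rf_one[symmetric])
    next
      case (gn_gen s u)
      obtain f where f: "u = rf f" using gn_gen(3) by blast
      have "s = rf (gen Gen_a) \<or> s = rf (gen Gen_x) \<or> s = rf (gen Gen_y)"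
        using gn_gen(1) by (simp add: rf_gen rho_gam)
      then obtain t where "s = rf (gen t)" by blast
      then have "s * u = rf (gen t * f)" by (simp only: f rf_mult)
      then show ?case by (rule range_eqI)
    next
      case (gn_add u v)
      obtain f g where "u = rf f" "v = rf g" using gn_add(3,4) by blast
      then have "u + v = rf (f + g)" by (simp only: rf_add)
      then show ?case by (rule range_eqI)
    next
      case (gn_scale u c)
      obtain f where "u = rf f" using gn_scale(2) by blast
      then have "lscale c u = rf (pscale c f)" by (simp only: rf_scale)
      then show ?case by (rule range_eqI)
    qed
  qed
  then have "CL \<subseteq> range rf" using hp.C_gn by blast
  then obtain f where "\<rho> u = rf f" using assms by (auto simp: CL_def)
  then have "u = \<phi> f" using H.rho_inj[OF assms, of "\<phi> f"] by (simp add: rf_def)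
  then show ?thesis by (rule that)
qed

lemma Phi_closed [simp]: "u \<in> cU \<Longrightarrow> \<Phi> u \<in> carrier Qa"
  by (rule phi_surj[of u]) (auto simp: Phi_phi Q_sel)

lemma Phi_add: "u \<in> cU \<Longrightarrow> v \<in> cU \<Longrightarrow> \<Phi> (u \<oplus> v) = \<Phi> u \<oplus>\<^bsub>Qa\<^esub> \<Phi> v"
  and Phi_mult: "u \<in> cU \<Longrightarrow> v \<in> cU \<Longrightarrow> \<Phi> (u \<otimes> v) = \<Phi> u \<otimes>\<^bsub>Qa\<^esub> \<Phi> v"
  and Phi_scale: "u \<in> cU \<Longrightarrow> \<Phi> (c \<odot> u) = c \<odot>\<^bsub>Qa\<^esub> \<Phi> u"
proof -
  assume u: "u \<in> cU"
  obtain f where f: "u = \<phi> f" by (rule phi_surj[OF u])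
  show "\<Phi> (c \<odot> u) = c \<odot>\<^bsub>Qa\<^esub> \<Phi> u" by (simp add: f Phi_phi Q_ops flip: phi_scale)
  assume v: "v \<in> cU"
  obtain g where g: "v = \<phi> g" by (rule phi_surj[OF v])
  show "\<Phi> (u \<oplus> v) = \<Phi> u \<oplus>\<^bsub>Qa\<^esub> \<Phi> v" "\<Phi> (u \<otimes> v) = \<Phi> u \<otimes>\<^bsub>Qa\<^esub> \<Phi> v"
    by (simp_all add: f g Phi_phi Q_ops flip: phi_add phi_mult)
qed

lemma Phi_one: "\<Phi> \<one> = \<one>\<^bsub>Qa\<^esub>"
proof -
  have "\<phi> 1 = \<one>" using rf_one H.rho_inj[of "\<phi> 1" "\<one>"] by (simp add: rf_def H.rho_one)
  then show ?thesis using Phi_phi[of 1] by (simp add: Q_sel)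
qed

lemma Phi_pow: "u \<in> cU \<Longrightarrow> \<Phi> (u [^] (n::nat)) = \<Phi> u [^]\<^bsub>Qa\<^esub> n"
  by (induction n) (simp_all add: Phi_one Phi_mult)

lemma Phi_inj:
  assumes u: "u \<in> cU" and v: "v \<in> cU" and eq: "\<Phi> u = \<Phi> v"
  shows "u = v"
proof -
  obtain f where f: "u = \<phi> f" by (rule phi_surj[OF u])
  then have "f \<in> \<Phi> u" by (simp add: \<Phi>_def)
  then show ?thesis unfolding eq using f by (simp add: \<Phi>_def)
qed

lemma Phi_gam: "\<Phi> (gam s) = U_class N \<nu> \<omega> s"
proof -
  have "\<phi> (gen s) = gam s" by (simp add: phi_single) (simp add: word_prod_def)
  then show ?thesis using Phi_phi[of "gen s"] by (simp add: U_class_def)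
qed

section \<open>Compatibility with comultiplication, counit and antipode\<close>

definition MM' :: "('u \<times> 'u \<Rightarrow>\<^sub>0 'k) set \<Rightarrow> _" where "MM' = tensor_map Qa Qa \<Phi> \<Phi>"

lemma M_closed [simp]: "X \<in> carrier T \<Longrightarrow> MM' X \<in> carrier TQ"
  unfolding MM'_def tensor_map_def
  by (rule UU.tensor_lift_closed[OF KQ.T.kalgebra_axioms]) auto

lemma tl_M:
  assumes X: "X \<in> carrier T" and pq: "KQ.A.lin p" "KQ.A.lin p'"
  shows "tl (\<lambda>u v. p u * p' v) (MM' X) = tl (\<lambda>u v. p (\<Phi> u) * p' (\<Phi> v)) X"
proof -
  note b = KQ.bil_prod[OF pq]
  have "tl (\<lambda>u v. p u * p' v) (MM' X) = tl (\<lambda>u v. tl (\<lambda>u v. p u * p' v) (tens Qa Qa (\<Phi> u) (\<Phi> v))) X"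
    unfolding MM'_def tensor_map_def
    by (rule UU.lin_lift[OF KQ.T.kalgebra_axioms KQ.tl_lin[OF b] X]) auto
  also have "\<dots> = tl (\<lambda>u v. p (\<Phi> u) * p' (\<Phi> v)) X"
    by (rule UU.tl_cong[OF X]) (simp add: KQ.tl_ts[OF b])
  finally show ?thesis .
qed

lemma bil_Phi:
  assumes "KQ.A.lin p" "KQ.A.lin p'" shows "UU.bil (\<lambda>u v. p (\<Phi> u) * p' (\<Phi> v))"
proof -
  have "UU.A.lin (\<lambda>u. p (\<Phi> u))" if "KQ.A.lin p" for p
    by (simp add: UU.A.lin_def Phi_add Phi_scale KQ.A.lin_simps[OF that])
  then show ?thesis using assms UU.bil_prod by blast
qed

lemma M_add: "X \<in> carrier T \<Longrightarrow> Y \<in> carrier T \<Longrightarrow> MM' (X \<oplus>\<^bsub>T\<^esub> Y) = MM' X \<oplus>\<^bsub>TQ\<^esub> MM' Y"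
  by (rule KQ.T_eqI)
     (simp_all add: tl_M KQ.T.lin_simps[OF KQ.tl_lin[OF KQ.bil_prod]] UU.T.lin_simps[OF UU.tl_lin[OF bil_Phi]])

lemma M_scale: "X \<in> carrier T \<Longrightarrow> MM' (c \<odot>\<^bsub>T\<^esub> X) = c \<odot>\<^bsub>TQ\<^esub> MM' X"
  by (rule KQ.T_eqI)
     (simp_all add: tl_M KQ.T.lin_simps[OF KQ.tl_lin[OF KQ.bil_prod]] UU.T.lin_simps[OF UU.tl_lin[OF bil_Phi]])

lemma M_zero: "MM' \<zero>\<^bsub>T\<^esub> = \<zero>\<^bsub>TQ\<^esub>"
  using M_scale[of "\<zero>\<^bsub>T\<^esub>" 0] by simp

lemma M_tens: "u \<in> cU \<Longrightarrow> v \<in> cU \<Longrightarrow> MM' (tens U U u v) = tens Qa Qa (\<Phi> u) (\<Phi> v)"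
  by (rule KQ.T_eqI) (simp_all add: tl_M UU.tl_ts[OF bil_Phi] KQ.tl_ts[OF KQ.bil_prod])

lemma M_mult:
  assumes X: "X \<in> carrier T" and Y: "Y \<in> carrier T"
  shows "MM' (X \<otimes>\<^bsub>T\<^esub> Y) = MM' X \<otimes>\<^bsub>TQ\<^esub> MM' Y"
  using X
proof (induction X rule: UU.T_induct)
  case zero then show ?case using Y by (simp add: M_zero)
next
  case (add u v X)
  have "MM' (tens U U u v \<otimes>\<^bsub>T\<^esub> Y) = MM' (tens U U u v) \<otimes>\<^bsub>TQ\<^esub> MM' Y" using Y
  proof (induction Y rule: UU.T_induct)
    case zero then show ?case using add(1,2) by (simp add: M_zero)
  next
    case (add u' v' Y)
    then show ?case using \<open>u \<in> cU\<close> \<open>v \<in> cU\<close>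
      by (simp add: UU.T.r_distr KQ.T.r_distr M_add M_tens UU.ts_mult KQ.ts_mult Phi_mult)
  qed
  then show ?case using add Y by (simp add: UU.T.l_distr KQ.T.l_distr M_add)
qed

lemma sp_gam: "\<Delta> (gam Gen_x) = tens U U (gam Gen_x) (a [^] \<nu>) \<oplus>\<^bsub>T\<^esub> tens U U \<one> (gam Gen_x)"
  "\<Delta> (gam Gen_y) = tens U U (gam Gen_y) (a [^] \<nu>) \<oplus>\<^bsub>T\<^esub> tens U U \<one> (gam Gen_y)"
  using sp_rho[of "a [^] \<nu>" "gam Gen_x"] sp_rho[of "a [^] \<nu>" "gam Gen_y"] hp.sp_x hp.sp_y
  by (simp_all add: H.rho_pow aU rho_gam skew_primitives_def)

lemma M_comult_gen: "MM' (\<Delta> (gam s)) = U_comult_gen N \<nu> \<omega> s"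
proof -
  have ga: "gam Gen_a = a" by (simp add: gam_def)
  have ca: "U_class N \<nu> \<omega> Gen_a = \<Phi> a" using Phi_gam[of Gen_a] ga by simp
  show ?thesis
  proof (cases s)
    case Gen_a
    have "\<Delta> a = tens U U a a" using a_grouplike by (simp add: grouplikes_def)
    then show ?thesis by (simp add: U_comult_gen_def Let_def Gen_a ga ca M_tens aU)
  qed (simp_all add: U_comult_gen_def Let_def ga ca sp_gam M_add M_tens aU Phi_pow Phi_one flip: Phi_gam)
qed

lemma M_comult_word: "MM' (\<Delta> (wU w)) = wC w"
proof (induction w)
  case Nil
  show ?case by (simp add: word_prod_def comult_hom UU.T_one KQ.T_one M_tens Phi_one)
next
  case (Cons s w)
  have "wU (s # w) = gam s \<otimes> wU w" by (simp add: word_prod_def)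
  then have "MM' (\<Delta> (wU (s # w))) = MM' (\<Delta> (gam s)) \<otimes>\<^bsub>TQ\<^esub> MM' (\<Delta> (wU w))"
    by (simp add: comult_hom M_mult)
  then show ?case by (simp add: Cons M_comult_gen) (simp add: word_prod_def)
qed

lemma M_comult: "MM' (\<Delta> (\<phi> f)) = lin_ext TQ wC f"
proof -
  have c: "wC w \<in> carrier TQ" for w
    unfolding M_comult_word[symmetric] by (simp add: comult_hom)
  have "pkeys f \<subseteq> UNIV" by simp
  then show ?thesis
  proof (induction f rule: pm_induct)
    case zero
    have "\<Delta> \<zero> = \<zero>\<^bsub>T\<^esub>" using comult_hom(3)[of "\<zero>" 0] comult_hom(1)[of "\<zero>"] by simp
    then show ?case by (simp add: M_zero)
  next
    case (add k d f)
    have "lin_ext TQ wC (psingle k d + f)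
      = lin_ext TQ wC (psingle k d) \<oplus>\<^bsub>TQ\<^esub> lin_ext TQ wC f"
      by (rule KQ.T.lin_ext_add) (use c in auto)
    also have "lin_ext TQ wC (psingle k d) = d \<odot>\<^bsub>TQ\<^esub> MM' (\<Delta> (wU k))"
      unfolding M_comult_word by (rule KQ.T.lin_ext_single) (rule c)
    finally show ?case using add(3) by (simp add: phi_add phi_single comult_hom M_add M_scale)
  qed
qed

lemma counit_phi: "counit U (\<phi> f) = lin_ext base_algebra (word_prod base_algebra U_counit_gen) f"
proof -
  interpret B: kalgebra "base_algebra :: ('k, 'k) module" by (rule kalgebra_base)
  have B: "carrier (base_algebra :: ('k, 'k) module) = UNIV" "mult (base_algebra :: ('k, 'k) module) = (*)"
    "\<one>\<^bsub>base_algebra :: ('k, 'k) module\<^esub> = 1" by (simp_all add: base_algebra_def)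
  have g: "counit U (gam s) = U_counit_gen s" for s
  proof -
    have "eps (\<rho> (gam s)) = U_counit_gen s"
      using a_grouplike hd.sp_eps[OF hp.sp_x hp.g_nz] hd.sp_eps[OF hp.sp_y hp.g_nz]
      by (cases s) (simp_all add: rho_gam eps_rho aU grouplikes_def)
    then show ?thesis by (simp add: eps_rho)
  qed
  have w: "counit U (wU w) = word_prod base_algebra U_counit_gen w" for w
    by (induction w) (simp_all add: word_prod_def counit_hom B g UU.A.word_prod_closed[of gam, unfolded word_prod_def])
  have "B.lin id" by (simp add: B.lin_def) (simp add: base_algebra_def)
  then have "lin_ext base_algebra (word_prod base_algebra U_counit_gen) f = ev (word_prod base_algebra U_counit_gen) f"
    using B.lin_lin_ext[of id "word_prod base_algebra U_counit_gen" f] B(1) by simp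
  moreover have "counit U (\<phi> f) = ev (\<lambda>w. counit U (wU w)) f"
    unfolding \<phi>_def by (rule UU.A.lin_lin_ext[OF counit_hom(1)]) simp
  ultimately show ?thesis by (simp add: w)
qed

abbreviation "a' \<equiv> antipode U a"

lemma a'_U [simp]: "a' \<in> cU" using aU by (rule antipode_hom)

lemma a_inverse: "a \<otimes> a' = \<one>" "a' \<otimes> a = \<one>" "\<rho> a * \<rho> a' = 1" "\<rho> a' * \<rho> a = 1"
  "\<rho> a ^ n * \<rho> a' ^ n = 1" "\<rho> a' ^ n * \<rho> a ^ n = 1"
proof -
  show 1: "a \<otimes> a' = \<one>" "a' \<otimes> a = \<one>" using unit_inverse[OF a_grouplike] by auto
  then show 2: "\<rho> a * \<rho> a' = 1" "\<rho> a' * \<rho> a = 1" using aU by (metis H.rho_mult H.rho_one a'_U)+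
  have "u ^ n * v ^ n = 1" if "u * v = (1 :: ('k, 'u) lop)" for u v
  proof (induction n)
    case (Suc n)
    have "u ^ Suc n * v ^ Suc n = u * (u ^ n * v ^ n) * v" unfolding power_Suc[of u] power_Suc2[of v] by (simp only: mult.assoc)
    then show ?case using Suc that by simp
  qed simp
  then show "\<rho> a ^ n * \<rho> a' ^ n = 1" "\<rho> a' ^ n * \<rho> a ^ n = 1" using 2 by blast+
qed

text \<open>The formulas for S (h u) and S (z u), specialised to u = 1, compute S on the generator;
  substituting this back turns them into a product in reversed order.\<close>

lemma antipode_gam:
  assumes u: "u \<in> cU"
  shows "antipode U (gam s \<otimes> u) = antipode U u \<otimes> antipode U (gam s)"
proof -
  have uC: "\<rho> u \<in> CL" using u by (simp add: CL_def)
  have sp: "SL (z * \<rho> u) = SL (\<rho> u) * SL z" if "hd.sp (\<rho> a ^ \<nu>) z" for z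
  proof -
    note S = hd.S_sp_mult[OF that hp.a_pow_gl[of \<nu>] a_inverse(5)]
    show ?thesis using S[OF uC] S[OF hd.one_C] by (simp add: hd.S_one mult.assoc)
  qed
  have gl: "SL (\<rho> a * \<rho> u) = SL (\<rho> u) * SL (\<rho> a)"
    using hd.S_gl_mult[OF hp.a_gl a_inverse(3) uC] aU by (simp add: SL_rho)
  have "SL (\<rho> (gam s) * \<rho> u) = SL (\<rho> u) * SL (\<rho> (gam s))"
    using gl sp[OF hp.sp_x] sp[OF hp.sp_y] by (cases s) (simp_all only: rho_gam)
  then have eq: "SL (\<rho> (gam s) * \<rho> u) = SL (\<rho> u) * SL (\<rho> (gam s))" .
  have "\<rho> (antipode U (gam s \<otimes> u)) = SL (\<rho> (gam s) * \<rho> u)"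
    using u by (simp add: SL_rho flip: H.rho_mult)
  also have "\<dots> = \<rho> (antipode U u \<otimes> antipode U (gam s))"
    unfolding eq using u by (simp add: SL_rho antipode_hom H.rho_mult)
  finally show ?thesis
    using H.rho_inj[of "antipode U (gam s \<otimes> u)" "antipode U u \<otimes> antipode U (gam s)"] u
    by (simp add: antipode_hom)
qed

text \<open>The antipode of z is - z times the inverse of \<open>\<rho> a ^ \<nu>\<close>; moving
  that inverse to the front costs a factor inverse to c.\<close>

lemma antipode_sp:
  assumes z: "z \<in> cU" "hd.sp (\<rho> a ^ \<nu>) (\<rho> z)" and c: "\<rho> z * \<rho> a ^ \<nu> = lscale c (\<rho> a ^ \<nu> * \<rho> z)" and c0: "c \<noteq> 0"
  shows "antipode U z = (- inverse c) \<odot> (a' [^] \<nu> \<otimes> z)"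
proof -
  let ?g = "\<rho> a ^ \<nu>" and ?h = "\<rho> a' ^ \<nu>"
  have "SL (\<rho> z) = - (\<rho> z * ?h)"
    using hd.S_sp_mult[OF z(2) hp.a_pow_gl[of \<nu>] a_inverse(5) hd.one_C] by (simp add: hd.S_one)
  moreover have "?h * \<rho> z = lscale c (\<rho> z * ?h)"
  proof -
    have "?h * (\<rho> z * ?g) * ?h = lscale c (?h * (?g * \<rho> z) * ?h)" unfolding c by (simp add: L.smult_simps)
    moreover have "?h * (\<rho> z * ?g) * ?h = ?h * \<rho> z" by (simp add: mult.assoc a_inverse(5))
    moreover have "?h * (?g * \<rho> z) * ?h = \<rho> z * ?h" using a_inverse(6)[of \<nu>] by (simp flip: mult.assoc)
    ultimately show ?thesis by simp
  qed
  then have "\<rho> z * ?h = lscale (inverse c) (?h * \<rho> z)" using c0 by simp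
  ultimately have "SL (\<rho> z) = lscale (- inverse c) (?h * \<rho> z)" by simp
  then have "\<rho> (antipode U z) = \<rho> ((- inverse c) \<odot> (a' [^] \<nu> \<otimes> z))"
    using z(1) by (simp add: SL_rho H.rho_scale H.rho_mult H.rho_pow)
  then show ?thesis using H.rho_inj z(1) antipode_hom(1) by simp
qed

lemma Phi_antipode_gen: "\<Phi> (antipode U (gam s)) = U_antipode_gen N \<nu> \<omega> s"
proof -
  have ga: "gam Gen_a = a" by (simp add: gam_def)
  have ca: "U_class N \<nu> \<omega> Gen_a = \<Phi> a" using Phi_gam[of Gen_a] ga by simp
  have inv: "inv\<^bsub>Qa\<^esub> (\<Phi> a) = \<Phi> a'"
    by (rule Units_eqI[OF KQ.A.ring_axioms]) (simp_all add: aU a_inverse Phi_one flip: Phi_mult)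
  have q0: "q ^ \<nu> \<noteq> 0"
    using prim by (auto simp: primitive_root_of_unity_def zero_power)
  have "antipode U (gam Gen_x) = (- inverse (q ^ \<nu>)) \<odot> (a' [^] \<nu> \<otimes> gam Gen_x)"
    by (rule antipode_sp) (simp_all add: rho_gam hp.sp_x hp.xg q0 del: power_eq_0_iff)
  moreover have "antipode U (gam Gen_y) = (- inverse (inverse q ^ \<nu>)) \<odot> (a' [^] \<nu> \<otimes> gam Gen_y)"
    by (rule antipode_sp) (use q0 in \<open>simp_all add: rho_gam hp.sp_y hp.yg\<close>)
  ultimately show ?thesis
    by (cases s) (simp_all add: ga ca inv Let_def Phi_scale Phi_mult Phi_pow power_inverse flip: Phi_gam)
qed

lemma Phi_antipode_word: "\<Phi> (antipode U (wU w)) = wS (rev w)"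
proof (induction w)
  case Nil
  have "\<rho> (antipode U \<one>) = \<rho> \<one>" using hd.S_one SL_rho[of "\<one>"] by (simp add: H.rho_one)
  then have "antipode U \<one> = \<one>" using H.rho_inj[OF antipode_hom(1)] by simp
  then show ?case by (simp add: word_prod_def Phi_one)
next
  case (Cons s w)
  have c: "U_antipode_gen N \<nu> \<omega> s \<in> carrier Qa" for s unfolding Phi_antipode_gen[symmetric] by (simp add: antipode_hom)
  have "wU (s # w) = gam s \<otimes> wU w" by (simp add: word_prod_def)
  then have "\<Phi> (antipode U (wU (s # w))) = \<Phi> (antipode U (wU w)) \<otimes>\<^bsub>Qa\<^esub> \<Phi> (antipode U (gam s))"
    by (simp add: antipode_gam antipode_hom Phi_mult)
  also have "\<dots> = wS (rev w) \<otimes>\<^bsub>Qa\<^esub> wS [s]"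
    unfolding Cons Phi_antipode_gen using c[of s] by (simp add: word_prod_def)
  also have "\<dots> = wS (rev (s # w))"
    using KQ.A.word_prod_append[of "U_antipode_gen N \<nu> \<omega>", OF c] by simp
  finally show ?case .
qed

lemma Phi_antipode: "\<Phi> (antipode U (\<phi> f)) = lin_ext Qa (\<lambda>w. wS (rev w)) f"
proof -
  let ?b = "\<lambda>w. wS (rev w)"
  have c: "?b w \<in> carrier Qa" for w unfolding Phi_antipode_word[symmetric] by (simp add: antipode_hom)
  have "pkeys f \<subseteq> UNIV" by simp
  then show ?thesis
  proof (induction f rule: pm_induct)
    case zero
    have "antipode U \<zero> = \<zero>" using antipode_hom(3)[of "\<zero>" 0] antipode_hom(1)[of "\<zero>"] by simp
    moreover have "\<Phi> \<zero> = \<zero>\<^bsub>Qa\<^esub>" using Phi_scale[of "\<zero>" 0] by simp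
    ultimately show ?case by simp
  next
    case (add k d f)
    have "lin_ext Qa ?b (psingle k d + f) = lin_ext Qa ?b (psingle k d) \<oplus>\<^bsub>Qa\<^esub> lin_ext Qa ?b f"
      by (rule KQ.A.lin_ext_add) (use c in auto)
    also have "lin_ext Qa ?b (psingle k d) = d \<odot>\<^bsub>Qa\<^esub> \<Phi> (antipode U (wU k))"
      unfolding Phi_antipode_word by (rule KQ.A.lin_ext_single) (rule c)
    finally show ?case using add(3) by (simp add: phi_add phi_single antipode_hom Phi_add Phi_scale)
  qed
qed

lemma U_hopf_sel:
  "carrier Uh = carrier Qa" "mult Uh = mult Qa" "one Uh = one Qa"
  "add Uh = add Qa" "smult Uh = smult Qa"
  by (simp_all add: U_hopf_def Let_def)

lemma U_hopf_ops:
  "comult Uh C = lin_ext TQ wC (SOME f. f \<in> C)"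
  "counit Uh C = lin_ext base_algebra (word_prod base_algebra U_counit_gen) (SOME f. f \<in> C)"
  "antipode Uh C = lin_ext Qa (\<lambda>w. wS (rev w)) (SOME f. f \<in> C)"
  by (simp_all add: U_hopf_def Let_def)

lemma Phi_alg_hom: "\<Phi> \<in> alg_hom U Uh"
  unfolding alg_hom_def
proof
  show "\<Phi> \<in> Ring.ring_hom U Uh"
    by (rule ring_hom_memI) (simp_all only: U_hopf_sel Phi_add Phi_mult Phi_one Phi_closed)
  show "\<Phi> \<in> LinearCombinations.module_hom class_ring U Uh"
    unfolding LinearCombinations.module_hom_def U_hopf_sel
    by (intro CollectI conjI allI impI funcsetI) (simp_all only: Phi_add Phi_scale Phi_closed)
qed

lemma Phi_bij: "bij_betw \<Phi> cU (carrier Uh)"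
  unfolding bij_betw_def U_hopf_sel
proof
  show "inj_on \<Phi> cU" by (rule inj_onI) (rule Phi_inj)
  show "\<Phi> ` cU = carrier Qa"
  proof (rule equalityI)
    show "\<Phi> ` cU \<subseteq> carrier Qa" by (rule image_subsetI) (rule Phi_closed)
    show "carrier Qa \<subseteq> \<Phi> ` cU"
    proof (rule subsetI)
      fix X assume "X \<in> carrier Qa"
      then obtain f where "X = Q.cls f" unfolding Q_sel by (rule imageE)
      then have "X = \<Phi> (\<phi> f)" by (simp only: Phi_phi)
      then show "X \<in> \<Phi> ` cU" by (rule image_eqI[OF _ phi_U])
    qed
  qed
qed

text \<open>The structure maps of the presented algebra are computed on a chosen representative of a
  coset; \<phi> takes the same value on all of them.\<close>

lemma phi_rep:
  assumes h: "h \<in> cU" shows "\<phi> (SOME f. f \<in> \<Phi> h) = h"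
proof (rule Phi_inj[OF phi_U h])
  show "\<Phi> (\<phi> (SOME f. f \<in> \<Phi> h)) = \<Phi> h"
    unfolding Phi_phi by (rule Q_rep(2)[OF Phi_closed[OF h]])
qed

lemma Phi_iso: "\<Phi> \<in> hopf_iso U Uh"
  unfolding hopf_iso_def
proof (intro CollectI conjI ballI Phi_alg_hom Phi_bij)
  fix h assume h: "h \<in> cU"
  note f = phi_rep[OF h]
  have tc: "tensor Uh Uh = TQ" "tens Uh Uh = tens Qa Qa"
    by (rule tensor_cong[OF U_hopf_sel])+
  show "comult Uh (\<Phi> h) = tensor_map Uh Uh \<Phi> \<Phi> (\<Delta> h)"
    unfolding U_hopf_ops tensor_map_def tc
    by (rule M_comult[of "SOME f. f \<in> \<Phi> h", unfolded f MM'_def tensor_map_def, symmetric])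
  show "counit Uh (\<Phi> h) = counit U h"
    unfolding U_hopf_ops by (rule counit_phi[of "SOME f. f \<in> \<Phi> h", unfolded f, symmetric])
  show "antipode Uh (\<Phi> h) = \<Phi> (antipode U h)"
    unfolding U_hopf_ops by (rule Phi_antipode[of "SOME f. f \<in> \<Phi> h", unfolded f, symmetric])
qed

lemma isomorphic: "hopf_isomorphic U Uh"
  unfolding hopf_isomorphic_def using Phi_iso by blast

end

lemma (in characterized) classification:
  "\<exists>\<omega>::'k. primitive_root_of_unity N \<omega> \<and> hopf_isomorphic U (U_hopf N \<nu> \<omega>)"
proof -
  obtain R where R: "hopf_qt lscale CL dl eps SL (\<rho> a) N \<nu> R" using hopf_qt_exists by blast
  interpret hq: hopf_qt lscale CL dl eps SL "\<rho> a" N \<nu> "\<rho> a ^ \<nu>" R by (rule R) simp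
  obtain x y \<alpha> where p: "hopf_pair lscale CL dl eps SL (\<rho> a) N \<nu> x y \<alpha> (inverse \<alpha>)"
    "y * x - lscale (inverse (\<alpha> ^ \<nu>)) (x * y) = \<rho> a ^ \<nu> * \<rho> a ^ \<nu> - 1"
    "\<And>m. \<alpha> ^ m = 1 \<longleftrightarrow> (\<rho> a ^ \<nu>) ^ m = 1"
    "x ^ ordk (\<alpha> ^ \<nu>) = 0" "y ^ ordk (\<alpha> ^ \<nu>) = 0"
  proof (rule hq.presentation, goal_cases)
    case (1 x y \<alpha>)
    show ?case by (rule 1(1)[OF 1(2-6)])
  qed
  \<comment> \<open>The equality of the orders of \<alpha> and \<open>\<rho> a ^ \<nu>\<close>,
    written as divisibility, is the hypothesis under which \<alpha> is the \<nu>-th power of a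
    primitive N-th root of unity.\<close>
  have ord: "\<alpha> ^ m = 1 \<longleftrightarrow> N dvd \<nu> * m" for m
    unfolding p(3) power_mult[symmetric] by (rule rho_a_pow)
  have "0 < N" using nu(2) by simp
  then obtain \<omega> where w: "primitive_root_of_unity N \<omega>" "\<omega> ^ \<nu> = \<alpha>"
    using ord by (rule primitive_root_with_power)
  note p' = p(1,2,4,5)[folded w(2)]
  have pr: "presented U N \<nu> a \<omega> x y"
    by (rule presented.intro[OF characterized_axioms presented_axioms.intro[OF p'(1) w(1) p'(2-4)]])
  show ?thesis by (rule exI, rule conjI[OF w(1) presented.isomorphic[OF pr]])
qed

theorem theorem3p6:
  fixes U :: "('k :: {alg_closed_field, field_char_0}, 'u) hopf"
    and N \<nu> :: nat and a :: 'u
  assumes "hopf_algebra U"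
    and "1 \<le> \<nu>" and "\<nu> < N" and "\<not> N dvd \<nu>\<^sup>2"
    and "a \<in> grouplikes U" and "group.ord (units_of U) a = N"
    and "generated_subalgebra U (insert a (skew_primitives U (a [^]\<^bsub>U\<^esub> \<nu>) \<one>\<^bsub>U\<^esub>)) = carrier U"
    and "vectorspace.fin_dim class_ring (U\<lparr>carrier := skew_primitives U (a [^]\<^bsub>U\<^esub> \<nu>) \<one>\<^bsub>U\<^esub>\<rparr>)"
    and "vectorspace.dim class_ring (U\<lparr>carrier := skew_primitives U (a [^]\<^bsub>U\<^esub> \<nu>) \<one>\<^bsub>U\<^esub>\<rparr>) = 3"
    and "\<And>i::nat. 0 < i \<Longrightarrow> \<not> [i = \<nu>] (mod N) \<Longrightarrow>
           skew_primitives U (a [^]\<^bsub>U\<^esub> i) \<one>\<^bsub>U\<^esub> = lin_span U {a [^]\<^bsub>U\<^esub> i \<ominus>\<^bsub>U\<^esub> \<one>\<^bsub>U\<^esub>}"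
    and "minimal_quasitriangular U"
  shows "\<exists>\<omega>::'k. primitive_root_of_unity N \<omega> \<and> hopf_isomorphic U (U_hopf N \<nu> \<omega>)"
  by (rule characterized.classification[OF characterized.intro[OF hopf_alg.intro[OF assms(1)]
    characterized_axioms.intro[OF assms(2-11)]]])

end
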